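(* Let $\mathcal C$ be a closed symmetric monoidal model category, and let $X\stackrel{f}{\to}Y\to Z$ be a cofibre sequence in $\mathcal C$. Then, for any two natural numbers $n$ and $i$, $i\leq n$, there is a cofibration $\Box^n_{i-1}(f)\to\Box^n_i(f)$ and a $\Sigma_n$-equivariant isomorphism $$\Box^n_i(f)/\Box^n_{i-1}(f)\simeq\mathrm{cor}^{\Sigma_n}_{\Sigma_{n-i}\times\Sigma_i}(X^{\wedge(n-i)}\wedge Z^{\wedge i})$$ in $\mathcal C$. If $f$ is a symmetrizable cofibration and all symmetric powers $\mathrm{Sym}^i(X)$ are cofibrant, then the morphism $\tilde\Box^n_{i-1}(f)\to\tilde\Box^n_i(f)$, obtained by passing to the colimit of the action of the symmetric group $\Sigma_n$, is a cofibration, and $\tilde\Box^n_i(f)/\tilde\Box^n_{i-1}(f)$ can be computed by Künneth's rule, $$\tilde\Box^n_i(f)/\tilde\Box^n_{i-1}(f)\simeq\mathrm{Sym}^{n-i}(X)\wedge\mathrm{Sym}^i(Z).$$ If $f$ is a symmetrizable trivial cofibration, then all the cofibrations $\tilde\Box^n_{i-1}(f)\to\tilde\Box^n_i(f)$ are trivial cofibrations.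
   Context: A closed symmetric monoidal model category is a closed symmetric monoidal category $(\mathcal C,\wedge,\mathbb 1)$ with a model structure satisfying the push-out product axiom (the push-out product of two cofibrations is a cofibration, trivial if one of them is) and the unit axiom (for a cofibrant replacement $q:Q\mathbb 1\to\mathbb 1$ and cofibrant $X$, $q\wedge\mathrm{id}_X$ and $\mathrm{id}_X\wedge q$ are weak equivalences). For a cofibration $X\to Y$, $Y/X$ is the colimit of $Y\leftarrow X\to *$, where $*$ is the terminal object; if $X$ and $Y$ are cofibrant, $X\to Y\to Y/X$ is called a cofibre sequence. Let $\Gamma$ be the category with two objects $0,1$ and one non-identity morphism $0\to 1$. A morphism $f:X\to Y$ is a functor $K:\Gamma\to\mathcal C$; let $K^n(f):\Gamma^n\to\mathcal C$ send $(\epsilon_1,\dots,\epsilon_n)$ to $K(\epsilon_1)\wedge\dots\wedge K(\epsilon_n)$. $\Gamma^n_i\subset\Gamma^n$ is the full subcategory of tuples with at most $i$ ones, and $\Box^n_i(f)$ is the colimit of $K^n(f)$ restricted to $\Gamma^n_i$; thus $\Box^n_0(f)=X^{\wedge n}$, $\Box^n_n(f)=Y^{\wedge n}$, and there are canonical morphisms $\Box^n_{i-1}(f)\to\Box^n_i(f)$ for $1\leq i\leq n$. The symmetric group $\Sigma_n$ acts compatibly, and $\tilde\Box^n_i(f)=\Box^n_i(f)/\Sigma_n$ (colimit of the action). $\mathrm{Sym}^n(X)=X^{\wedge n}/\Sigma_n$. A morphism $f:X\to Y$ is a symmetrizable (trivial) cofibration if the canonical morphism $\tilde\Box^n_{n-1}(f)\to\mathrm{Sym}^n(Y)$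 is a (trivial) cofibration for every integer $n\geq 1$. For a subgroup $H$ of a finite group $G$, $\mathrm{cor}^G_H$ is the left adjoint of the restriction functor from objects with $G$-action to objects with $H$-action, $\mathrm{cor}^G_H(W)\simeq(G\times W)/H$, where $G\times W$ is the coproduct of copies of $W$ indexed by $G$.
   Formalization: The two isomorphisms are claimed only when the terminal object * is also initial; otherwise they fail (simplicial sets, Δ⁰→Δ¹, n=2, i=1). The last sentence keeps the assumption that the symmetric powers of X are cofibrant; i ≥ 1 throughout. *)

theory Defs
  imports "HOL-Algebra.Sym_Groups"
begin

section \<open>Categories and finite (co)limits\<close>

record ('o, 'm) cat =
  Obj :: "'o set"
  Arr :: "'m set"
  Dom :: "'m \<Rightarrow> 'o"
  Cod :: "'m \<Rightarrow> 'o"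
  Id :: "'o \<Rightarrow> 'm"
  Comp :: "'m \<Rightarrow> 'm \<Rightarrow> 'm" (infixr "\<bullet>\<index>" 60)

definition Hom :: "('o, 'm, 'z) cat_scheme \<Rightarrow> 'o \<Rightarrow> 'o \<Rightarrow> 'm set" where
  "Hom C A B = {f \<in> Arr C. Dom C f = A \<and> Cod C f = B}"

locale category =
  fixes C :: "('o, 'm, 'z) cat_scheme" (structure)
  assumes Dom_in: "f \<in> Arr C \<Longrightarrow> Dom C f \<in> Obj C"
    and Cod_in: "f \<in> Arr C \<Longrightarrow> Cod C f \<in> Obj C"
    and Id_in: "A \<in> Obj C \<Longrightarrow> Id C A \<in> Hom C A A"
    and Comp_in: "\<lbrakk>f \<in> Hom C A B; g \<in> Hom C B D\<rbrakk> \<Longrightarrow> g \<bullet> f \<in> Hom C A D"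
    and Comp_Id: "f \<in> Hom C A B \<Longrightarrow> f \<bullet> Id C A = f"
    and Id_Comp: "f \<in> Hom C A B \<Longrightarrow> Id C B \<bullet> f = f"
    and Comp_assoc: "\<lbrakk>f \<in> Hom C A B; g \<in> Hom C B D; h \<in> Hom C D E\<rbrakk>
      \<Longrightarrow> (h \<bullet> g) \<bullet> f = h \<bullet> (g \<bullet> f)"

definition is_inverse :: "('o, 'm, 'z) cat_scheme \<Rightarrow> 'm \<Rightarrow> 'm \<Rightarrow> bool" where
  "is_inverse C f g \<longleftrightarrow> f \<in> Arr C \<and> g \<in> Hom C (Cod C f) (Dom C f) \<and>
     g \<bullet>\<^bsub>C\<^esub> f = Id C (Dom C f) \<and> f \<bullet>\<^bsub>C\<^esub> g = Id C (Cod C f)"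

definition iso_arr :: "('o, 'm, 'z) cat_scheme \<Rightarrow> 'm \<Rightarrow> bool" where
  "iso_arr C f \<longleftrightarrow> (\<exists>g. is_inverse C f g)"

definition inverse_arr :: "('o, 'm, 'z) cat_scheme \<Rightarrow> 'm \<Rightarrow> 'm" where
  "inverse_arr C f = (THE g. is_inverse C f g)"

definition isomorphic :: "('o, 'm, 'z) cat_scheme \<Rightarrow> 'o \<Rightarrow> 'o \<Rightarrow> bool" where
  "isomorphic C A B \<longleftrightarrow> (\<exists>f \<in> Hom C A B. iso_arr C f)"

definition is_initial :: "('o, 'm, 'z) cat_scheme \<Rightarrow> 'o \<Rightarrow> bool" where
  "is_initial C I \<longleftrightarrow> I \<in> Obj C \<and> (\<forall>A \<in> Obj C. \<exists>!f. f \<in> Hom C I A)"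

definition is_terminal :: "('o, 'm, 'z) cat_scheme \<Rightarrow> 'o \<Rightarrow> bool" where
  "is_terminal C T \<longleftrightarrow> T \<in> Obj C \<and> (\<forall>A \<in> Obj C. \<exists>!f. f \<in> Hom C A T)"

text \<open>If the terminal object is not initial, subquotients such as \<open>\<box>\<^sup>2\<^sub>1(f) / \<box>\<^sup>2\<^sub>0(f)\<close> are glued along it
  and are not coproducts: for simplicial sets with the cartesian product and
  \<open>f : \<Delta>\<^sup>0 \<rightarrow> \<Delta>\<^sup>1\<close> this one is connected.\<close>

definition pointed :: "('o, 'm, 'z) cat_scheme \<Rightarrow> bool" where
  "pointed C \<longleftrightarrow> (\<exists>V. is_initial C V \<and> is_terminal C V)"

record ('a, 'b, 'o, 'm) diag =
  on_obj :: "'a \<Rightarrow> 'o"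
  on_arr :: "'b \<Rightarrow> 'm"

definition diagram ::
  "('a, 'b, 'y) cat_scheme \<Rightarrow> ('o, 'm, 'z) cat_scheme \<Rightarrow> ('a, 'b, 'o, 'm) diag \<Rightarrow> bool" where
  "diagram J C F \<longleftrightarrow>
     (\<forall>a \<in> Obj J. on_obj F a \<in> Obj C \<and> on_arr F (Id J a) = Id C (on_obj F a)) \<and>
     (\<forall>s \<in> Arr J. on_arr F s \<in> Hom C (on_obj F (Dom J s)) (on_obj F (Cod J s))) \<and>
     (\<forall>s \<in> Arr J. \<forall>t \<in> Arr J. Cod J s = Dom J t \<longrightarrow>
        on_arr F (t \<bullet>\<^bsub>J\<^esub> s) = on_arr F t \<bullet>\<^bsub>C\<^esub> on_arr F s)"

definition is_cocone ::
  "('a, 'b, 'y) cat_scheme \<Rightarrow> ('o, 'm, 'z) cat_scheme \<Rightarrow> ('a, 'b, 'o, 'm) diag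
    \<Rightarrow> 'o \<Rightarrow> ('a \<Rightarrow> 'm) \<Rightarrow> bool" where
  "is_cocone J C F V l \<longleftrightarrow> V \<in> Obj C \<and>
     (\<forall>a \<in> Obj J. l a \<in> Hom C (on_obj F a) V) \<and>
     (\<forall>s \<in> Arr J. l (Cod J s) \<bullet>\<^bsub>C\<^esub> on_arr F s = l (Dom J s))"

definition is_colimit ::
  "('a, 'b, 'y) cat_scheme \<Rightarrow> ('o, 'm, 'z) cat_scheme \<Rightarrow> ('a, 'b, 'o, 'm) diag
    \<Rightarrow> 'o \<Rightarrow> ('a \<Rightarrow> 'm) \<Rightarrow> bool" where
  "is_colimit J C F V l \<longleftrightarrow> is_cocone J C F V l \<and>
     (\<forall>U k. is_cocone J C F U k \<longrightarrow>
        (\<exists>!u. u \<in> Hom C V U \<and> (\<forall>a \<in> Obj J. u \<bullet>\<^bsub>C\<^esub> l a = k a)))"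

definition is_cone ::
  "('a, 'b, 'y) cat_scheme \<Rightarrow> ('o, 'm, 'z) cat_scheme \<Rightarrow> ('a, 'b, 'o, 'm) diag
    \<Rightarrow> 'o \<Rightarrow> ('a \<Rightarrow> 'm) \<Rightarrow> bool" where
  "is_cone J C F V l \<longleftrightarrow> V \<in> Obj C \<and>
     (\<forall>a \<in> Obj J. l a \<in> Hom C V (on_obj F a)) \<and>
     (\<forall>s \<in> Arr J. on_arr F s \<bullet>\<^bsub>C\<^esub> l (Dom J s) = l (Cod J s))"

definition is_limit ::
  "('a, 'b, 'y) cat_scheme \<Rightarrow> ('o, 'm, 'z) cat_scheme \<Rightarrow> ('a, 'b, 'o, 'm) diag
    \<Rightarrow> 'o \<Rightarrow> ('a \<Rightarrow> 'm) \<Rightarrow> bool" where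
  "is_limit J C F V l \<longleftrightarrow> is_cone J C F V l \<and>
     (\<forall>U k. is_cone J C F U k \<longrightarrow>
        (\<exists>!u. u \<in> Hom C U V \<and> (\<forall>a \<in> Obj J. l a \<bullet>\<^bsub>C\<^esub> u = k a)))"

text \<open>Every finite category is isomorphic to one whose objects and morphisms are natural
  numbers, so quantifying over those covers all finite diagrams.\<close>

definition has_finite_colimits :: "('o, 'm, 'z) cat_scheme \<Rightarrow> bool" where
  "has_finite_colimits C \<longleftrightarrow>
     (\<forall>(J :: (nat, nat) cat) F. category J \<and> finite (Obj J) \<and> finite (Arr J) \<and> diagram J C F
        \<longrightarrow> (\<exists>V l. is_colimit J C F V l))"

definition has_finite_limits :: "('o, 'm, 'z) cat_scheme \<Rightarrow> bool" where
  "has_finite_limits C \<longleftrightarrow>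
     (\<forall>(J :: (nat, nat) cat) F. category J \<and> finite (Obj J) \<and> finite (Arr J) \<and> diagram J C F
        \<longrightarrow> (\<exists>V l. is_limit J C F V l))"

text \<open>A choice of colimits. Only the universal property is available, so nothing depends on
  which colimit is chosen.\<close>

definition colimit ::
  "('a, 'b, 'y) cat_scheme \<Rightarrow> ('o, 'm, 'z) cat_scheme \<Rightarrow> ('a, 'b, 'o, 'm) diag
    \<Rightarrow> 'o \<times> ('a \<Rightarrow> 'm)" where
  "colimit J C F = (SOME (V, l). is_colimit J C F V l)"

definition colim_obj ::
  "('a, 'b, 'y) cat_scheme \<Rightarrow> ('o, 'm, 'z) cat_scheme \<Rightarrow> ('a, 'b, 'o, 'm) diag \<Rightarrow> 'o" where
  "colim_obj J C F = fst (colimit J C F)"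

definition colim_leg ::
  "('a, 'b, 'y) cat_scheme \<Rightarrow> ('o, 'm, 'z) cat_scheme \<Rightarrow> ('a, 'b, 'o, 'm) diag \<Rightarrow> 'a \<Rightarrow> 'm" where
  "colim_leg J C F = snd (colimit J C F)"

definition colim_desc ::
  "('a, 'b, 'y) cat_scheme \<Rightarrow> ('o, 'm, 'z) cat_scheme \<Rightarrow> ('a, 'b, 'o, 'm) diag
    \<Rightarrow> 'o \<Rightarrow> ('a \<Rightarrow> 'm) \<Rightarrow> 'm" where
  "colim_desc J C F U k =
     (THE u. u \<in> Hom C (colim_obj J C F) U \<and> (\<forall>a \<in> Obj J. u \<bullet>\<^bsub>C\<^esub> colim_leg J C F a = k a))"

definition is_pushout ::
  "('o, 'm, 'z) cat_scheme \<Rightarrow> 'm \<Rightarrow> 'm \<Rightarrow> 'o \<Rightarrow> 'm \<Rightarrow> 'm \<Rightarrow> bool" where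
  "is_pushout C f g P i j \<longleftrightarrow>
     f \<in> Arr C \<and> g \<in> Arr C \<and> Dom C f = Dom C g \<and>
     i \<in> Hom C (Cod C f) P \<and> j \<in> Hom C (Cod C g) P \<and> i \<bullet>\<^bsub>C\<^esub> f = j \<bullet>\<^bsub>C\<^esub> g \<and>
     (\<forall>U h k. h \<in> Hom C (Cod C f) U \<and> k \<in> Hom C (Cod C g) U \<and> h \<bullet>\<^bsub>C\<^esub> f = k \<bullet>\<^bsub>C\<^esub> g
        \<longrightarrow> (\<exists>!u. u \<in> Hom C P U \<and> u \<bullet>\<^bsub>C\<^esub> i = h \<and> u \<bullet>\<^bsub>C\<^esub> j = k))"

text \<open>For \<open>g : A \<rightarrow> B\<close> the object \<open>Q\<close>, with \<open>p : B \<rightarrow> Q\<close> and \<open>z : * \<rightarrow> Q\<close>, is the colimit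
  \<open>B/A\<close> of \<open>B \<leftarrow> A \<rightarrow> *\<close>.\<close>

definition is_quotient :: "('o, 'm, 'z) cat_scheme \<Rightarrow> 'm \<Rightarrow> 'o \<Rightarrow> 'm \<Rightarrow> 'm \<Rightarrow> bool" where
  "is_quotient C g Q p z \<longleftrightarrow>
     (\<exists>T t. is_terminal C T \<and> t \<in> Hom C (Dom C g) T \<and> is_pushout C g t Q p z)"

definition quotient :: "('o, 'm, 'z) cat_scheme \<Rightarrow> 'm \<Rightarrow> 'o \<times> 'm \<times> 'm" where
  "quotient C g = (SOME (Q, p, z). is_quotient C g Q p z)"

definition quot_obj :: "('o, 'm, 'z) cat_scheme \<Rightarrow> 'm \<Rightarrow> 'o" where
  "quot_obj C g = fst (quotient C g)"

text \<open>The endomorphism of \<open>B/A\<close> induced by an endomorphism \<open>b\<close> of \<open>B\<close> preserving \<open>A\<close>.\<close>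

definition quot_endo :: "('o, 'm, 'z) cat_scheme \<Rightarrow> 'm \<Rightarrow> 'm \<Rightarrow> 'm" where
  "quot_endo C g b = (case quotient C g of (Q, p, z) \<Rightarrow>
     (THE u. u \<in> Hom C Q Q \<and> u \<bullet>\<^bsub>C\<^esub> p = p \<bullet>\<^bsub>C\<^esub> b \<and> u \<bullet>\<^bsub>C\<^esub> z = z))"


section \<open>Closed symmetric monoidal categories\<close>

record ('o, 'm) mon_cat = "('o, 'm) cat" +
  Tensor :: "'o \<Rightarrow> 'o \<Rightarrow> 'o" (infixl "\<diamondop>\<index>" 70)
  Tensor_arr :: "'m \<Rightarrow> 'm \<Rightarrow> 'm" (infixl "\<diamond>\<index>" 70)
  Unit :: "'o"
  Assoc :: "'o \<Rightarrow> 'o \<Rightarrow> 'o \<Rightarrow> 'm"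
  Lunit :: "'o \<Rightarrow> 'm"
  Runit :: "'o \<Rightarrow> 'm"
  Braid :: "'o \<Rightarrow> 'o \<Rightarrow> 'm"

locale symmetric_monoidal_category = category C
  for C :: "('o, 'm, 'z) mon_cat_scheme" (structure) +
  assumes Tensor_in: "\<lbrakk>A \<in> Obj C; B \<in> Obj C\<rbrakk> \<Longrightarrow> A \<diamondop> B \<in> Obj C"
    and Tensor_arr_in:
      "\<lbrakk>f \<in> Hom C A A'; g \<in> Hom C B B'\<rbrakk> \<Longrightarrow> f \<diamond> g \<in> Hom C (A \<diamondop> B) (A' \<diamondop> B')"
    and Tensor_Id: "\<lbrakk>A \<in> Obj C; B \<in> Obj C\<rbrakk> \<Longrightarrow> Id C A \<diamond> Id C B = Id C (A \<diamondop> B)"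
    and Tensor_Comp:
      "\<lbrakk>f \<in> Hom C A A'; f' \<in> Hom C A' A''; g \<in> Hom C B B'; g' \<in> Hom C B' B''\<rbrakk>
        \<Longrightarrow> (f' \<bullet> f) \<diamond> (g' \<bullet> g) = (f' \<diamond> g') \<bullet> (f \<diamond> g)"
    and Unit_in: "Unit C \<in> Obj C"
    and Assoc_in: "\<lbrakk>A \<in> Obj C; B \<in> Obj C; D \<in> Obj C\<rbrakk>
      \<Longrightarrow> Assoc C A B D \<in> Hom C ((A \<diamondop> B) \<diamondop> D) (A \<diamondop> (B \<diamondop> D)) \<and> iso_arr C (Assoc C A B D)"
    and Assoc_natural: "\<lbrakk>f \<in> Hom C A A'; g \<in> Hom C B B'; h \<in> Hom C D D'\<rbrakk>
      \<Longrightarrow> Assoc C A' B' D' \<bullet> ((f \<diamond> g) \<diamond> h) = (f \<diamond> (g \<diamond> h)) \<bullet> Assoc C A B D"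
    and Lunit_in: "A \<in> Obj C \<Longrightarrow> Lunit C A \<in> Hom C (Unit C \<diamondop> A) A \<and> iso_arr C (Lunit C A)"
    and Lunit_natural: "f \<in> Hom C A A'
      \<Longrightarrow> Lunit C A' \<bullet> (Id C (Unit C) \<diamond> f) = f \<bullet> Lunit C A"
    and Runit_in: "A \<in> Obj C \<Longrightarrow> Runit C A \<in> Hom C (A \<diamondop> Unit C) A \<and> iso_arr C (Runit C A)"
    and Runit_natural: "f \<in> Hom C A A'
      \<Longrightarrow> Runit C A' \<bullet> (f \<diamond> Id C (Unit C)) = f \<bullet> Runit C A"
    and Braid_in: "\<lbrakk>A \<in> Obj C; B \<in> Obj C\<rbrakk> \<Longrightarrow> Braid C A B \<in> Hom C (A \<diamondop> B) (B \<diamondop> A)"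
    and Braid_natural: "\<lbrakk>f \<in> Hom C A A'; g \<in> Hom C B B'\<rbrakk>
      \<Longrightarrow> Braid C A' B' \<bullet> (f \<diamond> g) = (g \<diamond> f) \<bullet> Braid C A B"
    and symmetry: "\<lbrakk>A \<in> Obj C; B \<in> Obj C\<rbrakk> \<Longrightarrow> Braid C B A \<bullet> Braid C A B = Id C (A \<diamondop> B)"
    and pentagon: "\<lbrakk>A \<in> Obj C; B \<in> Obj C; D \<in> Obj C; E \<in> Obj C\<rbrakk>
      \<Longrightarrow> Assoc C A B (D \<diamondop> E) \<bullet> Assoc C (A \<diamondop> B) D E =
          (Id C A \<diamond> Assoc C B D E) \<bullet> (Assoc C A (B \<diamondop> D) E \<bullet> (Assoc C A B D \<diamond> Id C E))"
    and triangle: "\<lbrakk>A \<in> Obj C; B \<in> Obj C\<rbrakk>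
      \<Longrightarrow> (Id C A \<diamond> Lunit C B) \<bullet> Assoc C A (Unit C) B = Runit C A \<diamond> Id C B"
    and hexagon: "\<lbrakk>A \<in> Obj C; B \<in> Obj C; D \<in> Obj C\<rbrakk>
      \<Longrightarrow> Assoc C B D A \<bullet> (Braid C A (B \<diamondop> D) \<bullet> Assoc C A B D) =
          (Id C B \<diamond> Braid C A D) \<bullet> (Assoc C B A D \<bullet> (Braid C A B \<diamond> Id C D))"

text \<open>Closedness: every functor \<open>- \<and> B\<close> has a right adjoint, given by internal homs \<open>H\<close> with
  evaluations \<open>ev : H \<and> B \<rightarrow> D\<close>.\<close>

locale closed_symmetric_monoidal_category = symmetric_monoidal_category C
  for C :: "('o, 'm, 'z) mon_cat_scheme" (structure) +
  assumes closed: "\<lbrakk>B \<in> Obj C; D \<in> Obj C\<rbrakk> \<Longrightarrow>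
    \<exists>H ev. H \<in> Obj C \<and> ev \<in> Hom C (H \<diamondop> B) D \<and>
      (\<forall>A \<in> Obj C. \<forall>g \<in> Hom C (A \<diamondop> B) D.
         \<exists>!h. h \<in> Hom C A H \<and> ev \<bullet> (h \<diamond> Id C B) = g)"


section \<open>Model structures\<close>

record ('o, 'm) mon_model_cat = "('o, 'm) mon_cat" +
  Weq :: "'m set"
  Cofib :: "'m set"
  Fib :: "'m set"

definition wide_subcategory :: "('o, 'm, 'z) cat_scheme \<Rightarrow> 'm set \<Rightarrow> bool" where
  "wide_subcategory C S \<longleftrightarrow> S \<subseteq> Arr C \<and> (\<forall>A \<in> Obj C. Id C A \<in> S) \<and>
     (\<forall>f \<in> S. \<forall>g \<in> S. Cod C f = Dom C g \<longrightarrow> g \<bullet>\<^bsub>C\<^esub> f \<in> S)"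

definition is_retract :: "('o, 'm, 'z) cat_scheme \<Rightarrow> 'm \<Rightarrow> 'm \<Rightarrow> bool" where
  "is_retract C f g \<longleftrightarrow> f \<in> Arr C \<and> g \<in> Arr C \<and>
     (\<exists>i r i' r'. i \<in> Hom C (Dom C f) (Dom C g) \<and> r \<in> Hom C (Dom C g) (Dom C f) \<and>
        i' \<in> Hom C (Cod C f) (Cod C g) \<and> r' \<in> Hom C (Cod C g) (Cod C f) \<and>
        r \<bullet>\<^bsub>C\<^esub> i = Id C (Dom C f) \<and> r' \<bullet>\<^bsub>C\<^esub> i' = Id C (Cod C f) \<and>
        g \<bullet>\<^bsub>C\<^esub> i = i' \<bullet>\<^bsub>C\<^esub> f \<and> f \<bullet>\<^bsub>C\<^esub> r = r' \<bullet>\<^bsub>C\<^esub> g)"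

definition lifts :: "('o, 'm, 'z) cat_scheme \<Rightarrow> 'm \<Rightarrow> 'm \<Rightarrow> bool" where
  "lifts C i p \<longleftrightarrow>
     (\<forall>u v. u \<in> Hom C (Dom C i) (Dom C p) \<and> v \<in> Hom C (Cod C i) (Cod C p) \<and>
        p \<bullet>\<^bsub>C\<^esub> u = v \<bullet>\<^bsub>C\<^esub> i \<longrightarrow>
        (\<exists>h. h \<in> Hom C (Cod C i) (Dom C p) \<and> h \<bullet>\<^bsub>C\<^esub> i = u \<and> p \<bullet>\<^bsub>C\<^esub> h = v))"

text \<open>Only finite limits and colimits and non-functorial factorizations are required, so that
  both Quillen's and Hovey's conventions are instances.\<close>

locale model_category = category C
  for C :: "('o, 'm, 'z) mon_model_cat_scheme" (structure) +
  assumes finite_limits: "has_finite_limits C"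
    and finite_colimits: "has_finite_colimits C"
    and subcategories:
      "wide_subcategory C (Weq C)" "wide_subcategory C (Cofib C)" "wide_subcategory C (Fib C)"
    and two_of_three: "\<lbrakk>f \<in> Hom C A B; g \<in> Hom C B D\<rbrakk> \<Longrightarrow>
      (f \<in> Weq C \<and> g \<in> Weq C \<longrightarrow> g \<bullet> f \<in> Weq C) \<and>
      (f \<in> Weq C \<and> g \<bullet> f \<in> Weq C \<longrightarrow> g \<in> Weq C) \<and>
      (g \<in> Weq C \<and> g \<bullet> f \<in> Weq C \<longrightarrow> f \<in> Weq C)"
    and retracts: "is_retract C f g \<Longrightarrow>
      (g \<in> Weq C \<longrightarrow> f \<in> Weq C) \<and> (g \<in> Cofib C \<longrightarrow> f \<in> Cofib C) \<and> (g \<in> Fib C \<longrightarrow> f \<in> Fib C)"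
    and lifting: "\<lbrakk>i \<in> Cofib C; p \<in> Fib C; i \<in> Weq C \<or> p \<in> Weq C\<rbrakk> \<Longrightarrow> lifts C i p"
    and factorization_trivial_cofibration: "f \<in> Hom C A B \<Longrightarrow>
      \<exists>E i p. i \<in> Hom C A E \<inter> Cofib C \<inter> Weq C \<and> p \<in> Hom C E B \<inter> Fib C \<and> f = p \<bullet> i"
    and factorization_trivial_fibration: "f \<in> Hom C A B \<Longrightarrow>
      \<exists>E i p. i \<in> Hom C A E \<inter> Cofib C \<and> p \<in> Hom C E B \<inter> Fib C \<inter> Weq C \<and> f = p \<bullet> i"

definition cofibrant :: "('o, 'm, 'z) mon_model_cat_scheme \<Rightarrow> 'o \<Rightarrow> bool" where
  "cofibrant C X \<longleftrightarrow> X \<in> Obj C \<and> (\<exists>I i. is_initial C I \<and> i \<in> Hom C I X \<and> i \<in> Cofib C)"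

definition cofibrant_replacement :: "('o, 'm, 'z) mon_model_cat_scheme \<Rightarrow> 'm \<Rightarrow> 'o \<Rightarrow> bool" where
  "cofibrant_replacement C q A \<longleftrightarrow>
     q \<in> Arr C \<and> Cod C q = A \<and> cofibrant C (Dom C q) \<and> q \<in> Fib C \<inter> Weq C"

text \<open>In \<open>pushout_product\<close>, the morphism \<open>u\<close> is the push-out product
  \<open>(B \<and> C') \<squnion> (A \<and> D') \<rightarrow> B \<and> D'\<close> of \<open>f : A \<rightarrow> B\<close> and \<open>g : C' \<rightarrow> D'\<close>.\<close>

locale closed_symmetric_monoidal_model_category =
  closed_symmetric_monoidal_category C + model_category C
  for C :: "('o, 'm, 'z) mon_model_cat_scheme" (structure) +
  assumes pushout_product:
    "\<lbrakk>f \<in> Cofib C; g \<in> Cofib C;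
      is_pushout C (f \<diamond> Id C (Dom C g)) (Id C (Dom C f) \<diamond> g) P i j;
      u \<in> Hom C P (Cod C f \<diamondop> Cod C g);
      u \<bullet> i = Id C (Cod C f) \<diamond> g; u \<bullet> j = f \<diamond> Id C (Cod C g)\<rbrakk>
     \<Longrightarrow> u \<in> Cofib C \<and> (f \<in> Weq C \<or> g \<in> Weq C \<longrightarrow> u \<in> Weq C)"
    and unit_axiom:
    "\<lbrakk>cofibrant_replacement C q (Unit C); cofibrant C X\<rbrakk>
     \<Longrightarrow> q \<diamond> Id C X \<in> Weq C \<and> Id C X \<diamond> q \<in> Weq C"

definition cofibre_sequence ::
  "('o, 'm, 'z) mon_model_cat_scheme \<Rightarrow> 'o \<Rightarrow> 'o \<Rightarrow> 'o \<Rightarrow> 'm \<Rightarrow> 'm \<Rightarrow> bool" where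
  "cofibre_sequence C X Y Z f p \<longleftrightarrow>
     f \<in> Hom C X Y \<and> f \<in> Cofib C \<and> cofibrant C X \<and> cofibrant C Y \<and> (\<exists>z. is_quotient C f Z p z)"


section \<open>Group actions\<close>

definition action ::
  "('o, 'm, 'z) cat_scheme \<Rightarrow> ('g, 'y) monoid_scheme \<Rightarrow> 'o \<Rightarrow> ('g \<Rightarrow> 'm) \<Rightarrow> bool" where
  "action C G V a \<longleftrightarrow> V \<in> Obj C \<and> (\<forall>g \<in> carrier G. a g \<in> Hom C V V) \<and> a \<one>\<^bsub>G\<^esub> = Id C V \<and>
     (\<forall>g \<in> carrier G. \<forall>h \<in> carrier G. a (g \<otimes>\<^bsub>G\<^esub> h) = a g \<bullet>\<^bsub>C\<^esub> a h)"

definition equivariant ::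
  "('o, 'm, 'z) cat_scheme \<Rightarrow> 'g set \<Rightarrow> ('g \<Rightarrow> 'm) \<Rightarrow> ('g \<Rightarrow> 'm) \<Rightarrow> 'm \<Rightarrow> bool" where
  "equivariant C S a b u \<longleftrightarrow> (\<forall>g \<in> S. u \<bullet>\<^bsub>C\<^esub> a g = b g \<bullet>\<^bsub>C\<^esub> u)"

definition equivariantly_isomorphic ::
  "('o, 'm, 'z) cat_scheme \<Rightarrow> ('g, 'y) monoid_scheme \<Rightarrow> 'o \<times> ('g \<Rightarrow> 'm) \<Rightarrow> 'o \<times> ('g \<Rightarrow> 'm) \<Rightarrow> bool"
  where
  "equivariantly_isomorphic C G Va Ub \<longleftrightarrow>
     action C G (fst Va) (snd Va) \<and> action C G (fst Ub) (snd Ub) \<and>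
     (\<exists>u \<in> Hom C (fst Va) (fst Ub). iso_arr C u \<and> equivariant C (carrier G) (snd Va) (snd Ub) u)"

definition one_object_cat :: "('g, 'y) monoid_scheme \<Rightarrow> (unit, 'g) cat" where
  "one_object_cat G = \<lparr>Obj = {()}, Arr = carrier G, Dom = (\<lambda>_. ()), Cod = (\<lambda>_. ()),
     Id = (\<lambda>_. \<one>\<^bsub>G\<^esub>), Comp = (\<lambda>g h. g \<otimes>\<^bsub>G\<^esub> h)\<rparr>"

definition action_diag :: "'o \<Rightarrow> ('g \<Rightarrow> 'm) \<Rightarrow> (unit, 'g, 'o, 'm) diag" where
  "action_diag V a = \<lparr>on_obj = (\<lambda>_. V), on_arr = a\<rparr>"

definition orbit_obj ::
  "('o, 'm, 'z) cat_scheme \<Rightarrow> ('g, 'y) monoid_scheme \<Rightarrow> 'o \<Rightarrow> ('g \<Rightarrow> 'm) \<Rightarrow> 'o" where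
  "orbit_obj C G V a = colim_obj (one_object_cat G) C (action_diag V a)"

definition orbit_proj ::
  "('o, 'm, 'z) cat_scheme \<Rightarrow> ('g, 'y) monoid_scheme \<Rightarrow> 'o \<Rightarrow> ('g \<Rightarrow> 'm) \<Rightarrow> 'm" where
  "orbit_proj C G V a = colim_leg (one_object_cat G) C (action_diag V a) ()"

text \<open>The morphism \<open>V/G \<rightarrow> U/G\<close> induced by an equivariant \<open>u : (V, a) \<rightarrow> (U, b)\<close>.\<close>

definition orbit_map ::
  "('o, 'm, 'z) cat_scheme \<Rightarrow> ('g, 'y) monoid_scheme \<Rightarrow> 'o \<Rightarrow> ('g \<Rightarrow> 'm) \<Rightarrow> 'o \<Rightarrow> ('g \<Rightarrow> 'm)
    \<Rightarrow> 'm \<Rightarrow> 'm" where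
  "orbit_map C G V a U b u =
     colim_desc (one_object_cat G) C (action_diag V a) (orbit_obj C G U b)
       (\<lambda>_. orbit_proj C G U b \<bullet>\<^bsub>C\<^esub> u)"

text \<open>The left adjoint of restriction from \<open>G\<close>-objects to \<open>H\<close>-objects, given by a universal
  \<open>H\<close>-equivariant morphism \<open>e : W \<rightarrow> V\<close> to a \<open>G\<close>-object.\<close>

definition is_cor ::
  "('o, 'm, 'z) cat_scheme \<Rightarrow> ('g, 'y) monoid_scheme \<Rightarrow> 'g set \<Rightarrow> 'o \<Rightarrow> ('g \<Rightarrow> 'm)
    \<Rightarrow> 'o \<Rightarrow> ('g \<Rightarrow> 'm) \<Rightarrow> 'm \<Rightarrow> bool" where
  "is_cor C G H W w V b e \<longleftrightarrow>
     action C G V b \<and> e \<in> Hom C W V \<and> equivariant C H w b e \<and>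
     (\<forall>U d k. action C G U d \<and> k \<in> Hom C W U \<and> equivariant C H w d k \<longrightarrow>
        (\<exists>!u. u \<in> Hom C V U \<and> equivariant C (carrier G) b d u \<and> u \<bullet>\<^bsub>C\<^esub> e = k))"

definition cor ::
  "('o, 'm, 'z) cat_scheme \<Rightarrow> ('g, 'y) monoid_scheme \<Rightarrow> 'g set \<Rightarrow> 'o \<times> ('g \<Rightarrow> 'm)
    \<Rightarrow> 'o \<times> ('g \<Rightarrow> 'm)" where
  "cor C G H Ww = (SOME Vb. \<exists>e. is_cor C G H (fst Ww) (snd Ww) (fst Vb) (snd Vb) e)"


section \<open>Permuting the factors of a monoidal product\<close>

text \<open>\<open>x\<^sub>1 \<and> \<dots> \<and> x\<^sub>n\<close>, bracketed to the left, for a family \<open>x\<close> indexed from 1 as in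
  \<^const>\<open>sym_group\<close>.\<close>

fun tensor :: "('o, 'm, 'z) mon_cat_scheme \<Rightarrow> nat \<Rightarrow> (nat \<Rightarrow> 'o) \<Rightarrow> 'o" where
  "tensor C 0 x = Unit C"
| "tensor C (Suc 0) x = x 1"
| "tensor C (Suc (Suc n)) x = tensor C (Suc n) x \<diamondop>\<^bsub>C\<^esub> x (Suc (Suc n))"

fun tensor_arr :: "('o, 'm, 'z) mon_cat_scheme \<Rightarrow> nat \<Rightarrow> (nat \<Rightarrow> 'm) \<Rightarrow> 'm" where
  "tensor_arr C 0 f = Id C (Unit C)"
| "tensor_arr C (Suc 0) f = f 1"
| "tensor_arr C (Suc (Suc n)) f = tensor_arr C (Suc n) f \<diamond>\<^bsub>C\<^esub> f (Suc (Suc n))"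

text \<open>For \<open>1 \<le> j < n\<close>, the morphism exchanging the factors \<open>j\<close> and \<open>j + 1\<close> by the symmetry
  constraint.\<close>

fun swap :: "('o, 'm, 'z) mon_cat_scheme \<Rightarrow> nat \<Rightarrow> nat \<Rightarrow> (nat \<Rightarrow> 'o) \<Rightarrow> 'm" where
  "swap C 0 j x = Id C (Unit C)"
| "swap C (Suc 0) j x = Id C (x 1)"
| "swap C (Suc (Suc n)) j x =
     (if j < Suc n then swap C (Suc n) j x \<diamond>\<^bsub>C\<^esub> Id C (x (Suc (Suc n)))
      else if n = 0 then Braid C (x 1) (x 2)
      else inverse_arr C (Assoc C (tensor C n x) (x (Suc (Suc n))) (x (Suc n))) \<bullet>\<^bsub>C\<^esub>
        ((Id C (tensor C n x) \<diamond>\<^bsub>C\<^esub> Braid C (x (Suc n)) (x (Suc (Suc n)))) \<bullet>\<^bsub>C\<^esub>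
         Assoc C (tensor C n x) (x (Suc n)) (x (Suc (Suc n)))))"

fun swaps :: "('o, 'm, 'z) mon_cat_scheme \<Rightarrow> nat \<Rightarrow> nat list \<Rightarrow> (nat \<Rightarrow> 'o) \<Rightarrow> 'm" where
  "swaps C n [] x = Id C (tensor C n x)"
| "swaps C n (j # js) x = swaps C n js (x \<circ> transpose j (Suc j)) \<bullet>\<^bsub>C\<^esub> swap C n j x"

fun word_perm :: "nat list \<Rightarrow> nat \<Rightarrow> nat" where
  "word_perm [] = id"
| "word_perm (j # js) = word_perm js \<circ> transpose j (Suc j)"

text \<open>For \<open>\<sigma> \<in> \<Sigma>\<^sub>n\<close>, the morphism from \<open>tensor C n x\<close> to \<open>tensor C n (x \<circ> \<sigma>\<^sup>-\<^sup>1)\<close> that moves the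
  factor in position \<open>k\<close> to position \<open>\<sigma> k\<close>. By coherence it does not depend on the chosen
  expression of \<open>\<sigma>\<close> as a product of adjacent transpositions.\<close>

definition permute :: "('o, 'm, 'z) mon_cat_scheme \<Rightarrow> nat \<Rightarrow> (nat \<Rightarrow> nat) \<Rightarrow> (nat \<Rightarrow> 'o) \<Rightarrow> 'm" where
  "permute C n \<sigma> x = swaps C n (SOME js. set js \<subseteq> {1..<n} \<and> word_perm js = \<sigma>) x"

definition tensor_pow :: "('o, 'm, 'z) mon_cat_scheme \<Rightarrow> nat \<Rightarrow> 'o \<Rightarrow> 'o" where
  "tensor_pow C n X = tensor C n (\<lambda>_. X)"

definition pow_act :: "('o, 'm, 'z) mon_cat_scheme \<Rightarrow> nat \<Rightarrow> 'o \<Rightarrow> (nat \<Rightarrow> nat) \<Rightarrow> 'm" where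
  "pow_act C n X \<sigma> = permute C n \<sigma> (\<lambda>_. X)"

definition sym_pow :: "('o, 'm, 'z) mon_cat_scheme \<Rightarrow> nat \<Rightarrow> 'o \<Rightarrow> 'o" where
  "sym_pow C n X = orbit_obj C (sym_group n) (tensor_pow C n X) (pow_act C n X)"

text \<open>\<open>\<Sigma>\<^sub>p \<times> \<Sigma>\<^sub>q\<close> as the subgroup of \<open>\<Sigma>\<^sub>p\<^sub>+\<^sub>q\<close> preserving the first \<open>p\<close> and the last \<open>q\<close> positions,
  with its two projections.\<close>

definition block_subgroup :: "nat \<Rightarrow> nat \<Rightarrow> (nat \<Rightarrow> nat) set" where
  "block_subgroup p q = {\<sigma> \<in> carrier (sym_group (p + q)). \<sigma> ` {1..p} = {1..p}}"

definition left_block :: "nat \<Rightarrow> (nat \<Rightarrow> nat) \<Rightarrow> nat \<Rightarrow> nat" where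
  "left_block p \<sigma> = (\<lambda>k. if k \<in> {1..p} then \<sigma> k else k)"

definition right_block :: "nat \<Rightarrow> nat \<Rightarrow> (nat \<Rightarrow> nat) \<Rightarrow> nat \<Rightarrow> nat" where
  "right_block p q \<sigma> = (\<lambda>k. if k \<in> {1..q} then \<sigma> (p + k) - p else k)"

definition block_object ::
  "('o, 'm, 'z) mon_cat_scheme \<Rightarrow> nat \<Rightarrow> nat \<Rightarrow> 'o \<Rightarrow> 'o \<Rightarrow> 'o \<times> ((nat \<Rightarrow> nat) \<Rightarrow> 'm)" where
  "block_object C p q X Z =
     (tensor_pow C p X \<diamondop>\<^bsub>C\<^esub> tensor_pow C q Z,
      \<lambda>\<sigma>. pow_act C p X (left_block p \<sigma>) \<diamond>\<^bsub>C\<^esub> pow_act C q Z (right_block p q \<sigma>))"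


section \<open>The objects \<open>\<box>\<^sup>n\<^sub>i(f)\<close> and their orbits\<close>

text \<open>\<open>\<Gamma>\<^sup>n\<^sub>i\<close> is a full subcategory of the poset of all \<open>nat \<Rightarrow> bool\<close>, ordered pointwise with
  \<open>False < True\<close>; a tuple \<open>\<epsilon>\<close> is \<open>False\<close> outside \<open>{1..n}\<close>.\<close>

definition Gamma :: "nat \<Rightarrow> nat \<Rightarrow> (nat \<Rightarrow> bool, (nat \<Rightarrow> bool) \<times> (nat \<Rightarrow> bool)) cat" where
  "Gamma n i = (let S = {\<epsilon>. {k. \<epsilon> k} \<subseteq> {1..n} \<and> card {k. \<epsilon> k} \<le> i} in
     \<lparr>Obj = S, Arr = {(\<epsilon>, \<delta>). \<epsilon> \<in> S \<and> \<delta> \<in> S \<and> \<epsilon> \<le> \<delta>}, Dom = fst, Cod = snd,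
      Id = (\<lambda>\<epsilon>. (\<epsilon>, \<epsilon>)), Comp = (\<lambda>t s. (fst s, snd t))\<rparr>)"

text \<open>The functor \<open>K\<close> given by \<open>f\<close>, on objects and on morphisms \<open>b \<le> b'\<close>.\<close>

definition K_obj :: "('o, 'm, 'z) cat_scheme \<Rightarrow> 'm \<Rightarrow> bool \<Rightarrow> 'o" where
  "K_obj C f b = (if b then Cod C f else Dom C f)"

definition K_arr :: "('o, 'm, 'z) cat_scheme \<Rightarrow> 'm \<Rightarrow> bool \<Rightarrow> bool \<Rightarrow> 'm" where
  "K_arr C f b b' = (if b = b' then Id C (K_obj C f b) else f)"

definition K_pow :: "('o, 'm, 'z) mon_cat_scheme \<Rightarrow> nat \<Rightarrow> 'm
    \<Rightarrow> (nat \<Rightarrow> bool, (nat \<Rightarrow> bool) \<times> (nat \<Rightarrow> bool), 'o, 'm) diag" where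
  "K_pow C n f =
     \<lparr>on_obj = (\<lambda>\<epsilon>. tensor C n (\<lambda>k. K_obj C f (\<epsilon> k))),
      on_arr = (\<lambda>(\<epsilon>, \<delta>). tensor_arr C n (\<lambda>k. K_arr C f (\<epsilon> k) (\<delta> k)))\<rparr>"

definition Box :: "('o, 'm, 'z) mon_cat_scheme \<Rightarrow> nat \<Rightarrow> nat \<Rightarrow> 'm \<Rightarrow> 'o" where
  "Box C n i f = colim_obj (Gamma n i) C (K_pow C n f)"

definition Box_leg ::
  "('o, 'm, 'z) mon_cat_scheme \<Rightarrow> nat \<Rightarrow> nat \<Rightarrow> 'm \<Rightarrow> (nat \<Rightarrow> bool) \<Rightarrow> 'm" where
  "Box_leg C n i f = colim_leg (Gamma n i) C (K_pow C n f)"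

definition Box_desc ::
  "('o, 'm, 'z) mon_cat_scheme \<Rightarrow> nat \<Rightarrow> nat \<Rightarrow> 'm \<Rightarrow> 'o \<Rightarrow> ((nat \<Rightarrow> bool) \<Rightarrow> 'm) \<Rightarrow> 'm" where
  "Box_desc C n i f = colim_desc (Gamma n i) C (K_pow C n f)"

text \<open>The canonical morphism from \<open>\<box>\<^sup>n\<^sub>i\<^sub>-\<^sub>1(f)\<close> to \<open>\<box>\<^sup>n\<^sub>i(f)\<close>, for \<open>1 \<le> i \<le> n\<close>.\<close>

definition Box_map :: "('o, 'm, 'z) mon_cat_scheme \<Rightarrow> nat \<Rightarrow> nat \<Rightarrow> 'm \<Rightarrow> 'm" where
  "Box_map C n i f = Box_desc C n (i - 1) f (Box C n i f) (Box_leg C n i f)"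

definition Box_act ::
  "('o, 'm, 'z) mon_cat_scheme \<Rightarrow> nat \<Rightarrow> nat \<Rightarrow> 'm \<Rightarrow> (nat \<Rightarrow> nat) \<Rightarrow> 'm" where
  "Box_act C n i f \<sigma> = Box_desc C n i f (Box C n i f)
     (\<lambda>\<epsilon>. Box_leg C n i f (\<epsilon> \<circ> inv' \<sigma>) \<bullet>\<^bsub>C\<^esub> permute C n \<sigma> (\<lambda>k. K_obj C f (\<epsilon> k)))"

text \<open>The \<open>\<Sigma>\<^sub>n\<close>-object \<open>\<box>\<^sup>n\<^sub>i(f) / \<box>\<^sup>n\<^sub>i\<^sub>-\<^sub>1(f)\<close>.\<close>

definition Box_quot ::
  "('o, 'm, 'z) mon_cat_scheme \<Rightarrow> nat \<Rightarrow> nat \<Rightarrow> 'm \<Rightarrow> 'o \<times> ((nat \<Rightarrow> nat) \<Rightarrow> 'm)" where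
  "Box_quot C n i f =
     (quot_obj C (Box_map C n i f), \<lambda>\<sigma>. quot_endo C (Box_map C n i f) (Box_act C n i f \<sigma>))"

definition tBox :: "('o, 'm, 'z) mon_cat_scheme \<Rightarrow> nat \<Rightarrow> nat \<Rightarrow> 'm \<Rightarrow> 'o" where
  "tBox C n i f = orbit_obj C (sym_group n) (Box C n i f) (Box_act C n i f)"

definition tBox_map :: "('o, 'm, 'z) mon_cat_scheme \<Rightarrow> nat \<Rightarrow> nat \<Rightarrow> 'm \<Rightarrow> 'm" where
  "tBox_map C n i f =
     orbit_map C (sym_group n) (Box C n (i - 1) f) (Box_act C n (i - 1) f)
       (Box C n i f) (Box_act C n i f) (Box_map C n i f)"

text \<open>The canonical morphisms from \<open>\<box>\<^sup>n\<^sub>n\<^sub>-\<^sub>1(f)\<close> to \<open>Y\<^sup>\<and>\<^sup>n\<close>, induced by the morphisms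
  \<open>K(\<epsilon>\<^sub>1) \<and> \<dots> \<and> K(\<epsilon>\<^sub>n) \<rightarrow> K(1) \<and> \<dots> \<and> K(1)\<close>, and from its orbits to \<open>Sym\<^sup>n(Y)\<close>.\<close>

definition Box_to_pow :: "('o, 'm, 'z) mon_cat_scheme \<Rightarrow> nat \<Rightarrow> 'm \<Rightarrow> 'm" where
  "Box_to_pow C n f = Box_desc C n (n - 1) f (tensor_pow C n (Cod C f))
     (\<lambda>\<epsilon>. on_arr (K_pow C n f) (\<epsilon>, \<lambda>k. k \<in> {1..n}))"

definition tBox_to_sym_pow :: "('o, 'm, 'z) mon_cat_scheme \<Rightarrow> nat \<Rightarrow> 'm \<Rightarrow> 'm" where
  "tBox_to_sym_pow C n f =
     orbit_map C (sym_group n) (Box C n (n - 1) f) (Box_act C n (n - 1) f)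
       (tensor_pow C n (Cod C f)) (pow_act C n (Cod C f)) (Box_to_pow C n f)"

definition symmetrizable_cofibration :: "('o, 'm, 'z) mon_model_cat_scheme \<Rightarrow> 'm \<Rightarrow> bool" where
  "symmetrizable_cofibration C f \<longleftrightarrow>
     f \<in> Arr C \<and> (\<forall>n\<ge>1. tBox_to_sym_pow C n f \<in> Cofib C)"

definition symmetrizable_trivial_cofibration ::
  "('o, 'm, 'z) mon_model_cat_scheme \<Rightarrow> 'm \<Rightarrow> bool" where
  "symmetrizable_trivial_cofibration C f \<longleftrightarrow>
     f \<in> Arr C \<and> (\<forall>n\<ge>1. tBox_to_sym_pow C n f \<in> Cofib C \<inter> Weq C)"

end

theory Submission
  imports Defs
begin

text \<open>A morphism of a model category is a (trivial) cofibration iff it has the left lifting property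
  with respect to the trivial fibrations (all fibrations), so the cofibrancy claims are lifting
  problems and no push-out products have to be iterated explicitly. For \<open>\<box>\<^sup>n\<^sub>i\<^sub>-\<^sub>1(f) \<rightarrow> \<box>\<^sup>n\<^sub>i(f)\<close> it
  suffices to lift, one vertex with \<open>i\<close> ones at a time, along the inclusion of the boundary of the
  cube below the vertex, which is done by induction on \<open>n\<close>. After passing to orbits,
  \<open>\<box>\<^sup>n\<^sub>i\<^sub>-\<^sub>1(f) \<rightarrow> \<box>\<^sup>n\<^sub>i(f)\<close> inherits every lifting property of the product of \<open>Sym\<^sup>n\<^sup>-\<^sup>i(X)\<close> with
  \<open>\<box>\<^sup>i\<^sub>i\<^sub>-\<^sub>1(f) \<rightarrow> Y\<^sup>\<and>\<^sup>i\<close> modulo \<open>\<Sigma>\<^sub>i\<close>, because an invariant family on the cube is determined by its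
  values on one block of coordinates. In the pointed case the tensor product preserves cokernels, so
  the quotient is the coproduct of the corners of the cube of \<open>X \<rightarrow> Z\<close>; these are permuted
  transitively, with stabilizer \<open>\<Sigma>\<^sub>n\<^sub>-\<^sub>i \<times> \<Sigma>\<^sub>i\<close>. That the action by words of adjacent transpositions is
  well defined is the coherence theorem, proved by bringing words into normal form.\<close>

section \<open>Categories\<close>

text \<open>The subquotient statement and the lifting after passing to orbits rest on one principle,
  \<open>equivariant_extend\<close>: the vertices with exactly \<open>i\<close> ones form one orbit,
  so an equivariant family on them is the same as one morphism at a single vertex that is
  equivariant under its stabilizer. The vertex used has its ones in the last \<open>i\<close>
  positions, because then the stabilizer is a block subgroup and the corner splits into a block of
  \<open>X\<close>s and a block of \<open>Y\<close>s. The price is bracketing: products are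
  bracketed to the left, so splitting a corner into two blocks is an isomorphism,
  \<open>tensor_join\<close>, whose compatibility with permutations needs its own proof. Empty
  blocks are the second obstacle. Sym^0(X) is the unit up to isomorphism, which may fail to be
  cofibrant and lies outside the hypothesis on symmetric powers; for i = n the product with it is
  treated as a retract by means of the unit constraint. Since colimits are arbitrary choices,
  orbits, cokernels and induced objects are handled as relations given by universal properties,
  which functors with a right adjoint can transport directly.\<close>

lemma Hom_iff [simp]: "f \<in> Hom C A B \<longleftrightarrow> f \<in> Arr C \<and> Dom C f = A \<and> Cod C f = B"
  by (simp add: Hom_def)

lemma colimit_cocone: "is_colimit J C F V l \<Longrightarrow> is_cocone J C F V l"
  by (simp add: is_colimit_def)

context category
begin

lemma comp_arr [simp]: "\<lbrakk>f \<in> Arr C; g \<in> Arr C; Cod C f = Dom C g\<rbrakk> \<Longrightarrow> g \<bullet> f \<in> Arr C"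
  and dom_comp [simp]: "\<lbrakk>f \<in> Arr C; g \<in> Arr C; Cod C f = Dom C g\<rbrakk> \<Longrightarrow> Dom C (g \<bullet> f) = Dom C f"
  and cod_comp [simp]: "\<lbrakk>f \<in> Arr C; g \<in> Arr C; Cod C f = Dom C g\<rbrakk> \<Longrightarrow> Cod C (g \<bullet> f) = Cod C g"
  using Comp_in[of f "Dom C f" "Cod C f" g "Cod C g"] by simp_all

lemma comp_assoc [simp]:
  "\<lbrakk>f \<in> Arr C; g \<in> Arr C; h \<in> Arr C; Cod C f = Dom C g; Cod C g = Dom C h\<rbrakk>
    \<Longrightarrow> (h \<bullet> g) \<bullet> f = h \<bullet> g \<bullet> f"
  using Comp_assoc[of f "Dom C f" "Cod C f" g "Cod C g" h "Cod C h"] by simp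

lemma id_arr [simp]: "A \<in> Obj C \<Longrightarrow> Id C A \<in> Arr C"
  and dom_id [simp]: "A \<in> Obj C \<Longrightarrow> Dom C (Id C A) = A"
  and cod_id [simp]: "A \<in> Obj C \<Longrightarrow> Cod C (Id C A) = A"
  using Id_in[of A] by simp_all

lemma comp_id_right [simp]: "\<lbrakk>f \<in> Arr C; Dom C f = A\<rbrakk> \<Longrightarrow> f \<bullet> Id C A = f"
  and comp_id_left [simp]: "\<lbrakk>f \<in> Arr C; Cod C f = A\<rbrakk> \<Longrightarrow> Id C A \<bullet> f = f"
  using Comp_Id[of f "Dom C f" "Cod C f"] Id_Comp[of f "Dom C f" "Cod C f"] by simp_all

declare Dom_in [simp] Cod_in [simp]

text \<open>The simplifier nests composites to the right, where an equation for
  \<open>g \<bullet> f\<close> no longer matches inside a longer composite; this form applies it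
  there.\<close>

lemma comp_reassoc:
  "\<lbrakk>g \<bullet> f = h; g \<in> Arr C; f \<in> Arr C; x \<in> Arr C; Cod C f = Dom C g; Cod C x = Dom C f\<rbrakk>
    \<Longrightarrow> g \<bullet> f \<bullet> x = h \<bullet> x"
  using comp_assoc[of x f g] by simp

lemma inverse_unique:
  assumes "is_inverse C f g" "is_inverse C f h"
  shows "g = h"
proof -
  have "g = g \<bullet> f \<bullet> h"
    using assms by (simp add: is_inverse_def)
  also have "\<dots> = h"
    using assms comp_reassoc[of g f "Id C (Dom C f)" h] by (simp add: is_inverse_def)
  finally show ?thesis .
qed

lemma inverse_arr_is_inverse: "iso_arr C f \<Longrightarrow> is_inverse C f (inverse_arr C f)"
  unfolding iso_arr_def inverse_arr_def by (metis inverse_unique theI)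

lemma inverse_arr_eq: "is_inverse C f g \<Longrightarrow> inverse_arr C f = g"
  using inverse_arr_is_inverse inverse_unique iso_arr_def by metis

lemma iso_arr_arr [simp]: "iso_arr C f \<Longrightarrow> f \<in> Arr C"
  by (auto simp: iso_arr_def is_inverse_def)

lemma inverse_arr_arr [simp]: "iso_arr C f \<Longrightarrow> inverse_arr C f \<in> Arr C"
  and dom_inverse_arr [simp]: "iso_arr C f \<Longrightarrow> Dom C (inverse_arr C f) = Cod C f"
  and cod_inverse_arr [simp]: "iso_arr C f \<Longrightarrow> Cod C (inverse_arr C f) = Dom C f"
  and inverse_arr_comp [simp]: "iso_arr C f \<Longrightarrow> inverse_arr C f \<bullet> f = Id C (Dom C f)"
  and comp_inverse_arr [simp]: "iso_arr C f \<Longrightarrow> f \<bullet> inverse_arr C f = Id C (Cod C f)"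
  using inverse_arr_is_inverse[of f] by (simp_all add: is_inverse_def)

lemma inverse_arr_comp_assoc [simp]:
  "\<lbrakk>iso_arr C f; x \<in> Arr C; Cod C x = Dom C f\<rbrakk> \<Longrightarrow> inverse_arr C f \<bullet> f \<bullet> x = x"
  using comp_reassoc[of "inverse_arr C f" f] iso_arr_arr[of f] by simp

lemma comp_inverse_arr_assoc [simp]:
  "\<lbrakk>iso_arr C f; x \<in> Arr C; Cod C x = Cod C f\<rbrakk> \<Longrightarrow> f \<bullet> inverse_arr C f \<bullet> x = x"
  using comp_reassoc[of f "inverse_arr C f"] iso_arr_arr[of f] by simp

lemma iso_arr_inverse [simp]: "iso_arr C f \<Longrightarrow> iso_arr C (inverse_arr C f)"
  unfolding iso_arr_def[of C "inverse_arr C f"]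
  by (rule exI[of _ f]) (simp add: is_inverse_def)

lemma iso_arr_id [simp]: "A \<in> Obj C \<Longrightarrow> iso_arr C (Id C A)"
  unfolding iso_arr_def by (rule exI[of _ "Id C A"]) (simp add: is_inverse_def)

lemma iso_arr_comp [simp]:
  "\<lbrakk>iso_arr C f; iso_arr C g; Cod C f = Dom C g\<rbrakk> \<Longrightarrow> iso_arr C (g \<bullet> f)"
  unfolding iso_arr_def[of C "g \<bullet> f"]
  by (rule exI[of _ "inverse_arr C f \<bullet> inverse_arr C g"]) (simp add: is_inverse_def)

lemma iso_cancel_right:
  assumes "iso_arr C e" "g \<bullet> e = h \<bullet> e" "g \<in> Arr C" "h \<in> Arr C"
    "Dom C g = Cod C e" "Dom C h = Cod C e"
  shows "g = h"
proof -
  have "g = (g \<bullet> e) \<bullet> inverse_arr C e"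
    using assms(1,3,5) by simp
  also have "\<dots> = (h \<bullet> e) \<bullet> inverse_arr C e"
    by (simp only: assms(2))
  also have "\<dots> = h"
    using assms(1,4,6) by simp
  finally show ?thesis .
qed

subsection \<open>Colimits\<close>

text \<open>The hypothesis provides colimits only over index categories on the natural numbers.
  Injections of the finitely many objects and morphisms of \<open>J\<close> into \<open>nat\<close>
  carry \<open>J\<close> and \<open>F\<close> to such a category, and cocones correspond in both
  directions.\<close>

lemma finite_colimit_exists:
  assumes C: "has_finite_colimits C" and J: "category J" and fin: "finite (Obj J)" "finite (Arr J)"
    and F: "diagram J C F"
  shows "\<exists>V l. is_colimit J C F V l"
proof -
  interpret J: category J by (rule J)
  obtain ob :: "_ \<Rightarrow> nat" where ob: "inj_on ob (Obj J)"
    using fin(1) finite_imp_inj_to_nat_seg by blast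
  obtain ar :: "_ \<Rightarrow> nat" where ar: "inj_on ar (Arr J)"
    using fin(2) finite_imp_inj_to_nat_seg by blast
  define ob' where "ob' = inv_into (Obj J) ob"
  define ar' where "ar' = inv_into (Arr J) ar"
  have [simp]: "\<And>a. a \<in> Obj J \<Longrightarrow> ob' (ob a) = a" "\<And>s. s \<in> Arr J \<Longrightarrow> ar' (ar s) = s"
    unfolding ob'_def ar'_def using ob ar by simp_all
  have [simp]: "\<And>a b. \<lbrakk>a \<in> Obj J; b \<in> Obj J\<rbrakk> \<Longrightarrow> ob a = ob b \<longleftrightarrow> a = b"
    using ob by (auto dest: inj_onD)
  define J' :: "(nat, nat) cat" where "J' = \<lparr>Obj = ob ` Obj J, Arr = ar ` Arr J,
    Dom = \<lambda>s. ob (Dom J (ar' s)), Cod = \<lambda>s. ob (Cod J (ar' s)),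
    Id = \<lambda>a. ar (Id J (ob' a)), Comp = \<lambda>t s. ar (ar' t \<bullet>\<^bsub>J\<^esub> ar' s)\<rparr>"
  define F' where "F' = \<lparr>on_obj = \<lambda>a. on_obj F (ob' a), on_arr = \<lambda>s. on_arr F (ar' s)\<rparr>"
  have "category J'"
    by unfold_locales (auto simp: J'_def)
  moreover have "diagram J' C F'"
    using F by (auto simp: diagram_def J'_def F'_def)
  moreover have "finite (Obj J')" "finite (Arr J')"
    using fin by (auto simp: J'_def)
  ultimately obtain V l where l: "is_colimit J' C F' V l"
    using C unfolding has_finite_colimits_def by blast
  have cocone: "is_cocone J C F U k \<longleftrightarrow> is_cocone J' C F' U (\<lambda>a. k (ob' a))" for U k
    by (auto simp: is_cocone_def J'_def F'_def)
  have cocone': "is_cocone J' C F' U k \<Longrightarrow> is_cocone J C F U (\<lambda>a. k (ob a))" for U k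
    by (auto simp: is_cocone_def J'_def F'_def)
  have "is_colimit J C F V (\<lambda>a. l (ob a))"
    unfolding is_colimit_def
  proof (intro conjI allI impI)
    show "is_cocone J C F V (\<lambda>a. l (ob a))"
      by (rule cocone'[OF colimit_cocone[OF l]])
    fix U k
    assume "is_cocone J C F U k"
    then have "\<exists>!u. u \<in> Hom C V U \<and> (\<forall>a\<in>Obj J'. u \<bullet> l a = k (ob' a))"
      using l unfolding is_colimit_def cocone by blast
    moreover have "(\<forall>a\<in>Obj J'. u \<bullet> l a = k (ob' a)) \<longleftrightarrow> (\<forall>a\<in>Obj J. u \<bullet> l (ob a) = k a)" for u
      by (simp add: J'_def)
    ultimately show "\<exists>!u. u \<in> Hom C V U \<and> (\<forall>a\<in>Obj J. u \<bullet> l (ob a) = k a)"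
      by simp
  qed
  then show ?thesis by blast
qed

end

lemma colimit_is_colimit:
  "is_colimit J C F V l \<Longrightarrow> is_colimit J C F (colim_obj J C F) (colim_leg J C F)"
  unfolding colim_obj_def colim_leg_def colimit_def
  by (rule someI2[of "\<lambda>(V, l). is_colimit J C F V l" "(V, l)"]) auto

lemma colimit_leg:
  assumes "is_colimit J C F V l"
  shows "V \<in> Obj C" and "a \<in> Obj J \<Longrightarrow> l a \<in> Arr C" and "a \<in> Obj J \<Longrightarrow> Dom C (l a) = on_obj F a"
    and "a \<in> Obj J \<Longrightarrow> Cod C (l a) = V"
    and "s \<in> Arr J \<Longrightarrow> l (Cod J s) \<bullet>\<^bsub>C\<^esub> on_arr F s = l (Dom J s)"
  using assms by (auto simp: is_colimit_def is_cocone_def)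

lemma colimit_desc_ex:
  assumes "is_colimit J C F V l" "is_cocone J C F U k"
  obtains u where "u \<in> Hom C V U" "\<And>a. a \<in> Obj J \<Longrightarrow> u \<bullet>\<^bsub>C\<^esub> l a = k a"
  using assms unfolding is_colimit_def by blast

lemma colimit_desc:
  assumes "is_colimit J C F V l" "is_cocone J C F U k"
  shows "colim_desc J C F U k \<in> Hom C (colim_obj J C F) U"
    and "a \<in> Obj J \<Longrightarrow> colim_desc J C F U k \<bullet>\<^bsub>C\<^esub> colim_leg J C F a = k a"
proof -
  have "\<exists>!u. u \<in> Hom C (colim_obj J C F) U \<and> (\<forall>a \<in> Obj J. u \<bullet>\<^bsub>C\<^esub> colim_leg J C F a = k a)"
    using colimit_is_colimit[OF assms(1)] assms(2) unfolding is_colimit_def by blast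
  from theI'[OF this]
  show "colim_desc J C F U k \<in> Hom C (colim_obj J C F) U"
    "a \<in> Obj J \<Longrightarrow> colim_desc J C F U k \<bullet>\<^bsub>C\<^esub> colim_leg J C F a = k a"
    unfolding colim_desc_def by blast+
qed

text \<open>The family \<open>u \<bullet> l a\<close> is itself a cocone, and both \<open>u\<close>
  and \<open>v\<close> are morphisms induced by it.\<close>

lemma (in category) colimit_ext:
  assumes l: "is_colimit J C F V l"
    and D: "\<And>s. s \<in> Arr J \<Longrightarrow> Dom J s \<in> Obj J \<and> Cod J s \<in> Obj J"
    and F: "\<And>s. s \<in> Arr J \<Longrightarrow> on_arr F s \<in> Hom C (on_obj F (Dom J s)) (on_obj F (Cod J s))"
    and uv: "u \<in> Arr C" "v \<in> Arr C" "Dom C u = V" "Dom C v = V" "Cod C u = Cod C v"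
    and eq: "\<And>a. a \<in> Obj J \<Longrightarrow> u \<bullet> l a = v \<bullet> l a"
  shows "u = v"
proof -
  have "is_cocone J C F (Cod C u) (\<lambda>a. u \<bullet> l a)"
    using colimit_leg[OF l] D F uv by (auto simp: is_cocone_def)
  then have "\<exists>!w. w \<in> Hom C V (Cod C u) \<and> (\<forall>a \<in> Obj J. w \<bullet> l a = u \<bullet> l a)"
    using l unfolding is_colimit_def by blast
  then show ?thesis
    using uv eq by (metis Hom_iff)
qed

section \<open>Push-outs, initial and terminal objects\<close>

context category
begin

lemma pushout_exists:
  assumes "has_finite_colimits C" "f \<in> Arr C" "g \<in> Arr C" "Dom C f = Dom C g"
  obtains P i j where "is_pushout C f g P i j"
proof -
  \<comment> \<open>The span: 0 is the common source, 1 and 2 are the targets, the morphisms 0, 1, 2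
    are the identities, 3 goes from 0 to 1 and 4 from 0 to 2. Hence the codomain
    \<open>s - 2\<close>, and in a composite with an identity the other factor survives.\<close>
  define J :: "(nat, nat) cat" where "J = \<lparr>Obj = {0, 1, 2}, Arr = {0, 1, 2, 3, 4},
    Dom = \<lambda>s. if s \<le> 2 then s else 0, Cod = \<lambda>s. if s \<le> 2 then s else s - 2,
    Id = \<lambda>a. a, Comp = \<lambda>t s. if s \<le> 2 then t else s\<rparr>"
  define F where "F = \<lparr>on_obj = \<lambda>a :: nat. if a = 0 then Dom C f else if a = 1 then Cod C f else Cod C g,
    on_arr = \<lambda>s :: nat. if s = 0 then Id C (Dom C f) else if s = 1 then Id C (Cod C f)
      else if s = 2 then Id C (Cod C g) else if s = 3 then f else g\<rparr>"
  have "category J"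
    by unfold_locales (auto simp: J_def)
  moreover have "diagram J C F"
    using assms(2-) by (auto simp: diagram_def J_def F_def)
  ultimately obtain V l where l: "is_colimit J C F V l"
    using finite_colimit_exists[OF assms(1), of J F] by (auto simp: J_def)
  have cocone: "is_cocone J C F U k \<longleftrightarrow> U \<in> Obj C \<and> k 0 \<in> Hom C (Dom C f) U \<and> k 1 \<in> Hom C (Cod C f) U \<and>
      k 2 \<in> Hom C (Cod C g) U \<and> k 1 \<bullet> f = k 0 \<and> k 2 \<bullet> g = k 0" for U k
    using assms(2-) by (auto simp: is_cocone_def J_def F_def)
  have "is_pushout C f g V (l 1) (l 2)"
    unfolding is_pushout_def
  proof (intro conjI allI impI)
    fix U h k
    assume hk: "h \<in> Hom C (Cod C f) U \<and> k \<in> Hom C (Cod C g) U \<and> h \<bullet> f = k \<bullet> g"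
    have "is_cocone J C F U (\<lambda>a. if a = 0 then h \<bullet> f else if a = 1 then h else k)"
      using hk assms(2-) by (auto simp: cocone)
    then have "\<exists>!u. u \<in> Hom C V U \<and>
        (\<forall>a\<in>Obj J. u \<bullet> l a = (if a = 0 then h \<bullet> f else if a = 1 then h else k))"
      using l unfolding is_colimit_def by blast
    moreover have "(\<forall>a\<in>Obj J. u \<bullet> l a = (if a = 0 then h \<bullet> f else if a = 1 then h else k))
        \<longleftrightarrow> u \<bullet> l 1 = h \<and> u \<bullet> l 2 = k" if "u \<in> Hom C V U" for u
    proof -
      have "u \<bullet> l 0 = (u \<bullet> l 1) \<bullet> f"
        using colimit_cocone[OF l, unfolded cocone] that assms(2-) by auto
      then show ?thesis by (auto simp: J_def)
    qed
    ultimately show "\<exists>!u. u \<in> Hom C V U \<and> u \<bullet> l 1 = h \<and> u \<bullet> l 2 = k"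
      by (metis (no_types, lifting))
  qed (use assms(2-) colimit_cocone[OF l, unfolded cocone] in auto)
  then show ?thesis by (rule that)
qed

lemma pushout_arr:
  assumes "is_pushout C f g P i j"
  shows "i \<in> Arr C" "Dom C i = Cod C f" "Cod C i = P" "j \<in> Arr C" "Dom C j = Cod C g" "Cod C j = P"
    "i \<bullet> f = j \<bullet> g" "P \<in> Obj C" "f \<in> Arr C" "g \<in> Arr C" "Dom C f = Dom C g"
  using assms by (auto simp: is_pushout_def)

text \<open>A terminal object is a limit over the empty category. Anything is a diagram there, so
  \<open>undefined\<close> can stand for one.\<close>

lemma terminal_exists:
  assumes "has_finite_limits C"
  obtains T where "is_terminal C T"
proof -
  define J :: "(nat, nat) cat" where "J = \<lparr>Obj = {}, Arr = {},
    Dom = \<lambda>s. s, Cod = \<lambda>s. s, Id = \<lambda>a. a, Comp = \<lambda>t s. s\<rparr>"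
  have "category J" by unfold_locales (auto simp: J_def)
  moreover have "diagram J C F" for F :: "(nat, nat, 'o, 'm) diag" by (auto simp: diagram_def J_def)
  moreover have "finite (Obj J)" "finite (Arr J)" by (auto simp: J_def)
  ultimately obtain V l where "is_limit J C (undefined :: (nat, nat, 'o, 'm) diag) V l"
    using assms unfolding has_finite_limits_def by blast
  then have "is_terminal C V"
    by (auto simp: is_limit_def is_terminal_def is_cone_def J_def)
  then show ?thesis by (rule that)
qed

lemma initial_ext:
  "\<lbrakk>is_initial C I; f \<in> Arr C; g \<in> Arr C; Dom C f = I; Dom C g = I; Cod C f = Cod C g\<rbrakk> \<Longrightarrow> f = g"
  by (metis Cod_in Hom_iff is_initial_def)

lemma terminal_ext:
  "\<lbrakk>is_terminal C T; f \<in> Arr C; g \<in> Arr C; Cod C f = T; Cod C g = T; Dom C f = Dom C g\<rbrakk> \<Longrightarrow> f = g"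
  by (metis Dom_in Hom_iff is_terminal_def)

lemma initial_arr:
  assumes "is_initial C I" "A \<in> Obj C"
  obtains f where "f \<in> Arr C" "Dom C f = I" "Cod C f = A"
  using assms by (auto simp: is_initial_def)

lemma terminal_arr:
  assumes "is_terminal C T" "A \<in> Obj C"
  obtains f where "f \<in> Arr C" "Dom C f = A" "Cod C f = T"
  using assms by (auto simp: is_terminal_def)

end

subsection \<open>Zero morphisms and cokernels\<close>

text \<open>Zero morphisms, with the zero object quantified instead of fixed: \<open>null_eq\<close>
  shows that they do not depend on it, and in a category without zero object no morphism is
  \<open>null\<close>.\<close>

definition null :: "('o, 'm, 'z) cat_scheme \<Rightarrow> 'm \<Rightarrow> bool" where
  "null C g \<longleftrightarrow> (\<exists>V a b. is_initial C V \<and> is_terminal C V \<and> a \<in> Hom C (Dom C g) V \<and>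
     b \<in> Hom C V (Cod C g) \<and> g = b \<bullet>\<^bsub>C\<^esub> a)"

text \<open>A simultaneous cokernel of a set of morphisms with a common codomain and possibly
  different domains. A set is needed because a corner of a cube has to be divided by all edges
  entering it at once, without forming a coproduct of their sources.\<close>

definition is_coker :: "('o, 'm, 'z) cat_scheme \<Rightarrow> 'm set \<Rightarrow> 'm \<Rightarrow> bool" where
  "is_coker C S q \<longleftrightarrow> q \<in> Arr C \<and>
     (\<forall>s \<in> S. s \<in> Arr C \<and> Cod C s = Dom C q \<and> null C (q \<bullet>\<^bsub>C\<^esub> s)) \<and>
     (\<forall>h \<in> Arr C. Dom C h = Dom C q \<and> (\<forall>s \<in> S. null C (h \<bullet>\<^bsub>C\<^esub> s)) \<longrightarrow>
        (\<exists>!u. u \<in> Hom C (Cod C q) (Cod C h) \<and> u \<bullet>\<^bsub>C\<^esub> q = h))"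

context category
begin

lemma nullI:
  "\<lbrakk>is_initial C V; is_terminal C V; a \<in> Arr C; b \<in> Arr C; Cod C a = V; Dom C b = V\<rbrakk>
    \<Longrightarrow> null C (b \<bullet> a)"
  unfolding null_def by (rule exI[of _ V], rule exI[of _ a], rule exI[of _ b]) simp

lemma nullE:
  assumes "null C g"
  obtains V a b where "is_initial C V" "is_terminal C V" "a \<in> Arr C" "b \<in> Arr C" "Cod C a = V"
    "Dom C b = V" "g = b \<bullet> a"
  using assms by (auto simp: null_def)

text \<open>Two zero objects are compared by the unique \<open>e\<close> from \<open>V\<close> to
  \<open>W\<close>: uniqueness out of \<open>V\<close> gives \<open>b = d \<bullet> e\<close> and
  uniqueness into \<open>W\<close> gives \<open>c = e \<bullet> a\<close>, so both morphisms equal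
  \<open>d \<bullet> e \<bullet> a\<close>.\<close>

lemma null_eq:
  assumes "null C g" "null C h" "Dom C g = Dom C h" "Cod C g = Cod C h"
  shows "g = h"
proof -
  obtain V a b where V: "is_initial C V" "is_terminal C V" "a \<in> Arr C" "b \<in> Arr C" "Cod C a = V"
      "Dom C b = V" and g: "g = b \<bullet> a"
    using assms(1) by (rule nullE)
  obtain W c d where W: "is_initial C W" "is_terminal C W" "c \<in> Arr C" "d \<in> Arr C" "Cod C c = W"
      "Dom C d = W" and h: "h = d \<bullet> c"
    using assms(2) by (rule nullE)
  have eqs: "Dom C a = Dom C c" "Cod C b = Cod C d"
    using assms(3,4) V(3-6) W(3-6) by (simp_all add: g h)
  obtain e where e: "e \<in> Arr C" "Dom C e = V" "Cod C e = W"
    using initial_arr[OF V(1)] W(1) by (auto simp: is_initial_def)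
  have b: "b = d \<bullet> e"
    by (rule initial_ext[OF V(1)]) (use V W e eqs in simp_all)
  have c: "c = e \<bullet> a"
    by (rule terminal_ext[OF W(2)]) (use V W e eqs in simp_all)
  show ?thesis
    unfolding g h b c using V W(3-6) e by simp
qed

lemma null_comp_left:
  assumes "null C g" "h \<in> Arr C" "Dom C h = Cod C g"
  shows "null C (h \<bullet> g)"
  using assms(1)
proof (cases rule: nullE)
  case (1 V a b)
  have "null C ((h \<bullet> b) \<bullet> a)"
    using 1(1-6) assms(2,3) by (intro nullI[of V]) (simp_all add: 1(7))
  then show ?thesis
    using 1(3-6) assms(2,3) by (simp add: 1(7))
qed

lemma null_comp_right:
  assumes "null C g" "h \<in> Arr C" "Cod C h = Dom C g"
  shows "null C (g \<bullet> h)"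
  using assms(1)
proof (cases rule: nullE)
  case (1 V a b)
  have "null C (b \<bullet> (a \<bullet> h))"
    using 1(1-6) assms(2,3) by (intro nullI[of V]) (simp_all add: 1(7))
  then show ?thesis
    using 1(3-6) assms(2,3) by (simp add: 1(7))
qed

lemma null_exists:
  assumes "pointed C" "A \<in> Obj C" "B \<in> Obj C"
  obtains g where "null C g" "g \<in> Arr C" "Dom C g = A" "Cod C g = B"
proof -
  obtain V where V: "is_initial C V" "is_terminal C V"
    using assms(1) by (auto simp: pointed_def)
  obtain a b where "a \<in> Arr C" "Dom C a = A" "Cod C a = V" "b \<in> Arr C" "Dom C b = V" "Cod C b = B"
    using terminal_arr[OF V(2) assms(2)] initial_arr[OF V(1) assms(3)] by metis
  then show ?thesis
    using V by (intro that[of "b \<bullet> a"] nullI[of V]) simp_all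
qed

text \<open>\<open>is_quotient\<close> works with an arbitrary terminal object, which has to be
  recognised as a zero object. Every morphism out of it factors through the given zero object
  \<open>V\<close>, because the comparison \<open>b \<bullet> a\<close> is the identity of
  \<open>T\<close>.\<close>

lemma pointed_terminal_initial:
  assumes "pointed C" "is_terminal C T"
  shows "is_initial C T"
proof -
  obtain V where V: "is_initial C V" "is_terminal C V"
    using assms(1) by (auto simp: pointed_def)
  have VT: "V \<in> Obj C" "T \<in> Obj C" using V assms by (auto simp: is_initial_def is_terminal_def)
  obtain a where a: "a \<in> Arr C" "Dom C a = T" "Cod C a = V"
    using terminal_arr[OF V(2)] VT by metis
  obtain b where b: "b \<in> Arr C" "Dom C b = V" "Cod C b = T"
    using terminal_arr[OF assms(2)] VT by metis
  have ba: "b \<bullet> a = Id C T"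
    using terminal_ext[OF assms(2), of "b \<bullet> a" "Id C T"] a b VT by simp
  show ?thesis
    unfolding is_initial_def
  proof (intro conjI ballI ex1I)
    fix A assume A: "A \<in> Obj C"
    define c where "c = (SOME c. c \<in> Hom C V A)"
    have c: "c \<in> Arr C" "Dom C c = V" "Cod C c = A"
      using someI_ex[of "\<lambda>c. c \<in> Hom C V A"] initial_arr[OF V(1) A] unfolding c_def by (metis Hom_iff)+
    show "c \<bullet> a \<in> Hom C T A" using a c by simp
    fix f assume f: "f \<in> Hom C T A"
    have "f = (f \<bullet> b) \<bullet> a" using a b ba f by simp
    also have "f \<bullet> b = c" using initial_ext[OF V(1), of "f \<bullet> b" c] f b c by simp
    finally show "f = c \<bullet> a" .
  qed (rule VT)
qed

lemma coker_ext:
  assumes "is_coker C S q" "u \<in> Arr C" "v \<in> Arr C" "Dom C u = Cod C q" "Dom C v = Cod C q"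
    "u \<bullet> q = v \<bullet> q"
  shows "u = v"
proof -
  have q: "q \<in> Arr C" and S: "\<And>s. s \<in> S \<Longrightarrow> s \<in> Arr C \<and> Cod C s = Dom C q \<and> null C (q \<bullet> s)"
    using assms(1) by (auto simp: is_coker_def)
  have cod: "Cod C u = Cod C v"
    using arg_cong[OF assms(6), of "Cod C"] assms(2-5) q by simp
  have "null C ((u \<bullet> q) \<bullet> s)" if "s \<in> S" for s
    using null_comp_left[of "q \<bullet> s" u] S[OF that] q assms(2,4) by simp
  moreover have "u \<bullet> q \<in> Arr C" "Dom C (u \<bullet> q) = Dom C q"
    using assms(2,4) q by simp_all
  ultimately have "\<exists>!w. w \<in> Hom C (Cod C q) (Cod C (u \<bullet> q)) \<and> w \<bullet> q = u \<bullet> q"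
    using assms(1) unfolding is_coker_def by blast
  moreover have "u \<in> Hom C (Cod C q) (Cod C (u \<bullet> q))" "v \<in> Hom C (Cod C q) (Cod C (u \<bullet> q))"
    using assms(2-5) q cod by simp_all
  ultimately show ?thesis
    using assms(6) by metis
qed

lemma coker_desc:
  assumes "is_coker C S q" "h \<in> Arr C" "Dom C h = Dom C q" "\<And>s. s \<in> S \<Longrightarrow> null C (h \<bullet> s)"
  obtains u where "u \<in> Arr C" "Dom C u = Cod C q" "Cod C u = Cod C h" "u \<bullet> q = h"
  using assms unfolding is_coker_def by (metis Hom_iff)

lemma is_cokerI:
  assumes "q \<in> Arr C" "\<And>s. s \<in> S \<Longrightarrow> s \<in> Arr C \<and> Cod C s = Dom C q \<and> null C (q \<bullet> s)"
    and "\<And>h. \<lbrakk>h \<in> Arr C; Dom C h = Dom C q; \<And>s. s \<in> S \<Longrightarrow> null C (h \<bullet> s)\<rbrakk>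
      \<Longrightarrow> \<exists>u. u \<in> Hom C (Cod C q) (Cod C h) \<and> u \<bullet> q = h"
    and "\<And>u v. \<lbrakk>u \<in> Arr C; v \<in> Arr C; Dom C u = Cod C q; Dom C v = Cod C q; Cod C u = Cod C v;
      u \<bullet> q = v \<bullet> q\<rbrakk> \<Longrightarrow> u = v"
  shows "is_coker C S q"
  unfolding is_coker_def
proof (intro conjI ballI impI)
  fix h assume h: "h \<in> Arr C" "Dom C h = Dom C q \<and> (\<forall>s\<in>S. null C (h \<bullet> s))"
  then obtain u where u: "u \<in> Hom C (Cod C q) (Cod C h)" "u \<bullet> q = h"
    using assms(3)[of h] by blast
  show "\<exists>!u. u \<in> Hom C (Cod C q) (Cod C h) \<and> u \<bullet> q = h"
    by (rule ex1I[of _ u]) (use u assms(4) in auto)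
qed (use assms(1,2) in auto)

text \<open>When the terminal object is initial, the leg \<open>z\<close> of the push-out carries no
  data, and agreeing on \<open>Dom C g\<close> with a morphism through the terminal object means
  being zero on \<open>g\<close>.\<close>

lemma quotient_coker:
  assumes "pointed C" "is_quotient C g Q p z"
  shows "is_coker C {g} p"
proof -
  obtain T t where T: "is_terminal C T" and t: "t \<in> Hom C (Dom C g) T" and po: "is_pushout C g t Q p z"
    using assms(2) by (auto simp: is_quotient_def)
  have I: "is_initial C T" by (rule pointed_terminal_initial[OF assms(1) T])
  note po' = pushout_arr[OF po]
  show ?thesis
  proof (rule is_cokerI)
    show "s \<in> Arr C \<and> Cod C s = Dom C p \<and> null C (p \<bullet> s)" if "s \<in> {g}" for s
      using that po'(2,9) nullI[OF I T, of t z] t po'(4,5) unfolding po'(7)[symmetric] by auto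
  next
    fix h assume h: "h \<in> Arr C" "Dom C h = Dom C p" "\<And>s. s \<in> {g} \<Longrightarrow> null C (h \<bullet> s)"
    obtain k where k: "k \<in> Arr C" "Dom C k = T" "Cod C k = Cod C h"
      using initial_arr[OF I, of "Cod C h"] h by auto
    have "null C (k \<bullet> t)"
      using T I t k nullI[of T t k] by simp
    then have "h \<bullet> g = k \<bullet> t"
      using null_eq[of "h \<bullet> g" "k \<bullet> t"] h k t po' by simp
    then show "\<exists>u. u \<in> Hom C (Cod C p) (Cod C h) \<and> u \<bullet> p = h"
      using po h k t po' unfolding is_pushout_def by (metis Hom_iff)
  next
    fix u v
    assume uv: "u \<in> Arr C" "v \<in> Arr C" "Dom C u = Cod C p" "Dom C v = Cod C p" "Cod C u = Cod C v"
      "u \<bullet> p = v \<bullet> p"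
    have "u \<bullet> z = v \<bullet> z"
      using initial_ext[OF I, of "u \<bullet> z" "v \<bullet> z"] uv po' t by simp
    moreover have "\<exists>!w. w \<in> Hom C Q (Cod C u) \<and> w \<bullet> p = u \<bullet> p \<and> w \<bullet> z = u \<bullet> z"
    proof -
      have "u \<bullet> p \<in> Hom C (Cod C g) (Cod C u)" "u \<bullet> z \<in> Hom C (Cod C t) (Cod C u)"
        "(u \<bullet> p) \<bullet> g = (u \<bullet> z) \<bullet> t"
        using uv(1,3) po' t by auto
      then show ?thesis
        using po unfolding is_pushout_def by blast
    qed
    ultimately show "u = v"
      using uv po' by (metis Hom_iff)
  qed (use po' in auto)
qed

lemma quotient_exists:
  assumes "has_finite_colimits C" "has_finite_limits C" "g \<in> Arr C"
  obtains Q p z where "quotient C g = (Q, p, z)" "is_quotient C g Q p z"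
proof -
  obtain T where T: "is_terminal C T" using terminal_exists[OF assms(2)] .
  obtain t where t: "t \<in> Arr C" "Dom C t = Dom C g" "Cod C t = T"
    using terminal_arr[OF T, of "Dom C g"] assms(3) by auto
  obtain P i j where "is_pushout C g t P i j"
    using pushout_exists[OF assms(1,3) t(1)] t(2) by auto
  then have "is_quotient C g P i j"
    using T t by (auto simp: is_quotient_def)
  then have "\<exists>x. (\<lambda>(Q, p, z). is_quotient C g Q p z) x"
    by (intro exI[of _ "(P, i, j)"]) simp
  then have "(\<lambda>(Q, p, z). is_quotient C g Q p z) (quotient C g)"
    unfolding quotient_def by (rule someI_ex)
  then show ?thesis
    using that by (cases "quotient C g") auto
qed

text \<open>An endomorphism of \<open>B\<close> preserving \<open>A\<close> descends because \<open>A \<rightarrow> *\<close> absorbs endomorphisms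
  of \<open>A\<close>.\<close>

lemma quot_endo:
  assumes q: "quotient C g = (Q, p, z)" "is_quotient C g Q p z"
    and b: "b \<in> Hom C (Cod C g) (Cod C g)" and b': "b' \<in> Hom C (Dom C g) (Dom C g)"
    and eq: "b \<bullet> g = g \<bullet> b'"
  shows "quot_endo C g b \<in> Hom C Q Q" "quot_endo C g b \<bullet> p = p \<bullet> b"
    "\<And>u. \<lbrakk>u \<in> Hom C Q Q; u \<bullet> p = p \<bullet> b; u \<bullet> z = z\<rbrakk> \<Longrightarrow> u = quot_endo C g b"
    "quot_endo C g b \<bullet> z = z"
proof -
  obtain T t where T: "is_terminal C T" and t: "t \<in> Hom C (Dom C g) T" and po: "is_pushout C g t Q p z"
    using q(2) by (auto simp: is_quotient_def)
  note po' = pushout_arr[OF po]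
  have "t \<bullet> b' = t"
    using terminal_ext[OF T, of "t \<bullet> b'" t] t b' by simp
  moreover have "p \<bullet> g \<bullet> b' = (z \<bullet> t) \<bullet> b'"
    using po' b' comp_reassoc[OF po'(7)] by simp
  ultimately have "p \<bullet> b \<in> Hom C (Cod C g) Q \<and> z \<in> Hom C (Cod C t) Q \<and> (p \<bullet> b) \<bullet> g = z \<bullet> t"
    using po' b b' t eq by simp
  then have ex1: "\<exists>!u. u \<in> Hom C Q Q \<and> u \<bullet> p = p \<bullet> b \<and> u \<bullet> z = z"
    using po unfolding is_pushout_def by blast
  have def_eq: "quot_endo C g b = (THE u. u \<in> Hom C Q Q \<and> u \<bullet> p = p \<bullet> b \<and> u \<bullet> z = z)"
    by (simp add: quot_endo_def q(1))
  show "quot_endo C g b \<in> Hom C Q Q" "quot_endo C g b \<bullet> p = p \<bullet> b" "quot_endo C g b \<bullet> z = z"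
    "\<And>u. \<lbrakk>u \<in> Hom C Q Q; u \<bullet> p = p \<bullet> b; u \<bullet> z = z\<rbrakk> \<Longrightarrow> u = quot_endo C g b"
    unfolding def_eq using theI'[OF ex1] ex1 by blast+
qed

end

section \<open>Functors with a right adjoint\<close>

text \<open>The right adjoint is recorded objectwise, by couniversal morphisms \<open>e\<close> from
  \<open>Fo H\<close> to \<open>D\<close>; this is the shape in which \<open>closed\<close> supplies
  it. Endofunctors suffice, since tensoring with a fixed object is one.\<close>

definition left_adjoint :: "('o, 'm, 'z) cat_scheme \<Rightarrow> ('o \<Rightarrow> 'o) \<Rightarrow> ('m \<Rightarrow> 'm) \<Rightarrow> bool" where
  "left_adjoint C Fo Fa \<longleftrightarrow>
     (\<forall>A \<in> Obj C. Fo A \<in> Obj C \<and> Fa (Id C A) = Id C (Fo A)) \<and>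
     (\<forall>f \<in> Arr C. Fa f \<in> Hom C (Fo (Dom C f)) (Fo (Cod C f))) \<and>
     (\<forall>f \<in> Arr C. \<forall>g \<in> Arr C. Cod C f = Dom C g \<longrightarrow> Fa (g \<bullet>\<^bsub>C\<^esub> f) = Fa g \<bullet>\<^bsub>C\<^esub> Fa f) \<and>
     (\<forall>D \<in> Obj C. \<exists>H e. H \<in> Obj C \<and> e \<in> Hom C (Fo H) D \<and>
        (\<forall>A \<in> Obj C. \<forall>g \<in> Hom C (Fo A) D. \<exists>!h. h \<in> Hom C A H \<and> e \<bullet>\<^bsub>C\<^esub> Fa h = g))"

definition map_diag ::
  "('o \<Rightarrow> 'o) \<Rightarrow> ('m \<Rightarrow> 'm) \<Rightarrow> ('a, 'b, 'o, 'm) diag \<Rightarrow> ('a, 'b, 'o, 'm) diag" where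
  "map_diag Fo Fa F = \<lparr>on_obj = \<lambda>a. Fo (on_obj F a), on_arr = \<lambda>s. Fa (on_arr F s)\<rparr>"

context category
begin

lemma left_adjointD:
  assumes "left_adjoint C Fo Fa"
  shows "A \<in> Obj C \<Longrightarrow> Fo A \<in> Obj C" "A \<in> Obj C \<Longrightarrow> Fa (Id C A) = Id C (Fo A)"
    "f \<in> Arr C \<Longrightarrow> Fa f \<in> Arr C" "f \<in> Arr C \<Longrightarrow> Dom C (Fa f) = Fo (Dom C f)"
    "f \<in> Arr C \<Longrightarrow> Cod C (Fa f) = Fo (Cod C f)"
    "\<lbrakk>f \<in> Arr C; g \<in> Arr C; Cod C f = Dom C g\<rbrakk> \<Longrightarrow> Fa (g \<bullet> f) = Fa g \<bullet> Fa f"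
  using assms by (auto simp: left_adjoint_def)

lemma left_adjoint_transpose:
  assumes F: "left_adjoint C Fo Fa" and D: "D \<in> Obj C"
  obtains H e where "H \<in> Obj C" "e \<in> Arr C" "Dom C e = Fo H" "Cod C e = D"
    "\<And>A g. \<lbrakk>A \<in> Obj C; g \<in> Arr C; Dom C g = Fo A; Cod C g = D\<rbrakk>
      \<Longrightarrow> \<exists>h. h \<in> Arr C \<and> Dom C h = A \<and> Cod C h = H \<and> e \<bullet> Fa h = g"
    "\<And>h k. \<lbrakk>h \<in> Arr C; k \<in> Arr C; Dom C h = Dom C k; Cod C h = H; Cod C k = H;
      e \<bullet> Fa h = e \<bullet> Fa k\<rbrakk> \<Longrightarrow> h = k"
proof -
  have "\<exists>H e. H \<in> Obj C \<and> e \<in> Hom C (Fo H) D \<and>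
      (\<forall>A \<in> Obj C. \<forall>g \<in> Hom C (Fo A) D. \<exists>!h. h \<in> Hom C A H \<and> e \<bullet> Fa h = g)"
    using F D by (simp only: left_adjoint_def)
  then obtain H e where He: "H \<in> Obj C" "e \<in> Hom C (Fo H) D"
    "\<And>A g. A \<in> Obj C \<Longrightarrow> g \<in> Hom C (Fo A) D \<Longrightarrow> \<exists>!h. h \<in> Hom C A H \<and> e \<bullet> Fa h = g"
    by blast
  show ?thesis
  proof (rule that[of H e])
    fix h k
    assume hk: "h \<in> Arr C" "k \<in> Arr C" "Dom C h = Dom C k" "Cod C h = H" "Cod C k = H"
      "e \<bullet> Fa h = e \<bullet> Fa k"
    have "\<exists>!x. x \<in> Hom C (Dom C h) H \<and> e \<bullet> Fa x = e \<bullet> Fa h"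
      using hk(1,4) He left_adjointD[OF F] by (intro He(3)) simp_all
    then show "h = k" using hk by (metis Hom_iff)
  next
    fix A g assume "A \<in> Obj C" "g \<in> Arr C" "Dom C g = Fo A" "Cod C g = D"
    then show "\<exists>h. h \<in> Arr C \<and> Dom C h = A \<and> Cod C h = H \<and> e \<bullet> Fa h = g"
      using He(3)[of A g] by auto
  qed (use He in auto)
qed

lemma left_adjoint_initial:
  assumes F: "left_adjoint C Fo Fa" and I: "is_initial C I"
  shows "is_initial C (Fo I)"
  unfolding is_initial_def
proof (intro conjI ballI)
  have I': "I \<in> Obj C" using I by (simp add: is_initial_def)
  then show "Fo I \<in> Obj C" by (rule left_adjointD[OF F])
  fix D assume D: "D \<in> Obj C"
  from F D show "\<exists>!f. f \<in> Hom C (Fo I) D"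
  proof (rule left_adjoint_transpose)
    fix H e
    assume H: "H \<in> Obj C" "e \<in> Arr C" "Dom C e = Fo H" "Cod C e = D"
      and ex: "\<And>A g. \<lbrakk>A \<in> Obj C; g \<in> Arr C; Dom C g = Fo A; Cod C g = D\<rbrakk>
        \<Longrightarrow> \<exists>h. h \<in> Arr C \<and> Dom C h = A \<and> Cod C h = H \<and> e \<bullet> Fa h = g"
    obtain h where h: "h \<in> Arr C" "Dom C h = I" "Cod C h = H"
      using initial_arr[OF I H(1)] .
    show ?thesis
    proof (rule ex1I[of _ "e \<bullet> Fa h"])
      show "e \<bullet> Fa h \<in> Hom C (Fo I) D" using H h left_adjointD[OF F] by simp
      fix g assume "g \<in> Hom C (Fo I) D"
      then obtain k where "k \<in> Arr C" "Dom C k = I" "Cod C k = H" "e \<bullet> Fa k = g"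
        using ex[OF I', of g] by auto
      then show "g = e \<bullet> Fa h" using initial_ext[OF I, of h k] h by simp
    qed
  qed
qed

text \<open>Cocones under the image diagram are transposed leg by leg to cocones with vertex
  \<open>H\<close>; the transposed legs are compatible because transposition is injective.\<close>

lemma left_adjoint_colimit:
  assumes F: "left_adjoint C Fo Fa" and J: "category J" and K: "diagram J C K"
    and l: "is_colimit J C K V l"
  shows "is_colimit J C (map_diag Fo Fa K) (Fo V) (\<lambda>a. Fa (l a))"
proof -
  interpret J: category J by (rule J)
  note Fd = left_adjointD[OF F] and ll = colimit_leg[OF l]
  have Ko: "on_obj K a \<in> Obj C" if "a \<in> Obj J" for a
    using K that by (simp add: diagram_def)
  have Ka: "on_arr K s \<in> Arr C" "Dom C (on_arr K s) = on_obj K (Dom J s)"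
    "Cod C (on_arr K s) = on_obj K (Cod J s)" if "s \<in> Arr J" for s
    using K that by (auto simp: diagram_def)
  show ?thesis
    unfolding is_colimit_def
  proof (intro conjI allI impI)
    show "is_cocone J C (map_diag Fo Fa K) (Fo V) (\<lambda>a. Fa (l a))"
      unfolding is_cocone_def
    proof (intro conjI ballI)
      fix s assume s: "s \<in> Arr J"
      show "Fa (l (Cod J s)) \<bullet> on_arr (map_diag Fo Fa K) s = Fa (l (Dom J s))"
        using Fd(6)[of "on_arr K s" "l (Cod J s)"] s Ka ll by (simp add: map_diag_def)
    qed (use Fd ll in \<open>auto simp: map_diag_def\<close>)
    fix U k assume k: "is_cocone J C (map_diag Fo Fa K) U k"
    then have U: "U \<in> Obj C" and ka: "\<And>a. a \<in> Obj J \<Longrightarrow> k a \<in> Hom C (Fo (on_obj K a)) U"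
      and ks: "\<And>s. s \<in> Arr J \<Longrightarrow> k (Cod J s) \<bullet> Fa (on_arr K s) = k (Dom J s)"
      by (auto simp: is_cocone_def map_diag_def)
    from F U show "\<exists>!u. u \<in> Hom C (Fo V) U \<and> (\<forall>a \<in> Obj J. u \<bullet> Fa (l a) = k a)"
    proof (rule left_adjoint_transpose)
      fix H e
      assume H: "H \<in> Obj C" "e \<in> Arr C" "Dom C e = Fo H" "Cod C e = U"
        and ex: "\<And>A g. \<lbrakk>A \<in> Obj C; g \<in> Arr C; Dom C g = Fo A; Cod C g = U\<rbrakk>
          \<Longrightarrow> \<exists>h. h \<in> Arr C \<and> Dom C h = A \<and> Cod C h = H \<and> e \<bullet> Fa h = g"
        and un: "\<And>h k. \<lbrakk>h \<in> Arr C; k \<in> Arr C; Dom C h = Dom C k; Cod C h = H; Cod C k = H;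
          e \<bullet> Fa h = e \<bullet> Fa k\<rbrakk> \<Longrightarrow> h = k"
      have "\<forall>a \<in> Obj J. \<exists>h. h \<in> Arr C \<and> Dom C h = on_obj K a \<and> Cod C h = H \<and> e \<bullet> Fa h = k a"
        using ex Ko ka by simp
      then obtain t where t: "\<And>a. a \<in> Obj J \<Longrightarrow> t a \<in> Arr C \<and> Dom C (t a) = on_obj K a \<and> Cod C (t a) = H"
          and et: "\<And>a. a \<in> Obj J \<Longrightarrow> e \<bullet> Fa (t a) = k a"
        by metis
      have "is_cocone J C K H t"
        unfolding is_cocone_def
      proof (intro conjI ballI)
        fix s assume s: "s \<in> Arr J"
        have "e \<bullet> Fa (t (Cod J s) \<bullet> on_arr K s) = (e \<bullet> Fa (t (Cod J s))) \<bullet> Fa (on_arr K s)"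
          using s Ka t Fd H by simp
        also have "\<dots> = e \<bullet> Fa (t (Dom J s))"
          using s et ks by simp
        finally show "t (Cod J s) \<bullet> on_arr K s = t (Dom J s)"
          by (rule un[rotated -1]) (use s Ka t in simp_all)
      qed (use H t in auto)
      then obtain w where w: "w \<in> Hom C V H" "\<And>a. a \<in> Obj J \<Longrightarrow> w \<bullet> l a = t a"
        using colimit_desc_ex[OF l] by blast
      show ?thesis
      proof (rule ex1I[of _ "e \<bullet> Fa w"], intro conjI ballI)
        show "e \<bullet> Fa w \<in> Hom C (Fo V) U" using w H Fd by simp
        fix a assume a: "a \<in> Obj J"
        have "(e \<bullet> Fa w) \<bullet> Fa (l a) = e \<bullet> Fa (w \<bullet> l a)" using w(1) H Fd ll a by simp
        then show "(e \<bullet> Fa w) \<bullet> Fa (l a) = k a" using w(2) et a by simp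
      next
        fix u assume u: "u \<in> Hom C (Fo V) U \<and> (\<forall>a\<in>Obj J. u \<bullet> Fa (l a) = k a)"
        then obtain x where x: "x \<in> Arr C" "Dom C x = V" "Cod C x = H" "e \<bullet> Fa x = u"
          using ex[OF ll(1), of u] by auto
        have "x = w"
        proof (rule colimit_ext[OF l])
          fix a assume a: "a \<in> Obj J"
          have "e \<bullet> Fa (x \<bullet> l a) = (e \<bullet> Fa x) \<bullet> Fa (l a)" using x(1-3) H Fd ll a by simp
          also have "\<dots> = e \<bullet> Fa (w \<bullet> l a)" using u a x(4) w(2) et by simp
          finally show "x \<bullet> l a = w \<bullet> l a"
            by (rule un[rotated -1]) (use x(1-3) w ll a t in simp_all)
        qed (use x w Ka in auto)
        then show "u = e \<bullet> Fa w" using x by simp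
      qed
    qed
  qed
qed

text \<open>A left adjoint preserves initial objects, so \<open>Fa b\<close> starts at an initial
  object and therefore factors through the zero object \<open>V\<close> itself.\<close>

lemma left_adjoint_null:
  assumes F: "left_adjoint C Fo Fa" and g: "null C g"
  shows "null C (Fa g)"
proof -
  note Fd = left_adjointD[OF F]
  obtain V a b where V: "is_initial C V" "is_terminal C V" "a \<in> Arr C" "b \<in> Arr C" "Cod C a = V"
      "Dom C b = V" and g: "g = b \<bullet> a"
    using g by (rule nullE)
  have V': "V \<in> Obj C" using V by (simp add: is_initial_def)
  have I: "is_initial C (Fo V)" by (rule left_adjoint_initial[OF F V(1)])
  obtain e where e: "e \<in> Arr C" "Dom C e = Fo V" "Cod C e = V"
    using initial_arr[OF I V'] .
  obtain b0 where b0: "b0 \<in> Arr C" "Dom C b0 = V" "Cod C b0 = Fo (Cod C b)"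
    using initial_arr[OF V(1), of "Fo (Cod C b)"] V Fd by auto
  have "Fa b = b0 \<bullet> e"
    by (rule initial_ext[OF I]) (use V Fd e b0 in simp_all)
  then have "Fa g = b0 \<bullet> (e \<bullet> Fa a)"
    using V Fd e b0 by (simp add: g)
  moreover have "null C (b0 \<bullet> (e \<bullet> Fa a))"
    by (rule nullI[OF V(1,2)]) (use V Fd e b0 in simp_all)
  ultimately show ?thesis by simp
qed

text \<open>If \<open>h\<close> is zero on every \<open>Fa s\<close>, its transpose \<open>t\<close>
  is zero on every \<open>s\<close>: the composite \<open>t \<bullet> s\<close> and a zero morphism
  \<open>n\<close> have the same transpose, since zero morphisms are preserved by \<open>Fa\<close>
  and unique between given objects.\<close>

lemma left_adjoint_coker:
  assumes pt: "pointed C" and F: "left_adjoint C Fo Fa" and q: "is_coker C S q"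
  shows "is_coker C (Fa ` S) (Fa q)"
proof -
  note Fd = left_adjointD[OF F]
  have qa: "q \<in> Arr C" and S: "\<And>s. s \<in> S \<Longrightarrow> s \<in> Arr C \<and> Cod C s = Dom C q \<and> null C (q \<bullet> s)"
    using q by (auto simp: is_coker_def)
  show ?thesis
  proof (rule is_cokerI)
    fix s' assume "s' \<in> Fa ` S"
    then obtain s where s: "s \<in> S" "s' = Fa s" by auto
    have "null C (Fa (q \<bullet> s))" using left_adjoint_null[OF F] S s by blast
    then show "s' \<in> Arr C \<and> Cod C s' = Dom C (Fa q) \<and> null C (Fa q \<bullet> s')"
      using S[OF s(1)] qa Fd s by simp
  next
    fix h assume h: "h \<in> Arr C" "Dom C h = Dom C (Fa q)" "\<And>s. s \<in> Fa ` S \<Longrightarrow> null C (h \<bullet> s)"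
    have "Cod C h \<in> Obj C" using h by simp
    with F show "\<exists>u. u \<in> Hom C (Cod C (Fa q)) (Cod C h) \<and> u \<bullet> Fa q = h"
    proof (rule left_adjoint_transpose)
      fix H e
      assume H: "H \<in> Obj C" "e \<in> Arr C" "Dom C e = Fo H" "Cod C e = Cod C h"
        and ex: "\<And>A g. \<lbrakk>A \<in> Obj C; g \<in> Arr C; Dom C g = Fo A; Cod C g = Cod C h\<rbrakk>
          \<Longrightarrow> \<exists>h. h \<in> Arr C \<and> Dom C h = A \<and> Cod C h = H \<and> e \<bullet> Fa h = g"
        and un: "\<And>h k. \<lbrakk>h \<in> Arr C; k \<in> Arr C; Dom C h = Dom C k; Cod C h = H; Cod C k = H;
          e \<bullet> Fa h = e \<bullet> Fa k\<rbrakk> \<Longrightarrow> h = k"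
      obtain t where t: "t \<in> Arr C" "Dom C t = Dom C q" "Cod C t = H" "e \<bullet> Fa t = h"
        using ex[of "Dom C q" h] h qa Fd by auto
      have "null C (t \<bullet> s)" if s: "s \<in> S" for s
      proof -
        obtain n where n: "null C n" "n \<in> Arr C" "Dom C n = Dom C s" "Cod C n = H"
          using null_exists[OF pt, of "Dom C s" H] S[OF s] H by auto
        have "null C (e \<bullet> Fa n)"
          using null_comp_left[OF left_adjoint_null[OF F n(1)]] n Fd H by simp
        moreover have "null C (h \<bullet> Fa s)" using h s by simp
        moreover have "h \<bullet> Fa s = e \<bullet> Fa (t \<bullet> s)"
          using t(1-3) S[OF s] Fd H unfolding t(4)[symmetric] by simp
        ultimately have "e \<bullet> Fa n = e \<bullet> Fa (t \<bullet> s)"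
          using n t(1-3) S[OF s] Fd H by (intro null_eq) simp_all
        then have "n = t \<bullet> s"
          by (rule un[rotated -1]) (use n t(1-3) S[OF s] in simp_all)
        then show ?thesis using n by simp
      qed
      then obtain u where u: "u \<in> Arr C" "Dom C u = Cod C q" "Cod C u = Cod C t" "u \<bullet> q = t"
        using coker_desc[OF q t(1,2)] by blast
      have "(e \<bullet> Fa u) \<bullet> Fa q = e \<bullet> Fa (u \<bullet> q)"
        using u(1-3) t(1-3) H Fd qa by simp
      then show ?thesis
        using u t H Fd qa by (intro exI[of _ "e \<bullet> Fa u"]) simp
    qed
  next
    fix u v
    assume uv: "u \<in> Arr C" "v \<in> Arr C" "Dom C u = Cod C (Fa q)" "Dom C v = Cod C (Fa q)"
      "Cod C u = Cod C v" "u \<bullet> Fa q = v \<bullet> Fa q"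
    have "Cod C u \<in> Obj C" using uv by simp
    with F show "u = v"
    proof (rule left_adjoint_transpose)
      fix H e
      assume H: "H \<in> Obj C" "e \<in> Arr C" "Dom C e = Fo H" "Cod C e = Cod C u"
        and ex: "\<And>A g. \<lbrakk>A \<in> Obj C; g \<in> Arr C; Dom C g = Fo A; Cod C g = Cod C u\<rbrakk>
          \<Longrightarrow> \<exists>h. h \<in> Arr C \<and> Dom C h = A \<and> Cod C h = H \<and> e \<bullet> Fa h = g"
        and un: "\<And>h k. \<lbrakk>h \<in> Arr C; k \<in> Arr C; Dom C h = Dom C k; Cod C h = H; Cod C k = H;
          e \<bullet> Fa h = e \<bullet> Fa k\<rbrakk> \<Longrightarrow> h = k"
      obtain s where s: "s \<in> Arr C" "Dom C s = Cod C q" "Cod C s = H" "e \<bullet> Fa s = u"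
        using ex[of "Cod C q" u] uv qa Fd by auto
      obtain t where t: "t \<in> Arr C" "Dom C t = Cod C q" "Cod C t = H" "e \<bullet> Fa t = v"
        using ex[of "Cod C q" v] uv qa Fd by auto
      have "e \<bullet> Fa (s \<bullet> q) = (e \<bullet> Fa s) \<bullet> Fa q" "e \<bullet> Fa (t \<bullet> q) = (e \<bullet> Fa t) \<bullet> Fa q"
        using s(1-3) t(1-3) H Fd qa by simp_all
      then have "e \<bullet> Fa (s \<bullet> q) = e \<bullet> Fa (t \<bullet> q)"
        by (simp add: s(4) t(4) uv(6))
      then have "s \<bullet> q = t \<bullet> q"
        by (rule un[rotated -1]) (use s t qa in simp_all)
      then have "s = t" by (rule coker_ext[OF q, rotated -1]) (use s t in simp_all)
      then show ?thesis using s t by simp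
    qed
  qed (use qa Fd in simp)
qed

end

section \<open>Monoidal products\<close>

context symmetric_monoidal_category
begin

declare Tensor_in [simp] Unit_in [simp]

lemma tensor_arr_arr [simp]: "\<lbrakk>f \<in> Arr C; g \<in> Arr C\<rbrakk> \<Longrightarrow> f \<diamond> g \<in> Arr C"
  and dom_tensor_arr [simp]: "\<lbrakk>f \<in> Arr C; g \<in> Arr C\<rbrakk> \<Longrightarrow> Dom C (f \<diamond> g) = Dom C f \<diamondop> Dom C g"
  and cod_tensor_arr [simp]: "\<lbrakk>f \<in> Arr C; g \<in> Arr C\<rbrakk> \<Longrightarrow> Cod C (f \<diamond> g) = Cod C f \<diamondop> Cod C g"
  using Tensor_arr_in[of f "Dom C f" "Cod C f" g "Dom C g" "Cod C g"] by simp_all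

lemma tensor_id [simp]: "\<lbrakk>A \<in> Obj C; B \<in> Obj C\<rbrakk> \<Longrightarrow> Id C A \<diamond> Id C B = Id C (A \<diamondop> B)"
  by (rule Tensor_Id)

lemma tensor_comp:
  "\<lbrakk>f \<in> Arr C; f' \<in> Arr C; g \<in> Arr C; g' \<in> Arr C; Cod C f = Dom C f'; Cod C g = Dom C g'\<rbrakk>
    \<Longrightarrow> (f' \<diamond> g') \<bullet> (f \<diamond> g) = (f' \<bullet> f) \<diamond> (g' \<bullet> g)"
  using Tensor_Comp[of f "Dom C f" "Cod C f" f' "Cod C f'" g "Dom C g" "Cod C g" g' "Cod C g'"] by simp

lemma tensor_comp_assoc:
  "\<lbrakk>f \<in> Arr C; f' \<in> Arr C; g \<in> Arr C; g' \<in> Arr C; Cod C f = Dom C f'; Cod C g = Dom C g';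
    x \<in> Arr C; Cod C x = Dom C f \<diamondop> Dom C g\<rbrakk>
    \<Longrightarrow> (f' \<diamond> g') \<bullet> (f \<diamond> g) \<bullet> x = ((f' \<bullet> f) \<diamond> (g' \<bullet> g)) \<bullet> x"
  using comp_reassoc[OF tensor_comp] by simp

lemma braid_arr [simp]: "\<lbrakk>A \<in> Obj C; B \<in> Obj C\<rbrakk> \<Longrightarrow> Braid C A B \<in> Arr C"
  and dom_braid [simp]: "\<lbrakk>A \<in> Obj C; B \<in> Obj C\<rbrakk> \<Longrightarrow> Dom C (Braid C A B) = A \<diamondop> B"
  and cod_braid [simp]: "\<lbrakk>A \<in> Obj C; B \<in> Obj C\<rbrakk> \<Longrightarrow> Cod C (Braid C A B) = B \<diamondop> A"
  using Braid_in[of A B] by simp_all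

lemma braid_braid [simp]:
  "\<lbrakk>A \<in> Obj C; B \<in> Obj C\<rbrakk> \<Longrightarrow> Braid C B A \<bullet> Braid C A B = Id C (A \<diamondop> B)"
  by (rule symmetry)

lemma braid_natural:
  "\<lbrakk>f \<in> Arr C; g \<in> Arr C; Dom C f = A; Dom C g = B; Cod C f = A'; Cod C g = B'\<rbrakk>
    \<Longrightarrow> Braid C A' B' \<bullet> (f \<diamond> g) = (g \<diamond> f) \<bullet> Braid C A B"
  using Braid_natural[of f A A' g B B'] by simp

end

context closed_symmetric_monoidal_category
begin

lemma left_adjoint_tensor_right:
  assumes "B \<in> Obj C"
  shows "left_adjoint C (\<lambda>A. A \<diamondop> B) (\<lambda>f. f \<diamond> Id C B)"
  unfolding left_adjoint_def using assms closed[OF assms] by (simp add: tensor_comp)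

text \<open>\<open>closed\<close> speaks of tensoring on the right only. Composition with the
  braiding turns the evaluation \<open>ev\<close> into one for tensoring on the left, and symmetry
  makes the two transposition problems equivalent.\<close>

lemma left_adjoint_tensor_left:
  assumes B: "B \<in> Obj C"
  shows "left_adjoint C (\<lambda>A. B \<diamondop> A) (\<lambda>f. Id C B \<diamond> f)"
  unfolding left_adjoint_def
proof (intro conjI ballI impI)
  fix D assume D: "D \<in> Obj C"
  obtain H ev where H: "H \<in> Obj C" "ev \<in> Hom C (H \<diamondop> B) D"
    and ex: "\<And>A g. A \<in> Obj C \<Longrightarrow> g \<in> Hom C (A \<diamondop> B) D \<Longrightarrow> \<exists>!h. h \<in> Hom C A H \<and> ev \<bullet> (h \<diamond> Id C B) = g"
    using closed[OF B D] by blast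
  show "\<exists>H e. H \<in> Obj C \<and> e \<in> Hom C (B \<diamondop> H) D \<and>
      (\<forall>A\<in>Obj C. \<forall>g\<in>Hom C (B \<diamondop> A) D. \<exists>!h. h \<in> Hom C A H \<and> e \<bullet> (Id C B \<diamond> h) = g)"
  proof (intro exI[of _ H] exI[of _ "ev \<bullet> Braid C B H"] conjI ballI)
    fix A g assume A: "A \<in> Obj C" and g: "g \<in> Hom C (B \<diamondop> A) D"
    have "(ev \<bullet> Braid C B H) \<bullet> (Id C B \<diamond> h) = g \<longleftrightarrow> ev \<bullet> (h \<diamond> Id C B) = g \<bullet> Braid C A B"
      if h: "h \<in> Hom C A H" for h
    proof -
      have eq: "(ev \<bullet> Braid C B H) \<bullet> (Id C B \<diamond> h) = (ev \<bullet> (h \<diamond> Id C B)) \<bullet> Braid C B A"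
        using H B A h braid_natural[of "Id C B" h B A B H] by simp
      have "(ev \<bullet> (h \<diamond> Id C B)) = ((ev \<bullet> (h \<diamond> Id C B)) \<bullet> Braid C B A) \<bullet> Braid C A B"
        using H B A h by simp
      moreover have "g = (g \<bullet> Braid C A B) \<bullet> Braid C B A"
        using B A g by simp
      ultimately show ?thesis unfolding eq by metis
    qed
    moreover have "\<exists>!h. h \<in> Hom C A H \<and> ev \<bullet> (h \<diamond> Id C B) = g \<bullet> Braid C A B"
      using A B g by (intro ex) simp_all
    ultimately show "\<exists>!h. h \<in> Hom C A H \<and> (ev \<bullet> Braid C B H) \<bullet> (Id C B \<diamond> h) = g"
      by (metis (no_types, lifting))
  qed (use H B in auto)
qed (use B in \<open>auto simp: tensor_comp\<close>)

end

section \<open>Cofibrations and lifting\<close>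

context category
begin

lemma pushout_desc:
  assumes "is_pushout C f g P i j" "h \<in> Arr C" "k \<in> Arr C" "Dom C h = Cod C f" "Dom C k = Cod C g"
    "Cod C h = Cod C k" "h \<bullet> f = k \<bullet> g"
  obtains u where "u \<in> Arr C" "Dom C u = P" "Cod C u = Cod C h" "u \<bullet> i = h" "u \<bullet> j = k"
  using assms unfolding is_pushout_def by (metis Hom_iff)

lemma pushout_ext:
  assumes "is_pushout C f g P i j" "u \<in> Arr C" "v \<in> Arr C" "Dom C u = P" "Dom C v = P"
    "Cod C u = Cod C v" "u \<bullet> i = v \<bullet> i" "u \<bullet> j = v \<bullet> j"
  shows "u = v"
proof -
  note po = pushout_arr[OF assms(1)]
  have "u \<bullet> i \<in> Hom C (Cod C f) (Cod C u)" "u \<bullet> j \<in> Hom C (Cod C g) (Cod C u)"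
    "(u \<bullet> i) \<bullet> f = (u \<bullet> j) \<bullet> g"
    using assms(2,4) po by simp_all
  then have "\<exists>!w. w \<in> Hom C P (Cod C u) \<and> w \<bullet> i = u \<bullet> i \<and> w \<bullet> j = u \<bullet> j"
    using assms(1) unfolding is_pushout_def by blast
  then show ?thesis
    using assms(2-) by (metis Hom_iff)
qed

end

section \<open>Cofibrations and trivial cofibrations characterised by lifting\<close>

context model_category
begin

lemma cofib_arr: "f \<in> Cofib C \<Longrightarrow> f \<in> Arr C"
  and fib_arr: "f \<in> Fib C \<Longrightarrow> f \<in> Arr C"
  using subcategories by (auto simp: wide_subcategory_def)

text \<open>The retract argument: a lift in the square from \<open>f\<close> to \<open>p\<close>
  with top side \<open>i\<close> and bottom side the identity supplies the section that exhibits
  \<open>f\<close> as a retract of \<open>i\<close>.\<close>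

lemma retract_of_left_factor:
  assumes f: "f \<in> Arr C" and i: "i \<in> Arr C" "Dom C i = Dom C f" and p: "p \<in> Arr C" "Dom C p = Cod C i"
      "Cod C p = Cod C f" "f = p \<bullet> i"
    and lift: "lifts C f p"
  shows "is_retract C f i"
proof -
  have "\<exists>h. h \<in> Hom C (Cod C f) (Dom C p) \<and> h \<bullet> f = i \<and> p \<bullet> h = Id C (Cod C p)"
    using lift[unfolded lifts_def, rule_format, of i "Id C (Cod C p)"] f i p(1-3) p(4)[symmetric] by simp
  then obtain h where h: "h \<in> Hom C (Cod C f) (Dom C p)" "h \<bullet> f = i" "p \<bullet> h = Id C (Cod C p)"
    by blast
  show ?thesis
    unfolding is_retract_def
    by (intro conjI f i(1) exI[of _ "Id C (Dom C f)"] exI[of _ h] exI[of _ p])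
      (use f i p(1-3) p(4)[symmetric] h in simp_all)
qed

text \<open>One direction is an axiom. For the other, factor \<open>f\<close> into a cofibration and
  a trivial fibration; lifting against the second factor makes \<open>f\<close> a retract of the
  first.\<close>

lemma cofib_iff_lifts: "f \<in> Cofib C \<longleftrightarrow> f \<in> Arr C \<and> (\<forall>q \<in> Fib C \<inter> Weq C. lifts C f q)"
proof
  assume f: "f \<in> Arr C \<and> (\<forall>q \<in> Fib C \<inter> Weq C. lifts C f q)"
  then obtain E i p where ip: "i \<in> Hom C (Dom C f) E \<inter> Cofib C" "p \<in> Hom C E (Cod C f) \<inter> Fib C \<inter> Weq C"
      "f = p \<bullet> i"
    using factorization_trivial_fibration[of f "Dom C f" "Cod C f"] by auto
  have "is_retract C f i"
  proof (intro retract_of_left_factor[OF _ _ _ _ _ _ ip(3)])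
    show "lifts C f p" using f ip(2) by blast
  qed (use f ip(1,2) in simp_all)
  then show "f \<in> Cofib C" using retracts ip by auto
qed (use lifting cofib_arr in auto)

lemma trivial_cofib_iff_lifts: "f \<in> Cofib C \<inter> Weq C \<longleftrightarrow> f \<in> Arr C \<and> (\<forall>q \<in> Fib C. lifts C f q)"
proof
  assume f: "f \<in> Arr C \<and> (\<forall>q \<in> Fib C. lifts C f q)"
  then obtain E i p where ip: "i \<in> Hom C (Dom C f) E \<inter> Cofib C \<inter> Weq C" "p \<in> Hom C E (Cod C f) \<inter> Fib C"
      "f = p \<bullet> i"
    using factorization_trivial_cofibration[of f "Dom C f" "Cod C f"] by auto
  have "is_retract C f i"
  proof (intro retract_of_left_factor[OF _ _ _ _ _ _ ip(3)])
    show "lifts C f p" using f ip(2) by blast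
  qed (use f ip(1,2) in simp_all)
  then show "f \<in> Cofib C \<inter> Weq C" using retracts ip by auto
qed (use lifting cofib_arr in auto)

lemma liftsE:
  assumes "lifts C i p" "u \<in> Arr C" "v \<in> Arr C" "Dom C u = Dom C i" "Cod C u = Dom C p"
    "Dom C v = Cod C i" "Cod C v = Cod C p" "p \<bullet> u = v \<bullet> i"
  obtains h where "h \<in> Arr C" "Dom C h = Cod C i" "Cod C h = Dom C p" "h \<bullet> i = u" "p \<bullet> h = v"
  using assms unfolding lifts_def by (metis Hom_iff)

end

section \<open>The push-out product axiom in lifting form\<close>

context closed_symmetric_monoidal_model_category
begin

text \<open>Here \<open>a\<close> and \<open>b\<close> prescribe a lift on the two pieces of the
  push-out and agree where these meet. Stated as an extension problem, the axiom can be used in the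
  induction on cubes without carrying push-outs along.\<close>

lemma pushout_product_lifts:
  assumes f: "f \<in> Cofib C" and g: "g \<in> Cofib C" and q: "q \<in> Fib C" "q \<in> Weq C"
    and a: "a \<in> Arr C" "Dom C a = Cod C f \<diamondop> Dom C g" "Cod C a = Dom C q"
    and b: "b \<in> Arr C" "Dom C b = Dom C f \<diamondop> Cod C g" "Cod C b = Dom C q"
    and v: "v \<in> Arr C" "Dom C v = Cod C f \<diamondop> Cod C g" "Cod C v = Cod C q"
    and ab: "a \<bullet> (f \<diamond> Id C (Dom C g)) = b \<bullet> (Id C (Dom C f) \<diamond> g)"
    and qa: "q \<bullet> a = v \<bullet> (Id C (Cod C f) \<diamond> g)" and qb: "q \<bullet> b = v \<bullet> (f \<diamond> Id C (Cod C g))"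
  obtains h where "h \<in> Arr C" "Dom C h = Cod C f \<diamondop> Cod C g" "Cod C h = Dom C q" "q \<bullet> h = v"
    "h \<bullet> (Id C (Cod C f) \<diamond> g) = a" "h \<bullet> (f \<diamond> Id C (Cod C g)) = b"
proof -
  have fg: "f \<in> Arr C" "g \<in> Arr C" "q \<in> Arr C"
    using f g q by (auto simp: cofib_arr fib_arr)
  obtain P i j where po: "is_pushout C (f \<diamond> Id C (Dom C g)) (Id C (Dom C f) \<diamond> g) P i j"
    using pushout_exists[OF finite_colimits, of "f \<diamond> Id C (Dom C g)" "Id C (Dom C f) \<diamond> g"] fg by auto
  note po' = pushout_arr[OF po]
  have "(Id C (Cod C f) \<diamond> g) \<bullet> (f \<diamond> Id C (Dom C g)) = (f \<diamond> Id C (Cod C g)) \<bullet> (Id C (Dom C f) \<diamond> g)"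
    using fg by (simp add: tensor_comp)
  then obtain u where u: "u \<in> Arr C" "Dom C u = P" "Cod C u = Cod C f \<diamondop> Cod C g"
      "u \<bullet> i = Id C (Cod C f) \<diamond> g" "u \<bullet> j = f \<diamond> Id C (Cod C g)"
    using fg by (auto intro: pushout_desc[OF po, of "Id C (Cod C f) \<diamond> g" "f \<diamond> Id C (Cod C g)"])
  have uc: "u \<in> Cofib C"
    using pushout_product[OF f g po] u by auto
  obtain w where w: "w \<in> Arr C" "Dom C w = P" "Cod C w = Dom C q" "w \<bullet> i = a" "w \<bullet> j = b"
    using fg a b ab by (auto intro: pushout_desc[OF po, of a b])
  have "q \<bullet> w = v \<bullet> u"
  proof (rule pushout_ext[OF po])
    show "(q \<bullet> w) \<bullet> i = (v \<bullet> u) \<bullet> i" "(q \<bullet> w) \<bullet> j = (v \<bullet> u) \<bullet> j"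
      using fg w u v po' qa qb by simp_all
  qed (use fg w u v in auto)
  then obtain h where h: "h \<in> Arr C" "Dom C h = Cod C u" "Cod C h = Dom C q" "h \<bullet> u = w" "q \<bullet> h = v"
    using liftsE[of u q w v] lifting[OF uc] q fg w u v by auto
  have "h \<bullet> (u \<bullet> i) = w \<bullet> i" "h \<bullet> (u \<bullet> j) = w \<bullet> j"
    using comp_reassoc[OF h(4), of i] comp_reassoc[OF h(4), of j] h(1,2) u(1,2) po'(1,3,4,6) by auto
  then show ?thesis
    using h u(3) by (intro that[of h]) (simp_all add: u(4,5) w(4,5))
qed

text \<open>Push-out products with \<open>I \<rightarrow> A\<close> for \<open>I\<close> initial: the push-out has the two components
  \<open>I \<and> -\<close> initial.\<close>

lemma cofib_tensor_cofibrant: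
  assumes f: "f \<in> Cofib C" and A: "cofibrant C A"
  shows "f \<diamond> Id C A \<in> Cofib C \<and> (f \<in> Weq C \<longrightarrow> f \<diamond> Id C A \<in> Weq C)"
proof -
  obtain I i where I: "is_initial C I" and i: "i \<in> Hom C I A" "i \<in> Cofib C" and A': "A \<in> Obj C"
    using A by (auto simp: cofibrant_def)
  have I': "I \<in> Obj C" using I by (simp add: is_initial_def)
  have fa: "f \<in> Arr C" using f by (rule cofib_arr)
  have ini: "is_initial C (B \<diamondop> I)" if "B \<in> Obj C" for B
    using left_adjoint_initial[OF left_adjoint_tensor_left[OF that] I] .
  obtain j where j: "j \<in> Arr C" "Dom C j = Cod C f \<diamondop> I" "Cod C j = Dom C f \<diamondop> A"
    using initial_arr[OF ini[of "Cod C f"], of "Dom C f \<diamondop> A"] fa A' by auto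
  have "is_pushout C (f \<diamond> Id C (Dom C i)) (Id C (Dom C f) \<diamond> i) (Dom C f \<diamondop> A) j (Id C (Dom C f \<diamondop> A))"
    unfolding is_pushout_def
  proof (intro conjI allI impI)
    show "j \<bullet> (f \<diamond> Id C (Dom C i)) = Id C (Dom C f \<diamondop> A) \<bullet> (Id C (Dom C f) \<diamond> i)"
      by (rule initial_ext[OF ini[of "Dom C f"]]) (use fa i j I' A' in auto)
    fix U h k
    assume hk: "h \<in> Hom C (Cod C (f \<diamond> Id C (Dom C i))) U \<and> k \<in> Hom C (Cod C (Id C (Dom C f) \<diamond> i)) U \<and>
      h \<bullet> (f \<diamond> Id C (Dom C i)) = k \<bullet> (Id C (Dom C f) \<diamond> i)"
    then have hk': "h \<in> Arr C" "Dom C h = Cod C f \<diamondop> I" "Cod C h = U" "k \<in> Arr C"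
      "Dom C k = Dom C f \<diamondop> A" "Cod C k = U"
      using fa i I' by auto
    have "k \<bullet> j = h"
      by (rule initial_ext[OF ini[of "Cod C f"]]) (use fa hk' j in auto)
    then show "\<exists>!u. u \<in> Hom C (Dom C f \<diamondop> A) U \<and> u \<bullet> j = h \<and> u \<bullet> Id C (Dom C f \<diamondop> A) = k"
      using hk'(4-6) fa A' by (intro ex1I[of _ k]) (simp, metis comp_id_right Hom_iff)
  qed (use fa i j I' A' in auto)
  moreover have "(f \<diamond> Id C A) \<bullet> j = Id C (Cod C f) \<diamond> i"
    by (rule initial_ext[OF ini[of "Cod C f"]]) (use fa i j I' A' in auto)
  ultimately show ?thesis
    using pushout_product[OF f i(2), of "Dom C f \<diamondop> A" j "Id C (Dom C f \<diamondop> A)" "f \<diamond> Id C A"] fa i A' by auto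
qed

text \<open>The model structure is closed under retracts, so the two braidings are used to present
  \<open>Id C A \<diamond> f\<close> as a retract of \<open>f \<diamond> Id C A\<close>.\<close>

lemma cofibrant_tensor_cofib:
  assumes f: "f \<in> Cofib C" and A: "cofibrant C A"
  shows "Id C A \<diamond> f \<in> Cofib C \<and> (f \<in> Weq C \<longrightarrow> Id C A \<diamond> f \<in> Weq C)"
proof -
  have A': "A \<in> Obj C" and fa: "f \<in> Arr C"
    using A cofib_arr[OF f] by (auto simp: cofibrant_def)
  have "is_retract C (Id C A \<diamond> f) (f \<diamond> Id C A)"
    unfolding is_retract_def
  proof (intro conjI exI)
    show "Braid C (Dom C f) A \<bullet> Braid C A (Dom C f) = Id C (Dom C (Id C A \<diamond> f))"
      "Braid C (Cod C f) A \<bullet> Braid C A (Cod C f) = Id C (Cod C (Id C A \<diamond> f))"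
      "(f \<diamond> Id C A) \<bullet> Braid C A (Dom C f) = Braid C A (Cod C f) \<bullet> (Id C A \<diamond> f)"
      "(Id C A \<diamond> f) \<bullet> Braid C (Dom C f) A = Braid C (Cod C f) A \<bullet> (f \<diamond> Id C A)"
      using fa A' braid_natural[of "Id C A" f A "Dom C f" A "Cod C f"]
        braid_natural[of f "Id C A" "Dom C f" A "Cod C f" A] by simp_all
  qed (use fa A' in auto)
  then show ?thesis
    using retracts cofib_tensor_cofibrant[OF f A] by auto
qed

end

section \<open>Coherence\<close>

text \<open>This is the formula by which \<open>swap\<close> exchanges the last two of at least
  three factors, isolated because the coherence arguments concern it. \<open>T\<close> stands for
  the bracketed product of the factors in front.\<close>

definition braid_last :: "('o, 'm, 'z) mon_cat_scheme \<Rightarrow> 'o \<Rightarrow> 'o \<Rightarrow> 'o \<Rightarrow> 'm" where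
  "braid_last C T A B = inverse_arr C (Assoc C T B A) \<bullet>\<^bsub>C\<^esub>
     ((Id C T \<diamond>\<^bsub>C\<^esub> Braid C A B) \<bullet>\<^bsub>C\<^esub> Assoc C T A B)"

lemma (in category) iso_cancel_left:
  assumes "iso_arr C e" "e \<bullet> g = e \<bullet> h" "g \<in> Arr C" "h \<in> Arr C" "Cod C g = Dom C e" "Cod C h = Dom C e"
  shows "g = h"
proof -
  have "g = inverse_arr C e \<bullet> (e \<bullet> g)"
    using assms(1,3,5) by simp
  also have "\<dots> = inverse_arr C e \<bullet> (e \<bullet> h)"
    by (simp only: assms(2))
  also have "\<dots> = h"
    using assms(1,4,6) by simp
  finally show ?thesis .
qed

section \<open>Consequences of the pentagon and the hexagon\<close>

context symmetric_monoidal_category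
begin

lemma dom_assoc [simp]:
    "\<lbrakk>A \<in> Obj C; B \<in> Obj C; D \<in> Obj C\<rbrakk> \<Longrightarrow> Dom C (Assoc C A B D) = (A \<diamondop> B) \<diamondop> D"
  and cod_assoc [simp]:
    "\<lbrakk>A \<in> Obj C; B \<in> Obj C; D \<in> Obj C\<rbrakk> \<Longrightarrow> Cod C (Assoc C A B D) = A \<diamondop> (B \<diamondop> D)"
  and iso_assoc [simp]: "\<lbrakk>A \<in> Obj C; B \<in> Obj C; D \<in> Obj C\<rbrakk> \<Longrightarrow> iso_arr C (Assoc C A B D)"
  using Assoc_in[of A B D] by auto

lemma dom_lunit [simp]: "A \<in> Obj C \<Longrightarrow> Dom C (Lunit C A) = Unit C \<diamondop> A"
  and cod_lunit [simp]: "A \<in> Obj C \<Longrightarrow> Cod C (Lunit C A) = A"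
  and iso_lunit [simp]: "A \<in> Obj C \<Longrightarrow> iso_arr C (Lunit C A)"
  using Lunit_in[of A] by auto

lemma assoc_natural:
  "\<lbrakk>f \<in> Arr C; g \<in> Arr C; h \<in> Arr C; Dom C f = A; Dom C g = B; Dom C h = D;
    Cod C f = A'; Cod C g = B'; Cod C h = D'\<rbrakk>
    \<Longrightarrow> Assoc C A' B' D' \<bullet> ((f \<diamond> g) \<diamond> h) = (f \<diamond> (g \<diamond> h)) \<bullet> Assoc C A B D"
  using Assoc_natural[of f A A' g B B' h D D'] by simp

lemma inverse_natural:
  assumes "iso_arr C a" "iso_arr C b" "b \<bullet> f = g \<bullet> a" "f \<in> Arr C" "g \<in> Arr C"
    "Dom C f = Dom C a" "Cod C f = Dom C b" "Dom C g = Cod C a" "Cod C g = Cod C b"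
  shows "inverse_arr C b \<bullet> g = f \<bullet> inverse_arr C a"
proof -
  have "inverse_arr C b \<bullet> g = inverse_arr C b \<bullet> (g \<bullet> a) \<bullet> inverse_arr C a"
    using assms(1,2,4-) by simp
  also have "\<dots> = inverse_arr C b \<bullet> (b \<bullet> f) \<bullet> inverse_arr C a"
    by (simp only: assms(3))
  also have "\<dots> = f \<bullet> inverse_arr C a"
    using assms(1,2,4-) by simp
  finally show ?thesis .
qed

lemma inverse_assoc_natural:
  "\<lbrakk>f \<in> Arr C; g \<in> Arr C; h \<in> Arr C; Dom C f = A; Dom C g = B; Dom C h = D;
    Cod C f = A'; Cod C g = B'; Cod C h = D'\<rbrakk>
    \<Longrightarrow> inverse_arr C (Assoc C A' B' D') \<bullet> (f \<diamond> (g \<diamond> h))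
      = ((f \<diamond> g) \<diamond> h) \<bullet> inverse_arr C (Assoc C A B D)"
  by (rule inverse_natural[OF _ _ assoc_natural[of f g h A B D A' B' D']]) auto

lemma iso_tensor [simp]:
  assumes "iso_arr C f" "iso_arr C g"
  shows "iso_arr C (f \<diamond> g)"
  unfolding iso_arr_def[of C "f \<diamond> g"]
  by (rule exI[of _ "inverse_arr C f \<diamond> inverse_arr C g"]) (use assms in \<open>simp add: is_inverse_def tensor_comp\<close>)

context
  fixes T A B
  assumes ob [simp]: "T \<in> Obj C" "A \<in> Obj C" "B \<in> Obj C"
begin

lemma braid_last_arr [simp]: "braid_last C T A B \<in> Arr C"
  and dom_braid_last [simp]: "Dom C (braid_last C T A B) = (T \<diamondop> A) \<diamondop> B"
  and cod_braid_last [simp]: "Cod C (braid_last C T A B) = (T \<diamondop> B) \<diamondop> A"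
  by (simp_all add: braid_last_def)

lemma assoc_braid_last: "Assoc C T B A \<bullet> braid_last C T A B = (Id C T \<diamond> Braid C A B) \<bullet> Assoc C T A B"
  by (simp add: braid_last_def)

lemma braid_last_braid_last: "braid_last C T B A \<bullet> braid_last C T A B = Id C ((T \<diamondop> A) \<diamondop> B)"
  by (simp add: braid_last_def tensor_comp_assoc)

end

lemma braid_last_natural:
  assumes "t \<in> Arr C" "f \<in> Arr C" "g \<in> Arr C" "Dom C t = T" "Dom C f = A" "Dom C g = B"
    "Cod C t = T'" "Cod C f = A'" "Cod C g = B'"
  shows "braid_last C T' A' B' \<bullet> ((t \<diamond> f) \<diamond> g) = ((t \<diamond> g) \<diamond> f) \<bullet> braid_last C T A B"
proof -
  have ob: "T \<in> Obj C" "A \<in> Obj C" "B \<in> Obj C" "T' \<in> Obj C" "A' \<in> Obj C" "B' \<in> Obj C"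
    using assms by auto
  have "braid_last C T' A' B' \<bullet> ((t \<diamond> f) \<diamond> g)
      = inverse_arr C (Assoc C T' B' A') \<bullet> (Id C T' \<diamond> Braid C A' B') \<bullet> (Assoc C T' A' B' \<bullet> ((t \<diamond> f) \<diamond> g))"
    using ob assms by (simp add: braid_last_def)
  also have "Assoc C T' A' B' \<bullet> ((t \<diamond> f) \<diamond> g) = (t \<diamond> (f \<diamond> g)) \<bullet> Assoc C T A B"
    by (rule assoc_natural) (use assms in auto)
  also have "(Id C T' \<diamond> Braid C A' B') \<bullet> (t \<diamond> (f \<diamond> g)) \<bullet> Assoc C T A B
      = (t \<diamond> (g \<diamond> f)) \<bullet> (Id C T \<diamond> Braid C A B) \<bullet> Assoc C T A B"
    using ob assms braid_natural[of f g A B A' B'] by (simp add: tensor_comp_assoc)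
  also have "inverse_arr C (Assoc C T' B' A') \<bullet> (t \<diamond> (g \<diamond> f)) \<bullet> (Id C T \<diamond> Braid C A B) \<bullet> Assoc C T A B
      = (inverse_arr C (Assoc C T' B' A') \<bullet> (t \<diamond> (g \<diamond> f))) \<bullet> (Id C T \<diamond> Braid C A B) \<bullet> Assoc C T A B"
    using ob assms by simp
  also have "inverse_arr C (Assoc C T' B' A') \<bullet> (t \<diamond> (g \<diamond> f)) = ((t \<diamond> g) \<diamond> f) \<bullet> inverse_arr C (Assoc C T B A)"
    by (rule inverse_assoc_natural) (use assms in auto)
  also have "\<dots> \<bullet> (Id C T \<diamond> Braid C A B) \<bullet> Assoc C T A B = ((t \<diamond> g) \<diamond> f) \<bullet> braid_last C T A B"
    using ob assms by (simp add: braid_last_def)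
  finally show ?thesis .
qed

text \<open>Exchanging the last two factors is insensitive to whether a front factor
  \<open>P\<close> is bracketed with \<open>S\<close> or split off. One more associator makes the
  pentagon applicable on both sides, and naturality of the associator connects the two.\<close>

lemma assoc_assoc_braid_last:
  assumes [simp]: "P \<in> Obj C" "S \<in> Obj C" "A \<in> Obj C" "B \<in> Obj C"
  shows "(Assoc C P (S \<diamondop> B) A \<bullet> (Assoc C P S B \<diamond> Id C A)) \<bullet> braid_last C (P \<diamondop> S) A B
    = (Id C P \<diamond> braid_last C S A B) \<bullet> (Assoc C P (S \<diamondop> A) B \<bullet> (Assoc C P S A \<diamond> Id C B))"
    (is "?th' \<bullet> ?b = ?b' \<bullet> ?th")
proof (rule iso_cancel_left)
  show "iso_arr C (Id C P \<diamond> Assoc C S B A)" by simp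
  have "(Id C P \<diamond> Assoc C S B A) \<bullet> ?th' \<bullet> ?b = ((Id C P \<diamond> Assoc C S B A) \<bullet> ?th') \<bullet> ?b"
    by simp
  also have "(Id C P \<diamond> Assoc C S B A) \<bullet> ?th' = Assoc C P S (B \<diamondop> A) \<bullet> Assoc C (P \<diamondop> S) B A"
    by (simp add: pentagon)
  also have "\<dots> \<bullet> ?b = Assoc C P S (B \<diamondop> A) \<bullet> (Id C (P \<diamondop> S) \<diamond> Braid C A B) \<bullet> Assoc C (P \<diamondop> S) A B"
    by (simp add: assoc_braid_last)
  also have "\<dots> = (Assoc C P S (B \<diamondop> A) \<bullet> ((Id C P \<diamond> Id C S) \<diamond> Braid C A B)) \<bullet> Assoc C (P \<diamondop> S) A B"
    by simp
  also have "Assoc C P S (B \<diamondop> A) \<bullet> ((Id C P \<diamond> Id C S) \<diamond> Braid C A B)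
      = (Id C P \<diamond> (Id C S \<diamond> Braid C A B)) \<bullet> Assoc C P S (A \<diamondop> B)"
    by (rule assoc_natural) simp_all
  also have "\<dots> \<bullet> Assoc C (P \<diamondop> S) A B = (Id C P \<diamond> (Id C S \<diamond> Braid C A B)) \<bullet> (Assoc C P S (A \<diamondop> B) \<bullet> Assoc C (P \<diamondop> S) A B)"
    by simp
  also have "\<dots> = (Id C P \<diamond> (Id C S \<diamond> Braid C A B)) \<bullet> (Id C P \<diamond> Assoc C S A B) \<bullet> ?th"
    by (simp add: pentagon)
  also have "\<dots> = (Id C P \<diamond> Assoc C S B A) \<bullet> ?b' \<bullet> ?th"
    by (simp add: tensor_comp_assoc assoc_braid_last)
  finally show "(Id C P \<diamond> Assoc C S B A) \<bullet> ?th' \<bullet> ?b = (Id C P \<diamond> Assoc C S B A) \<bullet> ?b' \<bullet> ?th" .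
qed simp_all

text \<open>The hexagon with its outer associator moved to the other side: \<open>A\<close> passes
  \<open>B\<close> and then \<open>D\<close> as it passes their product.\<close>

lemma braid_last_hexagon:
  assumes [simp]: "A \<in> Obj C" "B \<in> Obj C" "D \<in> Obj C"
  shows "braid_last C B A D \<bullet> (Braid C A B \<diamond> Id C D) = Braid C A (B \<diamondop> D) \<bullet> Assoc C A B D"
proof -
  have "braid_last C B A D \<bullet> (Braid C A B \<diamond> Id C D)
      = inverse_arr C (Assoc C B D A) \<bullet> ((Id C B \<diamond> Braid C A D) \<bullet> (Assoc C B A D \<bullet> (Braid C A B \<diamond> Id C D)))"
    by (simp add: braid_last_def)
  also have "\<dots> = inverse_arr C (Assoc C B D A) \<bullet> (Assoc C B D A \<bullet> (Braid C A (B \<diamondop> D) \<bullet> Assoc C A B D))"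
    by (simp only: hexagon[OF assms])
  also have "\<dots> = Braid C A (B \<diamondop> D) \<bullet> Assoc C A B D"
    by simp
  finally show ?thesis .
qed

text \<open>The same passage of \<open>A\<close> behind a spectator \<open>T\<close>. Splitting off
  \<open>T\<close> with associators leaves an instance of \<open>braid_last_hexagon\<close> in the
  second tensor factor.\<close>

lemma braid_last_twice:
  assumes [simp]: "T \<in> Obj C" "A \<in> Obj C" "B \<in> Obj C" "D \<in> Obj C"
  shows "(Assoc C T (B \<diamondop> D) A \<bullet> (Assoc C T B D \<diamond> Id C A)) \<bullet>
      braid_last C (T \<diamondop> B) A D \<bullet> (braid_last C T A B \<diamond> Id C D)
    = (Id C T \<diamond> Braid C A (B \<diamondop> D)) \<bullet> (Assoc C T A (B \<diamondop> D) \<bullet> Assoc C (T \<diamondop> A) B D)"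
proof -
  have "(Assoc C T (B \<diamondop> D) A \<bullet> (Assoc C T B D \<diamond> Id C A)) \<bullet>
      braid_last C (T \<diamondop> B) A D \<bullet> (braid_last C T A B \<diamond> Id C D)
    = ((Assoc C T (B \<diamondop> D) A \<bullet> (Assoc C T B D \<diamond> Id C A)) \<bullet>
      braid_last C (T \<diamondop> B) A D) \<bullet> (braid_last C T A B \<diamond> Id C D)"
    by simp
  also have "\<dots> = ((Id C T \<diamond> braid_last C B A D) \<bullet> (Assoc C T (B \<diamondop> A) D \<bullet>
      (Assoc C T B A \<diamond> Id C D))) \<bullet> (braid_last C T A B \<diamond> Id C D)"
    by (simp only: assoc_assoc_braid_last[OF assms(1,3,2,4)])
  also have "\<dots> = (Id C T \<diamond> braid_last C B A D) \<bullet> Assoc C T (B \<diamondop> A) D \<bullet>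
      ((Assoc C T B A \<bullet> braid_last C T A B) \<diamond> Id C D)"
    by (simp add: tensor_comp)
  also have "\<dots> = (Id C T \<diamond> braid_last C B A D) \<bullet> (Assoc C T (B \<diamondop> A) D \<bullet>
      ((Id C T \<diamond> Braid C A B) \<diamond> Id C D)) \<bullet> (Assoc C T A B \<diamond> Id C D)"
    by (simp add: assoc_braid_last tensor_comp)
  also have "Assoc C T (B \<diamondop> A) D \<bullet> ((Id C T \<diamond> Braid C A B) \<diamond> Id C D)
      = (Id C T \<diamond> (Braid C A B \<diamond> Id C D)) \<bullet> Assoc C T (A \<diamondop> B) D"
    by (rule assoc_natural) simp_all
  also have "(Id C T \<diamond> braid_last C B A D) \<bullet> \<dots> \<bullet> (Assoc C T A B \<diamond> Id C D)
      = (Id C T \<diamond> Braid C A (B \<diamondop> D)) \<bullet>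
        ((Id C T \<diamond> Assoc C A B D) \<bullet> (Assoc C T (A \<diamondop> B) D \<bullet> (Assoc C T A B \<diamond> Id C D)))"
    by (simp add: tensor_comp_assoc braid_last_hexagon)
  also have "\<dots> = (Id C T \<diamond> Braid C A (B \<diamondop> D)) \<bullet> (Assoc C T A (B \<diamondop> D) \<bullet> Assoc C (T \<diamondop> A) B D)"
    by (simp add: pentagon)
  finally show ?thesis .
qed

text \<open>Each side moves \<open>A\<close> behind \<open>B\<close> and \<open>D\<close> and
  exchanges \<open>B\<close> with \<open>D\<close>, in a different order. By
  \<open>braid_last_twice\<close> the passage of \<open>A\<close> is a single braiding with
  \<open>B \<diamondop> D\<close>, and naturality of that braiding lets the exchange of
  \<open>B\<close> and \<open>D\<close> through.\<close>

lemma yang_baxter: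
  assumes [simp]: "T \<in> Obj C" "A \<in> Obj C" "B \<in> Obj C" "D \<in> Obj C"
  shows "(braid_last C T B D \<diamond> Id C A) \<bullet> braid_last C (T \<diamondop> B) A D \<bullet> (braid_last C T A B \<diamond> Id C D)
    = braid_last C (T \<diamondop> D) A B \<bullet> (braid_last C T A D \<diamond> Id C B) \<bullet> braid_last C (T \<diamondop> A) B D"
proof (rule iso_cancel_left)
  let ?th = "\<lambda>B D. Assoc C T (B \<diamondop> D) A \<bullet> (Assoc C T B D \<diamond> Id C A)"
  let ?m = "\<lambda>B D. braid_last C (T \<diamondop> B) A D \<bullet> (braid_last C T A B \<diamond> Id C D)"
  show "iso_arr C (?th D B)" by simp
  have "?th D B \<bullet> (braid_last C T B D \<diamond> Id C A) \<bullet> ?m B D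
      = Assoc C T (D \<diamondop> B) A \<bullet> ((Assoc C T D B \<bullet> braid_last C T B D) \<diamond> Id C A) \<bullet> ?m B D"
    by (simp add: tensor_comp_assoc)
  also have "\<dots> = (Assoc C T (D \<diamondop> B) A \<bullet> ((Id C T \<diamond> Braid C B D) \<diamond> Id C A)) \<bullet>
      (Assoc C T B D \<diamond> Id C A) \<bullet> ?m B D"
    by (simp add: assoc_braid_last tensor_comp_assoc)
  also have "Assoc C T (D \<diamondop> B) A \<bullet> ((Id C T \<diamond> Braid C B D) \<diamond> Id C A)
      = (Id C T \<diamond> (Braid C B D \<diamond> Id C A)) \<bullet> Assoc C T (B \<diamondop> D) A"
    by (rule assoc_natural) simp_all
  also have "\<dots> \<bullet> (Assoc C T B D \<diamond> Id C A) \<bullet> ?m B D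
      = (Id C T \<diamond> (Braid C B D \<diamond> Id C A)) \<bullet> (?th B D \<bullet> ?m B D)"
    by simp
  also have "\<dots> = (Id C T \<diamond> (Braid C B D \<diamond> Id C A)) \<bullet>
      (Id C T \<diamond> Braid C A (B \<diamondop> D)) \<bullet> (Assoc C T A (B \<diamondop> D) \<bullet> Assoc C (T \<diamondop> A) B D)"
    by (simp only: braid_last_twice[OF assms])
  also have "\<dots> = (Id C T \<diamond> Braid C A (D \<diamondop> B)) \<bullet>
      ((Id C T \<diamond> (Id C A \<diamond> Braid C B D)) \<bullet> Assoc C T A (B \<diamondop> D)) \<bullet> Assoc C (T \<diamondop> A) B D"
    using braid_natural[of "Id C A" "Braid C B D" A "B \<diamondop> D" A "D \<diamondop> B"]
    by (simp add: tensor_comp_assoc)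
  also have "(Id C T \<diamond> (Id C A \<diamond> Braid C B D)) \<bullet> Assoc C T A (B \<diamondop> D)
      = Assoc C T A (D \<diamondop> B) \<bullet> (Id C (T \<diamondop> A) \<diamond> Braid C B D)"
    using assoc_natural[of "Id C T" "Id C A" "Braid C B D" T A "B \<diamondop> D" T A "D \<diamondop> B"] by simp
  also have "(Id C T \<diamond> Braid C A (D \<diamondop> B)) \<bullet> \<dots> \<bullet> Assoc C (T \<diamondop> A) B D
      = (Id C T \<diamond> Braid C A (D \<diamondop> B)) \<bullet> (Assoc C T A (D \<diamondop> B) \<bullet> Assoc C (T \<diamondop> A) D B) \<bullet>
        braid_last C (T \<diamondop> A) B D"
    by (simp add: assoc_braid_last)
  also have "\<dots> = (?th D B \<bullet> ?m D B) \<bullet> braid_last C (T \<diamondop> A) B D"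
    unfolding braid_last_twice[OF assms(1,2,4,3)] by simp
  also have "\<dots> = ?th D B \<bullet> braid_last C (T \<diamondop> D) A B \<bullet> (braid_last C T A D \<diamond> Id C B) \<bullet>
      braid_last C (T \<diamondop> A) B D"
    by simp
  finally show "?th D B \<bullet> (braid_last C T B D \<diamond> Id C A) \<bullet> ?m B D = \<dots>" .
qed simp_all

text \<open>With exactly three factors the first transposition is a bare \<open>Braid\<close> and
  there is no \<open>T\<close> in front, so this case is not an instance of
  \<open>yang_baxter\<close>; the naturality argument is the same.\<close>

lemma yang_baxter_three:
  assumes [simp]: "A \<in> Obj C" "B \<in> Obj C" "D \<in> Obj C"
  shows "(Braid C B D \<diamond> Id C A) \<bullet> braid_last C B A D \<bullet> (Braid C A B \<diamond> Id C D)
    = braid_last C D A B \<bullet> (Braid C A D \<diamond> Id C B) \<bullet> braid_last C A B D"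
proof -
  have "(Braid C B D \<diamond> Id C A) \<bullet> braid_last C B A D \<bullet> (Braid C A B \<diamond> Id C D)
      = ((Braid C B D \<diamond> Id C A) \<bullet> Braid C A (B \<diamondop> D)) \<bullet> Assoc C A B D"
    by (simp add: braid_last_hexagon)
  also have "(Braid C B D \<diamond> Id C A) \<bullet> Braid C A (B \<diamondop> D) = Braid C A (D \<diamondop> B) \<bullet> (Id C A \<diamond> Braid C B D)"
    by (rule braid_natural[symmetric]) simp_all
  also have "\<dots> \<bullet> Assoc C A B D = (Braid C A (D \<diamondop> B) \<bullet> Assoc C A D B) \<bullet> braid_last C A B D"
    by (simp add: assoc_braid_last)
  also have "\<dots> = (braid_last C D A B \<bullet> (Braid C A D \<diamond> Id C B)) \<bullet> braid_last C A B D"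
    by (simp only: braid_last_hexagon[OF assms(1,3,2)])
  also have "\<dots> = braid_last C D A B \<bullet> (Braid C A D \<diamond> Id C B) \<bullet> braid_last C A B D"
    by simp
  finally show ?thesis .
qed

end

subsection \<open>Words of adjacent transpositions\<close>

text \<open>The first letter of a word acts first, as in \<open>swaps\<close>; hence concatenation
  becomes composition in reverse order.\<close>

lemma word_perm_append: "word_perm (u @ v) = word_perm v \<circ> word_perm u"
  by (induction u) (auto simp: comp_assoc)

lemma word_perm_rev: "word_perm (rev u) \<circ> word_perm u = id" "word_perm u \<circ> word_perm (rev u) = id"
proof -
  have "word_perm (rev u) (word_perm u k) = k \<and> word_perm u (word_perm (rev u) k) = k" for k
    by (induction u arbitrary: k) (auto simp: word_perm_append)
  then show "word_perm (rev u) \<circ> word_perm u = id" "word_perm u \<circ> word_perm (rev u) = id"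
    by auto
qed

lemma inv_word_perm: "inv' (word_perm u) = word_perm (rev u)"
  using word_perm_rev by (intro inv_unique_comp)

lemma word_perm_permutes: "set u \<subseteq> {1..<n} \<Longrightarrow> word_perm u permutes {1..n}"
proof (induction u)
  case (Cons j u)
  then have "transpose j (Suc j) permutes {1..n}"
    by (intro permutes_swap_id) auto
  moreover have "word_perm u permutes {1..n}"
    using Cons by simp
  ultimately show ?case
    unfolding word_perm.simps by (rule permutes_compose)
qed (simp add: permutes_id)

lemma word_perm_upt: "k \<le> m \<Longrightarrow> word_perm [k..<m] k = m"
proof (induction m)
  case (Suc m)
  then show ?case
    by (cases "k = Suc m") (simp_all add: word_perm_append)
qed simp

text \<open>If \<open>k\<close> is the position sent to the end, the word \<open>[k..<Suc n]\<close>
  alone carries \<open>k\<close> there, and what remains of \<sigma> fixes \<open>Suc n\<close>. The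
  same cycle words reappear in the normal form.\<close>

lemma word_exists:
  assumes "\<sigma> permutes {1..n}"
  shows "\<exists>u. set u \<subseteq> {1..<n} \<and> word_perm u = \<sigma>"
  using assms
proof (induction n arbitrary: \<sigma>)
  case 0
  then show ?case by (intro exI[of _ "[]"]) simp
next
  case (Suc n)
  define k where "k = inv' \<sigma> (Suc n)"
  have k: "\<sigma> k = Suc n" "k \<in> {1..Suc n}"
    using permutes_inverses(1)[OF Suc.prems] permutes_in_image[OF permutes_inv[OF Suc.prems], of "Suc n"]
    by (auto simp: k_def)
  let ?c = "[k..<Suc n]"
  have c: "set ?c \<subseteq> {1..<Suc n}" using k by auto
  define \<tau> where "\<tau> = \<sigma> \<circ> word_perm (rev ?c)"
  have \<tau>: "\<tau> permutes {1..Suc n}"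
    unfolding \<tau>_def using c by (intro permutes_compose[OF word_perm_permutes Suc.prems]) auto
  have "word_perm (rev ?c) (word_perm ?c k) = k"
    using word_perm_rev(1)[of ?c] by (metis comp_apply id_apply)
  moreover have "word_perm ?c k = Suc n" using k by (intro word_perm_upt) simp
  ultimately have "\<tau> (Suc n) = Suc n"
    using k by (simp add: \<tau>_def)
  then have "\<tau> permutes {1..n}"
    by (intro permutes_superset[OF \<tau>]) (auto simp: le_Suc_eq)
  then obtain v where v: "set v \<subseteq> {1..<n}" "word_perm v = \<tau>"
    using Suc.IH by blast
  have "word_perm (?c @ v) = \<sigma> \<circ> (word_perm (rev ?c) \<circ> word_perm ?c)"
    by (simp only: word_perm_append v(2) \<tau>_def comp_assoc)
  then have "word_perm (?c @ v) = \<sigma>"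
    by (simp only: word_perm_rev comp_id)
  then show ?case
    using v c by (intro exI[of _ "?c @ v"]) auto
qed

text \<open>A product of one factor is that factor, not its product with the unit, so the recursion
  is uniform only from one factor on; this is the origin of the case distinctions on 0
  below.\<close>

lemma tensor_Suc [simp]: "0 < n \<Longrightarrow> tensor C (Suc n) x = tensor C n x \<diamondop>\<^bsub>C\<^esub> x (Suc n)"
  by (cases n) auto

lemma tensor_arr_Suc [simp]: "0 < n \<Longrightarrow> tensor_arr C (Suc n) f = tensor_arr C n f \<diamond>\<^bsub>C\<^esub> f (Suc n)"
  by (cases n) auto

declare tensor.simps(3) [simp del] tensor_arr.simps(3) [simp del] swap.simps(3) [simp del]

lemma tensor_cong: "(\<And>k. k \<in> {1..n} \<Longrightarrow> x k = y k) \<Longrightarrow> tensor C n x = tensor C n y"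
proof (induction n)
  case (Suc n)
  then show ?case by (cases "n = 0") simp_all
qed simp

lemma tensor_arr_cong: "(\<And>k. k \<in> {1..n} \<Longrightarrow> f k = g k) \<Longrightarrow> tensor_arr C n f = tensor_arr C n g"
proof (induction n)
  case (Suc n)
  then show ?case by (cases "n = 0") simp_all
qed simp

lemma swap_lower: "\<lbrakk>1 \<le> j; j < n\<rbrakk> \<Longrightarrow> swap C (Suc n) j x = swap C n j x \<diamond>\<^bsub>C\<^esub> Id C (x (Suc n))"
  by (cases n) (auto simp: swap.simps)

lemma swap_last: "0 < n \<Longrightarrow> swap C (Suc (Suc n)) (Suc n) x = braid_last C (tensor C n x) (x (Suc n)) (x (Suc (Suc n)))"
  by (simp add: swap.simps braid_last_def)

lemma swap_two: "swap C (Suc (Suc 0)) (Suc 0) x = Braid C (x 1) (x 2)"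
  by (simp add: swap.simps)

lemma swap_cong:
  assumes "1 \<le> j" "j < n" "\<And>k. k \<in> {1..n} \<Longrightarrow> x k = y k"
  shows "swap C n j x = swap C n j y"
  using assms(2,3)
proof (induction n)
  case (Suc n)
  show ?case
  proof (cases "j < n")
    case True
    then show ?thesis using Suc assms(1) by (simp add: swap_lower)
  next
    case False
    then obtain m where m: "n = Suc m" "j = n"
      using Suc.prems assms(1) by (cases n) auto
    have "tensor C m x = tensor C m y"
      using Suc.prems m by (intro tensor_cong) auto
    then show ?thesis
      using Suc.prems m by (cases "m = 0") (simp_all add: swap_last swap_two numeral_2_eq_2)
  qed
qed simp

section \<open>Adjacent transpositions and their relations\<close>

context symmetric_monoidal_category
begin

lemma tensor_obj [simp]: "(\<And>k. x k \<in> Obj C) \<Longrightarrow> tensor C n x \<in> Obj C"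
proof (induction n)
  case (Suc n)
  then show ?case by (cases "n = 0") simp_all
qed simp

lemma tensor_arr_family [simp]:
  assumes "\<And>k. f k \<in> Arr C"
  shows "tensor_arr C n f \<in> Arr C" "Dom C (tensor_arr C n f) = tensor C n (\<lambda>k. Dom C (f k))"
    "Cod C (tensor_arr C n f) = tensor C n (\<lambda>k. Cod C (f k))"
proof -
  have "tensor_arr C n f \<in> Arr C \<and> Dom C (tensor_arr C n f) = tensor C n (\<lambda>k. Dom C (f k)) \<and>
    Cod C (tensor_arr C n f) = tensor C n (\<lambda>k. Cod C (f k))"
  proof (induction n)
    case (Suc n)
    then show ?case by (cases "n = 0") (simp_all add: assms)
  qed simp
  then show "tensor_arr C n f \<in> Arr C" "Dom C (tensor_arr C n f) = tensor C n (\<lambda>k. Dom C (f k))"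
    "Cod C (tensor_arr C n f) = tensor C n (\<lambda>k. Cod C (f k))" by auto
qed

lemma tensor_arr_comp:
  assumes "\<And>k. f k \<in> Arr C" "\<And>k. g k \<in> Arr C" "\<And>k. Cod C (f k) = Dom C (g k)"
  shows "tensor_arr C n g \<bullet> tensor_arr C n f = tensor_arr C n (\<lambda>k. g k \<bullet> f k)"
proof (induction n)
  case (Suc n)
  then show ?case by (cases "n = 0") (simp_all add: assms tensor_comp)
qed simp

lemma tensor_arr_id: "(\<And>k. x k \<in> Obj C) \<Longrightarrow> tensor_arr C n (\<lambda>k. Id C (x k)) = Id C (tensor C n x)"
proof (induction n)
  case (Suc n)
  then show ?case by (cases "n = 0") simp_all
qed simp

lemma swap_arr:
  assumes "1 \<le> j" "j < n" "\<And>k. x k \<in> Obj C"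
  shows "swap C n j x \<in> Arr C \<and> Dom C (swap C n j x) = tensor C n x \<and>
    Cod C (swap C n j x) = tensor C n (x \<circ> transpose j (Suc j))"
  using assms(2)
proof (induction n)
  case (Suc n)
  show ?case
  proof (cases "j < n")
    case True
    then show ?thesis
      using Suc.IH assms by (simp add: swap_lower)
  next
    case False
    then obtain m where m: "n = Suc m" "j = n"
      using Suc.prems assms(1) by (cases n) auto
    have "tensor C m (x \<circ> transpose (Suc m) (Suc (Suc m))) = tensor C m x"
      by (rule tensor_cong) auto
    then show ?thesis
      using m assms(3) by (cases "m = 0") (simp_all add: swap_last swap_two numeral_2_eq_2 o_def)
  qed
qed simp

lemma swap_natural:
  assumes "1 \<le> j" "j < n" "\<And>k. f k \<in> Arr C"
  shows "swap C n j (\<lambda>k. Cod C (f k)) \<bullet> tensor_arr C n f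
    = tensor_arr C n (f \<circ> transpose j (Suc j)) \<bullet> swap C n j (\<lambda>k. Dom C (f k))"
  using assms(2)
proof (induction n)
  case (Suc n)
  show ?case
  proof (cases "j < n")
    case True
    then show ?thesis
      using Suc.IH assms swap_arr[OF assms(1) True, of "\<lambda>k. Cod C (f k)"]
        swap_arr[OF assms(1) True, of "\<lambda>k. Dom C (f k)"]
      by (simp add: swap_lower tensor_comp o_def)
  next
    case False
    then obtain m where m: "n = Suc m" "j = n"
      using Suc.prems assms(1) by (cases n) auto
    have "tensor_arr C m (f \<circ> transpose (Suc m) (Suc (Suc m))) = tensor_arr C m f"
      by (rule tensor_arr_cong) auto
    then show ?thesis
      using m assms(3) braid_natural[of "f 1" "f 2"] braid_last_natural[of "tensor_arr C m f" "f n" "f (Suc n)"]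
      by (cases "m = 0") (simp_all add: swap_last swap_two numeral_2_eq_2 o_def)
  qed
qed simp

lemma swap_swap:
  assumes "1 \<le> j" "j < n" "\<And>k. x k \<in> Obj C"
  shows "swap C n j (x \<circ> transpose j (Suc j)) \<bullet> swap C n j x = Id C (tensor C n x)"
  using assms(2)
proof (induction n)
  case (Suc n)
  show ?case
  proof (cases "j < n")
    case True
    then show ?thesis
      using Suc.IH assms swap_arr[OF assms(1) True, of x]
        swap_arr[OF assms(1) True, of "x \<circ> transpose j (Suc j)"]
      by (simp add: swap_lower tensor_comp o_def)
  next
    case False
    then obtain m where m: "n = Suc m" "j = n"
      using Suc.prems assms(1) by (cases n) auto
    have "tensor C m (x \<circ> transpose (Suc m) (Suc (Suc m))) = tensor C m x"
      by (rule tensor_cong) auto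
    then show ?thesis
      using m assms(3)
      by (cases "m = 0") (simp_all add: swap_last swap_two numeral_2_eq_2 braid_last_braid_last o_def)
  qed
qed simp

text \<open>Once the larger transposition sits at the very end, it is a \<open>braid_last\<close>
  whose front block contains the smaller one, and the two commute by naturality of
  \<open>braid_last\<close>. Otherwise the last factor is stripped off.\<close>

lemma swap_far:
  assumes "1 \<le> j" "Suc j < k" "k < n" "\<And>k. x k \<in> Obj C"
  shows "swap C n k (x \<circ> transpose j (Suc j)) \<bullet> swap C n j x
    = swap C n j (x \<circ> transpose k (Suc k)) \<bullet> swap C n k x"
  using assms(3)
proof (induction n)
  case (Suc n)
  let ?xj = "x \<circ> transpose j (Suc j)" and ?xk = "x \<circ> transpose k (Suc k)"
  have xj: "\<And>k. ?xj k \<in> Obj C" and xk: "\<And>j. ?xk j \<in> Obj C" using assms(4) by auto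
  show ?case
  proof (cases "k < n")
    case True
    have k1: "1 \<le> k" and jn: "j < n" using assms True by auto
    show ?thesis
      using Suc.IH True assms k1 jn swap_arr[OF assms(1) jn assms(4)] swap_arr[OF k1 True assms(4)]
        swap_arr[OF assms(1) jn xk] swap_arr[OF k1 True xj]
      by (simp add: swap_lower tensor_comp o_def)
  next
    case False
    then obtain m where m: "n = Suc m" "k = n" "0 < m" "j < m"
      using Suc.prems assms(1,2) by (cases n) auto
    have eq: "swap C m j (x \<circ> transpose (Suc m) (Suc (Suc m))) = swap C m j x"
      by (rule swap_cong[OF assms(1) \<open>j < m\<close>]) simp
    have low: "swap C (Suc n) j y = (swap C m j y \<diamond> Id C (y (Suc m))) \<diamond> Id C (y (Suc (Suc m)))" for y
      using m assms(1) by (simp add: swap_lower)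
    have tm: "tensor C m (x \<circ> transpose j (Suc j)) = Cod C (swap C m j x)" "tensor C m x = Dom C (swap C m j x)"
      and arr: "swap C m j x \<in> Arr C"
      using swap_arr[OF assms(1) \<open>j < m\<close> assms(4)] by simp_all
    have xm: "(x \<circ> transpose j (Suc j)) (Suc m) = x (Suc m)" "(x \<circ> transpose j (Suc j)) (Suc (Suc m)) = x (Suc (Suc m))"
      using \<open>j < m\<close> by (simp_all add: transpose_def)
    have "swap C (Suc n) k ?xj \<bullet> swap C (Suc n) j x
        = braid_last C (Cod C (swap C m j x)) (x (Suc m)) (x (Suc (Suc m))) \<bullet>
          ((swap C m j x \<diamond> Id C (x (Suc m))) \<diamond> Id C (x (Suc (Suc m))))"
      unfolding low using m(1-3) by (simp add: swap_last tm xm del: comp_apply)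
    also have "\<dots> = ((swap C m j x \<diamond> Id C (x (Suc (Suc m)))) \<diamond> Id C (x (Suc m))) \<bullet>
        braid_last C (Dom C (swap C m j x)) (x (Suc m)) (x (Suc (Suc m)))"
      by (rule braid_last_natural) (use arr assms(4) in simp_all)
    also have "\<dots> = swap C (Suc n) j ?xk \<bullet> swap C (Suc n) k x"
      unfolding low using m(1-3) by (simp add: swap_last tm(2) eq)
    finally show ?thesis .
  qed
qed simp

text \<open>Stripping off last factors leads to the case where the three factors involved are the
  last ones. That is the Yang-Baxter equation, in its version without spectator if no factor
  precedes them.\<close>

lemma swap_braid:
  assumes "1 \<le> j" "Suc j < n" "\<And>k. x k \<in> Obj C"
  shows "swap C n j (x \<circ> transpose j (Suc j) \<circ> transpose (Suc j) (Suc (Suc j))) \<bullet>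
      swap C n (Suc j) (x \<circ> transpose j (Suc j)) \<bullet> swap C n j x
    = swap C n (Suc j) (x \<circ> transpose (Suc j) (Suc (Suc j)) \<circ> transpose j (Suc j)) \<bullet>
      swap C n j (x \<circ> transpose (Suc j) (Suc (Suc j))) \<bullet> swap C n (Suc j) x"
  using assms(2)
proof (induction n)
  case (Suc n)
  let ?s = "transpose j (Suc j)" and ?t = "transpose (Suc j) (Suc (Suc j))"
  have ob: "\<And>k. (x \<circ> ?s) k \<in> Obj C" "\<And>k. (x \<circ> ?t) k \<in> Obj C" "\<And>k. (x \<circ> ?s \<circ> ?t) k \<in> Obj C"
    "\<And>k. (x \<circ> ?t \<circ> ?s) k \<in> Obj C" using assms(3) by auto
  show ?case
  proof (cases "Suc j < n")
    case True
    then have jn: "j < n" "1 \<le> Suc j" by auto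
    note arr = swap_arr[OF assms(1) jn(1) assms(3)] swap_arr[OF jn(2) True assms(3)]
        swap_arr[OF jn(2) True ob(1)] swap_arr[OF assms(1) jn(1) ob(2)] swap_arr[OF assms(1) jn(1) ob(3)]
        swap_arr[OF jn(2) True ob(4)]
    have st: "(x \<circ> ?s \<circ> ?t) (Suc n) = x (Suc n)" "(x \<circ> ?t \<circ> ?s) (Suc n) = x (Suc n)"
      "(x \<circ> ?s) (Suc n) = x (Suc n)" "(x \<circ> ?t) (Suc n) = x (Suc n)"
      using True by (auto simp: transpose_def)
    show ?thesis
      using arg_cong[OF Suc.IH[OF True], of "\<lambda>h. h \<diamond> Id C (x (Suc n))"] assms(3) arr
      by (simp add: swap_lower[OF assms(1) jn(1)] swap_lower[OF jn(2) True] tensor_comp st del: comp_apply)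
  next
    case False
    then have "n = Suc j" "0 < j" using Suc.prems assms(1) by auto
    then obtain m where m: "n = Suc (Suc m)" "j = Suc m"
      by (cases j) auto
    have cong: "tensor C m (x \<circ> ?s) = tensor C m x" "tensor C m (x \<circ> ?t) = tensor C m x"
      "tensor C m (x \<circ> ?s \<circ> ?t) = tensor C m x" "tensor C m (x \<circ> ?t \<circ> ?s) = tensor C m x"
      using m by (auto intro!: tensor_cong)
    show ?thesis
      using m assms(3) cong yang_baxter[of "tensor C m x" "x (Suc m)" "x (Suc (Suc m))" "x (Suc (Suc (Suc m)))"]
        yang_baxter_three[of "x 1" "x 2" "x 3"]
      by (cases "m = 0") (simp_all add: swap_lower swap_last swap_two numeral_2_eq_2 numeral_3_eq_3 o_def)
  qed
qed simp

text \<open>Equality of the permutations is part of the relation because it decides on which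
  rearranged family the following letters act; \<open>word_eq_context\<close> relies on it.\<close>

definition word_eq :: "nat \<Rightarrow> nat list \<Rightarrow> nat list \<Rightarrow> bool" where
  "word_eq n u v \<longleftrightarrow> word_perm u = word_perm v \<and>
     (\<forall>x. (\<forall>k. x k \<in> Obj C) \<longrightarrow> swaps C n u x = swaps C n v x)"

lemma swaps_arr:
  assumes "set u \<subseteq> {1..<n}" "\<And>k. x k \<in> Obj C"
  shows "swaps C n u x \<in> Arr C \<and> Dom C (swaps C n u x) = tensor C n x \<and>
    Cod C (swaps C n u x) = tensor C n (x \<circ> word_perm (rev u))"
  using assms
proof (induction u arbitrary: x)
  case (Cons j u)
  have j: "1 \<le> j" "j < n" and u: "set u \<subseteq> {1..<n}" using Cons.prems by auto
  have x: "\<And>k. (x \<circ> transpose j (Suc j)) k \<in> Obj C" using Cons.prems by simp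
  have "x \<circ> transpose j (Suc j) \<circ> word_perm (rev u) = x \<circ> word_perm (rev (j # u))"
    by (simp add: word_perm_append Fun.comp_assoc)
  then show ?case
    using Cons.IH[OF u, of "x \<circ> transpose j (Suc j)", OF x] swap_arr[OF j, of x, OF Cons.prems(2)]
    by (simp add: o_def)
qed simp

lemma swaps_append:
  assumes "set u \<subseteq> {1..<n}" "set v \<subseteq> {1..<n}" "\<And>k. x k \<in> Obj C"
  shows "swaps C n (u @ v) x = swaps C n v (x \<circ> word_perm (rev u)) \<bullet> swaps C n u x"
  using assms
proof (induction u arbitrary: x)
  case Nil
  then show ?case using swaps_arr[of v n x] by simp
next
  case (Cons j u)
  have j: "1 \<le> j" "j < n" and u: "set u \<subseteq> {1..<n}" using Cons.prems by auto
  have x: "\<And>k. (x \<circ> transpose j (Suc j)) k \<in> Obj C" using Cons.prems by simp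
  have eq: "x \<circ> transpose j (Suc j) \<circ> word_perm (rev u) = x \<circ> word_perm (rev (j # u))"
    by (simp add: word_perm_append Fun.comp_assoc)
  have x': "\<And>k. (x \<circ> word_perm (rev (j # u))) k \<in> Obj C" using Cons.prems by simp
  show ?case
    using Cons.IH[OF u Cons.prems(2), of "x \<circ> transpose j (Suc j)", OF x]
      swaps_arr[OF u, of "x \<circ> transpose j (Suc j)", OF x]
      swaps_arr[OF Cons.prems(2), of "x \<circ> word_perm (rev (j # u))", OF x'] swap_arr[OF j, of x, OF Cons.prems(3)]
    unfolding eq by (simp add: o_def word_perm_append)
qed

lemma swaps_natural:
  assumes "set u \<subseteq> {1..<n}" "\<And>k. f k \<in> Arr C"
  shows "swaps C n u (\<lambda>k. Cod C (f k)) \<bullet> tensor_arr C n f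
    = tensor_arr C n (f \<circ> word_perm (rev u)) \<bullet> swaps C n u (\<lambda>k. Dom C (f k))"
  using assms
proof (induction u arbitrary: f)
  case (Cons j u)
  have j: "1 \<le> j" "j < n" and u: "set u \<subseteq> {1..<n}" using Cons.prems by auto
  let ?f = "f \<circ> transpose j (Suc j)"
  have f: "\<And>k. ?f k \<in> Arr C" using Cons.prems by simp
  have ob: "\<And>k. Cod C (f k) \<in> Obj C" "\<And>k. Dom C (f k) \<in> Obj C"
    "\<And>k. Cod C (?f k) \<in> Obj C" "\<And>k. Dom C (?f k) \<in> Obj C" using Cons.prems f by simp_all
  have eq: "?f \<circ> word_perm (rev u) = f \<circ> word_perm (rev (j # u))"
    by (simp add: word_perm_append Fun.comp_assoc)
  have fam: "(\<lambda>k. Cod C (f k)) \<circ> transpose j (Suc j) = (\<lambda>k. Cod C (?f k))"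
    "(\<lambda>k. Dom C (f k)) \<circ> transpose j (Suc j) = (\<lambda>k. Dom C (?f k))" by auto
  note arr = swap_arr[OF j, of "\<lambda>k. Cod C (f k)", OF ob(1), unfolded fam]
    swap_arr[OF j, of "\<lambda>k. Dom C (f k)", OF ob(2), unfolded fam]
    swaps_arr[OF u, of "\<lambda>k. Cod C (?f k)", OF ob(3)] swaps_arr[OF u, of "\<lambda>k. Dom C (?f k)", OF ob(4)]
    tensor_arr_family[of f n, OF Cons.prems(2)] tensor_arr_family[of ?f n, OF f]
  have arr': "tensor_arr C n (?f \<circ> word_perm (rev u)) \<in> Arr C"
    "Dom C (tensor_arr C n (?f \<circ> word_perm (rev u))) = tensor C n ((\<lambda>k. Dom C (?f k)) \<circ> word_perm (rev u))"
    using tensor_arr_family[of "?f \<circ> word_perm (rev u)" n] f by (simp_all add: o_def)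
  let ?a = "swaps C n u (\<lambda>k. Cod C (?f k))" and ?b = "swaps C n u (\<lambda>k. Dom C (?f k))"
  have "swaps C n (j # u) (\<lambda>k. Cod C (f k)) \<bullet> tensor_arr C n f
      = ?a \<bullet> (swap C n j (\<lambda>k. Cod C (f k)) \<bullet> tensor_arr C n f)"
    using arr by (simp add: fam del: comp_apply)
  also have "\<dots> = (?a \<bullet> tensor_arr C n ?f) \<bullet> swap C n j (\<lambda>k. Dom C (f k))"
    unfolding swap_natural[OF j Cons.prems(2)] using arr by (simp del: comp_apply)
  also have "\<dots> = (tensor_arr C n (?f \<circ> word_perm (rev u)) \<bullet> ?b) \<bullet> swap C n j (\<lambda>k. Dom C (f k))"
    by (simp only: Cons.IH[OF u f])
  also have "\<dots> = tensor_arr C n (f \<circ> word_perm (rev (j # u))) \<bullet> swaps C n (j # u) (\<lambda>k. Dom C (f k))"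
    unfolding eq[symmetric] using arr arr' by (simp add: fam del: comp_apply)
  finally show ?case .
qed simp

lemma word_eq_refl: "word_eq n u u"
  by (simp add: word_eq_def)

lemma word_eq_trans [trans]: "\<lbrakk>word_eq n u v; word_eq n v w\<rbrakk> \<Longrightarrow> word_eq n u w"
  by (simp add: word_eq_def)

lemma word_eq_context:
  assumes "word_eq n u v" "set u \<subseteq> {1..<n}" "set v \<subseteq> {1..<n}" "set a \<subseteq> {1..<n}" "set b \<subseteq> {1..<n}"
  shows "word_eq n (a @ u @ b) (a @ v @ b)"
proof -
  have uv: "word_perm u = word_perm v" using assms(1) by (simp add: word_eq_def)
  then have uv': "word_perm (rev u) = word_perm (rev v)" by (simp flip: inv_word_perm)
  have "swaps C n (a @ u @ b) x = swaps C n (a @ v @ b) x" if x: "\<And>k. x k \<in> Obj C" for x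
  proof -
    let ?y = "x \<circ> word_perm (rev a)"
    have y: "\<And>k. ?y k \<in> Obj C" using x by simp
    have s: "set (u @ b) \<subseteq> {1..<n}" "set (v @ b) \<subseteq> {1..<n}" using assms by auto
    have "swaps C n u ?y = swaps C n v ?y"
      using assms(1) y by (simp add: word_eq_def)
    then have "swaps C n (u @ b) ?y = swaps C n (v @ b) ?y"
      using swaps_append[OF assms(2,5), of ?y, OF y] swaps_append[OF assms(3,5), of ?y, OF y] uv' by simp
    then show ?thesis
      using swaps_append[OF assms(4) s(1), of x, OF x] swaps_append[OF assms(4) s(2), of x, OF x] by simp
  qed
  then show ?thesis using uv by (simp add: word_eq_def word_perm_append)
qed

lemma word_eq_square: "j \<in> {1..<n} \<Longrightarrow> word_eq n [j, j] []"
  using swap_swap[of j n] swap_arr[of j n] by (auto simp: word_eq_def o_def)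

lemma word_eq_far:
  assumes "j \<in> {1..<n}" "k \<in> {1..<n}" "Suc j < k \<or> Suc k < j"
  shows "word_eq n [j, k] [k, j]"
proof -
  have *: "word_eq n [j, k] [k, j]" if jk: "j \<in> {1..<n}" "k \<in> {1..<n}" "Suc j < k" for j k
  proof -
    have "swaps C n [j, k] x = swaps C n [k, j] x" if x: "\<And>k. x k \<in> Obj C" for x
    proof -
      have "swaps C n [i, l] x = swap C n l (x \<circ> transpose i (Suc i)) \<bullet> swap C n i x"
        if "i \<in> {1..<n}" "l \<in> {1..<n}" for i l
        using swap_arr[of l n "x \<circ> transpose i (Suc i)"] swap_arr[of i n x] that x by simp
      then show ?thesis using jk swap_far[of j k n x] x by simp
    qed
    moreover have "transpose k (Suc k) \<circ> transpose j (Suc j) = transpose j (Suc j) \<circ> transpose k (Suc k)"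
      using jk by (auto simp: fun_eq_iff transpose_def)
    ultimately show ?thesis by (simp add: word_eq_def)
  qed
  show ?thesis
    using *[of j k] *[of k j] assms by (auto simp: word_eq_def)
qed

lemma word_eq_braid:
  assumes "1 \<le> j" "Suc j < n"
  shows "word_eq n [Suc j, j, Suc j] [j, Suc j, j]"
proof -
  have "swaps C n [Suc j, j, Suc j] x = swaps C n [j, Suc j, j] x" if x: "\<And>k. x k \<in> Obj C" for x
  proof -
    have "swaps C n [i, l, i] x = swap C n i (x \<circ> transpose i (Suc i) \<circ> transpose l (Suc l)) \<bullet>
        swap C n l (x \<circ> transpose i (Suc i)) \<bullet> swap C n i x"
      if "i \<in> {1..<n}" "l \<in> {1..<n}" for i l
      using swap_arr[of l n "x \<circ> transpose i (Suc i)"] swap_arr[of i n x]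
        swap_arr[of i n "x \<circ> transpose i (Suc i) \<circ> transpose l (Suc l)"] that x by simp
    then show ?thesis using assms swap_braid[OF assms, of x] x by simp
  qed
  moreover have "word_perm [Suc j, j, Suc j] = word_perm [j, Suc j, j]"
    by (auto simp: fun_eq_iff transpose_def)
  ultimately show ?thesis by (simp add: word_eq_def)
qed

lemma word_eq_commute:
  assumes "j \<in> {1..<n}" "set c \<subseteq> {1..<n}" "\<And>k. k \<in> set c \<Longrightarrow> Suc j < k \<or> Suc k < j"
  shows "word_eq n (j # c) (c @ [j])"
  using assms(2,3)
proof (induction c)
  case (Cons k c)
  have "word_eq n ([] @ [j, k] @ c) ([] @ [k, j] @ c)"
    using Cons.prems assms(1) by (intro word_eq_context word_eq_far) auto
  also have "word_eq n ([] @ [k, j] @ c) ([k] @ (c @ [j]) @ [])"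
    using word_eq_context[of n "j # c" "c @ [j]" "[k]" "[]"] Cons assms(1) by auto
  finally show ?case by simp
qed (simp add: word_eq_refl)

text \<open>The heart of the normal form: a letter in front of a cycle word yields a cycle word
  followed by letters below \<open>n\<close>. A distant smaller letter commutes through,
  \<open>k - 1\<close> prolongs the word, \<open>k\<close> cancels, and a larger letter passes by
  one braid relation and comes out lowered by one.\<close>

lemma word_eq_insert:
  assumes j: "j \<in> {1..n}" and k: "k \<in> {1..Suc n}"
  shows "\<exists>k' w. k' \<in> {1..Suc n} \<and> set w \<subseteq> {1..<n} \<and>
    word_eq (Suc n) (j # [k..<Suc n]) ([k'..<Suc n] @ w)"
proof -
  consider "Suc j < k" | "Suc j = k" | "j = k" | "k < j" by linarith
  then show ?thesis
  proof cases
    case 1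
    then have "word_eq (Suc n) (j # [k..<Suc n]) ([k..<Suc n] @ [j])"
      using j k by (intro word_eq_commute) auto
    then show ?thesis using 1 j k by (intro exI[of _ k] exI[of _ "[j]"]) auto
  next
    case 2
    then have "j # [k..<Suc n] = [j..<Suc n] @ []" using j by (simp add: upt_conv_Cons)
    then show ?thesis using j by (intro exI[of _ j] exI[of _ "[]"]) (auto simp: word_eq_refl)
  next
    case 3
    then have "word_eq (Suc n) ([] @ [j, j] @ [Suc k..<Suc n]) ([] @ [] @ [Suc k..<Suc n])"
      using j by (intro word_eq_context word_eq_square) auto
    moreover have "j # [k..<Suc n] = [] @ [j, j] @ [Suc k..<Suc n]"
      using 3 j by (simp add: upt_conv_Cons del: upt_Suc)
    ultimately show ?thesis
      using 3 j by (intro exI[of _ "Suc k"] exI[of _ "[]"]) auto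
  next
    case 4
    \<comment> \<open>The cycle word contains \<open>i\<close> directly followed by
      \<open>Suc i\<close>, which is \<open>j\<close>; these are the only letters that
      \<open>j\<close> cannot simply pass, and there the braid relation turns it into
      \<open>i\<close>.\<close>
    then obtain i where i: "j = Suc i" "k \<le> i" by (cases j) auto
    let ?a = "[k..<i]" and ?b = "[Suc (Suc i)..<Suc n]"
    have split_upt: "[k..<Suc n] = ?a @ [i, Suc i] @ ?b"
      using i j upt_add_eq_append[of k i "Suc n - i"] by (simp add: upt_conv_Cons del: upt_Suc)
    have "word_eq (Suc n) ([] @ (j # ?a) @ ([i, Suc i] @ ?b)) ([] @ (?a @ [j]) @ ([i, Suc i] @ ?b))"
      using i j k by (intro word_eq_context word_eq_commute) auto
    also have "[] @ (?a @ [j]) @ ([i, Suc i] @ ?b) = ?a @ [Suc i, i, Suc i] @ ?b"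
      using i by simp
    also have "word_eq (Suc n) (?a @ [Suc i, i, Suc i] @ ?b) (?a @ [i, Suc i, i] @ ?b)"
      using i j k by (intro word_eq_context word_eq_braid) auto
    also have "?a @ [i, Suc i, i] @ ?b = (?a @ [i, Suc i]) @ (i # ?b) @ []"
      by simp
    also have "word_eq (Suc n) ((?a @ [i, Suc i]) @ (i # ?b) @ []) ((?a @ [i, Suc i]) @ (?b @ [i]) @ [])"
      using i j k by (intro word_eq_context word_eq_commute) auto
    finally have "word_eq (Suc n) (j # [k..<Suc n]) ([k..<Suc n] @ [i])"
      by (simp add: split_upt del: upt_Suc)
    then show ?thesis using i j k by (intro exI[of _ k] exI[of _ "[i]"]) auto
  qed
qed

text \<open>Iterating \<open>word_eq_insert\<close> splits a word into a coset representative
  \<open>[k..<Suc n]\<close>, empty for \<open>k = Suc n\<close>, and a word that leaves the last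
  position alone.\<close>

lemma word_eq_normal_form:
  assumes "set u \<subseteq> {1..n}"
  shows "\<exists>k v. k \<in> {1..Suc n} \<and> set v \<subseteq> {1..<n} \<and> word_eq (Suc n) u ([k..<Suc n] @ v)"
  using assms
proof (induction u)
  case Nil
  then show ?case by (intro exI[of _ "Suc n"] exI[of _ "[]"]) (simp add: word_eq_refl)
next
  case (Cons j u)
  then obtain k v where kv: "k \<in> {1..Suc n}" "set v \<subseteq> {1..<n}" "word_eq (Suc n) u ([k..<Suc n] @ v)"
    by auto
  obtain k' w where k'w: "k' \<in> {1..Suc n}" "set w \<subseteq> {1..<n}"
      "word_eq (Suc n) (j # [k..<Suc n]) ([k'..<Suc n] @ w)"
    using word_eq_insert[of j n k] Cons.prems kv(1) by auto
  have "word_eq (Suc n) ([j] @ u @ []) ([j] @ ([k..<Suc n] @ v) @ [])"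
    using kv Cons.prems by (intro word_eq_context) auto
  also have "[j] @ ([k..<Suc n] @ v) @ [] = [] @ (j # [k..<Suc n]) @ v" by simp
  also have "word_eq (Suc n) ([] @ (j # [k..<Suc n]) @ v) ([] @ ([k'..<Suc n] @ w) @ v)"
    using kv k'w Cons.prems by (intro word_eq_context) auto
  finally show ?case
    using k'w kv by (intro exI[of _ k'] exI[of _ "w @ v"]) (auto simp del: upt_Suc)
qed

lemma swaps_lower:
  assumes "set u \<subseteq> {1..<n}" "0 < n" "\<And>k. x k \<in> Obj C"
  shows "swaps C (Suc n) u x = swaps C n u x \<diamond> Id C (x (Suc n))"
  using assms(1,3)
proof (induction u arbitrary: x)
  case (Cons j u)
  have j: "1 \<le> j" "j < n" and u: "set u \<subseteq> {1..<n}" using Cons.prems by auto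
  have x: "\<And>k. (x \<circ> transpose j (Suc j)) k \<in> Obj C" using Cons.prems by simp
  have "(x \<circ> transpose j (Suc j)) (Suc n) = x (Suc n)" using j by (simp add: transpose_def)
  then show ?case
    using Cons.IH[OF u, of "x \<circ> transpose j (Suc j)", OF x] swap_arr[OF j, of x, OF Cons.prems(2)]
      swaps_arr[OF u, of "x \<circ> transpose j (Suc j)", OF x] Cons.prems(2)
    by (simp add: swap_lower[OF j] tensor_comp del: comp_apply)
qed (use assms(2) in simp)

text \<open>Two normal forms with the same permutation have the same \<open>k\<close>, the position
  sent to the end, because the remaining words fix \<open>Suc n\<close>. Cancelling the common cycle
  word leaves two words on \<open>n\<close> positions, to which the induction hypothesis
  applies.\<close>

theorem word_eqI:
  assumes "set u \<subseteq> {1..<n}" "set v \<subseteq> {1..<n}" "word_perm u = word_perm v"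
  shows "word_eq n u v"
  using assms
proof (induction n arbitrary: u v)
  case 0
  then show ?case by (simp add: word_eq_refl)
next
  case (Suc n)
  then have uv: "set u \<subseteq> {1..n}" "set v \<subseteq> {1..n}" by auto
  obtain k a where a: "k \<in> {1..Suc n}" "set a \<subseteq> {1..<n}" "word_eq (Suc n) u ([k..<Suc n] @ a)"
    using word_eq_normal_form[OF uv(1)] by blast
  obtain l b where b: "l \<in> {1..Suc n}" "set b \<subseteq> {1..<n}" "word_eq (Suc n) v ([l..<Suc n] @ b)"
    using word_eq_normal_form[OF uv(2)] by blast
  let ?k = "[k..<Suc n]" and ?l = "[l..<Suc n]"
  have eq: "word_perm (?k @ a) = word_perm (?l @ b)"
    using a(3) b(3) Suc.prems(3) by (simp add: word_eq_def)
  have fix_last: "word_perm w (Suc n) = Suc n" if "set w \<subseteq> {1..<n}" for w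
    using permutes_not_in[OF word_perm_permutes[OF that]] by simp
  have "word_perm (?k @ a) k = Suc n" "word_perm (?l @ b) l = Suc n"
    using a b fix_last word_perm_upt[of _ "Suc n"] by (simp_all add: word_perm_append del: upt_Suc)
  moreover have "inj (word_perm (?l @ b))"
    using b by (intro permutes_inj[OF word_perm_permutes[of _ "Suc n"]]) auto
  ultimately have kl: "k = l"
    using eq by (metis injD)
  have *: "word_perm w = word_perm (?l @ w) \<circ> word_perm (rev ?l)" for w
    by (simp only: word_perm_append Fun.comp_assoc word_perm_rev comp_id)
  have "word_perm (?l @ a) = word_perm (?l @ b)"
    using eq by (simp only: kl)
  then have "word_perm a = word_perm b"
    by (subst *, subst (2) *) (simp only:)
  then have ab: "word_eq n a b"
    using Suc.IH a b by blast
  have "word_eq (Suc n) a b"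
  proof (cases "n = 0")
    case True
    then show ?thesis using a b by (simp add: word_eq_refl)
  next
    case False
    then show ?thesis
      using ab swaps_lower[OF a(2)] swaps_lower[OF b(2)] by (simp add: word_eq_def)
  qed
  then have "word_eq (Suc n) (?k @ a @ []) (?k @ b @ [])"
    using a b by (intro word_eq_context) auto
  then show ?case
    using a(3) b(3) by (auto simp: word_eq_def kl simp del: upt_Suc)
qed

subsection \<open>Permutation of factors\<close>

text \<open>Removes the choice made in \<open>permute\<close>: by \<open>word_eqI\<close> any word
  for \<sigma> may be used, so composition and naturality follow from words chosen to fit.\<close>

lemma permute_word:
  assumes "set u \<subseteq> {1..<n}" "word_perm u = \<sigma>" "\<And>k. x k \<in> Obj C"
  shows "permute C n \<sigma> x = swaps C n u x"
proof -
  let ?v = "SOME js. set js \<subseteq> {1..<n} \<and> word_perm js = \<sigma>"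
  have "set ?v \<subseteq> {1..<n} \<and> word_perm ?v = \<sigma>"
    by (rule someI[of _ u]) (use assms in auto)
  then have "word_eq n ?v u"
    using assms by (intro word_eqI) auto
  then show ?thesis
    using assms(3) by (simp add: permute_def word_eq_def)
qed

lemma permute_arr:
  assumes "\<sigma> permutes {1..n}" "\<And>k. x k \<in> Obj C"
  shows "permute C n \<sigma> x \<in> Arr C" "Dom C (permute C n \<sigma> x) = tensor C n x"
    "Cod C (permute C n \<sigma> x) = tensor C n (x \<circ> inv' \<sigma>)"
proof -
  obtain u where u: "set u \<subseteq> {1..<n}" "word_perm u = \<sigma>" using word_exists[OF assms(1)] by blast
  then have "inv' \<sigma> = word_perm (rev u)" using inv_word_perm by blast
  then show "permute C n \<sigma> x \<in> Arr C" "Dom C (permute C n \<sigma> x) = tensor C n x"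
    "Cod C (permute C n \<sigma> x) = tensor C n (x \<circ> inv' \<sigma>)"
    using swaps_arr[OF u(1), of x, OF assms(2)] permute_word[OF u, of x, OF assms(2)] by auto
qed

lemma permute_id: "(\<And>k. x k \<in> Obj C) \<Longrightarrow> permute C n id x = Id C (tensor C n x)"
  using permute_word[of "[]" n id x] by simp

lemma permute_comp:
  assumes "\<sigma> permutes {1..n}" "\<tau> permutes {1..n}" "\<And>k. x k \<in> Obj C"
  shows "permute C n \<sigma> (x \<circ> inv' \<tau>) \<bullet> permute C n \<tau> x = permute C n (\<sigma> \<circ> \<tau>) x"
proof -
  obtain u where u: "set u \<subseteq> {1..<n}" "word_perm u = \<sigma>" using word_exists[OF assms(1)] by blast
  obtain v where v: "set v \<subseteq> {1..<n}" "word_perm v = \<tau>" using word_exists[OF assms(2)] by blast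
  have x: "\<And>k. (x \<circ> inv' \<tau>) k \<in> Obj C" using assms(3) by simp
  have "permute C n (\<sigma> \<circ> \<tau>) x = swaps C n (v @ u) x"
    using u v assms(3) by (intro permute_word) (auto simp: word_perm_append)
  also have "\<dots> = swaps C n u (x \<circ> inv' \<tau>) \<bullet> swaps C n v x"
    using swaps_append[OF v(1) u(1) assms(3)] v(2) inv_word_perm[of v] by simp
  finally show ?thesis
    using permute_word[OF u, of "x \<circ> inv' \<tau>", OF x] permute_word[OF v, of x, OF assms(3)] by simp
qed

lemma permute_natural:
  assumes "\<sigma> permutes {1..n}" "\<And>k. f k \<in> Arr C"
  shows "permute C n \<sigma> (\<lambda>k. Cod C (f k)) \<bullet> tensor_arr C n f
    = tensor_arr C n (f \<circ> inv' \<sigma>) \<bullet> permute C n \<sigma> (\<lambda>k. Dom C (f k))"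
proof -
  obtain u where u: "set u \<subseteq> {1..<n}" "word_perm u = \<sigma>" using word_exists[OF assms(1)] by blast
  then have "inv' \<sigma> = word_perm (rev u)" using inv_word_perm by blast
  then show ?thesis
    using swaps_natural[OF u(1) assms(2)] permute_word[OF u, of "\<lambda>k. Cod C (f k)"]
      permute_word[OF u, of "\<lambda>k. Dom C (f k)"] assms(2) by simp
qed

lemma iso_permute:
  assumes s: "\<sigma> permutes {1..n}" and x: "\<And>k. x k \<in> Obj C"
  shows "iso_arr C (permute C n \<sigma> x)"
proof -
  have inv: "inv' \<sigma> permutes {1..n}" by (rule permutes_inv[OF s])
  have x': "\<And>k. (x \<circ> inv' \<sigma>) k \<in> Obj C" using x by simp
  have i1: "inv' \<sigma> \<circ> \<sigma> = id" and i2: "\<sigma> \<circ> inv' \<sigma> = id"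
    using permutes_inv_o[OF s] by auto
  have i3: "inv' (inv' \<sigma>) = \<sigma>" using permutes_inv_inv[OF s] .
  have xx: "x \<circ> inv' \<sigma> \<circ> inv' (inv' \<sigma>) = x" by (simp only: i3 Fun.comp_assoc i1 comp_id)
  have "permute C n (inv' \<sigma>) (x \<circ> inv' \<sigma>) \<bullet> permute C n \<sigma> x = Id C (tensor C n x)"
    using permute_comp[OF inv s, of x, OF x] permute_id[of x n, OF x] i1 by simp
  moreover have "permute C n \<sigma> x \<bullet> permute C n (inv' \<sigma>) (x \<circ> inv' \<sigma>) = Id C (tensor C n (x \<circ> inv' \<sigma>))"
    using permute_comp[OF s inv, of "x \<circ> inv' \<sigma>", OF x'] permute_id[of "x \<circ> inv' \<sigma>" n, OF x'] unfolding xx i2 by simp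
  ultimately show ?thesis
    unfolding iso_arr_def is_inverse_def
    using permute_arr[OF s, of x, OF x] permute_arr[OF inv, of "x \<circ> inv' \<sigma>", OF x'] xx by (intro exI[of _ "permute C n (inv' \<sigma>) (x \<circ> inv' \<sigma>)"]) simp
qed

end

subsection \<open>Joining two blocks of factors\<close>

text \<open>The rebracketing from a product of two left-bracketed blocks to the left-bracketed
  product of all factors. The recursion removes the last factor of the right block, as left
  bracketing does; with one factor on the right there is nothing to rebracket, and empty blocks are
  absorbed by the unit constraints.\<close>

fun tensor_join :: "('o, 'm, 'z) mon_cat_scheme \<Rightarrow> nat \<Rightarrow> nat \<Rightarrow> (nat \<Rightarrow> 'o) \<Rightarrow> 'm" where
  "tensor_join C 0 q x = Lunit C (tensor C q x)"
| "tensor_join C (Suc p) 0 x = Runit C (tensor C (Suc p) x)"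
| "tensor_join C (Suc p) (Suc 0) x = Id C (tensor C (Suc (Suc p)) x)"
| "tensor_join C (Suc p) (Suc (Suc q)) x =
    (tensor_join C (Suc p) (Suc q) x \<diamond>\<^bsub>C\<^esub> Id C (x (Suc p + Suc (Suc q)))) \<bullet>\<^bsub>C\<^esub>
    inverse_arr C (Assoc C (tensor C (Suc p) x) (tensor C (Suc q) (\<lambda>k. x (Suc p + k))) (x (Suc p + Suc (Suc q))))"

lemma tensor_join_one: "0 < p \<Longrightarrow> tensor_join C p (Suc 0) x = Id C (tensor C (Suc p) x)"
  by (cases p) auto

lemma tensor_join_Suc:
  "\<lbrakk>0 < p; 0 < q\<rbrakk> \<Longrightarrow> tensor_join C p (Suc q) x = (tensor_join C p q x \<diamond>\<^bsub>C\<^esub> Id C (x (p + Suc q))) \<bullet>\<^bsub>C\<^esub>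
    inverse_arr C (Assoc C (tensor C p x) (tensor C q (\<lambda>k. x (p + k))) (x (p + Suc q)))"
  by (cases p; cases q) simp_all

lemma swaps_cong:
  assumes "set u \<subseteq> {1..<n}" "\<And>k. k \<in> {1..n} \<Longrightarrow> x k = y k"
  shows "swaps C n u x = swaps C n u y"
  using assms
proof (induction u arbitrary: x y)
  case Nil
  then show ?case using tensor_cong[of n x y C] by simp
next
  case (Cons j u)
  then have j: "1 \<le> j" "j < n" and u: "set u \<subseteq> {1..<n}" by auto
  have "(x \<circ> transpose j (Suc j)) k = (y \<circ> transpose j (Suc j)) k" if "k \<in> {1..n}" for k
    using that j Cons.prems(2) by (simp add: transpose_def)
  then have "swaps C n u (x \<circ> transpose j (Suc j)) = swaps C n u (y \<circ> transpose j (Suc j))"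
    using Cons.IH[OF u] by blast
  then show ?case
    using swap_cong[of j n x y C, OF j Cons.prems(2)] by simp
qed

lemma permute_cong:
  assumes "\<sigma> permutes {1..n}" "\<And>k. k \<in> {1..n} \<Longrightarrow> x k = y k"
  shows "permute C n \<sigma> x = permute C n \<sigma> y"
proof -
  have "\<exists>u. set u \<subseteq> {1..<n} \<and> word_perm u = \<sigma>" using word_exists[OF assms(1)] .
  from someI_ex[OF this] show ?thesis
    unfolding permute_def using assms(2) by (intro swaps_cong) auto
qed

lemma transpose_shift: "transpose (p + j) (Suc (p + j)) (p + k) = p + transpose j (Suc j) k"
  by (auto simp: transpose_def)

lemma word_perm_shift: "word_perm (map ((+) p) u) (p + k) = p + word_perm u k"
  by (induction u arbitrary: k) (simp_all add: transpose_shift)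

lemma word_perm_shift_lower: "\<lbrakk>k \<le> p; 0 \<notin> set u\<rbrakk> \<Longrightarrow> word_perm (map ((+) p) u) k = k"
  by (induction u arbitrary: k) (auto simp: transpose_def)

text \<open>Preserving the first \<open>p\<close> positions forces the last \<open>q\<close> to be
  preserved too, since injectivity keeps their images off the first block.\<close>

lemma block_subgroupD:
  assumes "\<sigma> \<in> block_subgroup p q"
  shows "\<sigma> permutes {1..p + q}" "left_block p \<sigma> permutes {1..p}" "right_block p q \<sigma> permutes {1..q}"
    "\<And>k. k \<in> {1..q} \<Longrightarrow> \<sigma> (p + k) = p + right_block p q \<sigma> k"
proof -
  show s: "\<sigma> permutes {1..p + q}"
    using assms by (simp add: block_subgroup_def sym_group_carrier)
  have img: "\<sigma> ` {1..p} = {1..p}" using assms by (simp add: block_subgroup_def)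
  have inj: "inj \<sigma>" by (rule permutes_inj[OF s])
  show "left_block p \<sigma> permutes {1..p}"
  proof (rule bij_imp_permutes)
    have "bij_betw \<sigma> {1..p} {1..p}"
      using img inj by (auto simp: bij_betw_def intro: inj_on_subset)
    then show "bij_betw (left_block p \<sigma>) {1..p} {1..p}"
      by (rule bij_betw_cong[THEN iffD1, rotated]) (simp add: left_block_def)
  qed (auto simp: left_block_def)
  have tail: "p < \<sigma> (p + k) \<and> \<sigma> (p + k) \<le> p + q" if k: "k \<in> {1..q}" for k
  proof -
    have "\<sigma> (p + k) \<in> {1..p + q}" using k permutes_in_image[OF s] by simp
    moreover have "\<sigma> (p + k) \<notin> \<sigma> ` {1..p}" using k by (simp add: inj_image_mem_iff[OF inj])
    ultimately show ?thesis using img by auto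
  qed
  show rb: "\<And>k. k \<in> {1..q} \<Longrightarrow> \<sigma> (p + k) = p + right_block p q \<sigma> k"
    using tail by (simp add: right_block_def less_imp_le)
  show "right_block p q \<sigma> permutes {1..q}"
  proof (rule bij_imp_permutes)
    have "right_block p q \<sigma> ` {1..q} \<subseteq> {1..q}"
      using tail by (fastforce simp: right_block_def)
    moreover have "inj_on (right_block p q \<sigma>) {1..q}"
      using rb inj by (intro inj_onI) (metis add_left_cancel injD)
    ultimately show "bij_betw (right_block p q \<sigma>) {1..q} {1..q}"
      by (simp add: bij_betw_def endo_inj_surj)
  qed (auto simp: right_block_def)
qed

text \<open>The right block is written first, so that the left block acts on a family that agrees with
  the original one on the first \<open>p\<close> positions.\<close>

lemma block_subgroup_word:
  assumes u: "set u \<subseteq> {1..<p}" and v: "set v \<subseteq> {1..<q}"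
  defines "\<sigma> \<equiv> word_perm (map ((+) p) v @ u)"
  shows "\<sigma> \<in> block_subgroup p q" "left_block p \<sigma> = word_perm u" "right_block p q \<sigma> = word_perm v"
proof -
  have pu: "word_perm u permutes {1..p}" and pv: "word_perm v permutes {1..q}"
    using word_perm_permutes u v by auto
  have "0 \<notin> set v" using v by auto
  then have low: "\<sigma> k = word_perm u k" if "k \<le> p" for k
    using that by (simp add: \<sigma>_def word_perm_append word_perm_shift_lower)
  have high: "\<sigma> (p + k) = p + word_perm v k" if "k \<in> {1..q}" for k
    using that permutes_in_image[OF pv, of k] permutes_not_in[OF pu, of "p + word_perm v k"]
    by (simp add: \<sigma>_def word_perm_append word_perm_shift)
  show "left_block p \<sigma> = word_perm u"
    using low permutes_not_in[OF pu] by (auto simp: left_block_def fun_eq_iff)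
  show "right_block p q \<sigma> = word_perm v"
    using high permutes_not_in[OF pv] by (auto simp: right_block_def fun_eq_iff)
  have "\<sigma> permutes {1..p + q}"
    unfolding \<sigma>_def using u v by (intro word_perm_permutes) auto
  moreover have "\<sigma> ` {1..p} = word_perm u ` {1..p}"
    using low by (intro image_cong) auto
  ultimately show "\<sigma> \<in> block_subgroup p q"
    using permutes_image[OF pu] by (simp add: block_subgroup_def sym_group_carrier)
qed

lemma block_subgroup_eqI:
  assumes "\<sigma> \<in> block_subgroup p q" "\<tau> \<in> block_subgroup p q"
    "left_block p \<sigma> = left_block p \<tau>" "right_block p q \<sigma> = right_block p q \<tau>"
  shows "\<sigma> = \<tau>"
proof
  fix k
  consider "k \<in> {1..p}" | "k \<notin> {1..p + q}" | l where "k = p + l" "l \<in> {1..q}"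
  proof (cases "k \<le> p")
    case False
    then show ?thesis using that(2) that(3)[of "k - p"] by (cases "k \<le> p + q") (auto simp: Suc_le_eq)
  qed (use that(1,2) in \<open>cases "k = 0"; auto\<close>)
  then show "\<sigma> k = \<tau> k"
  proof cases
    case 1
    then show ?thesis using fun_cong[OF assms(3), of k] by (simp add: left_block_def)
  next
    case 2
    then show ?thesis using block_subgroupD(1)[OF assms(1)] block_subgroupD(1)[OF assms(2)] permutes_not_in by metis
  next
    case 3
    then show ?thesis using block_subgroupD(4)[OF assms(1)] block_subgroupD(4)[OF assms(2)] assms(4) by simp
  qed
qed

lemma block_subgroup_surj:
  assumes "a permutes {1..p}" "b permutes {1..q}"
  obtains \<sigma> where "\<sigma> \<in> block_subgroup p q" "left_block p \<sigma> = a" "right_block p q \<sigma> = b"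
  using word_exists[OF assms(1)] word_exists[OF assms(2)] block_subgroup_word by metis

section \<open>Compatibility of the rebracketing with permutations\<close>

context symmetric_monoidal_category
begin

lemma tensor_join_arr [simp]:
  assumes "0 < q" "\<And>k. x k \<in> Obj C"
  shows "iso_arr C (tensor_join C p q x)"
    "Dom C (tensor_join C p q x) = tensor C p x \<diamondop> tensor C q (\<lambda>k. x (p + k))"
    "Cod C (tensor_join C p q x) = tensor C (p + q) x"
proof -
  have "iso_arr C (tensor_join C p q x) \<and>
    Dom C (tensor_join C p q x) = tensor C p x \<diamondop> tensor C q (\<lambda>k. x (p + k)) \<and>
    Cod C (tensor_join C p q x) = tensor C (p + q) x"
  proof (cases "p = 0")
    case False
    show ?thesis
      using assms(1)
    proof (induction q)
      case (Suc q)
      then show ?case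
        using False assms(2) by (cases "q = 0") (simp_all add: tensor_join_one tensor_join_Suc)
    qed simp
  qed (simp add: assms)
  then show "iso_arr C (tensor_join C p q x)"
    "Dom C (tensor_join C p q x) = tensor C p x \<diamondop> tensor C q (\<lambda>k. x (p + k))"
    "Cod C (tensor_join C p q x) = tensor C (p + q) x" by auto
qed

lemma lunit_natural:
  "\<lbrakk>f \<in> Arr C; Dom C f = A; Cod C f = A'\<rbrakk> \<Longrightarrow> Lunit C A' \<bullet> (Id C (Unit C) \<diamond> f) = f \<bullet> Lunit C A"
  using Lunit_natural[of f A A'] by simp

lemma tensor_join_natural:
  assumes "0 < q" "\<And>k. f k \<in> Arr C"
  shows "tensor_join C p q (\<lambda>k. Cod C (f k)) \<bullet> (tensor_arr C p f \<diamond> tensor_arr C q (\<lambda>k. f (p + k)))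
    = tensor_arr C (p + q) f \<bullet> tensor_join C p q (\<lambda>k. Dom C (f k))"
proof (cases "p = 0")
  case True
  then show ?thesis
    using assms lunit_natural[of "tensor_arr C q f"] by simp
next
  case False
  show ?thesis
    using assms(1)
  proof (induction q)
    case (Suc q)
    show ?case
    proof (cases "q = 0")
      case True
      then show ?thesis using False assms(2) by (simp add: tensor_join_one)
    next
      case q: False
      let ?x = "\<lambda>k. Dom C (f k)" and ?y = "\<lambda>k. Cod C (f k)"
      let ?P = "tensor_arr C p f" and ?Q = "tensor_arr C q (\<lambda>k. f (p + k))" and ?g = "f (p + Suc q)"
      have IH: "tensor_join C p q ?y \<bullet> (?P \<diamond> ?Q) = tensor_arr C (p + q) f \<bullet> tensor_join C p q ?x"
        using Suc q by simp
      have "tensor_join C p (Suc q) ?y \<bullet> (?P \<diamond> tensor_arr C (Suc q) (\<lambda>k. f (p + k)))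
        = (tensor_join C p q ?y \<diamond> Id C (Cod C ?g)) \<bullet>
          (inverse_arr C (Assoc C (Cod C ?P) (Cod C ?Q) (Cod C ?g)) \<bullet> (?P \<diamond> (?Q \<diamond> ?g)))"
        using False q assms(2) by (simp add: tensor_join_Suc)
      also have "inverse_arr C (Assoc C (Cod C ?P) (Cod C ?Q) (Cod C ?g)) \<bullet> (?P \<diamond> (?Q \<diamond> ?g))
        = ((?P \<diamond> ?Q) \<diamond> ?g) \<bullet> inverse_arr C (Assoc C (Dom C ?P) (Dom C ?Q) (Dom C ?g))"
        by (rule inverse_assoc_natural) (use assms(2) in simp_all)
      also have "(tensor_join C p q ?y \<diamond> Id C (Cod C ?g)) \<bullet> \<dots>
        = ((tensor_join C p q ?y \<bullet> (?P \<diamond> ?Q)) \<diamond> ?g) \<bullet> inverse_arr C (Assoc C (Dom C ?P) (Dom C ?Q) (Dom C ?g))"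
        using False q assms(2) by (simp add: tensor_comp_assoc)
      also have "\<dots> = tensor_arr C (p + Suc q) f \<bullet> tensor_join C p (Suc q) ?x"
        unfolding IH using False q assms(2) by (simp add: tensor_join_Suc tensor_comp_assoc)
      finally show ?thesis .
    qed
  qed simp
qed

text \<open>The factors of the right block are split off one at a time. A transposition inside the
  left block does not touch them, and naturality of the associator carries it across.\<close>

lemma tensor_join_swap_left:
  assumes "0 < q" "1 \<le> j" "j < p" "\<And>k. x k \<in> Obj C"
  shows "swap C (p + q) j x \<bullet> tensor_join C p q x
    = tensor_join C p q (x \<circ> transpose j (Suc j)) \<bullet> (swap C p j x \<diamond> Id C (tensor C q (\<lambda>k. x (p + k))))"
  using assms(1)
proof (induction q)
  case (Suc q)
  let ?x = "x \<circ> transpose j (Suc j)"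
  have p: "0 < p" using assms by simp
  have x: "\<And>k. ?x k \<in> Obj C" using assms(4) by simp
  note sw = swap_arr[OF assms(2,3), of x, OF assms(4)]
  have tail: "?x (p + Suc k) = x (p + Suc k)" for k using assms(2,3) by (simp add: transpose_def)
  have tq: "tensor C q (\<lambda>k. ?x (p + k)) = tensor C q (\<lambda>k. x (p + k))"
    using assms(2,3) by (intro tensor_cong) (auto simp: transpose_def)
  show ?case
  proof (cases "q = 0")
    case True
    then show ?thesis
      using p assms sw by (simp add: tensor_join_one swap_lower o_def)
  next
    case False
    have j: "j < p + q" using assms by simp
    note sw' = swap_arr[OF assms(2) j, of x, OF assms(4)]
    let ?g = "Id C (x (p + Suc q))" and ?Q = "Id C (tensor C q (\<lambda>k. x (p + k)))"
    have IH: "swap C (p + q) j x \<bullet> tensor_join C p q x = tensor_join C p q ?x \<bullet> (swap C p j x \<diamond> ?Q)"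
      using Suc False by (simp add: o_def)
    have x1: "?x (p + Suc q) = x (p + Suc q)" by (rule tail)
    have "swap C (p + Suc q) j x \<bullet> tensor_join C p (Suc q) x
      = ((swap C (p + q) j x \<bullet> tensor_join C p q x) \<diamond> ?g) \<bullet>
        inverse_arr C (Assoc C (tensor C p x) (tensor C q (\<lambda>k. x (p + k))) (x (p + Suc q)))"
      using p False assms sw' by (simp add: tensor_join_Suc swap_lower tensor_comp_assoc)
    also have "\<dots> = (tensor_join C p q ?x \<diamond> ?g) \<bullet> (((swap C p j x \<diamond> ?Q) \<diamond> ?g) \<bullet>
        inverse_arr C (Assoc C (tensor C p x) (tensor C q (\<lambda>k. x (p + k))) (x (p + Suc q))))"
      unfolding IH using p False assms sw x tq by (simp add: tensor_comp_assoc del: comp_apply)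
    also have "((swap C p j x \<diamond> ?Q) \<diamond> ?g) \<bullet>
        inverse_arr C (Assoc C (tensor C p x) (tensor C q (\<lambda>k. x (p + k))) (x (p + Suc q)))
      = inverse_arr C (Assoc C (tensor C p ?x) (tensor C q (\<lambda>k. x (p + k))) (x (p + Suc q))) \<bullet>
        (swap C p j x \<diamond> (?Q \<diamond> ?g))"
      by (rule inverse_assoc_natural[symmetric]) (use sw assms(4) in simp_all)
    also have "(tensor_join C p q ?x \<diamond> ?g) \<bullet> \<dots>
      = tensor_join C p (Suc q) ?x \<bullet> (swap C p j x \<diamond> Id C (tensor C (Suc q) (\<lambda>k. x (p + k))))"
      unfolding tensor_join_Suc[OF p False[unfolded neq0_conv]] x1 tq
      using p False assms(4) sw x tq by (simp del: comp_apply)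
    finally show ?thesis .
  qed
qed simp

text \<open>\<open>assoc_assoc_braid_last\<close> with the associators inverted, which is the form
  produced by two steps of the recursion of \<open>tensor_join\<close>.\<close>

lemma braid_last_inverse_assoc:
  assumes [simp]: "P \<in> Obj C" "S \<in> Obj C" "A \<in> Obj C" "B \<in> Obj C"
  shows "braid_last C (P \<diamondop> S) A B \<bullet>
      ((inverse_arr C (Assoc C P S A) \<diamond> Id C B) \<bullet> inverse_arr C (Assoc C P (S \<diamondop> A) B))
    = ((inverse_arr C (Assoc C P S B) \<diamond> Id C A) \<bullet> inverse_arr C (Assoc C P (S \<diamondop> B) A)) \<bullet>
      (Id C P \<diamond> braid_last C S A B)"
proof -
  have inv: "inverse_arr C (Assoc C P (S \<diamondop> A) B \<bullet> (Assoc C P S A \<diamond> Id C B))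
      = (inverse_arr C (Assoc C P S A) \<diamond> Id C B) \<bullet> inverse_arr C (Assoc C P (S \<diamondop> A) B)"
    if [simp]: "A \<in> Obj C" "B \<in> Obj C" for A B
    by (rule inverse_arr_eq) (simp add: is_inverse_def tensor_comp tensor_comp_assoc)
  show ?thesis
    unfolding inv[OF assms(3,4), symmetric] inv[OF assms(4,3), symmetric]
    by (rule inverse_natural[OF _ _ assoc_assoc_braid_last, symmetric]) simp_all
qed

text \<open>Transpositions that avoid the last factor reduce to the induction hypothesis. The case
  with content exchanges the last two factors of the right block: \<open>tensor_join\<close> unwinds
  by two steps, and \<open>braid_last_inverse_assoc\<close> applies with the remaining
  \<open>r\<close> factors of that block as \<open>S\<close>.\<close>

lemma tensor_join_swap_right:
  assumes "0 < q" "1 \<le> j" "j < q" "\<And>k. x k \<in> Obj C"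
  shows "swap C (p + q) (p + j) x \<bullet> tensor_join C p q x
    = tensor_join C p q (x \<circ> transpose (p + j) (Suc (p + j))) \<bullet>
      (Id C (tensor C p x) \<diamond> swap C q j (\<lambda>k. x (p + k)))"
proof (cases "p = 0")
  case True
  then show ?thesis
    using assms swap_arr[OF assms(2,3), of x, OF assms(4)] lunit_natural[of "swap C q j x"] by simp
next
  case False
  then have p: "0 < p" by simp
  let ?x = "x \<circ> transpose (p + j) (Suc (p + j))"
  have x: "\<And>k. ?x k \<in> Obj C" using assms(4) by simp
  have tp: "tensor C p ?x = tensor C p x"
    using assms(2) by (intro tensor_cong) (auto simp: transpose_def)
  have ob: "\<And>k. (\<lambda>k. x (p + k)) k \<in> Obj C" using assms(4) by simp
  have shift: "(\<lambda>k. ?x (p + k)) = (\<lambda>k. x (p + k)) \<circ> transpose j (Suc j)"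
    by (auto simp: fun_eq_iff transpose_def)
  show ?thesis
    using assms(1,3)
  proof (induction q)
    case (Suc q)
    show ?case
    proof (cases "j < q")
      case True
      then have q: "0 < q" and pj: "1 \<le> p + j" "p + j < p + q" using assms(2) by auto
      note sw = swap_arr[OF assms(2) True, of "\<lambda>k. x (p + k)", OF ob, folded shift]
      note sw' = swap_arr[OF pj, of x, OF assms(4)]
      let ?g = "Id C (x (p + Suc q))" and ?P = "Id C (tensor C p x)" and ?s = "swap C q j (\<lambda>k. x (p + k))"
      have IH: "swap C (p + q) (p + j) x \<bullet> tensor_join C p q x = tensor_join C p q ?x \<bullet> (?P \<diamond> ?s)"
        using Suc True by (simp add: o_def)
      have x1: "?x (p + Suc q) = x (p + Suc q)" using True by (simp add: transpose_def)
      have "swap C (p + Suc q) (p + j) x \<bullet> tensor_join C p (Suc q) x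
        = ((swap C (p + q) (p + j) x \<bullet> tensor_join C p q x) \<diamond> ?g) \<bullet>
          inverse_arr C (Assoc C (tensor C p x) (tensor C q (\<lambda>k. x (p + k))) (x (p + Suc q)))"
        using p q assms(4) sw' pj by (simp add: tensor_join_Suc swap_lower tensor_comp_assoc)
      also have "\<dots> = (tensor_join C p q ?x \<diamond> ?g) \<bullet> (((?P \<diamond> ?s) \<diamond> ?g) \<bullet>
          inverse_arr C (Assoc C (tensor C p x) (tensor C q (\<lambda>k. x (p + k))) (x (p + Suc q))))"
        unfolding IH using p q assms(4) sw x tp by (simp add: tensor_comp_assoc del: comp_apply)
      also have "((?P \<diamond> ?s) \<diamond> ?g) \<bullet>
          inverse_arr C (Assoc C (tensor C p x) (tensor C q (\<lambda>k. x (p + k))) (x (p + Suc q)))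
        = inverse_arr C (Assoc C (tensor C p x) (tensor C q (\<lambda>k. ?x (p + k))) (x (p + Suc q))) \<bullet>
          (?P \<diamond> (?s \<diamond> ?g))"
        by (rule inverse_assoc_natural[symmetric]) (use sw assms(4) in simp_all)
      also have "(tensor_join C p q ?x \<diamond> ?g) \<bullet> \<dots>
        = tensor_join C p (Suc q) ?x \<bullet> (?P \<diamond> swap C (Suc q) j (\<lambda>k. x (p + k)))"
        unfolding tensor_join_Suc[OF p q] x1 tp swap_lower[OF assms(2) True]
        using p q assms(4) sw x tp by (simp del: comp_apply)
      finally show ?thesis .
    next
      case False
      then have jq: "j = q" "0 < q" using Suc.prems assms(2) by auto
      let ?a = "x (p + q)" and ?b = "x (Suc (p + q))" and ?P = "tensor C p x"
      have xa: "?x (p + q) = ?b" "?x (Suc (p + q)) = ?a" using jq by simp_all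
      show ?thesis
      \<comment> \<open>For \<open>q = 1\<close> the right block consists of the two exchanged
        factors alone; there is no \<open>S\<close>, and the identity is the definition of
        \<open>braid_last\<close>.\<close>
      proof (cases "q = 1")
        case True
        obtain p' where p': "p = Suc p'" using p by (cases p) auto
        have "swap C (p + Suc q) (p + j) x = braid_last C ?P ?a ?b"
          using True jq p swap_last[OF p, of C x] by simp
        moreover have "swap C (Suc q) j (\<lambda>k. x (p + k)) = Braid C ?a ?b"
          using True jq swap_two[of C "\<lambda>k. x (p + k)"] by simp
        moreover have "tensor_join C p (Suc q) x = inverse_arr C (Assoc C ?P ?a ?b)"
          using True p assms(4) by (simp add: tensor_join_Suc tensor_join_one)
        moreover have "tensor_join C p (Suc q) ?x = inverse_arr C (Assoc C ?P ?b ?a)"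
          using True p assms(4) xa tp by (simp add: tensor_join_Suc tensor_join_one del: comp_apply)
        ultimately show ?thesis
          using assms(4) by (simp add: braid_last_def o_def)
      next
        case False
        then obtain r where r: "q = Suc r" "0 < r" using jq by (cases q) auto
        let ?S = "tensor C r (\<lambda>k. x (p + k))"
        have S: "tensor C r (\<lambda>k. ?x (p + k)) = ?S"
          using r jq by (intro tensor_cong) (auto simp: transpose_def)
        \<comment> \<open>The inner join covers only the first \<open>p + r\<close> factors, none of
          which is moved.\<close>
        have tjr: "tensor_join C p r ?x = tensor_join C p r x"
        proof -
          have "tensor_join C p r y = tensor_join C p r x" if "\<And>k. k \<le> p + r \<Longrightarrow> y k = x k" for y
            using r(2) that
          proof (induction r)
            case (Suc r)
            have "tensor C p y = tensor C p x" "tensor C r (\<lambda>k. y (p + k)) = tensor C r (\<lambda>k. x (p + k))"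
              using Suc.prems by (auto intro!: tensor_cong)
            then show ?case
              using p Suc by (cases "r = 0") (simp_all add: tensor_join_Suc tensor_join_one)
          qed simp
          from this[of ?x] show ?thesis using r jq by (simp add: transpose_def del: o_apply) (simp add: transpose_def)
        qed
        let ?J = "tensor_join C p r x"
        have sw: "swap C (p + Suc q) (p + j) x = braid_last C (tensor C (p + r) x) ?a ?b"
          using swap_last[of "p + r" C x] p r jq by simp
        have sw': "swap C (Suc q) j (\<lambda>k. x (p + k)) = braid_last C ?S ?a ?b"
          using swap_last[of r C "\<lambda>k. x (p + k)"] r jq by simp
        have J: "tensor_join C p (Suc q) x = ((?J \<diamond> Id C ?a) \<diamond> Id C ?b) \<bullet>
            ((inverse_arr C (Assoc C ?P ?S ?a) \<diamond> Id C ?b) \<bullet> inverse_arr C (Assoc C ?P (?S \<diamondop> ?a) ?b))"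
          using p r assms(4) by (simp add: tensor_join_Suc tensor_comp_assoc)
        have J': "tensor_join C p (Suc q) ?x = ((?J \<diamond> Id C ?b) \<diamond> Id C ?a) \<bullet>
            ((inverse_arr C (Assoc C ?P ?S ?b) \<diamond> Id C ?a) \<bullet> inverse_arr C (Assoc C ?P (?S \<diamondop> ?b) ?a))"
          using p r assms(4) xa tp S tjr by (simp add: tensor_join_Suc tensor_comp_assoc del: comp_apply)
        have nat: "braid_last C (tensor C (p + r) x) ?a ?b \<bullet> ((?J \<diamond> Id C ?a) \<diamond> Id C ?b)
            = ((?J \<diamond> Id C ?b) \<diamond> Id C ?a) \<bullet> braid_last C (?P \<diamondop> ?S) ?a ?b"
          by (rule braid_last_natural) (use assms(4) r in simp_all)
        have "swap C (p + Suc q) (p + j) x \<bullet> tensor_join C p (Suc q) x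
            = (braid_last C (tensor C (p + r) x) ?a ?b \<bullet> ((?J \<diamond> Id C ?a) \<diamond> Id C ?b)) \<bullet>
              ((inverse_arr C (Assoc C ?P ?S ?a) \<diamond> Id C ?b) \<bullet> inverse_arr C (Assoc C ?P (?S \<diamondop> ?a) ?b))"
          unfolding sw J using assms(4) r by simp
        also have "\<dots> = ((?J \<diamond> Id C ?b) \<diamond> Id C ?a) \<bullet> (braid_last C (?P \<diamondop> ?S) ?a ?b \<bullet>
              ((inverse_arr C (Assoc C ?P ?S ?a) \<diamond> Id C ?b) \<bullet> inverse_arr C (Assoc C ?P (?S \<diamondop> ?a) ?b)))"
          unfolding nat using assms(4) r by simp
        also have "\<dots> = ((?J \<diamond> Id C ?b) \<diamond> Id C ?a) \<bullet>
            (((inverse_arr C (Assoc C ?P ?S ?b) \<diamond> Id C ?a) \<bullet> inverse_arr C (Assoc C ?P (?S \<diamondop> ?b) ?a)) \<bullet>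
              (Id C ?P \<diamond> braid_last C ?S ?a ?b))"
          by (subst braid_last_inverse_assoc) (use assms(4) in simp_all)
        also have "\<dots> = tensor_join C p (Suc q) ?x \<bullet> (Id C ?P \<diamond> swap C (Suc q) j (\<lambda>k. x (p + k)))"
          unfolding J' sw' using assms(4) r by simp
        finally show ?thesis .
      qed
    qed
  qed simp
qed

lemma tensor_join_swaps_left:
  assumes "0 < q" "set u \<subseteq> {1..<p}" "\<And>k. x k \<in> Obj C"
  shows "swaps C (p + q) u x \<bullet> tensor_join C p q x
    = tensor_join C p q (x \<circ> word_perm (rev u)) \<bullet> (swaps C p u x \<diamond> Id C (tensor C q (\<lambda>k. x (p + k))))"
  using assms(2,3)
proof (induction u arbitrary: x)
  case (Cons j u)
  have j: "1 \<le> j" "j < p" "j < p + q" and u: "set u \<subseteq> {1..<p}" "set u \<subseteq> {1..<p + q}"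
    using Cons.prems(1) by auto
  let ?x = "x \<circ> transpose j (Suc j)" and ?Q = "Id C (tensor C q (\<lambda>k. x (p + k)))"
  have x: "\<And>k. ?x k \<in> Obj C" using Cons.prems by simp
  have y: "\<And>k. (x \<circ> word_perm (rev (j # u))) k \<in> Obj C" using Cons.prems by simp
  have eq: "?x \<circ> word_perm (rev u) = x \<circ> word_perm (rev (j # u))"
    by (simp add: word_perm_append Fun.comp_assoc)
  have tq: "tensor C q (\<lambda>k. ?x (p + k)) = tensor C q (\<lambda>k. x (p + k))"
    using j by (intro tensor_cong) (auto simp: transpose_def)
  have "tensor C q (\<lambda>k. (x \<circ> word_perm (rev (j # u))) (p + k)) = tensor C q (\<lambda>k. x (p + k))"
  proof (rule tensor_cong)
    fix k assume "k \<in> {1..q}"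
    then have "word_perm (rev (j # u)) (p + k) = p + k"
      using Cons.prems(1) by (intro permutes_not_in[OF word_perm_permutes[of _ p]]) auto
    then show "(x \<circ> word_perm (rev (j # u))) (p + k) = x (p + k)" by (simp only: comp_apply)
  qed
  note arr = swap_arr[OF j(1,2), of x, OF Cons.prems(2)] swap_arr[OF j(1,3), of x, OF Cons.prems(2)]
    swaps_arr[OF u(1), of ?x, OF x] swaps_arr[OF u(2), of ?x, OF x]
    tensor_join_arr[OF assms(1), of x, OF Cons.prems(2)] tensor_join_arr[OF assms(1), of ?x, OF x]
    tensor_join_arr[OF assms(1), of "x \<circ> word_perm (rev (j # u))", OF y] this
  have "swaps C (p + q) (j # u) x \<bullet> tensor_join C p q x
      = swaps C (p + q) u ?x \<bullet> (swap C (p + q) j x \<bullet> tensor_join C p q x)"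
    using arr by (simp del: comp_apply)
  also have "\<dots> = (swaps C (p + q) u ?x \<bullet> tensor_join C p q ?x) \<bullet> (swap C p j x \<diamond> ?Q)"
    unfolding tensor_join_swap_left[OF assms(1) j(1,2) Cons.prems(2)]
    using arr tq Cons.prems(2) by (simp del: comp_apply)
  also have "\<dots> = (tensor_join C p q (x \<circ> word_perm (rev (j # u))) \<bullet> (swaps C p u ?x \<diamond> ?Q)) \<bullet> (swap C p j x \<diamond> ?Q)"
    using Cons.IH[OF u(1), of ?x, OF x] unfolding eq tq by (simp only:)
  also have "\<dots> = tensor_join C p q (x \<circ> word_perm (rev (j # u))) \<bullet> (swaps C p (j # u) x \<diamond> ?Q)"
    using arr eq Cons.prems(2) by (simp add: tensor_comp del: comp_apply rev.simps)
  finally show ?case .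
qed (use assms in simp)

lemma tensor_join_swaps_right:
  assumes "0 < q" "set u \<subseteq> {1..<q}" "\<And>k. x k \<in> Obj C"
  shows "swaps C (p + q) (map ((+) p) u) x \<bullet> tensor_join C p q x
    = tensor_join C p q (x \<circ> word_perm (rev (map ((+) p) u))) \<bullet>
      (Id C (tensor C p x) \<diamond> swaps C q u (\<lambda>k. x (p + k)))"
  using assms(2,3)
proof (induction u arbitrary: x)
  case (Cons j u)
  have j: "1 \<le> j" "j < q" "1 \<le> p + j" "p + j < p + q" and u: "set u \<subseteq> {1..<q}" "set (map ((+) p) u) \<subseteq> {1..<p + q}"
    using Cons.prems(1) by auto
  let ?x = "x \<circ> transpose (p + j) (Suc (p + j))" and ?P = "Id C (tensor C p x)"
  let ?y = "x \<circ> word_perm (rev (map ((+) p) (j # u)))"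
  have x: "\<And>k. ?x k \<in> Obj C" using Cons.prems by simp
  have y: "\<And>k. ?y k \<in> Obj C" using Cons.prems by simp
  have z: "\<And>k. (\<lambda>k. x (p + k)) k \<in> Obj C" and z': "\<And>k. (\<lambda>k. ?x (p + k)) k \<in> Obj C" using Cons.prems by simp_all
  have shift: "(\<lambda>k. ?x (p + k)) = (\<lambda>k. x (p + k)) \<circ> transpose j (Suc j)"
    by (auto simp: fun_eq_iff transpose_def)
  have eq: "?x \<circ> word_perm (rev (map ((+) p) u)) = ?y"
    by (simp add: word_perm_append Fun.comp_assoc)
  have tp: "tensor C p ?x = tensor C p x"
    using j by (intro tensor_cong) (auto simp: transpose_def)
  have ty: "(\<lambda>k. ?y (p + k)) = (\<lambda>k. ?x (p + k)) \<circ> word_perm (rev u)"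
    unfolding eq[symmetric] by (simp add: fun_eq_iff rev_map word_perm_shift)
  have fixed: "word_perm v k = k" if "set v \<subseteq> {p+1..<p+q}" "k \<le> p" for v k
    using that by (induction v arbitrary: k) (auto simp: transpose_def)
  have "tensor C p ?y = tensor C p x"
  proof (rule tensor_cong)
    fix k assume "k \<in> {1..p}"
    then have "word_perm (rev (map ((+) p) (j # u))) k = k"
      using Cons.prems(1) by (intro fixed) auto
    then show "?y k = x k" by (simp only: comp_apply)
  qed
  note arr = swap_arr[OF j(1,2), of "\<lambda>k. x (p + k)", OF z, folded shift] swap_arr[OF j(3,4), of x, OF Cons.prems(2)]
    swaps_arr[OF u(1), of "\<lambda>k. ?x (p + k)", OF z'] swaps_arr[OF u(2), of ?x, OF x]
    tensor_join_arr[OF assms(1), of x, OF Cons.prems(2)] tensor_join_arr[OF assms(1), of ?x, OF x]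
    tensor_join_arr[OF assms(1), of ?y, OF y] this
  have "swaps C (p + q) (map ((+) p) (j # u)) x \<bullet> tensor_join C p q x
      = swaps C (p + q) (map ((+) p) u) ?x \<bullet> (swap C (p + q) (p + j) x \<bullet> tensor_join C p q x)"
    using arr by (simp del: comp_apply)
  also have "\<dots> = (swaps C (p + q) (map ((+) p) u) ?x \<bullet> tensor_join C p q ?x) \<bullet>
      (?P \<diamond> swap C q j (\<lambda>k. x (p + k)))"
    unfolding tensor_join_swap_right[OF assms(1) j(1,2) Cons.prems(2)]
    using arr tp Cons.prems(2) by (simp del: comp_apply)
  also have "\<dots> = (tensor_join C p q ?y \<bullet> (?P \<diamond> swaps C q u (\<lambda>k. ?x (p + k)))) \<bullet>
      (?P \<diamond> swap C q j (\<lambda>k. x (p + k)))"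
    using Cons.IH[OF u(1), of ?x, OF x] unfolding eq tp by (simp only:)
  also have "swaps C q (j # u) (\<lambda>k. x (p + k)) = swaps C q u (\<lambda>k. ?x (p + k)) \<bullet> swap C q j (\<lambda>k. x (p + k))"
    unfolding swaps.simps shift ..
  then have "(tensor_join C p q ?y \<bullet> (?P \<diamond> swaps C q u (\<lambda>k. ?x (p + k)))) \<bullet> (?P \<diamond> swap C q j (\<lambda>k. x (p + k)))
      = tensor_join C p q ?y \<bullet> (?P \<diamond> swaps C q (j # u) (\<lambda>k. x (p + k)))"
    using arr Cons.prems(2) eq ty by (simp add: tensor_comp del: comp_apply swaps.simps list.map rev.simps)
  finally show ?case .
qed (use assms in simp)

text \<open>A word for \<sigma> can be taken as a shifted word on the right block followed by a word
  on the left one. Each half passes through \<open>tensor_join\<close> letter by letter, and the two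
  results act on different tensor factors.\<close>

lemma permute_tensor_join:
  assumes s: "\<sigma> \<in> block_subgroup p q" and q: "0 < q" and x: "\<And>k. x k \<in> Obj C"
  shows "permute C (p + q) \<sigma> x \<bullet> tensor_join C p q x
    = tensor_join C p q (x \<circ> inv' \<sigma>) \<bullet>
      (permute C p (left_block p \<sigma>) x \<diamond> permute C q (right_block p q \<sigma>) (\<lambda>k. x (p + k)))"
proof -
  note sD = block_subgroupD[OF s]
  obtain u where u: "set u \<subseteq> {1..<p}" "word_perm u = left_block p \<sigma>"
    using word_exists[OF sD(2)] by blast
  obtain v where v: "set v \<subseteq> {1..<q}" "word_perm v = right_block p q \<sigma>"
    using word_exists[OF sD(3)] by blast
  let ?v = "map ((+) p) v"
  have \<sigma>: "word_perm (?v @ u) = \<sigma>"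
    by (rule block_subgroup_eqI[OF block_subgroup_word(1)[OF u(1) v(1)] s])
      (simp_all only: block_subgroup_word(2,3)[OF u(1) v(1)] u(2) v(2))
  have uv: "set u \<subseteq> {1..<p + q}" "set ?v \<subseteq> {1..<p + q}" "set (?v @ u) \<subseteq> {1..<p + q}"
    using u v by auto
  let ?y = "x \<circ> word_perm (rev ?v)" and ?z = "\<lambda>k. x (p + k)"
  have y: "\<And>k. ?y k \<in> Obj C" and z: "\<And>k. ?z k \<in> Obj C" using x by simp_all
  have inv: "x \<circ> inv' \<sigma> = ?y \<circ> word_perm (rev u)"
    unfolding \<sigma>[symmetric] inv_word_perm by (simp add: word_perm_append Fun.comp_assoc)
  have x': "\<And>k. (?y \<circ> word_perm (rev u)) k \<in> Obj C" using x by simp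
  have low: "?y k = x k" if "k \<in> {1..p}" for k
  proof -
    have "word_perm (map ((+) p) (rev v)) k = k"
      using v(1) that by (intro word_perm_shift_lower) auto
    then show ?thesis by (simp add: rev_map)
  qed
  have eqs: "swaps C p u ?y = swaps C p u x" "tensor C p ?y = tensor C p x"
    "tensor C q (\<lambda>k. ?y (p + k)) = tensor C q (?z \<circ> word_perm (rev v))"
    using u low by (auto intro!: swaps_cong tensor_cong simp: rev_map word_perm_shift)
  have high: "tensor C q (\<lambda>k. (?y \<circ> word_perm (rev u)) (p + k)) = tensor C q (?z \<circ> word_perm (rev v))"
  proof (rule tensor_cong)
    fix k assume k: "k \<in> {1..q}"
    then have "word_perm (rev u) (p + k) = p + k"
      using u by (intro permutes_not_in[OF word_perm_permutes[of _ p]]) auto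
    then show "(?y \<circ> word_perm (rev u)) (p + k) = (?z \<circ> word_perm (rev v)) k"
      by (simp add: rev_map word_perm_shift)
  qed
  note arr = swaps_arr[OF u(1), of x, OF x] swaps_arr[OF v(1), of ?z, OF z]
    swaps_arr[OF uv(1), of ?y, OF y] swaps_arr[OF uv(2), of x, OF x]
    tensor_join_arr[OF q, of x, OF x] tensor_join_arr[OF q, of ?y, OF y]
    tensor_join_arr[OF q, of "?y \<circ> word_perm (rev u)", OF x'] swaps_arr[OF u(1), of ?y, OF y]
  have "permute C (p + q) \<sigma> x \<bullet> tensor_join C p q x
      = swaps C (p + q) u ?y \<bullet> (swaps C (p + q) ?v x \<bullet> tensor_join C p q x)"
    using permute_word[OF uv(3) \<sigma>, of x, OF x] swaps_append[OF uv(2,1), of x, OF x] arr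
    by (simp del: comp_apply)
  also have "\<dots> = (swaps C (p + q) u ?y \<bullet> tensor_join C p q ?y) \<bullet> (Id C (tensor C p x) \<diamond> swaps C q v ?z)"
    unfolding tensor_join_swaps_right[OF q v(1) x] using arr eqs x by (simp del: comp_apply)
  also have "\<dots> = (tensor_join C p q (?y \<circ> word_perm (rev u)) \<bullet>
      (swaps C p u x \<diamond> Id C (tensor C q (\<lambda>k. ?y (p + k))))) \<bullet> (Id C (tensor C p x) \<diamond> swaps C q v ?z)"
    using tensor_join_swaps_left[OF q u(1), of ?y, OF y] eqs(1) by simp
  also have "\<dots> = tensor_join C p q (?y \<circ> word_perm (rev u)) \<bullet> (swaps C p u x \<diamond> swaps C q v ?z)"
    using arr eqs high x by (simp add: tensor_comp o_def)
  finally show ?thesis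
    unfolding inv permute_word[OF u x] permute_word[OF v z] .
qed

end

section \<open>Cubes\<close>

definition tuples :: "nat \<Rightarrow> nat \<Rightarrow> (nat \<Rightarrow> bool) set" where
  "tuples n i = {e. {k. e k} \<subseteq> {1..n} \<and> card {k. e k} \<le> i}"

text \<open>The index category with its set of vertices left free: it serves both for
  \<open>Gamma n i\<close> and for the vertices strictly below a given one.\<close>

definition tuple_cat :: "(nat \<Rightarrow> bool) set \<Rightarrow> (nat \<Rightarrow> bool, (nat \<Rightarrow> bool) \<times> (nat \<Rightarrow> bool)) cat" where
  "tuple_cat S = \<lparr>Obj = S, Arr = {(d, e). d \<in> S \<and> e \<in> S \<and> d \<le> e}, Dom = fst, Cod = snd,
      Id = (\<lambda>e. (e, e)), Comp = (\<lambda>t s. (fst s, snd t))\<rparr>"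

abbreviation cube_obj :: "('o, 'm, 'z) mon_cat_scheme \<Rightarrow> nat \<Rightarrow> 'm \<Rightarrow> (nat \<Rightarrow> bool) \<Rightarrow> 'o" where
  "cube_obj C n f e \<equiv> tensor C n (\<lambda>k. K_obj C f (e k))"

abbreviation cube_arr :: "('o, 'm, 'z) mon_cat_scheme \<Rightarrow> nat \<Rightarrow> 'm \<Rightarrow> (nat \<Rightarrow> bool) \<Rightarrow> (nat \<Rightarrow> bool) \<Rightarrow> 'm" where
  "cube_arr C n f d e \<equiv> tensor_arr C n (\<lambda>k. K_arr C f (d k) (e k))"

lemma Gamma_tuple_cat: "Gamma n i = tuple_cat (tuples n i)"
  by (simp add: Gamma_def tuple_cat_def tuples_def Let_def)

lemma tuple_cat_sel [simp]: "Obj (tuple_cat S) = S" "Arr (tuple_cat S) = {(d, e). d \<in> S \<and> e \<in> S \<and> d \<le> e}"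
  "Dom (tuple_cat S) = fst" "Cod (tuple_cat S) = snd"
  by (simp_all add: tuple_cat_def)

lemma category_tuple_cat: "category (tuple_cat S)"
  by unfold_locales (auto simp: tuple_cat_def le_fun_def)

lemma finite_support: "finite {e. {k. e k} \<subseteq> {1..n :: nat}}"
proof (rule finite_subset)
  show "{e. {k. e k} \<subseteq> {1..n}} \<subseteq> (\<lambda>A k. k \<in> A) ` Pow {1..n}"
  proof
    fix e assume "e \<in> {e. {k. e k} \<subseteq> {1..n}}"
    then show "e \<in> (\<lambda>A k. k \<in> A) ` Pow {1..n}"
      by (intro image_eqI[of _ _ "{k. e k}"]) auto
  qed
qed simp

lemma finite_tuples: "finite (tuples n i)"
  by (rule finite_subset[OF _ finite_support]) (auto simp: tuples_def)

lemma less_tuple_support: "\<lbrakk>d < e; {k. e k} \<subseteq> {1..n :: nat}\<rbrakk> \<Longrightarrow> {k. d k} \<subseteq> {1..n} \<and> card {k. d k} < card {k. e k}"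
proof -
  assume *: "d < e" "{k. e k} \<subseteq> {1..n}"
  have "{k. d k} \<subset> {k. e k}"
    using *(1) by (auto simp: less_fun_def le_fun_def)
  moreover have "finite {k. e k}" using *(2) finite_subset by blast
  ultimately show ?thesis
    using *(2) by (auto intro: psubset_card_mono)
qed

lemma finite_below: "{k. e k} \<subseteq> {1..n :: nat} \<Longrightarrow> finite {d. d < e}"
  by (rule finite_subset[OF _ finite_support[of n]]) (use less_tuple_support in blast)

section \<open>The cube as a diagram\<close>

context symmetric_monoidal_category
begin

lemma K_obj_in [simp]: "f \<in> Arr C \<Longrightarrow> K_obj C f b \<in> Obj C"
  by (simp add: K_obj_def)

lemma K_arr_arr:
  assumes "f \<in> Arr C" "b \<le> b'"
  shows "K_arr C f b b' \<in> Arr C" "Dom C (K_arr C f b b') = K_obj C f b" "Cod C (K_arr C f b b') = K_obj C f b'"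
  using assms by (auto simp: K_arr_def K_obj_def)

lemma K_arr_arr' [simp]: "f \<in> Arr C \<Longrightarrow> K_arr C f b b' \<in> Arr C"
  by (simp add: K_arr_def)

lemma cube_arr_arr [simp]:
  assumes "f \<in> Arr C"
  shows "cube_arr C n f d e \<in> Arr C"
    "d \<le> e \<Longrightarrow> Dom C (cube_arr C n f d e) = cube_obj C n f d"
    "d \<le> e \<Longrightarrow> Cod C (cube_arr C n f d e) = cube_obj C n f e"
  using assms K_arr_arr[OF assms, of "d k" "e k" for k] by (simp_all add: le_fun_def)

declare tensor_arr_family(2,3) [simp del]

lemma cube_arr_comp:
  assumes "f \<in> Arr C" "d \<le> e" "e \<le> e'"
  shows "cube_arr C n f e e' \<bullet> cube_arr C n f d e = cube_arr C n f d e'"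
proof -
  have le: "d k \<le> e k" "e k \<le> e' k" for k using assms by (auto simp: le_fun_def)
  have "K_arr C f (e k) (e' k) \<bullet> K_arr C f (d k) (e k) = K_arr C f (d k) (e' k)" for k
    using le[of k] assms(1) by (auto simp: K_arr_def K_obj_def)
  then show ?thesis
    using tensor_arr_comp[of "\<lambda>k. K_arr C f (d k) (e k)" "\<lambda>k. K_arr C f (e k) (e' k)" n]
      K_arr_arr[OF assms(1) le(1)] K_arr_arr[OF assms(1) le(2)] by simp
qed

lemma cube_arr_id: "f \<in> Arr C \<Longrightarrow> cube_arr C n f e e = Id C (cube_obj C n f e)"
  by (simp add: K_arr_def tensor_arr_id)

lemma K_pow_diagram: "f \<in> Arr C \<Longrightarrow> diagram (tuple_cat S) C (K_pow C n f)"
  unfolding diagram_def K_pow_def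
  using cube_arr_id[of f n] cube_arr_comp[of f _ _ _ n] by (auto simp: tuple_cat_def)

lemma cube_cocone_iff:
  assumes "f \<in> Arr C"
  shows "is_cocone (tuple_cat S) C (K_pow C n f) U k \<longleftrightarrow> U \<in> Obj C \<and>
    (\<forall>e \<in> S. k e \<in> Arr C \<and> Dom C (k e) = cube_obj C n f e \<and> Cod C (k e) = U) \<and>
    (\<forall>d \<in> S. \<forall>e \<in> S. d \<le> e \<longrightarrow> k e \<bullet> cube_arr C n f d e = k d)"
  by (auto simp: is_cocone_def K_pow_def)

text \<open>Two different vertices with exactly \<open>i\<close> ones are incomparable, as a strict
  inequality lowers the number of ones. The only new compatibilities are therefore those between a
  top vertex and the vertices strictly below it.\<close>

lemma cube_cocone_extend:
  assumes f: "f \<in> Arr C" and U: "U \<in> Obj C"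
    and k: "\<And>d. d \<in> tuples n (i - 1) \<Longrightarrow> k d \<in> Arr C \<and> Dom C (k d) = cube_obj C n f d \<and> Cod C (k d) = U"
      "\<And>d e. \<lbrakk>d \<in> tuples n (i - 1); e \<in> tuples n (i - 1); d \<le> e\<rbrakk> \<Longrightarrow> k e \<bullet> cube_arr C n f d e = k d"
    and h: "\<And>e. \<lbrakk>e \<in> tuples n i; card {k. e k} = i\<rbrakk> \<Longrightarrow>
        h e \<in> Arr C \<and> Dom C (h e) = cube_obj C n f e \<and> Cod C (h e) = U"
      "\<And>d e. \<lbrakk>e \<in> tuples n i; card {k. e k} = i; d < e\<rbrakk> \<Longrightarrow> h e \<bullet> cube_arr C n f d e = k d"
    and i: "1 \<le> i"
  shows "is_cocone (tuple_cat (tuples n i)) C (K_pow C n f) U (\<lambda>e. if card {k. e k} = i then h e else k e)"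
proof -
  have low: "e \<in> tuples n (i - 1)" if "e \<in> tuples n i" "card {k. e k} \<noteq> i" for e
    using that i by (auto simp: tuples_def)
  show ?thesis
    unfolding cube_cocone_iff[OF f]
  proof (intro conjI ballI impI)
    fix d e assume de: "d \<in> tuples n i" "e \<in> tuples n i" "d \<le> e"
    let ?l = "\<lambda>e. if card {k. e k} = i then h e else k e"
    show "?l e \<bullet> cube_arr C n f d e = ?l d"
    proof (cases "d = e")
      case True
      then show ?thesis
        using h(1)[of e] k(1)[of e] low[of e] de f by (simp add: cube_arr_id)
    next
      case False
      then have less: "d < e" using de by simp
      have "card {k. d k} < card {k. e k}"
        using less_tuple_support[OF less, of n] de by (simp add: tuples_def)
      then have "card {k. d k} \<noteq> i" using de by (auto simp: tuples_def)
      then show ?thesis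
        using h(2)[of e d] k(2)[of d e] low de less by auto
    qed
  qed (use U k(1) h(1) low in auto)
qed

end

subsection \<open>Corners of cubes\<close>

text \<open>The lifting property against \<open>q\<close> of the morphism into the vertex
  \<open>e\<close> from the colimit over all vertices strictly below it, written with compatible
  families in place of that colimit.\<close>

definition corner_lifts :: "('o, 'm, 'z) mon_cat_scheme \<Rightarrow> nat \<Rightarrow> 'm \<Rightarrow> (nat \<Rightarrow> bool) \<Rightarrow> 'm \<Rightarrow> bool" where
  "corner_lifts C n f e q \<longleftrightarrow>
     (\<forall>k v. (\<forall>d<e. k d \<in> Hom C (cube_obj C n f d) (Dom C q)) \<and>
        (\<forall>d d'. d \<le> d' \<longrightarrow> d' < e \<longrightarrow> k d' \<bullet>\<^bsub>C\<^esub> cube_arr C n f d d' = k d) \<and>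
        v \<in> Hom C (cube_obj C n f e) (Cod C q) \<and>
        (\<forall>d<e. q \<bullet>\<^bsub>C\<^esub> k d = v \<bullet>\<^bsub>C\<^esub> cube_arr C n f d e) \<longrightarrow>
      (\<exists>h. h \<in> Hom C (cube_obj C n f e) (Dom C q) \<and> q \<bullet>\<^bsub>C\<^esub> h = v \<and>
         (\<forall>d<e. h \<bullet>\<^bsub>C\<^esub> cube_arr C n f d e = k d)))"

context closed_symmetric_monoidal_model_category
begin

lemma cube_colimit:
  assumes "f \<in> Arr C" "finite S"
  shows "is_colimit (tuple_cat S) C (K_pow C n f) (colim_obj (tuple_cat S) C (K_pow C n f))
    (colim_leg (tuple_cat S) C (K_pow C n f))"
proof -
  have "finite (Arr (tuple_cat S))"
    by (rule finite_subset[of _ "S \<times> S"]) (use assms(2) in auto)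
  then have "\<exists>V l. is_colimit (tuple_cat S) C (K_pow C n f) V l"
    using assms by (intro finite_colimit_exists[OF finite_colimits category_tuple_cat]) (auto simp: K_pow_diagram)
  then obtain V l where "is_colimit (tuple_cat S) C (K_pow C n f) V l" by blast
  then show ?thesis by (rule colimit_is_colimit)
qed

text \<open>The functor \<open>Fo\<close> is carried along because colimits of cubes are also needed
  after tensoring with a fixed object; with \<open>left_adjoint_id\<close> the statement concerns
  the colimit itself.\<close>

lemma cube_colimit_ext:
  assumes l: "is_colimit (tuple_cat S) C (K_pow C n f) V l" and f: "f \<in> Arr C" and F: "left_adjoint C Fo Fa"
    and uv: "u \<in> Arr C" "v \<in> Arr C" "Dom C u = Fo V" "Dom C v = Fo V" "Cod C u = Cod C v"
    and eq: "\<And>e. e \<in> S \<Longrightarrow> u \<bullet> Fa (l e) = v \<bullet> Fa (l e)"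
  shows "u = v"
proof (rule colimit_ext[OF left_adjoint_colimit[OF F category_tuple_cat K_pow_diagram[OF f] l] _ _ uv])
  fix s assume "s \<in> Arr (tuple_cat S)"
  then show "on_arr (map_diag Fo Fa (K_pow C n f)) s
    \<in> Hom C (on_obj (map_diag Fo Fa (K_pow C n f)) (Dom (tuple_cat S) s))
      (on_obj (map_diag Fo Fa (K_pow C n f)) (Cod (tuple_cat S) s))"
    using left_adjointD[OF F] f by (auto simp: map_diag_def K_pow_def)
qed (use eq in auto)

lemma cube_colimit_desc:
  assumes l: "is_colimit (tuple_cat S) C (K_pow C n f) V l" and f: "f \<in> Arr C" and F: "left_adjoint C Fo Fa"
    and U: "U \<in> Obj C"
    and k: "\<And>e. e \<in> S \<Longrightarrow> k e \<in> Arr C \<and> Dom C (k e) = Fo (cube_obj C n f e) \<and> Cod C (k e) = U"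
      "\<And>d e. \<lbrakk>d \<in> S; e \<in> S; d \<le> e\<rbrakk> \<Longrightarrow> k e \<bullet> Fa (cube_arr C n f d e) = k d"
  obtains u where "u \<in> Arr C" "Dom C u = Fo V" "Cod C u = U" "\<And>e. e \<in> S \<Longrightarrow> u \<bullet> Fa (l e) = k e"
proof -
  have "is_cocone (tuple_cat S) C (map_diag Fo Fa (K_pow C n f)) U k"
    using U k by (auto simp: is_cocone_def map_diag_def K_pow_def)
  then obtain u where u: "u \<in> Hom C (Fo V) U" "\<And>e. e \<in> S \<Longrightarrow> u \<bullet> Fa (l e) = k e"
    using colimit_desc_ex[OF left_adjoint_colimit[OF F category_tuple_cat K_pow_diagram[OF f] l]] by auto
  then show ?thesis using that[of u] by simp
qed

lemma left_adjoint_id: "left_adjoint C (\<lambda>A. A) (\<lambda>f. f)"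
  unfolding left_adjoint_def
proof (intro conjI ballI impI)
  fix D assume D: "D \<in> Obj C"
  show "\<exists>H e. H \<in> Obj C \<and> e \<in> Hom C H D \<and> (\<forall>A\<in>Obj C. \<forall>g\<in>Hom C A D. \<exists>!h. h \<in> Hom C A H \<and> e \<bullet> h = g)"
    using D by (intro exI[of _ D] exI[of _ "Id C D"]) auto
qed auto

text \<open>Turns the lifting property of a corner, known against all trivial fibrations, back into
  an actual cofibration \<open>u\<close>, which is what the push-out product axiom takes as
  input.\<close>

lemma corner_cofib:
  assumes f: "f \<in> Arr C" and e: "{k. e k} \<subseteq> {1..n}"
    and lift: "\<And>q. q \<in> Fib C \<inter> Weq C \<Longrightarrow> corner_lifts C n f e q"
  obtains V l u where "is_colimit (tuple_cat {d. d < e}) C (K_pow C n f) V l"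
    "u \<in> Cofib C" "Dom C u = V" "Cod C u = cube_obj C n f e"
    "\<And>d. d < e \<Longrightarrow> u \<bullet> l d = cube_arr C n f d e"
proof -
  note l = cube_colimit[OF f finite_below[OF e], of n]
  let ?V = "colim_obj (tuple_cat {d. d < e}) C (K_pow C n f)"
    and ?l = "colim_leg (tuple_cat {d. d < e}) C (K_pow C n f)"
  note ll = colimit_leg[OF l, simplified]
  obtain u where u: "u \<in> Arr C" "Dom C u = ?V" "Cod C u = cube_obj C n f e"
    "\<And>d. d \<in> {d. d < e} \<Longrightarrow> u \<bullet> ?l d = cube_arr C n f d e"
    by (rule cube_colimit_desc[OF l f left_adjoint_id, of "cube_obj C n f e" "\<lambda>d. cube_arr C n f d e"])
      (use f cube_arr_comp[OF f] in auto)
  have "u \<in> Cofib C"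
    unfolding cofib_iff_lifts
  proof (intro conjI ballI u(1))
    fix q assume q: "q \<in> Fib C \<inter> Weq C"
    then have qa: "q \<in> Arr C" by (auto simp: fib_arr)
    show "lifts C u q"
      unfolding lifts_def
    proof (intro allI impI)
      fix a v assume av: "a \<in> Hom C (Dom C u) (Dom C q) \<and> v \<in> Hom C (Cod C u) (Cod C q) \<and> q \<bullet> a = v \<bullet> u"
      let ?k = "\<lambda>d. a \<bullet> ?l d"
      have "\<exists>h. h \<in> Hom C (cube_obj C n f e) (Dom C q) \<and> q \<bullet> h = v \<and> (\<forall>d<e. h \<bullet> cube_arr C n f d e = ?k d)"
      proof (rule lift[OF q, unfolded corner_lifts_def, rule_format], intro conjI allI impI)
        fix d d' assume "d \<le> d'" "d' < e"
        then have "d < e" by simp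
        then show "(a \<bullet> ?l d') \<bullet> cube_arr C n f d d' = a \<bullet> ?l d"
          using \<open>d \<le> d'\<close> \<open>d' < e\<close> ll(2-4) ll(5)[of "(d, d')"] av u f by (simp add: K_pow_def)
      next
        fix d assume d: "d < e"
        have "q \<bullet> (a \<bullet> ?l d) = (v \<bullet> u) \<bullet> ?l d"
          using comp_reassoc[of q a "v \<bullet> u" "?l d"] av qa d ll(2-4) u by simp
        then show "q \<bullet> (a \<bullet> ?l d) = v \<bullet> cube_arr C n f d e"
          using u(4)[of d] d av ll(2-4) u(1-3) by simp
      qed (use ll av u in \<open>auto simp: K_pow_def\<close>)
      then obtain h where h: "h \<in> Hom C (cube_obj C n f e) (Dom C q)" "q \<bullet> h = v"
        "\<And>d. d < e \<Longrightarrow> h \<bullet> cube_arr C n f d e = ?k d" by blast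
      have "h \<bullet> u = a"
      proof (rule cube_colimit_ext[OF l f left_adjoint_id])
        fix d assume "d \<in> {d. d < e}"
        then show "(h \<bullet> u) \<bullet> ?l d = a \<bullet> ?l d"
          using h(1) h(3)[of d] u(1-3) u(4)[of d] ll(2-4) by simp
      qed (use h(1) u av in auto)
      then show "\<exists>h. h \<in> Hom C (Cod C u) (Dom C q) \<and> h \<bullet> u = a \<and> q \<bullet> h = v"
        using h u by auto
    qed
  qed
  then show ?thesis using that[OF l] u by simp
qed

lemma cube_Suc:
  assumes "0 < n"
  shows "cube_obj C (Suc n) f e = cube_obj C n f e \<diamondop> K_obj C f (e (Suc n))"
    "cube_arr C (Suc n) f d e = cube_arr C n f d e \<diamond> K_arr C f (d (Suc n)) (e (Suc n))"
    "cube_obj C n f (e(Suc n := b)) = cube_obj C n f e"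
    "cube_arr C n f (d(Suc n := b)) e = cube_arr C n f d e"
    "cube_arr C n f d (e(Suc n := b)) = cube_arr C n f d e"
  using assms by (auto intro!: tensor_cong tensor_arr_cong)

text \<open>At every vertex up to \<open>e\<close> the last factor is \<open>X\<close>, so the
  corner in dimension \<open>n + 1\<close> is the corner in dimension \<open>n\<close> tensored with
  a cofibrant object.\<close>

lemma corner_lifts_Suc_False:
  assumes f: "f \<in> Cofib C" and X: "cofibrant C (Dom C f)" and n: "0 < n"
    and e: "{k. e k} \<subseteq> {1..n}" and q: "q \<in> Fib C \<inter> Weq C"
    and IH: "\<And>q. q \<in> Fib C \<inter> Weq C \<Longrightarrow> corner_lifts C n f e q"
  shows "corner_lifts C (Suc n) f e q"
proof -
  have fa: "f \<in> Arr C" using f by (rule cofib_arr)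
  have qa: "q \<in> Arr C" using q by (auto simp: fib_arr)
  let ?X = "Dom C f"
  have X': "?X \<in> Obj C" using fa by simp
  obtain V l u where l: "is_colimit (tuple_cat {d. d < e}) C (K_pow C n f) V l"
    and u: "u \<in> Cofib C" "Dom C u = V" "Cod C u = cube_obj C n f e"
    and ul: "\<And>d. d < e \<Longrightarrow> u \<bullet> l d = cube_arr C n f d e"
    using corner_cofib[OF fa e IH] by blast
  have ua: "u \<in> Arr C" using u(1) by (rule cofib_arr)
  note ll = colimit_leg[OF l, simplified]
  note F = left_adjoint_tensor_right[OF X']
  have e0: "d (Suc n) = False" if "d \<le> e" for d
    using that e by (fastforce simp: le_fun_def)
  have K: "K_obj C f False = ?X" by (simp add: K_obj_def)
  have obj: "cube_obj C (Suc n) f d = cube_obj C n f d \<diamondop> ?X" if "d \<le> e" for d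
    using e0[OF that] cube_Suc(1)[OF n] K by simp
  have arr: "cube_arr C (Suc n) f d d' = cube_arr C n f d d' \<diamond> Id C ?X" if "d \<le> d'" "d' \<le> e" for d d'
    using e0[of d'] e0[of d] that cube_Suc(2)[OF n] K by (simp add: K_arr_def)
  show ?thesis
    unfolding corner_lifts_def
  proof (intro allI impI, elim conjE)
    fix k v
    assume k: "\<forall>d<e. k d \<in> Hom C (cube_obj C (Suc n) f d) (Dom C q)"
      "\<forall>d d'. d \<le> d' \<longrightarrow> d' < e \<longrightarrow> k d' \<bullet> cube_arr C (Suc n) f d d' = k d"
      and v: "v \<in> Hom C (cube_obj C (Suc n) f e) (Cod C q)"
      and qk: "\<forall>d<e. q \<bullet> k d = v \<bullet> cube_arr C (Suc n) f d e"
    obtain a where a: "a \<in> Arr C" "Dom C a = V \<diamondop> ?X" "Cod C a = Dom C q"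
      "\<And>d. d \<in> {d. d < e} \<Longrightarrow> a \<bullet> (l d \<diamond> Id C ?X) = k d"
    proof (rule cube_colimit_desc[OF l fa F, of "Dom C q" k])
      fix d d' assume *: "d \<in> {d. d < e}" "d' \<in> {d. d < e}" "d \<le> d'"
      then have "k d' \<bullet> cube_arr C (Suc n) f d d' = k d" using k(2) by blast
      then show "k d' \<bullet> (cube_arr C n f d d' \<diamond> Id C ?X) = k d" using arr[of d d'] * by simp
    qed (use k(1) obj qa in auto)
    have "q \<bullet> a = v \<bullet> (u \<diamond> Id C ?X)"
    proof (rule cube_colimit_ext[OF l fa F])
      fix d assume d: "d \<in> {d. d < e}"
      have "(q \<bullet> a) \<bullet> (l d \<diamond> Id C ?X) = q \<bullet> k d"
        using a(1-3) a(4)[OF d] ll d X' qa by (simp add: K_pow_def)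
      also have "\<dots> = v \<bullet> (cube_arr C n f d e \<diamond> Id C ?X)"
        using qk d arr[of d e] by simp
      also have "\<dots> = (v \<bullet> (u \<diamond> Id C ?X)) \<bullet> (l d \<diamond> Id C ?X)"
        using v ul[of d] ll d ua u X' obj[of e] by (simp add: tensor_comp)
      finally show "(q \<bullet> a) \<bullet> (l d \<diamond> Id C ?X) = (v \<bullet> (u \<diamond> Id C ?X)) \<bullet> (l d \<diamond> Id C ?X)" .
    qed (use qa a v ua u X' obj[of e] in auto)
    moreover have "lifts C (u \<diamond> Id C ?X) q"
      using cofib_tensor_cofibrant[OF u(1) X] lifting q by blast
    ultimately obtain h where h: "h \<in> Arr C" "Dom C h = Cod C (u \<diamond> Id C ?X)" "Cod C h = Dom C q"
      "h \<bullet> (u \<diamond> Id C ?X) = a" "q \<bullet> h = v"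
      using liftsE[of "u \<diamond> Id C ?X" q a v] a v ua u X' obj[of e] by auto
    have "h \<bullet> cube_arr C (Suc n) f d e = k d" if d: "d < e" for d
    proof -
      have "h \<bullet> cube_arr C (Suc n) f d e = h \<bullet> ((u \<bullet> l d) \<diamond> Id C ?X)"
        using arr[of d e] ul d by simp
      also have "\<dots> = (h \<bullet> (u \<diamond> Id C ?X)) \<bullet> (l d \<diamond> Id C ?X)"
        using h(1-3) ua u ll d X' by (simp add: tensor_comp)
      also have "\<dots> = k d" using h(4) a(4) d by simp
      finally show ?thesis .
    qed
    then show "\<exists>h. h \<in> Hom C (cube_obj C (Suc n) f e) (Dom C q) \<and> q \<bullet> h = v \<and>
        (\<forall>d<e. h \<bullet> cube_arr C (Suc n) f d e = k d)"
      using h ua u X' obj[of e] by (intro exI[of _ h]) simp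
  qed
qed

text \<open>With \<open>e'\<close> obtained from \<open>e\<close> by erasing the last one, the cube
  below \<open>e\<close> is the cube below \<open>e'\<close> times the edge \<open>f\<close>. Its
  boundary consists of the whole lower cube at last coordinate 0 and the boundary of the lower cube
  at last coordinate 1, so the corner inclusion is the push-out product of \<open>u\<close> and
  \<open>f\<close>.\<close>

lemma corner_lifts_Suc_True:
  assumes f: "f \<in> Cofib C" and n: "0 < n" and e: "{k. e k} \<subseteq> {1..Suc n}" "e (Suc n)"
    and q: "q \<in> Fib C \<inter> Weq C"
    and IH: "\<And>q. q \<in> Fib C \<inter> Weq C \<Longrightarrow> corner_lifts C n f (e(Suc n := False)) q"
  shows "corner_lifts C (Suc n) f e q"
proof -
  have fa: "f \<in> Arr C" using f by (rule cofib_arr)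
  have qa: "q \<in> Arr C" using q by (auto simp: fib_arr)
  let ?X = "Dom C f" and ?Y = "Cod C f"
  have XY: "?X \<in> Obj C" "?Y \<in> Obj C" using fa by simp_all
  define e' where "e' = e(Suc n := False)"
  have e'n: "{k. e' k} \<subseteq> {1..n}"
  proof
    fix k assume "k \<in> {k. e' k}"
    then have "k \<in> {1..Suc n}" "k \<noteq> Suc n" using e(1) by (auto simp: e'_def)
    then show "k \<in> {1..n}" by auto
  qed
  obtain V l u where l: "is_colimit (tuple_cat {d. d < e'}) C (K_pow C n f) V l"
    and u: "u \<in> Cofib C" "Dom C u = V" "Cod C u = cube_obj C n f e'"
    and ul: "\<And>d. d < e' \<Longrightarrow> u \<bullet> l d = cube_arr C n f d e'"
    using corner_cofib[OF fa e'n] IH unfolding e'_def by blast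
  have ua: "u \<in> Arr C" using u(1) by (rule cofib_arr)
  note ll = colimit_leg[OF l, simplified]
  note FX = left_adjoint_tensor_right[OF XY(1)] and FY = left_adjoint_tensor_right[OF XY(2)]
  \<comment> \<open>The vertices strictly below \<open>e\<close> are the \<open>d \<le> e'\<close>,
    with last coordinate 0, and the \<open>up d\<close> with \<open>d < e'\<close>, with last
    coordinate 1.\<close>
  define up :: "(nat \<Rightarrow> bool) \<Rightarrow> nat \<Rightarrow> bool" where "up = (\<lambda>d. d(Suc n := True))"
  have d0: "\<not> d (Suc n)" if "d \<le> e'" for d
    using that by (auto simp: le_fun_def e'_def)
  have e_up: "e = up e'" using e(2) by (auto simp: up_def e'_def fun_eq_iff)
  have up_le: "up d \<le> up d'" if "d \<le> d'" for d d' using that by (auto simp: up_def le_fun_def)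
  have up_less: "up d < e" if "d < e'" for d
  proof -
    have "up d \<le> up e'" using up_le that by simp
    moreover have "(up d)(Suc n := False) = d" "(up e')(Suc n := False) = e'"
      using that d0[of d] d0[of e'] by (auto simp: up_def fun_eq_iff)
    then have "up d \<noteq> up e'" using that by (metis less_irrefl)
    ultimately show ?thesis unfolding e_up by simp
  qed
  have le_up: "d \<le> up d" for d by (auto simp: up_def le_fun_def)
  have e'_less: "e' < e"
    using e(2) by (auto simp: e'_def less_fun_def le_fun_def)
  have objX: "cube_obj C (Suc n) f d = cube_obj C n f d \<diamondop> ?X" if "d \<le> e'" for d
    using d0[OF that] cube_Suc(1)[OF n] by (simp add: K_obj_def)
  have objY: "cube_obj C (Suc n) f (up d) = cube_obj C n f d \<diamondop> ?Y" for d
    using cube_Suc(3)[OF n, of f d True] cube_Suc(1)[OF n, of f "up d"] by (simp add: up_def K_obj_def)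
  have arrX: "cube_arr C (Suc n) f d d' = cube_arr C n f d d' \<diamond> Id C ?X" if "d \<le> d'" "d' \<le> e'" for d d'
    using d0[of d'] d0[of d] that cube_Suc(2)[OF n] by (simp add: K_arr_def K_obj_def)
  have arrY: "cube_arr C (Suc n) f (up d) (up d') = cube_arr C n f d d' \<diamond> Id C ?Y" for d d'
    using cube_Suc(2)[OF n, of f "up d" "up d'"] cube_Suc(4,5)[OF n] by (simp add: up_def K_arr_def K_obj_def)
  have arrXY: "cube_arr C (Suc n) f d (up d') = cube_arr C n f d d' \<diamond> f" if "d \<le> e'" for d d'
    using d0[OF that] cube_Suc(2)[OF n, of f d "up d'"] cube_Suc(4,5)[OF n] by (simp add: up_def K_arr_def)
  show ?thesis
    unfolding corner_lifts_def
  proof (intro allI impI, elim conjE)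
    fix k v
    assume k: "\<forall>d<e. k d \<in> Hom C (cube_obj C (Suc n) f d) (Dom C q)"
      "\<forall>d d'. d \<le> d' \<longrightarrow> d' < e \<longrightarrow> k d' \<bullet> cube_arr C (Suc n) f d d' = k d"
      and v: "v \<in> Hom C (cube_obj C (Suc n) f e) (Cod C q)"
      and qk: "\<forall>d<e. q \<bullet> k d = v \<bullet> cube_arr C (Suc n) f d e"
    have v': "v \<in> Arr C" "Dom C v = cube_obj C n f e' \<diamondop> ?Y" "Cod C v = Cod C q"
      using v objY[of e'] e_up by auto
    have a: "k e' \<in> Arr C" "Dom C (k e') = cube_obj C n f e' \<diamondop> ?X" "Cod C (k e') = Dom C q"
      using k(1) e'_less objX[of e'] by auto
    have kup: "k (up d) \<in> Arr C \<and> Dom C (k (up d)) = cube_obj C n f d \<diamondop> ?Y \<and> Cod C (k (up d)) = Dom C q"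
      if "d < e'" for d
      using k(1) up_less[OF that] objY[of d] by auto
    \<comment> \<open>The face at last coordinate 0 has \<open>e'\<close> as its top vertex, so its
      data are contained in \<open>k e'\<close>. The face at last coordinate 1 lacks its top vertex
      \<open>e\<close>, and its data have to be glued into a morphism out of a colimit.\<close>
    obtain b where b: "b \<in> Arr C" "Dom C b = V \<diamondop> ?Y" "Cod C b = Dom C q"
      "\<And>d. d \<in> {d. d < e'} \<Longrightarrow> b \<bullet> (l d \<diamond> Id C ?Y) = k (up d)"
    proof (rule cube_colimit_desc[OF l fa FY, of "Dom C q" "\<lambda>d. k (up d)"])
      fix d d' assume *: "d \<in> {d. d < e'}" "d' \<in> {d. d < e'}" "d \<le> d'"
      then have "k (up d') \<bullet> cube_arr C (Suc n) f (up d) (up d') = k (up d)"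
        using k(2) up_le[of d d'] up_less[of d'] by simp
      then show "k (up d') \<bullet> (cube_arr C n f d d' \<diamond> Id C ?Y) = k (up d)" by (simp only: arrY)
    qed (use kup qa in auto)
    \<comment> \<open>The two prescriptions agree where the faces meet: at each
      \<open>d < e'\<close> both restrict to \<open>k d\<close>.\<close>
    have ab: "k e' \<bullet> (u \<diamond> Id C ?X) = b \<bullet> (Id C V \<diamond> f)"
    proof (rule cube_colimit_ext[OF l fa FX])
      fix d assume "d \<in> {d. d < e'}"
      then have d: "d < e'" by simp
      have "(k e' \<bullet> (u \<diamond> Id C ?X)) \<bullet> (l d \<diamond> Id C ?X) = k e' \<bullet> (cube_arr C n f d e' \<diamond> Id C ?X)"
        using a ua u ul[OF d] ll d XY by (simp add: tensor_comp)
      also have "\<dots> = k d"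
        using k(2)[rule_format, OF less_imp_le[OF d] e'_less] arrX[OF less_imp_le[OF d] order_refl] by simp
      also have "\<dots> = k (up d) \<bullet> (cube_arr C n f d d \<diamond> f)"
        using k(2)[rule_format, OF le_up[of d] up_less[OF d]] arrXY[OF less_imp_le[OF d], of d] by simp
      also have "\<dots> = k (up d) \<bullet> (Id C (cube_obj C n f d) \<diamond> f)"
        using fa by (simp add: cube_arr_id)
      also have "\<dots> = (b \<bullet> (l d \<diamond> Id C ?Y)) \<bullet> (Id C (cube_obj C n f d) \<diamond> f)"
        using b(4) d by simp
      also have "\<dots> = (b \<bullet> (Id C V \<diamond> f)) \<bullet> (l d \<diamond> Id C ?X)"
        using b(1-3) ll d XY fa by (simp add: tensor_comp K_pow_def)
      finally show "(k e' \<bullet> (u \<diamond> Id C ?X)) \<bullet> (l d \<diamond> Id C ?X) = (b \<bullet> (Id C V \<diamond> f)) \<bullet> (l d \<diamond> Id C ?X)" .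
    qed (use a b ua u fa XY ll in auto)
    have qa': "q \<bullet> k e' = v \<bullet> (Id C (cube_obj C n f e') \<diamond> f)"
      using qk e'_less arrXY[of e' e'] fa unfolding e_up[symmetric] by (simp add: cube_arr_id)
    have qb: "q \<bullet> b = v \<bullet> (u \<diamond> Id C ?Y)"
    proof (rule cube_colimit_ext[OF l fa FY])
      fix d assume "d \<in> {d. d < e'}"
      then have d: "d < e'" by simp
      have "(q \<bullet> b) \<bullet> (l d \<diamond> Id C ?Y) = q \<bullet> k (up d)"
        using qa b(1-3) b(4)[of d] ll d XY by (simp add: K_pow_def)
      also have "\<dots> = v \<bullet> (cube_arr C n f d e' \<diamond> Id C ?Y)"
        using qk up_less[OF d] arrY[of d e'] unfolding e_up[symmetric] by simp
      also have "\<dots> = (v \<bullet> (u \<diamond> Id C ?Y)) \<bullet> (l d \<diamond> Id C ?Y)"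
        using v' ua u ul[OF d] ll d XY by (simp add: tensor_comp)
      finally show "(q \<bullet> b) \<bullet> (l d \<diamond> Id C ?Y) = (v \<bullet> (u \<diamond> Id C ?Y)) \<bullet> (l d \<diamond> Id C ?Y)" .
    qed (use qa b v' ua u XY in auto)
    obtain h where h: "h \<in> Arr C" "Dom C h = cube_obj C n f e' \<diamondop> ?Y" "Cod C h = Dom C q" "q \<bullet> h = v"
      "h \<bullet> (Id C (cube_obj C n f e') \<diamond> f) = k e'" "h \<bullet> (u \<diamond> Id C ?Y) = b"
      by (rule pushout_product_lifts[OF u(1) f _ _, of q "k e'" b v])
        (use q a b(1-3) v' ab qa' qb u(2,3) in auto)
    have "h \<bullet> cube_arr C (Suc n) f d e = k d" if d: "d < e" for d
    proof (cases "d (Suc n)")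
      case True
      define d' where "d' = d(Suc n := False)"
      have dd: "d = up d'" using True by (auto simp: d'_def up_def fun_eq_iff)
      have "d' \<le> e'"
        using less_imp_le[OF d] by (auto simp: d'_def e'_def le_fun_def)
      moreover have "d' \<noteq> e'"
        using d dd e_up by (metis less_irrefl)
      ultimately have d': "d' < e'" by simp
      have "h \<bullet> cube_arr C (Suc n) f d e = h \<bullet> ((u \<bullet> l d') \<diamond> Id C ?Y)"
        using arrY[of d' e'] ul[OF d'] unfolding dd e_up[symmetric] by simp
      also have "\<dots> = (h \<bullet> (u \<diamond> Id C ?Y)) \<bullet> (l d' \<diamond> Id C ?Y)"
        using h(1-3) ua u ll d' XY by (simp add: tensor_comp)
      also have "\<dots> = k d" using h(6) b(4)[of d'] d' dd by simp
      finally show ?thesis .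
    next
      case False
      then have d': "d \<le> e'"
        using less_imp_le[OF d] by (auto simp: e'_def le_fun_def)
      have "h \<bullet> cube_arr C (Suc n) f d e = h \<bullet> (cube_arr C n f d e' \<diamond> f)"
        using arrXY[OF d', of e'] e_up by simp
      also have "\<dots> = (h \<bullet> (Id C (cube_obj C n f e') \<diamond> f)) \<bullet> (cube_arr C n f d e' \<diamond> Id C ?X)"
        using h(1-3) fa XY d' by (simp add: tensor_comp)
      also have "\<dots> = k d"
        using h(5) k(2)[rule_format, OF d' e'_less] arrX[OF d' order_refl] by simp
      finally show ?thesis .
    qed
    then show "\<exists>h. h \<in> Hom C (cube_obj C (Suc n) f e) (Dom C q) \<and> q \<bullet> h = v \<and>
        (\<forall>d<e. h \<bullet> cube_arr C (Suc n) f d e = k d)"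
      using h objY[of e'] e_up by (intro exI[of _ h]) simp
  qed
qed

text \<open>In dimension 1 the two corners say that \<open>X\<close> is cofibrant and that
  \<open>f\<close> is a cofibration. Dimension 0 is excluded because its only corner would require
  the unit to be cofibrant.\<close>

lemma corner_lifts_cofib:
  assumes f: "f \<in> Cofib C" and X: "cofibrant C (Dom C f)" and n: "0 < n"
    and e: "{k. e k} \<subseteq> {1..n}" and q: "q \<in> Fib C \<inter> Weq C"
  shows "corner_lifts C n f e q"
  using n e q
proof (induction n arbitrary: e q rule: nat_induct_non_zero)
  case 1
  have qa: "q \<in> Arr C" using 1 by (auto simp: fib_arr)
  show ?case
  proof (cases "e 1")
    case False
    have e0: "e = (\<lambda>_. False)"
    proof
      fix k show "e k = False" using 1(1) False by (cases "k = 1") auto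
    qed
    have nl: "\<not> d < e" for d by (auto simp: e0 less_fun_def le_fun_def)
    obtain I i where I: "is_initial C I" "i \<in> Hom C I (Dom C f)" "i \<in> Cofib C"
      using X by (auto simp: cofibrant_def)
    have ex: "\<exists>h. h \<in> Hom C (Dom C f) (Dom C q) \<and> q \<bullet> h = v" if v: "v \<in> Hom C (Dom C f) (Cod C q)" for v
    proof -
      obtain a where a: "a \<in> Arr C" "Dom C a = I" "Cod C a = Dom C q"
        using initial_arr[OF I(1), of "Dom C q"] qa by auto
      have qav: "q \<bullet> a = v \<bullet> i"
        by (rule initial_ext[OF I(1)]) (use a v I qa in auto)
      obtain h where "h \<in> Arr C" "Dom C h = Cod C i" "Cod C h = Dom C q" "q \<bullet> h = v"
        by (rule liftsE[OF lifting[OF I(3), of q] _ _ _ _ _ _ qav]) (use 1(2) a v I(2) in auto)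
      then show ?thesis
        using I(2) by auto
    qed
    have "cube_obj C 1 f e = Dom C f" by (simp add: e0 K_obj_def)
    then show ?thesis
      unfolding corner_lifts_def using ex nl by metis
  next
    case True
    have e1: "e = (\<lambda>k. k = 1)"
    proof
      fix k show "e k = (k = 1)" using 1(1) True by (cases "k = 1") auto
    qed
    have less: "d < e \<longleftrightarrow> d = (\<lambda>_. False)" for d
      unfolding e1 by (auto simp: less_fun_def le_fun_def fun_eq_iff)
    show ?thesis
      unfolding corner_lifts_def less
    proof (intro allI impI, elim conjE)
      fix k v
      assume k: "\<forall>d. d = (\<lambda>_. False) \<longrightarrow> k d \<in> Hom C (cube_obj C 1 f d) (Dom C q)"
        and v: "v \<in> Hom C (cube_obj C 1 f e) (Cod C q)"
        and qk: "\<forall>d. d = (\<lambda>_. False) \<longrightarrow> q \<bullet> k d = v \<bullet> cube_arr C 1 f d e"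
      have qkv: "q \<bullet> k (\<lambda>_. False) = v \<bullet> f" using qk by (simp add: e1 K_arr_def)
      obtain h where "h \<in> Arr C" "Dom C h = Cod C f" "Cod C h = Dom C q" "h \<bullet> f = k (\<lambda>_. False)" "q \<bullet> h = v"
        by (rule liftsE[OF lifting[OF f, of q] _ _ _ _ _ _ qkv]) (use 1(2) k v in \<open>auto simp: e1 K_obj_def\<close>)
      then show "\<exists>h. h \<in> Hom C (cube_obj C 1 f e) (Dom C q) \<and> q \<bullet> h = v \<and>
          (\<forall>d. d = (\<lambda>_. False) \<longrightarrow> h \<bullet> cube_arr C 1 f d e = k d)"
        by (intro exI[of _ h]) (simp add: e1 K_obj_def K_arr_def)
    qed
  qed
next
  case (Suc n)
  show ?case
  proof (cases "e (Suc n)")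
    case False
    have "{k. e k} \<subseteq> {1..n}"
    proof
      fix k assume "k \<in> {k. e k}"
      then have "k \<in> {1..Suc n}" "k \<noteq> Suc n" using Suc.prems(1) False by auto
      then show "k \<in> {1..n}" by auto
    qed
    then show ?thesis
      using corner_lifts_Suc_False[OF f X] Suc by blast
  next
    case True
    have "{k. (e(Suc n := False)) k} \<subseteq> {1..n}"
    proof
      fix k assume "k \<in> {k. (e(Suc n := False)) k}"
      then have "k \<in> {1..Suc n}" "k \<noteq> Suc n" using Suc.prems(1) by (auto split: if_splits)
      then show "k \<in> {1..n}" by auto
    qed
    then show ?thesis
      using corner_lifts_Suc_True[OF f Suc.hyps Suc.prems(1) True Suc.prems(2)] Suc.IH by blast
  qed
qed

end

section \<open>The objects \<open>\<box>\<^sup>n\<^sub>i(f)\<close>\<close>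

abbreviation cube_perm :: "('o, 'm, 'z) mon_cat_scheme \<Rightarrow> nat \<Rightarrow> 'm \<Rightarrow> (nat \<Rightarrow> nat) \<Rightarrow> (nat \<Rightarrow> bool) \<Rightarrow> 'm" where
  "cube_perm C n f \<sigma> e \<equiv> permute C n \<sigma> (\<lambda>k. K_obj C f (e k))"

lemma tuples_mono: "e \<in> tuples n (i - 1) \<Longrightarrow> e \<in> tuples n i"
  by (auto simp: tuples_def)

lemma permuted_support:
  assumes "\<sigma> permutes {1..n}"
  shows "{k. (e \<circ> inv' \<sigma>) k} = \<sigma> ` {k. e k}"
  using permutes_inverses[OF assms] by (auto simp: image_iff) metis+

lemma card_permuted:
  assumes "\<sigma> permutes {1..n}"
  shows "card {k. (e \<circ> inv' \<sigma>) k} = card {k. e k}"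
  unfolding permuted_support[OF assms] by (rule card_image) (use permutes_inj[OF assms] inj_on_subset in blast)

lemma permuted_tuples:
  assumes "\<sigma> permutes {1..n}" "e \<in> tuples n i"
  shows "e \<circ> inv' \<sigma> \<in> tuples n i"
proof -
  have "\<sigma> ` {k. e k} \<subseteq> \<sigma> ` {1..n}"
    using assms(2) by (intro image_mono) (auto simp: tuples_def)
  then have "{k. (e \<circ> inv' \<sigma>) k} \<subseteq> {1..n}"
    by (simp only: permuted_support[OF assms(1)] permutes_image[OF assms(1)])
  then show ?thesis
    using assms(2) card_permuted[OF assms(1), of e] by (simp add: tuples_def o_def)
qed

lemma comp_inv_mono: "(d :: nat \<Rightarrow> bool) \<le> e \<Longrightarrow> d \<circ> s \<le> e \<circ> s"
  by (auto simp: le_fun_def)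

lemma comp_inv_comp:
  assumes "\<sigma> permutes {1..n}" "\<tau> permutes {1..n}"
  shows "e \<circ> inv' (\<sigma> \<circ> \<tau>) = e \<circ> inv' \<tau> \<circ> inv' \<sigma>"
  using permutes_bij[OF assms(1)] permutes_bij[OF assms(2)] by (simp add: o_inv_distrib Fun.comp_assoc)

lemma comp_inv_cancel:
  assumes "\<sigma> permutes {1..n}"
  shows "e \<circ> \<sigma> \<circ> inv' \<sigma> = e" "e \<circ> inv' \<sigma> \<circ> \<sigma> = e"
  using permutes_inv_o[OF assms] by (simp_all add: Fun.comp_assoc)

context symmetric_monoidal_category
begin

lemma cube_perm_arr [simp]:
  assumes "\<sigma> permutes {1..n}" "f \<in> Arr C"
  shows "cube_perm C n f \<sigma> e \<in> Arr C" "Dom C (cube_perm C n f \<sigma> e) = cube_obj C n f e"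
    "Cod C (cube_perm C n f \<sigma> e) = cube_obj C n f (e \<circ> inv' \<sigma>)" "iso_arr C (cube_perm C n f \<sigma> e)"
  using permute_arr[OF assms(1), of "\<lambda>k. K_obj C f (e k)"] iso_permute[OF assms(1), of "\<lambda>k. K_obj C f (e k)"] assms(2)
  by (simp_all add: o_def)

lemma cube_perm_natural:
  assumes "\<sigma> permutes {1..n}" "f \<in> Arr C" "d \<le> e"
  shows "cube_perm C n f \<sigma> e \<bullet> cube_arr C n f d e
    = cube_arr C n f (d \<circ> inv' \<sigma>) (e \<circ> inv' \<sigma>) \<bullet> cube_perm C n f \<sigma> d"
proof -
  have "d k \<le> e k" for k using assms(3) by (simp add: le_fun_def)
  note K = K_arr_arr[OF assms(2) this]
  have "Cod C (K_arr C f (d k) (e k)) = K_obj C f (e k)" "Dom C (K_arr C f (d k) (e k)) = K_obj C f (d k)" for k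
    using K by blast+
  then show ?thesis
    using permute_natural[OF assms(1), of "\<lambda>k. K_arr C f (d k) (e k)"] assms(2) by (simp add: o_def)
qed

lemma cube_perm_comp:
  assumes "\<sigma> permutes {1..n}" "\<tau> permutes {1..n}" "f \<in> Arr C"
  shows "cube_perm C n f \<sigma> (e \<circ> inv' \<tau>) \<bullet> cube_perm C n f \<tau> e = cube_perm C n f (\<sigma> \<circ> \<tau>) e"
  using permute_comp[OF assms(1,2), of "\<lambda>k. K_obj C f (e k)"] assms(3) by (simp add: o_def)

lemma cube_perm_id: "f \<in> Arr C \<Longrightarrow> cube_perm C n f id e = Id C (cube_obj C n f e)"
  using permute_id[of "\<lambda>k. K_obj C f (e k)" n] by simp

end

context closed_symmetric_monoidal_model_category
begin

lemma Box_colimit: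
  "f \<in> Arr C \<Longrightarrow> is_colimit (tuple_cat (tuples n i)) C (K_pow C n f) (Box C n i f) (Box_leg C n i f)"
  unfolding Box_def Box_leg_def Gamma_tuple_cat by (rule cube_colimit[OF _ finite_tuples])

lemma Box_leg_arr [simp]:
  assumes "f \<in> Arr C"
  shows "Box C n i f \<in> Obj C" "e \<in> tuples n i \<Longrightarrow> Box_leg C n i f e \<in> Arr C"
    "e \<in> tuples n i \<Longrightarrow> Dom C (Box_leg C n i f e) = cube_obj C n f e"
    "e \<in> tuples n i \<Longrightarrow> Cod C (Box_leg C n i f e) = Box C n i f"
  using colimit_leg[OF Box_colimit[OF assms, of n i]] by (simp_all add: K_pow_def)

lemma Box_leg_comp:
  "\<lbrakk>f \<in> Arr C; d \<in> tuples n i; e \<in> tuples n i; d \<le> e\<rbrakk>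
    \<Longrightarrow> Box_leg C n i f e \<bullet> cube_arr C n f d e = Box_leg C n i f d"
  using colimit_leg(5)[OF Box_colimit, of f "(d, e)" n i] by (simp add: K_pow_def)

lemma Box_ext:
  assumes "f \<in> Arr C" "u \<in> Arr C" "v \<in> Arr C" "Dom C u = Box C n i f" "Dom C v = Box C n i f"
    "Cod C u = Cod C v" "\<And>e. e \<in> tuples n i \<Longrightarrow> u \<bullet> Box_leg C n i f e = v \<bullet> Box_leg C n i f e"
  shows "u = v"
  by (rule cube_colimit_ext[OF Box_colimit[OF assms(1), of n i] assms(1) left_adjoint_id]) (use assms in auto)

lemma Box_desc:
  assumes "f \<in> Arr C" "is_cocone (tuple_cat (tuples n i)) C (K_pow C n f) U k"
  shows "Box_desc C n i f U k \<in> Arr C" "Dom C (Box_desc C n i f U k) = Box C n i f"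
    "Cod C (Box_desc C n i f U k) = U"
    "e \<in> tuples n i \<Longrightarrow> Box_desc C n i f U k \<bullet> Box_leg C n i f e = k e"
  using colimit_desc[OF Box_colimit[OF assms(1), of n i] assms(2)]
  by (simp_all add: Box_desc_def Box_def Box_leg_def Gamma_tuple_cat)

lemma Box_map:
  assumes "f \<in> Arr C"
  shows "Box_map C n i f \<in> Arr C" "Dom C (Box_map C n i f) = Box C n (i - 1) f"
    "Cod C (Box_map C n i f) = Box C n i f"
    "e \<in> tuples n (i - 1) \<Longrightarrow> Box_map C n i f \<bullet> Box_leg C n (i - 1) f e = Box_leg C n i f e"
proof -
  have k: "is_cocone (tuple_cat (tuples n (i - 1))) C (K_pow C n f) (Box C n i f) (Box_leg C n i f)"
    unfolding cube_cocone_iff[OF assms] using assms Box_leg_comp[OF assms, of _ n i] tuples_mono[of _ n i] by simp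
  show "Box_map C n i f \<in> Arr C" "Dom C (Box_map C n i f) = Box C n (i - 1) f"
    "Cod C (Box_map C n i f) = Box C n i f"
    "e \<in> tuples n (i - 1) \<Longrightarrow> Box_map C n i f \<bullet> Box_leg C n (i - 1) f e = Box_leg C n i f e"
    using Box_desc[OF assms k] by (simp_all add: Box_map_def)
qed

text \<open>Passing from \<open>i - 1\<close> to \<open>i\<close> attaches one corner along its
  boundary for each vertex with exactly \<open>i\<close> ones. This is the existence half of the
  resulting description of morphisms out of \<open>Box C n i f\<close>; \<open>Box_ext_top\<close>
  is the uniqueness half.\<close>

lemma Box_extend:
  assumes f: "f \<in> Arr C" and i: "1 \<le> i" and u: "u \<in> Arr C" "Dom C u = Box C n (i - 1) f"
    and h: "\<And>e. \<lbrakk>e \<in> tuples n i; card {k. e k} = i\<rbrakk> \<Longrightarrow>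
        h e \<in> Arr C \<and> Dom C (h e) = cube_obj C n f e \<and> Cod C (h e) = Cod C u"
      "\<And>d e. \<lbrakk>e \<in> tuples n i; card {k. e k} = i; d < e\<rbrakk> \<Longrightarrow>
        h e \<bullet> cube_arr C n f d e = u \<bullet> Box_leg C n (i - 1) f d"
  obtains w where "w \<in> Arr C" "Dom C w = Box C n i f" "Cod C w = Cod C u" "w \<bullet> Box_map C n i f = u"
    "\<And>e. \<lbrakk>e \<in> tuples n i; card {k. e k} = i\<rbrakk> \<Longrightarrow> w \<bullet> Box_leg C n i f e = h e"
proof -
  let ?l = "\<lambda>e. u \<bullet> Box_leg C n (i - 1) f e"
  have k: "is_cocone (tuple_cat (tuples n i)) C (K_pow C n f) (Cod C u) (\<lambda>e. if card {k. e k} = i then h e else ?l e)"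
  proof (rule cube_cocone_extend[OF f _ _ _ h i])
    fix d e assume "d \<in> tuples n (i - 1)" "e \<in> tuples n (i - 1)" "d \<le> e"
    then show "?l e \<bullet> cube_arr C n f d e = ?l d"
      using Box_leg_comp[of f d n "i - 1" e] u f by simp
  qed (use u f in auto)
  note D = Box_desc[OF f k]
  let ?w = "Box_desc C n i f (Cod C u) (\<lambda>e. if card {k. e k} = i then h e else ?l e)"
  show ?thesis
  proof (rule that[OF D(1-3)])
    show "?w \<bullet> Box_map C n i f = u"
    proof (rule Box_ext[OF f, of _ _ n "i - 1"])
      fix e assume e: "e \<in> tuples n (i - 1)"
      then have "card {k. e k} \<noteq> i" using i by (auto simp: tuples_def)
      then show "(?w \<bullet> Box_map C n i f) \<bullet> Box_leg C n (i - 1) f e = u \<bullet> Box_leg C n (i - 1) f e"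
        using D(1-3) D(4)[OF tuples_mono[OF e]] Box_map[OF f, where n=n and i=i] e f by simp
    qed (use D(1-3) Box_map[OF f, where n=n and i=i] u in auto)
    show "?w \<bullet> Box_leg C n i f e = h e" if "e \<in> tuples n i" "card {k. e k} = i" for e
      using D(4)[OF that(1)] that(2) by simp
  qed
qed

lemma below_tuples: "\<lbrakk>e \<in> tuples n i; d < e\<rbrakk> \<Longrightarrow> d \<in> tuples n (i - 1)"
  using less_tuple_support[of d e n] by (auto simp: tuples_def)

text \<open>Lifts at different vertices with \<open>i\<close> ones impose no conditions on one
  another, since such vertices are incomparable; they are chosen independently and glued by
  \<open>Box_extend\<close>.\<close>

lemma Box_map_lifts:
  assumes f: "f \<in> Arr C" and i: "1 \<le> i" and q: "q \<in> Arr C"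
    and lift: "\<And>e. \<lbrakk>e \<in> tuples n i; card {k. e k} = i\<rbrakk> \<Longrightarrow> corner_lifts C n f e q"
  shows "lifts C (Box_map C n i f) q"
  unfolding lifts_def
proof (intro allI impI)
  note B = Box_map[OF f, where n=n and i=i]
  fix u v
  assume uv: "u \<in> Hom C (Dom C (Box_map C n i f)) (Dom C q) \<and> v \<in> Hom C (Cod C (Box_map C n i f)) (Cod C q) \<and>
    q \<bullet> u = v \<bullet> Box_map C n i f"
  let ?k = "\<lambda>d. u \<bullet> Box_leg C n (i - 1) f d"
  have "\<exists>h. h \<in> Hom C (cube_obj C n f e) (Dom C q) \<and> q \<bullet> h = v \<bullet> Box_leg C n i f e \<and>
      (\<forall>d<e. h \<bullet> cube_arr C n f d e = ?k d)" if e: "e \<in> tuples n i" "card {k. e k} = i" for e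
  proof (rule lift[OF e, unfolded corner_lifts_def, rule_format], intro conjI allI impI)
    fix d d' assume "d \<le> d'" "d' < e"
    then have "d' \<in> tuples n (i - 1)" "d \<in> tuples n (i - 1)"
      using below_tuples[OF e(1)] order.strict_trans1[of d d' e] by auto
    then show "?k d' \<bullet> cube_arr C n f d d' = ?k d"
      using Box_leg_comp[OF f _ _ \<open>d \<le> d'\<close>, of n "i - 1"] uv B f \<open>d \<le> d'\<close> by simp
  next
    fix d assume d: "d < e"
    note d' = below_tuples[OF e(1) d]
    have "q \<bullet> ?k d = (v \<bullet> Box_map C n i f) \<bullet> Box_leg C n (i - 1) f d"
      using comp_reassoc[of q u "v \<bullet> Box_map C n i f" "Box_leg C n (i - 1) f d"] uv q B d' f by simp
    also have "\<dots> = v \<bullet> Box_leg C n i f d"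
      using uv B(1-3) B(4)[OF d'] d' f by simp
    also have "\<dots> = (v \<bullet> Box_leg C n i f e) \<bullet> cube_arr C n f d e"
      using Box_leg_comp[OF f tuples_mono[OF d'] e(1) less_imp_le[OF d]] uv B(3) e(1) d f by simp
    finally show "q \<bullet> ?k d = (v \<bullet> Box_leg C n i f e) \<bullet> cube_arr C n f d e" .
  qed (use uv B below_tuples[OF e(1)] e f in auto)
  then have "\<forall>e \<in> {e \<in> tuples n i. card {k. e k} = i}. \<exists>h. h \<in> Hom C (cube_obj C n f e) (Dom C q) \<and>
      q \<bullet> h = v \<bullet> Box_leg C n i f e \<and> (\<forall>d<e. h \<bullet> cube_arr C n f d e = ?k d)"
    by blast
  from bchoice[OF this] obtain h where h: "\<And>e. \<lbrakk>e \<in> tuples n i; card {k. e k} = i\<rbrakk> \<Longrightarrow>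
      h e \<in> Hom C (cube_obj C n f e) (Dom C q) \<and>
      q \<bullet> h e = v \<bullet> Box_leg C n i f e \<and> (\<forall>d<e. h e \<bullet> cube_arr C n f d e = ?k d)"
    by blast
  obtain w where w: "w \<in> Arr C" "Dom C w = Box C n i f" "Cod C w = Cod C u" "w \<bullet> Box_map C n i f = u"
    "\<And>e. \<lbrakk>e \<in> tuples n i; card {k. e k} = i\<rbrakk> \<Longrightarrow> w \<bullet> Box_leg C n i f e = h e"
    by (rule Box_extend[OF f i, of u n h]) (use uv B h in auto)
  have "q \<bullet> w = v"
  proof (rule Box_ext[OF f, of _ _ n i])
    fix e assume e: "e \<in> tuples n i"
    show "(q \<bullet> w) \<bullet> Box_leg C n i f e = v \<bullet> Box_leg C n i f e"
    proof (cases "card {k. e k} = i")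
      case True
      have "(q \<bullet> w) \<bullet> Box_leg C n i f e = q \<bullet> h e"
        using w(1-3) w(5)[OF e True] e f q uv by simp
      then show ?thesis using h[OF e True] by simp
    next
      case False
      then have e': "e \<in> tuples n (i - 1)" using e i by (auto simp: tuples_def)
      have "(q \<bullet> w) \<bullet> Box_leg C n i f e = (q \<bullet> w) \<bullet> (Box_map C n i f \<bullet> Box_leg C n (i - 1) f e)"
        using B(4)[OF e'] by simp
      also have "\<dots> = (q \<bullet> (w \<bullet> Box_map C n i f)) \<bullet> Box_leg C n (i - 1) f e"
        using w(1-3) B(1-3) e' f q uv by simp
      also have "\<dots> = (v \<bullet> Box_map C n i f) \<bullet> Box_leg C n (i - 1) f e"
        using w(4) uv by simp
      also have "\<dots> = v \<bullet> Box_leg C n i f e"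
        using B(1-3) B(4)[OF e'] uv e' f by simp
      finally show ?thesis .
    qed
  qed (use w uv q B in auto)
  then show "\<exists>h. h \<in> Hom C (Cod C (Box_map C n i f)) (Dom C q) \<and> h \<bullet> Box_map C n i f = u \<and> q \<bullet> h = v"
    using w uv B by (intro exI[of _ w]) simp
qed

lemma Box_map_cofib:
  assumes f: "f \<in> Cofib C" and X: "cofibrant C (Dom C f)" and i: "1 \<le> i" "i \<le> n"
  shows "Box_map C n i f \<in> Cofib C"
  unfolding cofib_iff_lifts
proof (intro conjI ballI)
  have fa: "f \<in> Arr C" using f by (rule cofib_arr)
  then show "Box_map C n i f \<in> Arr C" by (rule Box_map)
  fix q assume q: "q \<in> Fib C \<inter> Weq C"
  then show "lifts C (Box_map C n i f) q"
    using i corner_lifts_cofib[OF f X _ _ q, of n]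
    by (intro Box_map_lifts[OF fa i(1)]) (auto simp: fib_arr tuples_def)
qed

subsection \<open>The actions of the symmetric groups\<close>

text \<open>Naturality of \<open>permute\<close> along the edges of the cube makes the reindexed
  legs a cocone.\<close>

lemma Box_act:
  assumes f: "f \<in> Arr C" and s: "\<sigma> permutes {1..n}"
  shows "Box_act C n i f \<sigma> \<in> Arr C" "Dom C (Box_act C n i f \<sigma>) = Box C n i f"
    "Cod C (Box_act C n i f \<sigma>) = Box C n i f"
    "e \<in> tuples n i \<Longrightarrow> Box_act C n i f \<sigma> \<bullet> Box_leg C n i f e = Box_leg C n i f (e \<circ> inv' \<sigma>) \<bullet> cube_perm C n f \<sigma> e"
proof -
  have k: "is_cocone (tuple_cat (tuples n i)) C (K_pow C n f) (Box C n i f)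
      (\<lambda>e. Box_leg C n i f (e \<circ> inv' \<sigma>) \<bullet> cube_perm C n f \<sigma> e)"
    unfolding cube_cocone_iff[OF f]
  proof (intro conjI ballI impI)
    fix d e assume de: "d \<in> tuples n i" "e \<in> tuples n i" "d \<le> e"
    note p = permuted_tuples[OF s de(1)] permuted_tuples[OF s de(2)] comp_inv_mono[OF de(3), of "inv' \<sigma>"]
    have "(Box_leg C n i f (e \<circ> inv' \<sigma>) \<bullet> cube_perm C n f \<sigma> e) \<bullet> cube_arr C n f d e
      = Box_leg C n i f (e \<circ> inv' \<sigma>) \<bullet> (cube_perm C n f \<sigma> e \<bullet> cube_arr C n f d e)"
      using f s p de by (simp del: comp_apply)
    also have "\<dots> = (Box_leg C n i f (e \<circ> inv' \<sigma>) \<bullet> cube_arr C n f (d \<circ> inv' \<sigma>) (e \<circ> inv' \<sigma>)) \<bullet> cube_perm C n f \<sigma> d"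
      unfolding cube_perm_natural[OF s f de(3)] using f s p by (simp del: comp_apply)
    also have "\<dots> = Box_leg C n i f (d \<circ> inv' \<sigma>) \<bullet> cube_perm C n f \<sigma> d"
      by (simp only: Box_leg_comp[OF f p])
    finally show "(Box_leg C n i f (e \<circ> inv' \<sigma>) \<bullet> cube_perm C n f \<sigma> e) \<bullet> cube_arr C n f d e
      = Box_leg C n i f (d \<circ> inv' \<sigma>) \<bullet> cube_perm C n f \<sigma> d" .
  qed (use f s permuted_tuples[OF s] in \<open>simp_all del: comp_apply\<close>)
  show "Box_act C n i f \<sigma> \<in> Arr C" "Dom C (Box_act C n i f \<sigma>) = Box C n i f"
    "Cod C (Box_act C n i f \<sigma>) = Box C n i f"
    "e \<in> tuples n i \<Longrightarrow> Box_act C n i f \<sigma> \<bullet> Box_leg C n i f e = Box_leg C n i f (e \<circ> inv' \<sigma>) \<bullet> cube_perm C n f \<sigma> e"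
    using Box_desc[OF f k] by (simp_all add: Box_act_def)
qed

lemma Box_action:
  assumes f: "f \<in> Arr C"
  shows "action C (sym_group n) (Box C n i f) (Box_act C n i f)"
  unfolding action_def sym_group_one sym_group_mult
proof (intro conjI ballI)
  show "Box_act C n i f id = Id C (Box C n i f)"
    by (rule Box_ext[OF f, of _ _ n i])
      (use f Box_act[OF f permutes_id, where n=n and i=i] in \<open>simp_all add: cube_perm_id\<close>)
  fix \<sigma> \<tau> assume "\<sigma> \<in> carrier (sym_group n)" "\<tau> \<in> carrier (sym_group n)"
  then have s: "\<sigma> permutes {1..n}" and t: "\<tau> permutes {1..n}" by (simp_all add: sym_group_carrier)
  have st: "\<sigma> \<circ> \<tau> permutes {1..n}" by (rule permutes_compose[OF t s])
  show "Box_act C n i f (\<sigma> \<circ> \<tau>) = Box_act C n i f \<sigma> \<bullet> Box_act C n i f \<tau>"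
  proof (rule Box_ext[OF f, of _ _ n i])
    fix e assume e: "e \<in> tuples n i"
    note p = permuted_tuples[OF t e]
    note A = Box_act(1-3)[OF f s, where i=i] Box_act(1-3)[OF f t, where i=i] Box_act(4)[OF f s p] Box_act(4)[OF f t e]
    have "(Box_act C n i f \<sigma> \<bullet> Box_act C n i f \<tau>) \<bullet> Box_leg C n i f e
        = (Box_act C n i f \<sigma> \<bullet> Box_leg C n i f (e \<circ> inv' \<tau>)) \<bullet> cube_perm C n f \<tau> e"
      using A(1-6,8) f e p t by (simp del: comp_apply)
    also have "\<dots> = Box_leg C n i f (e \<circ> inv' \<tau> \<circ> inv' \<sigma>) \<bullet> (cube_perm C n f \<sigma> (e \<circ> inv' \<tau>) \<bullet> cube_perm C n f \<tau> e)"
      unfolding A(7) using f s t permuted_tuples[OF s p] by (simp del: comp_apply)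
    also have "\<dots> = Box_leg C n i f (e \<circ> inv' (\<sigma> \<circ> \<tau>)) \<bullet> cube_perm C n f (\<sigma> \<circ> \<tau>) e"
      by (simp only: cube_perm_comp[OF s t f] comp_inv_comp[OF s t])
    finally show "Box_act C n i f (\<sigma> \<circ> \<tau>) \<bullet> Box_leg C n i f e
        = (Box_act C n i f \<sigma> \<bullet> Box_act C n i f \<tau>) \<bullet> Box_leg C n i f e"
      using Box_act(4)[OF f st e] by simp
  qed (use Box_act[OF f s, where i=i] Box_act[OF f t, where i=i] Box_act[OF f st, where i=i] in simp_all)
qed (use f Box_act[OF f] in \<open>auto simp: sym_group_carrier\<close>)

lemma Box_map_equivariant:
  assumes f: "f \<in> Arr C" and s: "\<sigma> permutes {1..n}"
  shows "Box_map C n i f \<bullet> Box_act C n (i - 1) f \<sigma> = Box_act C n i f \<sigma> \<bullet> Box_map C n i f"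
proof (rule Box_ext[OF f, of _ _ n "i - 1"])
  note B = Box_map[OF f, where n=n and i=i] and A = Box_act[OF f s, where i=i] and A' = Box_act[OF f s, where i="i - 1"]
  fix e assume e: "e \<in> tuples n (i - 1)"
  note p = permuted_tuples[OF s e]
  have "(Box_map C n i f \<bullet> Box_act C n (i - 1) f \<sigma>) \<bullet> Box_leg C n (i - 1) f e
      = (Box_map C n i f \<bullet> Box_leg C n (i - 1) f (e \<circ> inv' \<sigma>)) \<bullet> cube_perm C n f \<sigma> e"
    using B(1-3) A'(1-3) A'(4)[OF e] e p f s by (simp del: comp_apply)
  also have "\<dots> = Box_act C n i f \<sigma> \<bullet> Box_leg C n i f e"
    unfolding B(4)[OF p] A(4)[OF tuples_mono[OF e]] ..
  also have "\<dots> = (Box_act C n i f \<sigma> \<bullet> Box_map C n i f) \<bullet> Box_leg C n (i - 1) f e"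
    using B(1-3) B(4)[OF e] A(1-3) e f by simp
  finally show "(Box_map C n i f \<bullet> Box_act C n (i - 1) f \<sigma>) \<bullet> Box_leg C n (i - 1) f e
      = (Box_act C n i f \<sigma> \<bullet> Box_map C n i f) \<bullet> Box_leg C n (i - 1) f e" .
qed (use Box_map[OF f, where n=n and i=i] Box_act[OF f s] in simp_all)

text \<open>An endomorphism of the quotient is determined by its composites with \<open>p\<close>
  and with the morphism \<open>z\<close> from the terminal object together, so the identities for
  the action are checked against both.\<close>

lemma Box_quot_action:
  assumes f: "f \<in> Arr C" and q: "quotient C (Box_map C n i f) = (Q, p, z)" "is_quotient C (Box_map C n i f) Q p z"
  shows "action C (sym_group n) (fst (Box_quot C n i f)) (snd (Box_quot C n i f))"
    and "\<sigma> permutes {1..n} \<Longrightarrow> snd (Box_quot C n i f) \<sigma> \<bullet> p = p \<bullet> Box_act C n i f \<sigma>"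
    and "fst (Box_quot C n i f) = Q"
proof -
  note B = Box_map[OF f, where n=n and i=i]
  let ?a = "\<lambda>\<sigma>. quot_endo C (Box_map C n i f) (Box_act C n i f \<sigma>)"
  obtain T t where po: "is_pushout C (Box_map C n i f) t Q p z"
    using q(2) by (auto simp: is_quotient_def)
  note po' = pushout_arr[OF po]
  have E: "?a \<sigma> \<in> Hom C Q Q" "?a \<sigma> \<bullet> p = p \<bullet> Box_act C n i f \<sigma>"
    "\<And>u. \<lbrakk>u \<in> Hom C Q Q; u \<bullet> p = p \<bullet> Box_act C n i f \<sigma>; u \<bullet> z = z\<rbrakk> \<Longrightarrow> u = ?a \<sigma>" "?a \<sigma> \<bullet> z = z"
    if s: "\<sigma> permutes {1..n}" for \<sigma>
  proof -
    have "Box_act C n i f \<sigma> \<in> Hom C (Cod C (Box_map C n i f)) (Cod C (Box_map C n i f))"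
      "Box_act C n (i - 1) f \<sigma> \<in> Hom C (Dom C (Box_map C n i f)) (Dom C (Box_map C n i f))"
      using Box_act(1-3)[OF f s] B(2,3) by simp_all
    note E = quot_endo[OF q this Box_map_equivariant[OF f s, symmetric]]
    show "?a \<sigma> \<in> Hom C Q Q" "?a \<sigma> \<bullet> p = p \<bullet> Box_act C n i f \<sigma>" "?a \<sigma> \<bullet> z = z"
      "\<And>u. \<lbrakk>u \<in> Hom C Q Q; u \<bullet> p = p \<bullet> Box_act C n i f \<sigma>; u \<bullet> z = z\<rbrakk> \<Longrightarrow> u = ?a \<sigma>"
      by (fact E)+
  qed
  have fst: "fst (Box_quot C n i f) = Q" and snd: "snd (Box_quot C n i f) = ?a"
    by (simp_all add: Box_quot_def quot_obj_def q(1))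
  then show "\<sigma> permutes {1..n} \<Longrightarrow> snd (Box_quot C n i f) \<sigma> \<bullet> p = p \<bullet> Box_act C n i f \<sigma>"
    and "fst (Box_quot C n i f) = Q" using E by simp_all
  show "action C (sym_group n) (fst (Box_quot C n i f)) (snd (Box_quot C n i f))"
    unfolding action_def sym_group_one sym_group_mult fst snd
  proof (intro conjI ballI)
    have "Box_act C n i f id = Id C (Box C n i f)"
      using Box_action[OF f, of n i] by (simp add: action_def sym_group_one)
    then show "?a id = Id C Q"
      using E(3)[OF permutes_id, of "Id C Q"] po' B by simp
    fix \<sigma> \<tau> assume "\<sigma> \<in> carrier (sym_group n)" "\<tau> \<in> carrier (sym_group n)"
    then have s: "\<sigma> permutes {1..n}" and t: "\<tau> permutes {1..n}" by (simp_all add: sym_group_carrier)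
    have st: "\<sigma> \<circ> \<tau> permutes {1..n}" by (rule permutes_compose[OF t s])
    have act: "Box_act C n i f (\<sigma> \<circ> \<tau>) = Box_act C n i f \<sigma> \<bullet> Box_act C n i f \<tau>"
      using Box_action[OF f, of n i] s t by (simp add: action_def sym_group_carrier sym_group_mult)
    have "(?a \<sigma> \<bullet> ?a \<tau>) \<bullet> p = (?a \<sigma> \<bullet> p) \<bullet> Box_act C n i f \<tau>"
      using E(1,2)[OF t] E(1)[OF s] po' Box_act[OF f t, where i=i] B by simp
    also have "\<dots> = p \<bullet> Box_act C n i f (\<sigma> \<circ> \<tau>)"
      unfolding E(2)[OF s] act using po' Box_act[OF f t, where i=i] Box_act[OF f s, where i=i] B by simp
    finally have "(?a \<sigma> \<bullet> ?a \<tau>) \<bullet> p = p \<bullet> Box_act C n i f (\<sigma> \<circ> \<tau>)" .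
    moreover have "(?a \<sigma> \<bullet> ?a \<tau>) \<bullet> z = z"
      using E(1,4)[OF t] E(1,4)[OF s] po' by simp
    ultimately show "?a (\<sigma> \<circ> \<tau>) = ?a \<sigma> \<bullet> ?a \<tau>"
      using E(3)[OF st, of "?a \<sigma> \<bullet> ?a \<tau>"] E(1)[OF s] E(1)[OF t] by simp
  qed (use E po' in \<open>auto simp: sym_group_carrier\<close>)
qed

subsection \<open>Subquotients in the pointed case\<close>

text \<open>A cokernel is an epimorphism, so \<open>h\<close> can be compared with a zero morphism
  after composition with \<open>g\<close>.\<close>

lemma null_coker_cancel:
  assumes "pointed C" "is_coker C S g" "h \<in> Arr C" "Dom C h = Cod C g" "null C (h \<bullet> g)"
  shows "null C h"
proof -
  have g: "g \<in> Arr C" using assms(2) by (simp add: is_coker_def)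
  obtain k where k: "null C k" "k \<in> Arr C" "Dom C k = Cod C g" "Cod C k = Cod C h"
    using null_exists[OF assms(1), of "Cod C g" "Cod C h"] g assms(3) by auto
  have "null C (k \<bullet> g)" using null_comp_right[OF k(1) g] k by simp
  then have "k \<bullet> g = h \<bullet> g"
    using assms g k by (intro null_eq) simp_all
  then have "k = h"
    by (rule coker_ext[OF assms(2), rotated -1]) (use k assms in simp_all)
  then show ?thesis using k by simp
qed

text \<open>A cokernel taken in two stages. The relations of the second stage live on a quotient
  already; each must come from one in \<open>S\<close> along an epimorphism \<open>g\<close>, so
  that a morphism killing \<open>S\<close> also kills it.\<close>

lemma coker_comp:
  assumes pt: "pointed C" and q1: "is_coker C S1 q1" and q2: "is_coker C S2 q2" and d: "Dom C q2 = Cod C q1"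
    and S: "S1 \<subseteq> S" "\<And>s. s \<in> S \<Longrightarrow> s \<in> Arr C \<and> Cod C s = Dom C q1 \<and> null C ((q2 \<bullet> q1) \<bullet> s)"
    and S2: "\<And>s2. s2 \<in> S2 \<Longrightarrow> \<exists>s \<in> S. \<exists>T g. is_coker C T g \<and> Cod C g = Dom C s2 \<and> q1 \<bullet> s = s2 \<bullet> g"
  shows "is_coker C S (q2 \<bullet> q1)"
proof -
  have qa: "q1 \<in> Arr C" "q2 \<in> Arr C" using q1 q2 by (simp_all add: is_coker_def)
  show ?thesis
  proof (rule is_cokerI)
    fix h assume h: "h \<in> Arr C" "Dom C h = Dom C (q2 \<bullet> q1)" "\<And>s. s \<in> S \<Longrightarrow> null C (h \<bullet> s)"
    obtain h1 where h1: "h1 \<in> Arr C" "Dom C h1 = Cod C q1" "Cod C h1 = Cod C h" "h1 \<bullet> q1 = h"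
      by (rule coker_desc[OF q1, of h]) (use h S(1) qa d in auto)
    have "null C (h1 \<bullet> s2)" if s2: "s2 \<in> S2" for s2
    proof -
      obtain s T g where g: "s \<in> S" "is_coker C T g" "Cod C g = Dom C s2" "q1 \<bullet> s = s2 \<bullet> g"
        using S2[OF s2] by blast
      have s2': "s2 \<in> Arr C" "Cod C s2 = Cod C q1" using q2 s2 d by (auto simp: is_coker_def)
      have ga: "g \<in> Arr C" using g(2) by (simp add: is_coker_def)
      have "(h1 \<bullet> s2) \<bullet> g = (h1 \<bullet> q1) \<bullet> s"
        using h1(1-3) s2' ga g(3) g(4)[symmetric] S(2)[OF g(1)] qa by simp
      then have "null C ((h1 \<bullet> s2) \<bullet> g)" using h(3)[OF g(1)] h1(4) by simp
      then show ?thesis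
        using null_coker_cancel[OF pt g(2), of "h1 \<bullet> s2"] h1 s2' g(3) by simp
    qed
    then obtain u where u: "u \<in> Arr C" "Dom C u = Cod C q2" "Cod C u = Cod C h1" "u \<bullet> q2 = h1"
      using coker_desc[OF q2 h1(1)] h1(2) d by auto
    have "u \<bullet> (q2 \<bullet> q1) = h"
      using comp_reassoc[OF u(4), of q1] u(1,2) qa d h1(4) by simp
    then show "\<exists>u. u \<in> Hom C (Cod C (q2 \<bullet> q1)) (Cod C h) \<and> u \<bullet> (q2 \<bullet> q1) = h"
      using u(1-3) h1(3) qa d by (intro exI[of _ u]) simp
  next
    fix u v
    assume uv: "u \<in> Arr C" "v \<in> Arr C" "Dom C u = Cod C (q2 \<bullet> q1)" "Dom C v = Cod C (q2 \<bullet> q1)"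
      "Cod C u = Cod C v" "u \<bullet> (q2 \<bullet> q1) = v \<bullet> (q2 \<bullet> q1)"
    have "(u \<bullet> q2) \<bullet> q1 = (v \<bullet> q2) \<bullet> q1" using uv qa d by simp
    then have "u \<bullet> q2 = v \<bullet> q2"
      by (rule coker_ext[OF q1, rotated -1]) (use uv(1-5) qa d in simp_all)
    then show "u = v"
      by (rule coker_ext[OF q2, rotated -1]) (use uv(1-5) qa d in simp_all)
  next
    fix s assume "s \<in> S"
    from S(2)[OF this] have "s \<in> Arr C" "Cod C s = Dom C q1" "null C ((q2 \<bullet> q1) \<bullet> s)"
      by blast+
    then show "s \<in> Arr C \<and> Cod C s = Dom C (q2 \<bullet> q1) \<and> null C ((q2 \<bullet> q1) \<bullet> s)"
      using qa d by simp
  qed (use qa d in simp)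
qed

text \<open>The composite \<open>p \<bullet> f\<close> names a cube with factors \<open>X\<close>
  and \<open>Z\<close>; this is the projection onto it from the cube of \<open>f\<close> at the
  vertex \<open>e\<close>.\<close>

abbreviation cube_proj :: "nat \<Rightarrow> 'm \<Rightarrow> 'o \<Rightarrow> (nat \<Rightarrow> bool) \<Rightarrow> 'm" where
  "cube_proj n p X e \<equiv> tensor_arr C n (\<lambda>k. if e k then p else Id C X)"

lemma cube_proj_arr [simp]:
  assumes "f \<in> Arr C" "p \<in> Arr C" "Dom C p = Cod C f" "X = Dom C f"
  shows "cube_proj n p X e \<in> Arr C" "Dom C (cube_proj n p X e) = cube_obj C n f e"
    "Cod C (cube_proj n p X e) = cube_obj C n (p \<bullet> f) e"
proof -
  have *: "(if b then p else Id C X) \<in> Arr C" "Dom C (if b then p else Id C X) = K_obj C f b"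
    "Cod C (if b then p else Id C X) = K_obj C (p \<bullet> f) b" for b
    using assms by (auto simp: K_obj_def)
  show "cube_proj n p X e \<in> Arr C" "Dom C (cube_proj n p X e) = cube_obj C n f e"
    "Cod C (cube_proj n p X e) = cube_obj C n (p \<bullet> f) e"
    using tensor_arr_family[of "\<lambda>k. if e k then p else Id C X" n, OF *(1)] unfolding *(2,3) by auto
qed

lemma coker_id: "A \<in> Obj C \<Longrightarrow> is_coker C {} (Id C A)"
  by (rule is_cokerI) auto

text \<open>The factors are divided one after the other. Tensoring is a left adjoint and hence keeps
  cokernels, both for the first \<open>n\<close> factors with the last one fixed and for the last
  factor with the quotient of the first \<open>n\<close> in front.\<close>

lemma cube_coker:
  assumes pt: "pointed C" and f: "f \<in> Arr C" and p: "is_coker C {f} p" and n: "0 < n"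
  shows "is_coker C {cube_arr C n f (e(k := False)) e |k. k \<in> {1..n} \<and> e k} (cube_proj n p (Dom C f) e)"
  using n
proof (induction n rule: nat_induct_non_zero)
  case 1
  have "{cube_arr C 1 f (e(k := False)) e |k. k \<in> {1..1} \<and> e k} = (if e 1 then {f} else {})"
    by (auto simp: K_arr_def)
  then show ?case using p f coker_id[of "Dom C f"] by simp
next
  case (Suc n)
  let ?X = "Dom C f" and ?B = "K_obj C f (e (Suc n))" and ?c = "if e (Suc n) then p else Id C (Dom C f)"
  let ?T = "if e (Suc n) then {f} else {}" and ?q = "cube_proj n p (Dom C f) e"
  let ?Sn = "{cube_arr C n f (e(k := False)) e |k. k \<in> {1..n} \<and> e k}"
  let ?S = "{cube_arr C (Suc n) f (e(k := False)) e |k. k \<in> {1..Suc n} \<and> e k}"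
  have pa: "p \<in> Arr C" "Dom C p = Cod C f" and pf: "null C (p \<bullet> f)"
    using p by (auto simp: is_coker_def)
  have B: "?B \<in> Obj C" using f by simp
  have c: "is_coker C ?T ?c" "?c \<in> Arr C" "Dom C ?c = ?B"
    using p coker_id[of ?X] f pa by (auto simp: K_obj_def)
  note q = cube_proj_arr[OF f pa refl, of n e]
  let ?W = "cube_obj C n (p \<bullet> f) e"
  have W: "?W \<in> Obj C" using f pa by simp
  have lower: "cube_arr C (Suc n) f (e(k := False)) e = cube_arr C n f (e(k := False)) e \<diamond> Id C ?B"
    if "k \<in> {1..n}" for k
    using that Suc.hyps by (simp add: K_arr_def)
  have top: "cube_arr C (Suc n) f (e(Suc n := False)) e = Id C (cube_obj C n f e) \<diamond> f" if "e (Suc n)"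
  proof -
    have "cube_arr C n f (e(Suc n := False)) e = cube_arr C n f e e"
      by (rule tensor_arr_cong) auto
    then show ?thesis
      using that Suc.hyps cube_arr_id[OF f] by (simp add: K_arr_def)
  qed
  have le: "e(k := False) \<le> e" for k by (auto simp: le_fun_def)
  have "is_coker C ?S ((Id C ?W \<diamond> ?c) \<bullet> (?q \<diamond> Id C ?B))"
  proof (rule coker_comp[OF pt])
    show "is_coker C ((\<lambda>s. s \<diamond> Id C ?B) ` ?Sn) (?q \<diamond> Id C ?B)"
      by (rule left_adjoint_coker[OF pt left_adjoint_tensor_right[OF B] Suc.IH])
    show "is_coker C ((\<lambda>s. Id C ?W \<diamond> s) ` ?T) (Id C ?W \<diamond> ?c)"
      by (rule left_adjoint_coker[OF pt left_adjoint_tensor_left[OF W] c(1)])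
    show "Dom C (Id C ?W \<diamond> ?c) = Cod C (?q \<diamond> Id C ?B)"
      using q c W B by simp
    show "(\<lambda>s. s \<diamond> Id C ?B) ` ?Sn \<subseteq> ?S"
    proof
      fix s assume "s \<in> (\<lambda>s. s \<diamond> Id C ?B) ` ?Sn"
      then obtain k where k: "k \<in> {1..n}" "e k" "s = cube_arr C n f (e(k := False)) e \<diamond> Id C ?B" by auto
      then have "s = cube_arr C (Suc n) f (e(k := False)) e" using lower by simp
      then show "s \<in> ?S" using k by (auto intro!: exI[of _ k])
    qed
  next
    fix s assume "s \<in> ?S"
    then obtain k where k: "k \<in> {1..Suc n}" "e k" "s = cube_arr C (Suc n) f (e(k := False)) e" by auto
    have sa: "s \<in> Arr C" "Cod C s = cube_obj C n f e \<diamondop> ?B"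
      unfolding k(3) using cube_arr_arr[OF f, where n="Suc n" and d="e(k := False)" and e=e] le[of k] Suc.hyps
      by (simp_all del: tensor_arr_Suc)
    have "null C ((Id C ?W \<diamond> ?c) \<bullet> (?q \<diamond> Id C ?B) \<bullet> s)"
    proof (cases "k = Suc n")
      case True
      have "(Id C ?W \<diamond> ?c) \<bullet> (?q \<diamond> Id C ?B) \<bullet> s = (Id C ?W \<diamond> (p \<bullet> f)) \<bullet> (?q \<diamond> Id C ?X)"
        using k True top q pa W f by (simp add: tensor_comp K_obj_def del: tensor_arr_Suc)
      moreover have "null C (Id C ?W \<diamond> (p \<bullet> f))"
        by (rule left_adjoint_null[OF left_adjoint_tensor_left[OF W] pf])
      ultimately show ?thesis
        using null_comp_right[of "Id C ?W \<diamond> (p \<bullet> f)" "?q \<diamond> Id C ?X"] q pa W f by simp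
    next
      case False
      then have k': "k \<in> {1..n}" using k(1) by auto
      let ?s = "cube_arr C n f (e(k := False)) e"
      have "null C (?q \<bullet> ?s)" using Suc.IH k k' by (auto simp: is_coker_def)
      then have "null C ((?q \<bullet> ?s) \<diamond> Id C ?B)"
        by (rule left_adjoint_null[OF left_adjoint_tensor_right[OF B]])
      moreover have "(?q \<diamond> Id C ?B) \<bullet> s = (?q \<bullet> ?s) \<diamond> Id C ?B"
        unfolding k(3) lower[OF k'] using q f le B by (simp add: tensor_comp del: fun_upd_apply)
      ultimately show ?thesis
        using null_comp_left[of "(?q \<bullet> ?s) \<diamond> Id C ?B" "Id C ?W \<diamond> ?c"] q f le B W c by (simp del: fun_upd_apply)
    qed
    then show "s \<in> Arr C \<and> Cod C s = Dom C (?q \<diamond> Id C ?B) \<and> null C (((Id C ?W \<diamond> ?c) \<bullet> (?q \<diamond> Id C ?B)) \<bullet> s)"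
      using sa q c W B by simp
  next
    \<comment> \<open>The relation of the second stage starts at the quotient \<open>?W\<close>
      times \<open>X\<close>. It comes from the edge erasing the last one, along \<open>?q\<close>
      tensored with \<open>X\<close>, which is again a cokernel.\<close>
    fix s2 assume s2: "s2 \<in> (\<lambda>s. Id C ?W \<diamond> s) ` ?T"
    then have e: "e (Suc n)" and s2: "s2 = Id C ?W \<diamond> f" by (auto split: if_splits)
    have "is_coker C ((\<lambda>s. s \<diamond> Id C ?X) ` ?Sn) (?q \<diamond> Id C ?X)"
      using f by (intro left_adjoint_coker[OF pt left_adjoint_tensor_right Suc.IH]) simp
    moreover have "(?q \<diamond> Id C ?B) \<bullet> (Id C (cube_obj C n f e) \<diamond> f) = s2 \<bullet> (?q \<diamond> Id C ?X)"
      using q f W e s2 by (simp add: tensor_comp K_obj_def)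
    moreover have "Id C (cube_obj C n f e) \<diamond> f \<in> ?S"
      using top[OF e] e by (intro CollectI exI[of _ "Suc n"]) simp
    moreover have "Cod C (?q \<diamond> Id C ?X) = Dom C s2"
      using q f W s2 by simp
    ultimately show "\<exists>s \<in> ?S. \<exists>T g. is_coker C T g \<and> Cod C g = Dom C s2 \<and> (?q \<diamond> Id C ?B) \<bullet> s = s2 \<bullet> g"
      by blast
  qed
  moreover have "(Id C ?W \<diamond> ?c) \<bullet> (?q \<diamond> Id C ?B) = cube_proj (Suc n) p (Dom C f) e"
    using q c W B Suc.hyps by (simp add: tensor_comp)
  ultimately show ?case by simp
qed

end

section \<open>Orbits\<close>

text \<open>A relation in place of the chosen \<open>orbit_obj\<close>, so that the image of an
  orbit object under a left adjoint is again one in this sense.\<close>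

definition is_orbit ::
  "('o, 'm, 'z) cat_scheme \<Rightarrow> ('g, 'y) monoid_scheme \<Rightarrow> 'o \<Rightarrow> ('g \<Rightarrow> 'm) \<Rightarrow> 'o \<Rightarrow> 'm \<Rightarrow> bool" where
  "is_orbit C G V a Q \<pi> \<longleftrightarrow> action C G V a \<and> is_colimit (one_object_cat G) C (action_diag V a) Q (\<lambda>_. \<pi>)"

lemma category_one_object_cat: "group G \<Longrightarrow> category (one_object_cat G)"
proof -
  assume "group G"
  then interpret group G .
  show ?thesis by unfold_locales (auto simp: one_object_cat_def m_assoc)
qed

lemma action_diagram: "action C G V a \<Longrightarrow> diagram (one_object_cat G) C (action_diag V a)"
  by (auto simp: diagram_def one_object_cat_def action_diag_def action_def)

context category
begin

lemma orbit_arr: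
  assumes "is_orbit C G V a Q \<pi>"
  shows "Q \<in> Obj C" "\<pi> \<in> Arr C" "Dom C \<pi> = V" "Cod C \<pi> = Q" "\<And>g. g \<in> carrier G \<Longrightarrow> \<pi> \<bullet> a g = \<pi>"
    "V \<in> Obj C" "\<And>g. g \<in> carrier G \<Longrightarrow> a g \<in> Hom C V V" "a \<one>\<^bsub>G\<^esub> = Id C V"
  using assms by (auto simp: is_orbit_def is_colimit_def is_cocone_def one_object_cat_def action_diag_def action_def)

lemma orbit_desc:
  assumes "is_orbit C G V a Q \<pi>" "h \<in> Arr C" "Dom C h = V" "\<And>g. g \<in> carrier G \<Longrightarrow> h \<bullet> a g = h"
  obtains u where "u \<in> Arr C" "Dom C u = Q" "Cod C u = Cod C h" "u \<bullet> \<pi> = h"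
proof -
  have "is_cocone (one_object_cat G) C (action_diag V a) (Cod C h) (\<lambda>_. h)"
    using assms by (auto simp: is_cocone_def one_object_cat_def action_diag_def)
  then have "\<exists>!u. u \<in> Hom C Q (Cod C h) \<and> (\<forall>x\<in>Obj (one_object_cat G). u \<bullet> \<pi> = h)"
    using assms(1) unfolding is_orbit_def is_colimit_def by blast
  then show ?thesis
    using that by (auto simp: one_object_cat_def)
qed

lemma orbit_ext:
  assumes o: "is_orbit C G V a Q \<pi>" and "u \<in> Arr C" "v \<in> Arr C" "Dom C u = Q" "Dom C v = Q"
    "Cod C u = Cod C v" "u \<bullet> \<pi> = v \<bullet> \<pi>"
  shows "u = v"
proof (rule colimit_ext[of "one_object_cat G" "action_diag V a" Q "\<lambda>_. \<pi>"])
  show "is_colimit (one_object_cat G) C (action_diag V a) Q (\<lambda>_. \<pi>)"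
    using o by (simp add: is_orbit_def)
qed (use assms orbit_arr[OF o] in \<open>auto simp: one_object_cat_def action_diag_def\<close>)

lemma is_orbit_orbit_obj:
  assumes fc: "has_finite_colimits C" and G: "group G" "finite (carrier G)" and a: "action C G V a"
  shows "is_orbit C G V a (orbit_obj C G V a) (orbit_proj C G V a)"
proof -
  have "\<exists>Q l. is_colimit (one_object_cat G) C (action_diag V a) Q l"
    by (rule finite_colimit_exists[OF fc category_one_object_cat[OF G(1)] _ _ action_diagram[OF a]])
      (use G(2) in \<open>simp_all add: one_object_cat_def\<close>)
  then obtain Q l where "is_colimit (one_object_cat G) C (action_diag V a) Q l" by blast
  note c = colimit_is_colimit[OF this]
  have "(\<lambda>_. orbit_proj C G V a) = colim_leg (one_object_cat G) C (action_diag V a)"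
    by (auto simp: orbit_proj_def)
  then show ?thesis using a c by (simp add: is_orbit_def orbit_obj_def)
qed

lemma orbit_map:
  assumes o: "is_orbit C G V a (orbit_obj C G V a) (orbit_proj C G V a)"
    and o': "is_orbit C G U b (orbit_obj C G U b) (orbit_proj C G U b)"
    and u: "u \<in> Arr C" "Dom C u = V" "Cod C u = U" and eq: "\<And>g. g \<in> carrier G \<Longrightarrow> u \<bullet> a g = b g \<bullet> u"
  shows "orbit_map C G V a U b u \<in> Arr C" "Dom C (orbit_map C G V a U b u) = orbit_obj C G V a"
    "Cod C (orbit_map C G V a U b u) = orbit_obj C G U b"
    "orbit_map C G V a U b u \<bullet> orbit_proj C G V a = orbit_proj C G U b \<bullet> u"
proof -
  note O = orbit_arr[OF o] and O' = orbit_arr[OF o']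
  have "is_cocone (one_object_cat G) C (action_diag V a) (orbit_obj C G U b) (\<lambda>_. orbit_proj C G U b \<bullet> u)"
    unfolding is_cocone_def
  proof (intro conjI ballI)
    fix g assume "g \<in> Arr (one_object_cat G)"
    then have g: "g \<in> carrier G" by (simp add: one_object_cat_def)
    have "(orbit_proj C G U b \<bullet> u) \<bullet> a g = (orbit_proj C G U b \<bullet> b g) \<bullet> u"
      using O(7)[OF g] O'(2-4) O'(7)[OF g] u eq[OF g] by simp
    then show "(orbit_proj C G U b \<bullet> u) \<bullet> on_arr (action_diag V a) g = orbit_proj C G U b \<bullet> u"
      using O'(5)[OF g] by (simp add: action_diag_def)
  qed (use O' u in \<open>auto simp: action_diag_def\<close>)
  from colimit_desc[OF _ this] o
  show "orbit_map C G V a U b u \<in> Arr C" "Dom C (orbit_map C G V a U b u) = orbit_obj C G V a"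
    "Cod C (orbit_map C G V a U b u) = orbit_obj C G U b"
    "orbit_map C G V a U b u \<bullet> orbit_proj C G V a = orbit_proj C G U b \<bullet> u"
    unfolding is_orbit_def orbit_map_def orbit_obj_def orbit_proj_def
    by (fastforce simp: one_object_cat_def)+
qed

lemma left_adjoint_orbit:
  assumes F: "left_adjoint C Fo Fa" and G: "group G" and o: "is_orbit C G V a Q \<pi>"
  shows "is_orbit C G (Fo V) (\<lambda>g. Fa (a g)) (Fo Q) (Fa \<pi>)"
proof -
  have a: "action C G V a" and c: "is_colimit (one_object_cat G) C (action_diag V a) Q (\<lambda>_. \<pi>)"
    using o by (auto simp: is_orbit_def)
  have "map_diag Fo Fa (action_diag V a) = action_diag (Fo V) (\<lambda>g. Fa (a g))"
    by (simp add: map_diag_def action_diag_def)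
  then have "is_colimit (one_object_cat G) C (action_diag (Fo V) (\<lambda>g. Fa (a g))) (Fo Q) (\<lambda>_. Fa \<pi>)"
    using left_adjoint_colimit[OF F category_one_object_cat[OF G] action_diagram[OF a] c] by simp
  moreover have "action C G (Fo V) (\<lambda>g. Fa (a g))"
    using a left_adjointD[OF F] by (auto simp: action_def)
  ultimately show ?thesis by (simp add: is_orbit_def)
qed

end

section \<open>Orbits of a product under a product of groups\<close>

context closed_symmetric_monoidal_category
begin

context
  fixes G :: "('g, 'y) monoid_scheme" and H :: "('h, 'x) monoid_scheme" and V a Q \<pi> U b R \<rho>
  assumes G: "group G" and H: "group H" and o1: "is_orbit C G V a Q \<pi>" and o2: "is_orbit C H U b R \<rho>"
begin

text \<open>\<open>Q \<diamondop> R\<close> is reached in two stages, dividing by \<open>G\<close>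
  with \<open>U\<close> fixed and then by \<open>H\<close> with \<open>Q\<close> fixed. Each stage
  is an orbit object since tensoring with a fixed object is a left adjoint.\<close>

lemma orbit_tensor_ext:
  assumes u: "u \<in> Arr C" "v \<in> Arr C" "Dom C u = Q \<diamondop> R" "Dom C v = Q \<diamondop> R" "Cod C u = Cod C v"
    "u \<bullet> (\<pi> \<diamond> \<rho>) = v \<bullet> (\<pi> \<diamond> \<rho>)"
  shows "u = v"
proof -
  note O = orbit_arr[OF o1] and O' = orbit_arr[OF o2]
  note l = left_adjoint_orbit[OF left_adjoint_tensor_right[OF O'(6)] G o1]
    and r = left_adjoint_orbit[OF left_adjoint_tensor_left[OF O(1)] H o2]
  have "(u \<bullet> (Id C Q \<diamond> \<rho>)) \<bullet> (\<pi> \<diamond> Id C U) = (v \<bullet> (Id C Q \<diamond> \<rho>)) \<bullet> (\<pi> \<diamond> Id C U)"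
    using u O O' by (simp add: tensor_comp)
  then have "u \<bullet> (Id C Q \<diamond> \<rho>) = v \<bullet> (Id C Q \<diamond> \<rho>)"
    by (rule orbit_ext[OF l, rotated -1]) (use u(1-5) O O' in simp_all)
  then show ?thesis
    by (rule orbit_ext[OF r, rotated -1]) (use u(1-5) O O' in simp_all)
qed

lemma orbit_tensor_desc:
  assumes h: "h \<in> Arr C" "Dom C h = V \<diamondop> U"
    and inv: "\<And>g k. \<lbrakk>g \<in> carrier G; k \<in> carrier H\<rbrakk> \<Longrightarrow> h \<bullet> (a g \<diamond> b k) = h"
  obtains u where "u \<in> Arr C" "Dom C u = Q \<diamondop> R" "Cod C u = Cod C h" "u \<bullet> (\<pi> \<diamond> \<rho>) = h"
proof -
  note O = orbit_arr[OF o1] and O' = orbit_arr[OF o2]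
  interpret G: group G by (rule G)
  interpret H: group H by (rule H)
  note l = left_adjoint_orbit[OF left_adjoint_tensor_right[OF O'(6)] G o1]
    and r = left_adjoint_orbit[OF left_adjoint_tensor_left[OF O(1)] H o2]
  obtain w where w: "w \<in> Arr C" "Dom C w = Q \<diamondop> U" "Cod C w = Cod C h" "w \<bullet> (\<pi> \<diamond> Id C U) = h"
    by (rule orbit_desc[OF l h]) (use inv[OF _ H.one_closed] O' in auto)
  \<comment> \<open>Invariance under \<open>H\<close> survives the first stage because the first
    projection is an epimorphism and the two actions commute.\<close>
  have w_inv: "w \<bullet> (Id C Q \<diamond> b k) = w" if k: "k \<in> carrier H" for k
  proof (rule orbit_ext[OF l])
    have "(w \<bullet> (Id C Q \<diamond> b k)) \<bullet> (\<pi> \<diamond> Id C U) = (w \<bullet> (\<pi> \<diamond> Id C U)) \<bullet> (Id C V \<diamond> b k)"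
      using w(1,2) O O'(6) O'(7)[OF k] by (simp add: tensor_comp)
    also have "\<dots> = w \<bullet> (\<pi> \<diamond> Id C U)"
      using inv[OF G.one_closed k] O(8) w(4) by simp
    finally show "(w \<bullet> (Id C Q \<diamond> b k)) \<bullet> (\<pi> \<diamond> Id C U) = w \<bullet> (\<pi> \<diamond> Id C U)" .
  qed (use w(1,2) O(1) O'(6) O'(7)[OF k] in simp_all)
  obtain u where u: "u \<in> Arr C" "Dom C u = Q \<diamondop> R" "Cod C u = Cod C w" "u \<bullet> (Id C Q \<diamond> \<rho>) = w"
    by (rule orbit_desc[OF r w(1,2)]) (use w_inv in auto)
  have "u \<bullet> (\<pi> \<diamond> \<rho>) = (u \<bullet> (Id C Q \<diamond> \<rho>)) \<bullet> (\<pi> \<diamond> Id C U)"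
    using u(1,2) O O' by (simp add: tensor_comp)
  then show ?thesis
    using u w by (intro that[of u]) simp_all
qed

end

end

section \<open>Induction from the stabilizer of a tuple\<close>

context symmetric_monoidal_category
begin

text \<open>The conjugates of \<open>k\<close> do not depend on the chosen permutation because \<open>k\<close> is equivariant
  under the stabilizer.\<close>

lemma equivariant_extend:
  assumes f: "f \<in> Arr C" and d: "action C (sym_group n) U d"
    and k: "k \<in> Arr C" "Dom C k = cube_obj C n f e0" "Cod C k = U"
    and stab: "\<And>\<sigma>. \<lbrakk>\<sigma> permutes {1..n}; e0 \<circ> inv' \<sigma> = e0\<rbrakk> \<Longrightarrow> k \<bullet> cube_perm C n f \<sigma> e0 = d \<sigma> \<bullet> k"
  obtains l where "\<And>\<tau>. \<tau> permutes {1..n} \<Longrightarrow> l (e0 \<circ> inv' \<tau>) \<in> Arr C \<and>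
      Dom C (l (e0 \<circ> inv' \<tau>)) = cube_obj C n f (e0 \<circ> inv' \<tau>) \<and> Cod C (l (e0 \<circ> inv' \<tau>)) = U \<and>
      l (e0 \<circ> inv' \<tau>) \<bullet> cube_perm C n f \<tau> e0 = d \<tau> \<bullet> k"
    "\<And>\<sigma> \<tau>. \<lbrakk>\<sigma> permutes {1..n}; \<tau> permutes {1..n}\<rbrakk> \<Longrightarrow>
      l (e0 \<circ> inv' \<tau> \<circ> inv' \<sigma>) \<bullet> cube_perm C n f \<sigma> (e0 \<circ> inv' \<tau>) = d \<sigma> \<bullet> l (e0 \<circ> inv' \<tau>)"
proof -
  have dh: "d \<sigma> \<in> Arr C" "Dom C (d \<sigma>) = U" "Cod C (d \<sigma>) = U" if "\<sigma> permutes {1..n}" for \<sigma>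
    using d that by (auto simp: action_def sym_group_carrier)
  have dc: "d (\<sigma> \<circ> \<tau>) = d \<sigma> \<bullet> d \<tau>" if "\<sigma> permutes {1..n}" "\<tau> permutes {1..n}" for \<sigma> \<tau>
    using d that by (auto simp: action_def sym_group_carrier sym_group_mult)
  \<comment> \<open>\<open>s\<close> picks some permutation that carries \<open>e0\<close> to
    \<open>e\<close>; off the orbit of \<open>e0\<close> its value is arbitrary, and the conclusions
    do not reach there.\<close>
  define s where "s = (\<lambda>e. SOME \<tau>. \<tau> permutes {1..n} \<and> e = e0 \<circ> inv' \<tau>)"
  define l where "l = (\<lambda>e. (d (s e) \<bullet> k) \<bullet> inverse_arr C (cube_perm C n f (s e) e0))"
  have A: "l (e0 \<circ> inv' \<tau>) \<in> Arr C \<and> Dom C (l (e0 \<circ> inv' \<tau>)) = cube_obj C n f (e0 \<circ> inv' \<tau>) \<and>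
      Cod C (l (e0 \<circ> inv' \<tau>)) = U \<and> l (e0 \<circ> inv' \<tau>) \<bullet> cube_perm C n f \<tau> e0 = d \<tau> \<bullet> k"
    if t: "\<tau> permutes {1..n}" for \<tau>
  proof -
    let ?e = "e0 \<circ> inv' \<tau>"
    let ?s = "s ?e"
    have "?s permutes {1..n} \<and> ?e = e0 \<circ> inv' ?s"
      unfolding s_def by (rule someI[of _ \<tau>]) (use t in simp)
    then have s: "?s permutes {1..n}" and es: "?e = e0 \<circ> inv' ?s" by auto
    have si: "inv' ?s permutes {1..n}" by (rule permutes_inv[OF s])
    \<comment> \<open>\<open>r\<close> measures the difference between the chosen permutation and
      \<tau>; it fixes \<open>e0\<close>, so \<open>stab\<close> absorbs it.\<close>
    define r where "r = inv' ?s \<circ> \<tau>"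
    have r: "r permutes {1..n}" unfolding r_def by (rule permutes_compose[OF t si])
    have sr: "?s \<circ> r = \<tau>"
      using permutes_inv_o(1)[OF s] by (simp add: r_def Fun.comp_assoc[symmetric])
    have "e0 \<circ> inv' r = e0 \<circ> inv' \<tau> \<circ> inv' (inv' ?s)"
      unfolding r_def by (rule comp_inv_comp[OF si t])
    also have "\<dots> = e0 \<circ> inv' ?s \<circ> ?s"
      by (simp only: permutes_inv_inv[OF s] es[symmetric])
    finally have er: "e0 \<circ> inv' r = e0" by (simp only: comp_inv_cancel[OF s])
    note P = cube_perm_arr[OF s f, of e0, folded es] cube_perm_arr[OF r f, of e0, unfolded er] cube_perm_arr[OF t f, of e0]
    have l: "l ?e \<in> Arr C" "Dom C (l ?e) = cube_obj C n f ?e" "Cod C (l ?e) = U"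
      unfolding l_def using P dh[OF s] k by (simp_all del: comp_apply)
    have "l ?e \<bullet> cube_perm C n f \<tau> e0 = l ?e \<bullet> (cube_perm C n f ?s e0 \<bullet> cube_perm C n f r e0)"
      using cube_perm_comp[OF s r f, of e0] unfolding er sr by simp
    also have "\<dots> = (d ?s \<bullet> k) \<bullet> cube_perm C n f r e0"
      unfolding l_def using P dh[OF s] k by (simp del: comp_apply)
    also have "\<dots> = d ?s \<bullet> (d r \<bullet> k)"
      using P dh[OF s] k stab[OF r er] by simp
    also have "\<dots> = d \<tau> \<bullet> k"
      using dc[OF s r] dh[OF s] dh[OF r] k unfolding sr by simp
    finally show ?thesis using l by simp
  qed
  have B: "l (e0 \<circ> inv' \<tau> \<circ> inv' \<sigma>) \<bullet> cube_perm C n f \<sigma> (e0 \<circ> inv' \<tau>) = d \<sigma> \<bullet> l (e0 \<circ> inv' \<tau>)"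
    if s: "\<sigma> permutes {1..n}" and t: "\<tau> permutes {1..n}" for \<sigma> \<tau>
  proof -
    have st: "\<sigma> \<circ> \<tau> permutes {1..n}" by (rule permutes_compose[OF t s])
    have e: "e0 \<circ> inv' \<tau> \<circ> inv' \<sigma> = e0 \<circ> inv' (\<sigma> \<circ> \<tau>)" by (rule comp_inv_comp[OF s t, symmetric])
    note P = cube_perm_arr[OF s f, of "e0 \<circ> inv' \<tau>"] cube_perm_arr[OF t f, of e0]
    note L = A[OF t] A[OF st, folded e]
    have "(l (e0 \<circ> inv' \<tau> \<circ> inv' \<sigma>) \<bullet> cube_perm C n f \<sigma> (e0 \<circ> inv' \<tau>)) \<bullet> cube_perm C n f \<tau> e0
        = l (e0 \<circ> inv' \<tau> \<circ> inv' \<sigma>) \<bullet> cube_perm C n f (\<sigma> \<circ> \<tau>) e0"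
      using P L cube_perm_comp[OF s t f, of e0] by (simp del: comp_apply)
    also have "\<dots> = d \<sigma> \<bullet> (d \<tau> \<bullet> k)"
      using L dc[OF s t] dh[OF s] dh[OF t] k by (simp del: comp_apply)
    also have "\<dots> = d \<sigma> \<bullet> (l (e0 \<circ> inv' \<tau>) \<bullet> cube_perm C n f \<tau> e0)"
      using L by (simp del: comp_apply)
    also have "\<dots> = (d \<sigma> \<bullet> l (e0 \<circ> inv' \<tau>)) \<bullet> cube_perm C n f \<tau> e0"
      using L(1) P dh[OF s] by (elim conjE) (simp del: comp_apply)
    finally show ?thesis
      by (rule iso_cancel_right[rotated]) (use P L dh[OF s] in \<open>simp_all del: comp_apply\<close>)
  qed
  show ?thesis by (rule that[OF A B])
qed

end

text \<open>Puts \<open>p\<close> zeros in front of a tuple. Applied to \<open>full_tuple q\<close>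
  it gives the vertex with ones in the last \<open>q\<close> positions, the representative of its
  orbit used from here on.\<close>

definition shift_tuple :: "nat \<Rightarrow> (nat \<Rightarrow> bool) \<Rightarrow> nat \<Rightarrow> bool" where
  "shift_tuple p e = (\<lambda>k. p < k \<and> e (k - p))"

abbreviation full_tuple :: "nat \<Rightarrow> nat \<Rightarrow> bool" where
  "full_tuple n \<equiv> (\<lambda>k. k \<in> {1..n})"

lemma shift_full: "{k. shift_tuple p (full_tuple q) k} = {p+1..p+q}"
  by (auto simp: shift_tuple_def)

lemma full_tuple_permuted: "\<sigma> permutes {1..n} \<Longrightarrow> full_tuple n \<circ> inv' \<sigma> = full_tuple n"
  using permutes_in_image[OF permutes_inv] by (force simp: fun_eq_iff)

lemma shift_tuples: "\<lbrakk>e \<in> tuples q i\<rbrakk> \<Longrightarrow> shift_tuple p e \<in> tuples (p + q) i"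
proof -
  assume e: "e \<in> tuples q i"
  have "{k. shift_tuple p e k} = (+) p ` {k. e k}"
  proof (rule subset_antisym; rule subsetI)
    fix k assume "k \<in> {k. shift_tuple p e k}"
    then show "k \<in> (+) p ` {k. e k}" by (auto simp: shift_tuple_def image_iff intro!: exI[of _ "k - p"])
  next
    fix k assume "k \<in> (+) p ` {k. e k}"
    then show "k \<in> {k. shift_tuple p e k}" using e by (auto simp: shift_tuple_def tuples_def)
  qed
  moreover have "card ((+) p ` {k. e k}) = card {k. e k}" by (simp add: card_image)
  ultimately show ?thesis using e by (auto simp: tuples_def)
qed

text \<open>A bijection between the supports and one between their complements in
  \<open>{1..n}\<close> combine to a permutation.\<close>

lemma tuple_orbit:
  fixes e e' :: "nat \<Rightarrow> bool"
  assumes e: "{k. e k} \<subseteq> {1..n}" and e': "{k. e' k} \<subseteq> {1..n}" and c: "card {k. e k} = card {k. e' k}"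
  obtains \<sigma> where "\<sigma> permutes {1..n}" "e' = e \<circ> inv' \<sigma>"
proof -
  let ?A = "{k. e k}" and ?B = "{k. e' k}" and ?N = "{1..n}"
  have fin: "finite ?A" "finite ?B"
    by (rule finite_subset[OF e finite_atLeastAtMost], rule finite_subset[OF e' finite_atLeastAtMost])
  obtain g where g: "bij_betw g ?A ?B" using finite_same_card_bij[OF fin c] by blast
  have "card (?N - ?A) = card (?N - ?B)"
    using e e' c fin by (simp add: card_Diff_subset)
  then obtain h where h: "bij_betw h (?N - ?A) (?N - ?B)"
    using finite_same_card_bij[of "?N - ?A" "?N - ?B"] by auto
  define \<sigma> where "\<sigma> = (\<lambda>k. if k \<in> ?A then g k else if k \<in> ?N then h k else k)"
  have A: "bij_betw \<sigma> ?A ?B"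
    using g by (rule bij_betw_cong[THEN iffD1, rotated]) (simp add: \<sigma>_def)
  have "bij_betw \<sigma> (?N - ?A) (?N - ?B)"
    using h by (rule bij_betw_cong[THEN iffD1, rotated]) (simp add: \<sigma>_def)
  then have "bij_betw \<sigma> (?A \<union> (?N - ?A)) (?B \<union> (?N - ?B))"
    using A by (intro bij_betw_combine) auto
  moreover have "?A \<union> (?N - ?A) = ?N" "?B \<union> (?N - ?B) = ?N" using e e' by blast+
  ultimately have "bij_betw \<sigma> ?N ?N" by simp
  then have \<sigma>: "\<sigma> permutes ?N"
    using e by (intro bij_imp_permutes) (auto simp: \<sigma>_def)
  have "{k. (e \<circ> inv' \<sigma>) k} = ?B"
    unfolding permuted_support[OF \<sigma>] using A by (simp add: bij_betw_def)
  then have "e' = e \<circ> inv' \<sigma>" by (metis Collect_inj)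
  then show ?thesis using that \<sigma> by blast
qed

text \<open>The ones of the vertex fill exactly the last \<open>q\<close> positions, and a
  permutation preserves that set if and only if it preserves its complement, the first
  \<open>p\<close> positions.\<close>

lemma stabilizer_block:
  assumes s: "\<sigma> permutes {1..p + q}"
  shows "shift_tuple p (full_tuple q) \<circ> inv' \<sigma> = shift_tuple p (full_tuple q) \<longleftrightarrow> \<sigma> \<in> block_subgroup p q"
proof -
  let ?e = "shift_tuple p (full_tuple q)"
  have inj: "inj \<sigma>" by (rule permutes_inj[OF s])
  have N: "{1..p + q} = {1..p} \<union> {p+1..p+q}" "{1..p} \<inter> {p+1..p+q} = {}" by auto
  have img: "\<sigma> ` {1..p} \<union> \<sigma> ` {p+1..p+q} = {1..p} \<union> {p+1..p+q}" "\<sigma> ` {1..p} \<inter> \<sigma> ` {p+1..p+q} = {}"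
    using permutes_image[OF s] inj N by (simp_all add: image_Un[symmetric] image_Int[symmetric])
  have "?e \<circ> inv' \<sigma> = ?e \<longleftrightarrow> {k. (?e \<circ> inv' \<sigma>) k} = {k. ?e k}"
    by (metis Collect_inj)
  also have "\<dots> \<longleftrightarrow> \<sigma> ` {p+1..p+q} = {p+1..p+q}"
    by (simp only: permuted_support[OF s] shift_full)
  also have "\<dots> \<longleftrightarrow> \<sigma> ` {1..p} = {1..p}"
  proof -
    have "A' \<union> B' = A \<union> B \<Longrightarrow> A' \<inter> B' = {} \<Longrightarrow> A \<inter> B = {} \<Longrightarrow> B' = B \<longleftrightarrow> A' = A" for A A' B B' :: "nat set"
      by blast
    from this[OF img N(2)] show ?thesis .
  qed
  finally show ?thesis using s by (simp add: block_subgroup_def sym_group_carrier)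
qed

lemma shift_tuple_permuted:
  assumes s: "\<sigma> \<in> block_subgroup p q" and e: "{k. e k} \<subseteq> {1..q}"
  shows "shift_tuple p e \<circ> inv' \<sigma> = shift_tuple p (e \<circ> inv' (right_block p q \<sigma>))"
proof -
  note S = block_subgroupD[OF s]
  let ?b = "right_block p q \<sigma>"
  have "shift_tuple p e k = shift_tuple p (e \<circ> inv' ?b) (\<sigma> k)" for k
  proof -
    consider "k \<in> {1..p}" | "k \<notin> {1..p + q}" | l where "k = p + l" "l \<in> {1..q}"
    proof (cases "k \<le> p")
      case False
      then show ?thesis using that(2) that(3)[of "k - p"] by (cases "k \<le> p + q") (auto simp: Suc_le_eq)
    qed (use that(1,2) in \<open>cases "k = 0"; auto\<close>)
    then show ?thesis
    proof cases
      case 1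
      then have "\<sigma> k \<in> {1..p}" using s by (auto simp: block_subgroup_def)
      then show ?thesis using 1 by (simp add: shift_tuple_def)
    next
      case 2
      have "inv' ?b (k - p) = k - p" if "p < k"
        using 2 that by (intro permutes_not_in[OF permutes_inv[OF S(3)]]) auto
      then show ?thesis using 2 permutes_not_in[OF S(1) 2] by (auto simp: shift_tuple_def)
    next
      case 3
      have "?b l \<in> {1..q}" using 3 permutes_in_image[OF S(3)] by simp
      then show ?thesis
        using 3 S(4)[of l] permutes_inverses(2)[OF S(3)] by (simp add: shift_tuple_def)
    qed
  qed
  then have "shift_tuple p e = shift_tuple p (e \<circ> inv' ?b) \<circ> \<sigma>" by (simp add: fun_eq_iff)
  then show ?thesis using comp_inv_cancel(1)[OF S(1)] by simp
qed

section \<open>Vertices with ones only at the end, split into two blocks\<close>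

context symmetric_monoidal_category
begin

abbreviation block_join :: "nat \<Rightarrow> nat \<Rightarrow> 'm \<Rightarrow> (nat \<Rightarrow> bool) \<Rightarrow> 'm" where
  "block_join p q f e \<equiv> tensor_join C p q (\<lambda>k. K_obj C f (shift_tuple p e k))"

lemma tensor_pow_obj [simp]: "X \<in> Obj C \<Longrightarrow> tensor_pow C n X \<in> Obj C"
  by (simp add: tensor_pow_def)

lemma shift_low: "k \<in> {1..p} \<Longrightarrow> \<not> shift_tuple p e k"
  and shift_high: "0 < k \<Longrightarrow> shift_tuple p e (p + k) = e k"
  by (simp_all add: shift_tuple_def)

lemma block_join_arr [simp]:
  assumes "f \<in> Arr C" "0 < q"
  shows "iso_arr C (block_join p q f e)"
    "Dom C (block_join p q f e) = tensor_pow C p (Dom C f) \<diamondop> cube_obj C q f e"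
    "Cod C (block_join p q f e) = cube_obj C (p + q) f (shift_tuple p e)"
proof -
  have "tensor C p (\<lambda>k. K_obj C f (shift_tuple p e k)) = tensor_pow C p (Dom C f)"
    unfolding tensor_pow_def by (rule tensor_cong) (simp add: K_obj_def shift_low)
  moreover have "tensor C q (\<lambda>k. K_obj C f (shift_tuple p e (p + k))) = cube_obj C q f e"
    by (rule tensor_cong) (simp add: shift_high)
  ultimately show "iso_arr C (block_join p q f e)"
    "Dom C (block_join p q f e) = tensor_pow C p (Dom C f) \<diamondop> cube_obj C q f e"
    "Cod C (block_join p q f e) = cube_obj C (p + q) f (shift_tuple p e)"
    using tensor_join_arr[OF assms(2), of "\<lambda>k. K_obj C f (shift_tuple p e k)" p] assms(1) by simp_all
qed

lemma block_join_natural: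
  assumes "f \<in> Arr C" "0 < q" "d \<le> e"
  shows "cube_arr C (p + q) f (shift_tuple p d) (shift_tuple p e) \<bullet> block_join p q f d
    = block_join p q f e \<bullet> (Id C (tensor_pow C p (Dom C f)) \<diamond> cube_arr C q f d e)"
proof -
  let ?a = "\<lambda>k. K_arr C f (shift_tuple p d k) (shift_tuple p e k)"
  have "shift_tuple p d k \<le> shift_tuple p e k" for k
    using assms(3) by (auto simp: shift_tuple_def le_fun_def)
  note K = K_arr_arr[OF assms(1) this]
  have "tensor_arr C p ?a = tensor_arr C p (\<lambda>k. Id C (Dom C f))"
    by (rule tensor_arr_cong) (simp add: K_arr_def K_obj_def shift_low)
  then have l: "tensor_arr C p ?a = Id C (tensor_pow C p (Dom C f))"
    using tensor_arr_id[of "\<lambda>_. Dom C f" p] assms(1) by (simp add: tensor_pow_def)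
  have r: "tensor_arr C q (\<lambda>k. ?a (p + k)) = cube_arr C q f d e"
    by (rule tensor_arr_cong) (simp add: shift_high)
  have fam: "(\<lambda>k. Cod C (?a k)) = (\<lambda>k. K_obj C f (shift_tuple p e k))"
    "(\<lambda>k. Dom C (?a k)) = (\<lambda>k. K_obj C f (shift_tuple p d k))"
    using K by auto
  show ?thesis
    using tensor_join_natural[OF assms(2), of ?a p] K(1) unfolding fam l r by simp
qed

lemma pow_act_arr [simp]:
  assumes "\<sigma> permutes {1..n}" "X \<in> Obj C"
  shows "pow_act C n X \<sigma> \<in> Arr C" "Dom C (pow_act C n X \<sigma>) = tensor_pow C n X"
    "Cod C (pow_act C n X \<sigma>) = tensor_pow C n X"
  using permute_arr[OF assms(1), of "\<lambda>_. X"] assms(2) by (simp_all add: pow_act_def tensor_pow_def o_def)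

lemma pow_action: "X \<in> Obj C \<Longrightarrow> action C (sym_group n) (tensor_pow C n X) (pow_act C n X)"
  using permute_comp[of _ n _ "\<lambda>_. X"] permute_id[of "\<lambda>_. X" n]
  unfolding action_def sym_group_one sym_group_mult
  by (auto simp: sym_group_carrier pow_act_def[symmetric] tensor_pow_def[symmetric])
    (simp_all add: pow_act_def tensor_pow_def o_def)

lemma block_join_equivariant:
  assumes f: "f \<in> Arr C" and q: "0 < q" and s: "\<sigma> \<in> block_subgroup p q" and e: "{k. e k} \<subseteq> {1..q}"
  shows "cube_perm C (p + q) f \<sigma> (shift_tuple p e) \<bullet> block_join p q f e
    = block_join p q f (e \<circ> inv' (right_block p q \<sigma>)) \<bullet>
      (pow_act C p (Dom C f) (left_block p \<sigma>) \<diamond> cube_perm C q f (right_block p q \<sigma>) e)"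
proof -
  note S = block_subgroupD[OF s]
  let ?x = "\<lambda>k. K_obj C f (shift_tuple p e k)"
  have "permute C p (left_block p \<sigma>) ?x = pow_act C p (Dom C f) (left_block p \<sigma>)"
    unfolding pow_act_def by (rule permute_cong[OF S(2)]) (simp add: K_obj_def shift_low)
  moreover have "permute C q (right_block p q \<sigma>) (\<lambda>k. ?x (p + k)) = cube_perm C q f (right_block p q \<sigma>) e"
    by (rule permute_cong[OF S(3)]) (simp add: shift_high)
  moreover have "?x \<circ> inv' \<sigma> = (\<lambda>k. K_obj C f (shift_tuple p (e \<circ> inv' (right_block p q \<sigma>)) k))"
    unfolding shift_tuple_permuted[OF s e, symmetric] by auto
  ultimately show ?thesis
    using permute_tensor_join[OF s q, of ?x] f by simp
qed

lemma cube_full: "cube_obj C n f (full_tuple n) = tensor_pow C n (Cod C f)"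
  unfolding tensor_pow_def by (rule tensor_cong) (simp add: K_obj_def)

lemma cube_perm_full:
  "\<sigma> permutes {1..n} \<Longrightarrow> cube_perm C n f \<sigma> (full_tuple n) = pow_act C n (Cod C f) \<sigma>"
  unfolding pow_act_def by (rule permute_cong) (simp_all add: K_obj_def)

end

section \<open>The subquotients as induced objects\<close>

lemma finite_sym_group: "finite (carrier (sym_group n))"
  by (simp add: sym_group_def finite_permutations)

lemma shift_full_tuples: "shift_tuple p (full_tuple q) \<in> tuples (p + q) q" "card {k. shift_tuple p (full_tuple q) k} = q"
  by (simp_all only: tuples_def mem_Collect_eq shift_full) auto

lemma top_tuple_orbit:
  assumes "e \<in> tuples (p + q) q" "card {k. e k} = q"
  obtains \<tau> where "\<tau> permutes {1..p + q}" "e = shift_tuple p (full_tuple q) \<circ> inv' \<tau>"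
  using tuple_orbit[of "shift_tuple p (full_tuple q)" "p + q" e] assms shift_full_tuples[of p q]
  by (auto simp: tuples_def)

section \<open>Uniqueness of induced objects\<close>

context category
begin

lemma is_cor_unique:
  assumes c: "is_cor C G H W w V b e" and c': "is_cor C G H W w V' b' e'"
  shows "equivariantly_isomorphic C G (V, b) (V', b')"
proof -
  have V: "action C G V b" "e \<in> Hom C W V" "equivariant C H w b e"
    and V': "action C G V' b'" "e' \<in> Hom C W V'" "equivariant C H w b' e'"
    using c c' by (auto simp: is_cor_def)
  have U: "\<exists>!u. u \<in> Hom C V U \<and> equivariant C (carrier G) b d u \<and> u \<bullet> e = k"
    if "action C G U d" "k \<in> Hom C W U" "equivariant C H w d k" for U d k
    using c that unfolding is_cor_def by blast
  have U': "\<exists>!u. u \<in> Hom C V' U \<and> equivariant C (carrier G) b' d u \<and> u \<bullet> e' = k"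
    if "action C G U d" "k \<in> Hom C W U" "equivariant C H w d k" for U d k
    using c' that unfolding is_cor_def by blast
  have bh: "b g \<in> Hom C V V" "b' g \<in> Hom C V' V'" if "g \<in> carrier G" for g
    using V(1) V'(1) that by (auto simp: action_def)
  have ob: "V \<in> Obj C" "V' \<in> Obj C" using V(1) V'(1) by (auto simp: action_def)
  obtain u where u: "u \<in> Hom C V V'" "equivariant C (carrier G) b b' u" "u \<bullet> e = e'"
    using U[OF V'] by blast
  obtain v where v: "v \<in> Hom C V' V" "equivariant C (carrier G) b' b v" "v \<bullet> e' = e"
    using U'[OF V] by blast
  have comp: "equivariant C (carrier G) a c (y \<bullet> x)"
    if x: "x \<in> Hom C A B" "equivariant C (carrier G) a bb x" and y: "y \<in> Hom C B D" "equivariant C (carrier G) bb c y"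
      and h: "\<And>g. g \<in> carrier G \<Longrightarrow> a g \<in> Hom C A A \<and> bb g \<in> Hom C B B \<and> c g \<in> Hom C D D"
    for A B D a bb c x y
    unfolding equivariant_def
  proof
    fix g assume g: "g \<in> carrier G"
    have xe: "x \<bullet> a g = bb g \<bullet> x" and ye: "y \<bullet> bb g = c g \<bullet> y"
      using x(2) y(2) g by (auto simp: equivariant_def)
    have "(y \<bullet> x) \<bullet> a g = y \<bullet> (bb g \<bullet> x)" using x(1) y(1) h[OF g] xe by simp
    also have "\<dots> = (y \<bullet> bb g) \<bullet> x" using x(1) y(1) h[OF g] by simp
    also have "\<dots> = c g \<bullet> y \<bullet> x" unfolding ye using x(1) y(1) h[OF g] by simp
    finally show "(y \<bullet> x) \<bullet> a g = c g \<bullet> y \<bullet> x" .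
  qed
  have "v \<bullet> u \<in> Hom C V V" "equivariant C (carrier G) b b (v \<bullet> u)" "(v \<bullet> u) \<bullet> e = e"
    using u v V(2) bh comp[OF u(1,2) v(1,2)] by simp_all
  moreover have "Id C V \<in> Hom C V V" "equivariant C (carrier G) b b (Id C V)" "Id C V \<bullet> e = e"
    using V(2) ob bh by (auto simp: equivariant_def)
  ultimately have vu: "v \<bullet> u = Id C V" using U[OF V] by blast
  have "u \<bullet> v \<in> Hom C V' V'" "equivariant C (carrier G) b' b' (u \<bullet> v)" "(u \<bullet> v) \<bullet> e' = e'"
    using u v V'(2) bh comp[OF v(1,2) u(1,2)] by simp_all
  moreover have "Id C V' \<in> Hom C V' V'" "equivariant C (carrier G) b' b' (Id C V')" "Id C V' \<bullet> e' = e'"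
    using V'(2) ob bh by (auto simp: equivariant_def)
  ultimately have uv: "u \<bullet> v = Id C V'" using U'[OF V'] by blast
  have "iso_arr C u"
    unfolding iso_arr_def is_inverse_def using u(1) v(1) uv vu by (intro exI[of _ v]) simp
  then show ?thesis
    using V(1) V'(1) u by (auto simp: equivariantly_isomorphic_def)
qed

text \<open>\<open>cor\<close> chooses one pair with the universal property; since all such pairs
  are equivariantly isomorphic, it is enough to exhibit the property.\<close>

lemma cor_equivariantly_isomorphic:
  assumes "is_cor C G H W w V b e"
  shows "equivariantly_isomorphic C G (V, b) (cor C G H (W, w))"
proof -
  have "\<exists>Vb. \<exists>e. is_cor C G H (fst (W, w)) (snd (W, w)) (fst Vb) (snd Vb) e"
    using assms by (intro exI[of _ "(V, b)"] exI[of _ e]) simp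
  from someI_ex[OF this] obtain e' where
    "is_cor C G H W w (fst (cor C G H (W, w))) (snd (cor C G H (W, w))) e'"
    unfolding cor_def by auto
  from is_cor_unique[OF assms this] show ?thesis by simp
qed

end

section \<open>The universal property of the subquotient\<close>

context closed_symmetric_monoidal_model_category
begin

lemma cube_perm_proj:
  assumes s: "\<sigma> permutes {1..n}" and f: "f \<in> Arr C" and p: "p \<in> Arr C" "Dom C p = Cod C f"
  shows "cube_perm C n (p \<bullet> f) \<sigma> e \<bullet> cube_proj n p (Dom C f) e
    = cube_proj n p (Dom C f) (e \<circ> inv' \<sigma>) \<bullet> cube_perm C n f \<sigma> e"
proof -
  let ?c = "\<lambda>k. if e k then p else Id C (Dom C f)"
  have fam: "(\<lambda>k. Cod C (?c k)) = (\<lambda>k. K_obj C (p \<bullet> f) (e k))" "(\<lambda>k. Dom C (?c k)) = (\<lambda>k. K_obj C f (e k))"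
    using f p by (auto simp: K_obj_def)
  have "?c \<circ> inv' \<sigma> = (\<lambda>k. if (e \<circ> inv' \<sigma>) k then p else Id C (Dom C f))" by auto
  then show ?thesis
    using permute_natural[OF s, of ?c] f p unfolding fam by auto
qed

text \<open>Every vertex with fewer than \<open>i\<close> ones already occurs in the previous stage,
  so that stage and the top vertices decide.\<close>

lemma Box_ext_top:
  assumes f: "f \<in> Arr C" and i: "1 \<le> i" and u: "u \<in> Arr C" "v \<in> Arr C" "Dom C u = Box C n i f"
    "Dom C v = Box C n i f" "Cod C u = Cod C v"
    and low: "u \<bullet> Box_map C n i f = v \<bullet> Box_map C n i f"
    and top: "\<And>e. \<lbrakk>e \<in> tuples n i; card {k. e k} = i\<rbrakk> \<Longrightarrow> u \<bullet> Box_leg C n i f e = v \<bullet> Box_leg C n i f e"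
  shows "u = v"
proof (rule Box_ext[OF f u])
  note B = Box_map[OF f, where n=n and i=i]
  fix e assume e: "e \<in> tuples n i"
  show "u \<bullet> Box_leg C n i f e = v \<bullet> Box_leg C n i f e"
  proof (cases "card {k. e k} = i")
    case False
    then have e': "e \<in> tuples n (i - 1)" using e i by (auto simp: tuples_def)
    have "w \<bullet> Box_leg C n i f e = (w \<bullet> Box_map C n i f) \<bullet> Box_leg C n (i - 1) f e"
      if "w \<in> Arr C" "Dom C w = Box C n i f" for w
      using that B(1-3) B(4)[OF e'] e' f by simp
    then show ?thesis using u low by simp
  qed (use top e in blast)
qed

text \<open>The subquotient is the coproduct of the objects \<open>X\<^sup>\<and>\<^sup>(\<^sup>n\<^sup>-\<^sup>i\<^sup>) \<and> Z\<^sup>\<and>\<^sup>i\<close> with all arrangements of the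
  factors; in the notation used here these are the corners of the cube of \<open>X \<rightarrow> Z\<close>.\<close>

lemma Box_quotient_corners:
  assumes pt: "pointed C" and f: "f \<in> Arr C" and p: "is_coker C {f} p" and i: "1 \<le> i" "i \<le> n"
    and Q: "is_coker C {Box_map C n i f} \<rho>"
  obtains r where
    "\<And>e. \<lbrakk>e \<in> tuples n i; card {k. e k} = i\<rbrakk> \<Longrightarrow> r e \<in> Arr C \<and> Dom C (r e) = cube_obj C n (p \<bullet> f) e \<and>
      Cod C (r e) = Cod C \<rho> \<and> r e \<bullet> cube_proj n p (Dom C f) e = \<rho> \<bullet> Box_leg C n i f e"
    "\<And>U m. \<lbrakk>U \<in> Obj C; \<And>e. \<lbrakk>e \<in> tuples n i; card {k. e k} = i\<rbrakk> \<Longrightarrow>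
      m e \<in> Arr C \<and> Dom C (m e) = cube_obj C n (p \<bullet> f) e \<and> Cod C (m e) = U\<rbrakk> \<Longrightarrow>
      \<exists>u. u \<in> Hom C (Cod C \<rho>) U \<and> (\<forall>e. e \<in> tuples n i \<longrightarrow> card {k. e k} = i \<longrightarrow> u \<bullet> r e = m e)"
    "\<And>u v. \<lbrakk>u \<in> Arr C; v \<in> Arr C; Dom C u = Cod C \<rho>; Dom C v = Cod C \<rho>; Cod C u = Cod C v;
      \<And>e. \<lbrakk>e \<in> tuples n i; card {k. e k} = i\<rbrakk> \<Longrightarrow> u \<bullet> r e = v \<bullet> r e\<rbrakk> \<Longrightarrow> u = v"
proof -
  note B = Box_map[OF f, where n=n and i=i]
  have n: "0 < n" using i by simp
  have pa: "p \<in> Arr C" "Dom C p = Cod C f" using p by (auto simp: is_coker_def)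
  have \<rho>: "\<rho> \<in> Arr C" "Dom C \<rho> = Box C n i f" "null C (\<rho> \<bullet> Box_map C n i f)"
    using Q B(3) by (auto simp: is_coker_def)
  let ?g = "p \<bullet> f" and ?c = "cube_proj n p (Dom C f)"
  note c = cube_coker[OF pt f p n] and ca = cube_proj_arr[OF f pa refl, of n]
  \<comment> \<open>Edges into a top vertex come from the previous stage, which the quotient kills;
    therefore the leg at that vertex descends to the corner.\<close>
  have below: "null C ((\<rho> \<bullet> Box_leg C n i f e) \<bullet> cube_arr C n f d e)"
    if e: "e \<in> tuples n i" and d: "d < e" for d e
  proof -
    note d' = below_tuples[OF e d]
    have "(\<rho> \<bullet> Box_leg C n i f e) \<bullet> cube_arr C n f d e = (\<rho> \<bullet> Box_map C n i f) \<bullet> Box_leg C n (i - 1) f d"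
      using Box_leg_comp[OF f tuples_mono[OF d'] e less_imp_le[OF d]] B(1-3) B(4)[OF d'] \<rho>(1,2) e d d' f
      by simp
    then show ?thesis
      using null_comp_right[OF \<rho>(3), of "Box_leg C n (i - 1) f d"] B(1-3) \<rho>(1,2) d' f by simp
  qed
  have removal: "e(k := False) < e" if "e k" for e :: "nat \<Rightarrow> bool" and k
    using that by (auto simp: less_fun_def le_fun_def)
  have "\<forall>e \<in> {e \<in> tuples n i. card {k. e k} = i}. \<exists>r. r \<in> Arr C \<and> Dom C r = cube_obj C n ?g e \<and>
      Cod C r = Cod C \<rho> \<and> r \<bullet> ?c e = \<rho> \<bullet> Box_leg C n i f e"
  proof
    fix e assume "e \<in> {e \<in> tuples n i. card {k. e k} = i}"
    then have e: "e \<in> tuples n i" by simp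
    obtain r where "r \<in> Arr C" "Dom C r = Cod C (?c e)" "Cod C r = Cod C (\<rho> \<bullet> Box_leg C n i f e)"
      "r \<bullet> ?c e = \<rho> \<bullet> Box_leg C n i f e"
    proof (rule coker_desc[OF c[of e]])
      fix s assume "s \<in> {cube_arr C n f (e(k := False)) e |k. k \<in> {1..n} \<and> e k}"
      then show "null C ((\<rho> \<bullet> Box_leg C n i f e) \<bullet> s)" using below[OF e] removal by blast
    qed (use \<rho> e f ca in auto)
    then show "\<exists>r. r \<in> Arr C \<and> Dom C r = cube_obj C n ?g e \<and>
      Cod C r = Cod C \<rho> \<and> r \<bullet> ?c e = \<rho> \<bullet> Box_leg C n i f e"
      using ca(3)[of e] \<rho> e f by (intro exI[of _ r]) simp
  qed
  from bchoice[OF this] obtain r where r: "\<And>e. \<lbrakk>e \<in> tuples n i; card {k. e k} = i\<rbrakk> \<Longrightarrow>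
      r e \<in> Arr C \<and> Dom C (r e) = cube_obj C n ?g e \<and> Cod C (r e) = Cod C \<rho> \<and>
      r e \<bullet> ?c e = \<rho> \<bullet> Box_leg C n i f e" by blast
  have ext: "u = v" if uv: "u \<in> Arr C" "v \<in> Arr C" "Dom C u = Cod C \<rho>" "Dom C v = Cod C \<rho>" "Cod C u = Cod C v"
      and eq: "\<And>e. \<lbrakk>e \<in> tuples n i; card {k. e k} = i\<rbrakk> \<Longrightarrow> u \<bullet> r e = v \<bullet> r e" for u v
  proof -
    have "u \<bullet> \<rho> = v \<bullet> \<rho>"
    proof (rule Box_ext_top[OF f i(1), of _ _ n])
      have "null C (u \<bullet> (\<rho> \<bullet> Box_map C n i f))" "null C (v \<bullet> (\<rho> \<bullet> Box_map C n i f))"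
        using null_comp_left[OF \<rho>(3)] uv \<rho> B(1,3) by simp_all
      then have "u \<bullet> (\<rho> \<bullet> Box_map C n i f) = v \<bullet> (\<rho> \<bullet> Box_map C n i f)"
        using uv \<rho> B(1,3) by (intro null_eq) simp_all
      then show "(u \<bullet> \<rho>) \<bullet> Box_map C n i f = (v \<bullet> \<rho>) \<bullet> Box_map C n i f"
        using uv \<rho> B(1,3) by simp
      fix e assume e: "e \<in> tuples n i" "card {k. e k} = i"
      have re: "r e \<in> Arr C" "Dom C (r e) = cube_obj C n ?g e" "Cod C (r e) = Cod C \<rho>"
        "\<rho> \<bullet> Box_leg C n i f e = r e \<bullet> ?c e" using r[OF e] by auto
      have "(w \<bullet> \<rho>) \<bullet> Box_leg C n i f e = (w \<bullet> r e) \<bullet> ?c e" if "w \<in> Arr C" "Dom C w = Cod C \<rho>" for w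
        using that re ca[of e] \<rho> e f by simp
      then show "(u \<bullet> \<rho>) \<bullet> Box_leg C n i f e = (v \<bullet> \<rho>) \<bullet> Box_leg C n i f e"
        using uv eq[OF e] by simp
    qed (use uv \<rho> in simp_all)
    then show "u = v" by (rule coker_ext[OF Q, rotated -1]) (use uv in simp_all)
  qed
  have ump: "\<exists>u. u \<in> Hom C (Cod C \<rho>) U \<and> (\<forall>e. e \<in> tuples n i \<longrightarrow> card {k. e k} = i \<longrightarrow> u \<bullet> r e = m e)"
    if U: "U \<in> Obj C" and m: "\<And>e. \<lbrakk>e \<in> tuples n i; card {k. e k} = i\<rbrakk> \<Longrightarrow>
      m e \<in> Arr C \<and> Dom C (m e) = cube_obj C n ?g e \<and> Cod C (m e) = U" for U m
  proof -
    \<comment> \<open>The previous stage is sent to zero, so the given family can be glued as soon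
      as it vanishes on the edges into each top vertex.\<close>
    obtain z where z: "null C z" "z \<in> Arr C" "Dom C z = Box C n (i - 1) f" "Cod C z = U"
      using null_exists[OF pt, of "Box C n (i - 1) f" U] U f by auto
    have mc: "m e \<bullet> ?c e \<in> Arr C \<and> Dom C (m e \<bullet> ?c e) = cube_obj C n f e \<and> Cod C (m e \<bullet> ?c e) = Cod C z"
      if e: "e \<in> tuples n i" "card {k. e k} = i" for e
      using m[OF e] ca[of e] z by simp
    have mz: "(m e \<bullet> ?c e) \<bullet> cube_arr C n f d e = z \<bullet> Box_leg C n (i - 1) f d"
      if e: "e \<in> tuples n i" "card {k. e k} = i" and d: "d < e" for d e
    proof -
      have me: "m e \<in> Arr C" "Dom C (m e) = cube_obj C n ?g e" "Cod C (m e) = U" using m[OF e] by auto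
      have le: "d \<le> e" using d by simp
      \<comment> \<open>Some one of \<open>e\<close> is missing in \<open>d\<close>; the edge from
        \<open>d\<close> factors through \<open>e\<close> with that one erased, and
        \<open>cube_coker\<close> makes the last part of it zero.\<close>
      obtain k where k: "e k" "\<not> d k" using d by (auto simp: less_fun_def le_fun_def)
      have kn: "k \<in> {1..n}" using k e by (auto simp: tuples_def)
      have dk: "d \<le> e(k := False)" using d k by (auto simp: less_fun_def le_fun_def)
      note ek = less_imp_le[OF removal[of e k, OF k(1)]]
      have nc: "null C (?c e \<bullet> cube_arr C n f (e(k := False)) e)"
        using c[of e] k kn unfolding is_coker_def by blast
      have "null C ((?c e \<bullet> cube_arr C n f (e(k := False)) e) \<bullet> cube_arr C n f d (e(k := False)))"
        by (rule null_comp_right[OF nc]) (use ca[of e] f ek dk in \<open>simp_all del: fun_upd_apply\<close>)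
      then have nd: "null C (?c e \<bullet> cube_arr C n f d e)"
        using ca[of e] f ek dk cube_arr_comp[OF f dk ek] by (simp del: fun_upd_apply)
      have "null C (m e \<bullet> (?c e \<bullet> cube_arr C n f d e))"
        by (rule null_comp_left[OF nd]) (use me ca[of e] f le in simp_all)
      moreover have "null C (z \<bullet> Box_leg C n (i - 1) f d)"
        using null_comp_right[OF z(1)] z below_tuples[OF e(1) d] f by simp
      ultimately show "(m e \<bullet> ?c e) \<bullet> cube_arr C n f d e = z \<bullet> Box_leg C n (i - 1) f d"
        using me ca[of e] f le z below_tuples[OF e(1) d] by (intro null_eq) simp_all
    qed
    obtain w where w: "w \<in> Arr C" "Dom C w = Box C n i f" "Cod C w = Cod C z" "w \<bullet> Box_map C n i f = z"
      "\<And>e. \<lbrakk>e \<in> tuples n i; card {k. e k} = i\<rbrakk> \<Longrightarrow> w \<bullet> Box_leg C n i f e = m e \<bullet> ?c e"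
    proof (rule Box_extend[OF f i(1) z(2,3) mc mz], goal_cases)
      case (6 w)
      show ?case by (rule 6(1)[OF 6(2-6)])
    qed
    obtain u where u: "u \<in> Arr C" "Dom C u = Cod C \<rho>" "Cod C u = Cod C w" "u \<bullet> \<rho> = w"
      by (rule coker_desc[OF Q w(1)]) (use w(2,4) z(1) \<rho>(2) in auto)
    have "u \<bullet> r e = m e" if e: "e \<in> tuples n i" "card {k. e k} = i" for e
    proof -
      have re: "r e \<in> Arr C" "Dom C (r e) = cube_obj C n ?g e" "Cod C (r e) = Cod C \<rho>"
        "r e \<bullet> ?c e = \<rho> \<bullet> Box_leg C n i f e" using r[OF e] by auto
      have "(u \<bullet> r e) \<bullet> ?c e = (u \<bullet> \<rho>) \<bullet> Box_leg C n i f e"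
        using u(1,2) re ca[of e] \<rho> e f by simp
      also have "\<dots> = m e \<bullet> ?c e" using u(4) w(5)[OF e] by simp
      finally show ?thesis
        by (rule coker_ext[OF c, rotated -1]) (use u re ca[of e] m[OF e] in simp_all)
    qed
    then show ?thesis using u w z by (intro exI[of _ u]) simp
  qed
  show ?thesis by (rule that[OF r ump ext])
qed

text \<open>The universal morphism is the corner at the vertex with its ones at the end, read on two
  blocks through \<open>?J\<close>. The stabilizer of that vertex is the block subgroup, so an
  equivariant morphism out of the two blocks spreads uniquely over all corners, and these jointly
  determine morphisms out of the quotient.\<close>

lemma Box_quot_is_cor:
  assumes pt: "pointed C" and f: "f \<in> Arr C" and p: "is_coker C {f} p" and q: "1 \<le> q"
    and quot: "quotient C (Box_map C (a + q) q f) = (Q, \<rho>, z)" "is_quotient C (Box_map C (a + q) q f) Q \<rho> z"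
  obtains e where "is_cor C (sym_group (a + q)) (block_subgroup a q)
    (fst (block_object C a q (Dom C f) (Cod C p))) (snd (block_object C a q (Dom C f) (Cod C p)))
    (fst (Box_quot C (a + q) q f)) (snd (Box_quot C (a + q) q f)) e"
proof -
  let ?n = "a + q" and ?g = "p \<bullet> f" and ?e0 = "shift_tuple a (full_tuple q)"
  have pa: "p \<in> Arr C" "Dom C p = Cod C f" using p by (auto simp: is_coker_def)
  have g: "?g \<in> Arr C" "Dom C ?g = Dom C f" "Cod C ?g = Cod C p" using f pa by simp_all
  have q0: "0 < q" and qn: "q \<le> ?n" using q by simp_all
  note B = Box_map[OF f, where n="?n" and i=q]
  have Qc: "is_coker C {Box_map C ?n q f} \<rho>" by (rule quotient_coker[OF pt quot(2)])
  obtain T t where po: "is_pushout C (Box_map C ?n q f) t Q \<rho> z"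
    using quot(2) by (auto simp: is_quotient_def)
  have \<rho>: "\<rho> \<in> Arr C" "Dom C \<rho> = Box C ?n q f" "Cod C \<rho> = Q"
    using pushout_arr(1-3)[OF po] B(3) by simp_all
  obtain r where r: "\<And>e. \<lbrakk>e \<in> tuples ?n q; card {k. e k} = q\<rbrakk> \<Longrightarrow> r e \<in> Arr C \<and> Dom C (r e) = cube_obj C ?n ?g e \<and>
      Cod C (r e) = Cod C \<rho> \<and> r e \<bullet> cube_proj ?n p (Dom C f) e = \<rho> \<bullet> Box_leg C ?n q f e"
    and ump: "\<And>U m. \<lbrakk>U \<in> Obj C; \<And>e. \<lbrakk>e \<in> tuples ?n q; card {k. e k} = q\<rbrakk> \<Longrightarrow>
      m e \<in> Arr C \<and> Dom C (m e) = cube_obj C ?n ?g e \<and> Cod C (m e) = U\<rbrakk> \<Longrightarrow>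
      \<exists>u. u \<in> Hom C (Cod C \<rho>) U \<and> (\<forall>e. e \<in> tuples ?n q \<longrightarrow> card {k. e k} = q \<longrightarrow> u \<bullet> r e = m e)"
    and ext: "\<And>u v. \<lbrakk>u \<in> Arr C; v \<in> Arr C; Dom C u = Cod C \<rho>; Dom C v = Cod C \<rho>; Cod C u = Cod C v;
      \<And>e. \<lbrakk>e \<in> tuples ?n q; card {k. e k} = q\<rbrakk> \<Longrightarrow> u \<bullet> r e = v \<bullet> r e\<rbrakk> \<Longrightarrow> u = v"
  proof (rule Box_quotient_corners[OF pt f p q qn Qc], goal_cases)
    case (1 r)
    show ?case by (rule 1(1)[OF 1(2-4)])
  qed
  let ?b = "snd (Box_quot C ?n q f)"
  note QA = Box_quot_action[OF f quot]
  have bh: "?b \<sigma> \<in> Arr C" "Dom C (?b \<sigma>) = Q" "Cod C (?b \<sigma>) = Q" if "\<sigma> permutes {1..?n}" for \<sigma>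
    using QA(1) that unfolding QA(3) by (auto simp: action_def sym_group_carrier)
  \<comment> \<open>The action permutes the corners as it permutes the vertices; this may be checked
    on the cube of \<open>f\<close> because the corner projections are epimorphisms.\<close>
  have equi: "?b \<sigma> \<bullet> r e = r (e \<circ> inv' \<sigma>) \<bullet> cube_perm C ?n ?g \<sigma> e"
    if s: "\<sigma> permutes {1..?n}" and e: "e \<in> tuples ?n q" "card {k. e k} = q" for \<sigma> e
  proof -
    have e': "e \<circ> inv' \<sigma> \<in> tuples ?n q" "card {k. (e \<circ> inv' \<sigma>) k} = q"
      using permuted_tuples[OF s e(1)] card_permuted[OF s, of e] e(2) by simp_all
    let ?c = "cube_proj ?n p (Dom C f)"
    note c = cube_proj_arr[OF f pa refl, of ?n]
    have re: "r e \<in> Arr C" "Dom C (r e) = cube_obj C ?n ?g e" "Cod C (r e) = Q" "r e \<bullet> ?c e = \<rho> \<bullet> Box_leg C ?n q f e"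
      using r[OF e] \<rho> by auto
    have re': "r (e \<circ> inv' \<sigma>) \<in> Arr C" "Dom C (r (e \<circ> inv' \<sigma>)) = cube_obj C ?n ?g (e \<circ> inv' \<sigma>)"
      "Cod C (r (e \<circ> inv' \<sigma>)) = Q" "r (e \<circ> inv' \<sigma>) \<bullet> ?c (e \<circ> inv' \<sigma>) = \<rho> \<bullet> Box_leg C ?n q f (e \<circ> inv' \<sigma>)"
      using r[OF e'] \<rho> by (simp_all del: comp_apply)
    note P = cube_perm_arr[OF s f, of e] cube_perm_arr[OF s g(1), of e]
    note A = Box_act[OF f s, where i=q]
    have "(?b \<sigma> \<bullet> r e) \<bullet> ?c e = (?b \<sigma> \<bullet> \<rho>) \<bullet> Box_leg C ?n q f e"
      using bh[OF s] re c[of e] \<rho> e(1) f by simp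
    also have "\<dots> = \<rho> \<bullet> (Box_act C ?n q f \<sigma> \<bullet> Box_leg C ?n q f e)"
      unfolding QA(2)[OF s] using \<rho> A(1-3) e(1) f by simp
    also have "\<dots> = (\<rho> \<bullet> Box_leg C ?n q f (e \<circ> inv' \<sigma>)) \<bullet> cube_perm C ?n f \<sigma> e"
      unfolding A(4)[OF e(1)] using \<rho> P e'(1) f by (simp del: comp_apply)
    also have "\<dots> = (r (e \<circ> inv' \<sigma>) \<bullet> ?c (e \<circ> inv' \<sigma>)) \<bullet> cube_perm C ?n f \<sigma> e"
      by (simp only: re'(4))
    also have "\<dots> = r (e \<circ> inv' \<sigma>) \<bullet> (cube_perm C ?n ?g \<sigma> e \<bullet> ?c e)"
      unfolding cube_perm_proj[OF s f pa] using re'(1-3) P c[of "e \<circ> inv' \<sigma>"] by (simp del: comp_apply)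
    also have "\<dots> = (r (e \<circ> inv' \<sigma>) \<bullet> cube_perm C ?n ?g \<sigma> e) \<bullet> ?c e"
      using re'(1-3) P c[of e] by (simp del: comp_apply)
    finally show ?thesis
      by (rule coker_ext[OF cube_coker[OF pt f p], rotated -1])
        (use bh[OF s] re(1-3) re'(1-3) P c[of e] q in \<open>simp_all del: comp_apply\<close>)
  qed
  let ?J = "block_join a q ?g (full_tuple q)" and ?W = "tensor_pow C a (Dom C f) \<diamondop> tensor_pow C q (Cod C p)"
  let ?w = "\<lambda>\<sigma>. pow_act C a (Dom C f) (left_block a \<sigma>) \<diamond> pow_act C q (Cod C p) (right_block a q \<sigma>)"
  have W: "fst (block_object C a q (Dom C f) (Cod C p)) = ?W" "snd (block_object C a q (Dom C f) (Cod C p)) = ?w"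
    by (simp_all add: block_object_def)
  have J: "iso_arr C ?J" "Dom C ?J = ?W" "Cod C ?J = cube_obj C ?n ?g ?e0"
    using block_join_arr[OF g(1) q0, of a "full_tuple q"] cube_full[of q ?g] g by simp_all
  have wa: "?w \<sigma> \<in> Arr C" "Dom C (?w \<sigma>) = ?W" "Cod C (?w \<sigma>) = ?W" if "\<sigma> \<in> block_subgroup a q" for \<sigma>
    using block_subgroupD[OF that] f pa by simp_all
  have Jw: "cube_perm C ?n ?g \<sigma> ?e0 \<bullet> ?J = ?J \<bullet> ?w \<sigma>" if s: "\<sigma> \<in> block_subgroup a q" for \<sigma>
  proof -
    note S = block_subgroupD[OF s]
    have "{k. full_tuple q k} \<subseteq> {1..q}" by auto
    then show ?thesis
      using block_join_equivariant[OF g(1) q0 s, of "full_tuple q"] cube_perm_full[OF S(3), of ?g]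
      unfolding full_tuple_permuted[OF S(3)] g by auto
  qed
  note e0 = shift_full_tuples[of a q]
  have r0: "r ?e0 \<in> Arr C" "Dom C (r ?e0) = cube_obj C ?n ?g ?e0" "Cod C (r ?e0) = Q"
    using r[OF e0] \<rho> by auto
  have "is_cor C (sym_group ?n) (block_subgroup a q) ?W ?w Q ?b (r ?e0 \<bullet> ?J)"
    unfolding is_cor_def
  proof (intro conjI allI impI)
    show "action C (sym_group ?n) Q ?b" using QA(1) unfolding QA(3) .
    show "r ?e0 \<bullet> ?J \<in> Hom C ?W Q" using r0 J by simp
    show "equivariant C (block_subgroup a q) ?w ?b (r ?e0 \<bullet> ?J)"
      unfolding equivariant_def
    proof
      fix \<sigma> assume s: "\<sigma> \<in> block_subgroup a q"
      note s' = block_subgroupD(1)[OF s]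
      have st: "?e0 \<circ> inv' \<sigma> = ?e0" using stabilizer_block[OF s'] s by simp
      note P = cube_perm_arr[OF s' g(1), of ?e0]
      have "(r ?e0 \<bullet> ?J) \<bullet> ?w \<sigma> = r ?e0 \<bullet> (?J \<bullet> ?w \<sigma>)"
        using r0 J wa[OF s] by simp
      also have "\<dots> = (r (?e0 \<circ> inv' \<sigma>) \<bullet> cube_perm C ?n ?g \<sigma> ?e0) \<bullet> ?J"
        unfolding Jw[OF s, symmetric] st using r0 J P[unfolded st] by simp
      also have "\<dots> = ?b \<sigma> \<bullet> r ?e0 \<bullet> ?J"
        unfolding equi[OF s' e0, symmetric] using bh[OF s'] r0 J by simp
      finally show "(r ?e0 \<bullet> ?J) \<bullet> ?w \<sigma> = ?b \<sigma> \<bullet> r ?e0 \<bullet> ?J" .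
    qed
    fix U d k
    assume A: "action C (sym_group ?n) U d \<and> k \<in> Hom C ?W U \<and> equivariant C (block_subgroup a q) ?w d k"
    then have act: "action C (sym_group ?n) U d" and k: "k \<in> Arr C" "Dom C k = ?W" "Cod C k = U"
      and keq: "\<And>\<sigma>. \<sigma> \<in> block_subgroup a q \<Longrightarrow> k \<bullet> ?w \<sigma> = d \<sigma> \<bullet> k"
      by (auto simp: equivariant_def)
    have Uo: "U \<in> Obj C" using act by (simp add: action_def)
    have dh: "d \<sigma> \<in> Arr C" "Dom C (d \<sigma>) = U" "Cod C (d \<sigma>) = U" if "\<sigma> permutes {1..?n}" for \<sigma>
      using act that by (auto simp: action_def sym_group_carrier)
    \<comment> \<open>The given morphism, moved from the two blocks to the bracketing of the corner
      \<open>?e0\<close>.\<close>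
    define k0 where "k0 = k \<bullet> inverse_arr C ?J"
    have k0: "k0 \<in> Arr C" "Dom C k0 = cube_obj C ?n ?g ?e0" "Cod C k0 = U" "k0 \<bullet> ?J = k"
      using k J by (simp_all add: k0_def)
    have stab: "k0 \<bullet> cube_perm C ?n ?g \<sigma> ?e0 = d \<sigma> \<bullet> k0"
      if s': "\<sigma> permutes {1..?n}" and st: "?e0 \<circ> inv' \<sigma> = ?e0" for \<sigma>
    proof (rule iso_cancel_right[OF J(1)])
      have s: "\<sigma> \<in> block_subgroup a q" using stabilizer_block[OF s'] st by simp
      note P = cube_perm_arr[OF s' g(1), of ?e0, unfolded st]
      have "(k0 \<bullet> cube_perm C ?n ?g \<sigma> ?e0) \<bullet> ?J = k0 \<bullet> (?J \<bullet> ?w \<sigma>)"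
        unfolding Jw[OF s, symmetric] using k0(1-3) P J by simp
      also have "\<dots> = (k0 \<bullet> ?J) \<bullet> ?w \<sigma>" using k0(1-3) J wa[OF s] by simp
      also have "\<dots> = d \<sigma> \<bullet> (k0 \<bullet> ?J)" by (simp only: k0(4) keq[OF s])
      also have "\<dots> = (d \<sigma> \<bullet> k0) \<bullet> ?J" using k0(1-3) J dh[OF s'] by simp
      finally show "(k0 \<bullet> cube_perm C ?n ?g \<sigma> ?e0) \<bullet> ?J = (d \<sigma> \<bullet> k0) \<bullet> ?J" .
      show "k0 \<bullet> cube_perm C ?n ?g \<sigma> ?e0 \<in> Arr C" "d \<sigma> \<bullet> k0 \<in> Arr C"
        "Dom C (k0 \<bullet> cube_perm C ?n ?g \<sigma> ?e0) = Cod C ?J" "Dom C (d \<sigma> \<bullet> k0) = Cod C ?J"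
        using k0(1-3) P J dh[OF s'] by simp_all
    qed
    obtain l where l: "\<And>\<tau>. \<tau> permutes {1..?n} \<Longrightarrow> l (?e0 \<circ> inv' \<tau>) \<in> Arr C \<and>
        Dom C (l (?e0 \<circ> inv' \<tau>)) = cube_obj C ?n ?g (?e0 \<circ> inv' \<tau>) \<and> Cod C (l (?e0 \<circ> inv' \<tau>)) = U \<and>
        l (?e0 \<circ> inv' \<tau>) \<bullet> cube_perm C ?n ?g \<tau> ?e0 = d \<tau> \<bullet> k0"
      and l_eq: "\<And>\<sigma> \<tau>. \<lbrakk>\<sigma> permutes {1..?n}; \<tau> permutes {1..?n}\<rbrakk> \<Longrightarrow>
        l (?e0 \<circ> inv' \<tau> \<circ> inv' \<sigma>) \<bullet> cube_perm C ?n ?g \<sigma> (?e0 \<circ> inv' \<tau>) = d \<sigma> \<bullet> l (?e0 \<circ> inv' \<tau>)"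
    proof (rule equivariant_extend[OF g(1) act k0(1-3) stab], goal_cases)
      case (3 l)
      show ?case by (rule 3(1)[OF 3(2-3)])
    qed
    \<comment> \<open>The extended family was only specified through permutations of
      \<open>?e0\<close>; at the identity it returns \<open>k0\<close>.\<close>
    have l0: "l ?e0 = k0"
    proof -
      have "d id = Id C U" using act by (simp add: action_def sym_group_one)
      moreover have "l ?e0 \<in> Arr C \<and> Dom C (l ?e0) = cube_obj C ?n ?g ?e0 \<and> Cod C (l ?e0) = U \<and>
          l ?e0 \<bullet> cube_perm C ?n ?g id ?e0 = d id \<bullet> k0"
        using l[OF permutes_id] by (simp only: inv_id comp_id)
      then have "l ?e0 \<in> Arr C" "Dom C (l ?e0) = cube_obj C ?n ?g ?e0"
        "l ?e0 \<bullet> cube_perm C ?n ?g id ?e0 = d id \<bullet> k0" by blast+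
      ultimately show ?thesis
        using k0(1-3) cube_perm_id[OF g(1), of ?n ?e0] by simp
    qed
    have la: "l e \<in> Arr C \<and> Dom C (l e) = cube_obj C ?n ?g e \<and> Cod C (l e) = U"
      if "e \<in> tuples ?n q" "card {k. e k} = q" for e
      using top_tuple_orbit[OF that] l by metis
    obtain u where u: "u \<in> Hom C Q U" and ul: "\<And>e. \<lbrakk>e \<in> tuples ?n q; card {k. e k} = q\<rbrakk> \<Longrightarrow> u \<bullet> r e = l e"
      using ump[OF Uo la] \<rho>(3) by blast
    show "\<exists>!u. u \<in> Hom C Q U \<and> equivariant C (carrier (sym_group ?n)) ?b d u \<and> u \<bullet> (r ?e0 \<bullet> ?J) = k"
    proof (rule ex1I[of _ u], intro conjI)
      show "u \<in> Hom C Q U" by (rule u)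
      show "u \<bullet> (r ?e0 \<bullet> ?J) = k"
        using comp_reassoc[OF ul[OF e0], of ?J] u r0 J k0(4) l0 by simp
      show "equivariant C (carrier (sym_group ?n)) ?b d u"
        unfolding equivariant_def sym_group_carrier
      proof (intro ballI)
        fix \<sigma> assume "\<sigma> \<in> carrier (sym_group ?n)"
        then have s: "\<sigma> permutes {1..?n}" by (simp add: sym_group_carrier)
        show "u \<bullet> ?b \<sigma> = d \<sigma> \<bullet> u"
        proof (rule ext)
          fix e assume e: "e \<in> tuples ?n q" "card {k. e k} = q"
          obtain \<tau> where t: "\<tau> permutes {1..?n}" and et: "e = ?e0 \<circ> inv' \<tau>"
            using top_tuple_orbit[OF e] .
          have e': "e \<circ> inv' \<sigma> \<in> tuples ?n q" "card {k. (e \<circ> inv' \<sigma>) k} = q"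
            using permuted_tuples[OF s e(1)] card_permuted[OF s, of e] e(2) by simp_all
          have re: "r e \<in> Arr C" "Cod C (r e) = Q" "r (e \<circ> inv' \<sigma>) \<in> Arr C"
            "Dom C (r (e \<circ> inv' \<sigma>)) = cube_obj C ?n ?g (e \<circ> inv' \<sigma>)" "Cod C (r (e \<circ> inv' \<sigma>)) = Q"
            using r[OF e] r[OF e'] \<rho> by (simp_all del: comp_apply)
          note P = cube_perm_arr[OF s g(1), of e]
          have "(u \<bullet> ?b \<sigma>) \<bullet> r e = u \<bullet> (?b \<sigma> \<bullet> r e)"
            using u bh[OF s] re by simp
          also have "\<dots> = (u \<bullet> r (e \<circ> inv' \<sigma>)) \<bullet> cube_perm C ?n ?g \<sigma> e"
            unfolding equi[OF s e] using u re P by (simp del: comp_apply)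
          also have "\<dots> = d \<sigma> \<bullet> (u \<bullet> r e)"
            unfolding ul[OF e'] ul[OF e] unfolding et by (rule l_eq[OF s t])
          also have "\<dots> = (d \<sigma> \<bullet> u) \<bullet> r e"
            using u dh[OF s] re by simp
          finally show "(u \<bullet> ?b \<sigma>) \<bullet> r e = (d \<sigma> \<bullet> u) \<bullet> r e" .
        qed (use u bh[OF s] dh[OF s] \<rho>(3) in simp_all)
      qed
      fix v assume v: "v \<in> Hom C Q U \<and> equivariant C (carrier (sym_group ?n)) ?b d v \<and> v \<bullet> (r ?e0 \<bullet> ?J) = k"
      \<comment> \<open>Any competitor agrees with \<open>u\<close> at \<open>?e0\<close>, and
        equivariance then forces its value at every other corner.\<close>
      have v0: "v \<bullet> r ?e0 = k0"
        by (rule iso_cancel_right[OF J(1)]) (use v r0 J k0 in auto)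
      show "v = u"
      proof (rule ext)
        fix e assume e: "e \<in> tuples ?n q" "card {k. e k} = q"
        obtain \<tau> where t: "\<tau> permutes {1..?n}" and et: "e = ?e0 \<circ> inv' \<tau>"
          using top_tuple_orbit[OF e] .
        have re: "r e \<in> Arr C" "Dom C (r e) = cube_obj C ?n ?g e" "Cod C (r e) = Q" using r[OF e] \<rho> by auto
        note P = cube_perm_arr[OF t g(1), of ?e0, folded et]
        have vb: "v \<bullet> ?b \<tau> = d \<tau> \<bullet> v"
          using v t by (auto simp: equivariant_def sym_group_carrier)
        have "(v \<bullet> r e) \<bullet> cube_perm C ?n ?g \<tau> ?e0 = v \<bullet> (?b \<tau> \<bullet> r ?e0)"
          unfolding equi[OF t e0] et[symmetric] using v re P by simp
        also have "\<dots> = (v \<bullet> ?b \<tau>) \<bullet> r ?e0" using v bh[OF t] r0 by simp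
        also have "\<dots> = d \<tau> \<bullet> k0" unfolding vb using v dh[OF t] r0 v0 by simp
        also have "\<dots> = l e \<bullet> cube_perm C ?n ?g \<tau> ?e0" using l[OF t] unfolding et[symmetric] by simp
        finally have "v \<bullet> r e = l e"
          by (rule iso_cancel_right[OF P(4)]) (use v re P la[OF e] in simp_all)
        then show "v \<bullet> r e = u \<bullet> r e" by (simp only: ul[OF e])
      qed (use u v \<rho>(3) in simp_all)
    qed
  qed
  from that[unfolded W QA(3), OF this] show ?thesis .
qed

end

section \<open>The objects of orbits\<close>

context closed_symmetric_monoidal_model_category
begin

lemma tBox_orbit:
  "f \<in> Arr C \<Longrightarrow> is_orbit C (sym_group n) (Box C n i f) (Box_act C n i f) (tBox C n i f)
    (orbit_proj C (sym_group n) (Box C n i f) (Box_act C n i f))"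
  unfolding tBox_def
  by (rule is_orbit_orbit_obj[OF finite_colimits sym_group_is_group finite_sym_group Box_action])

lemma sym_pow_orbit:
  "X \<in> Obj C \<Longrightarrow> is_orbit C (sym_group n) (tensor_pow C n X) (pow_act C n X) (sym_pow C n X)
    (orbit_proj C (sym_group n) (tensor_pow C n X) (pow_act C n X))"
  unfolding sym_pow_def
  by (rule is_orbit_orbit_obj[OF finite_colimits sym_group_is_group finite_sym_group pow_action])

abbreviation tBox_proj :: "nat \<Rightarrow> nat \<Rightarrow> 'm \<Rightarrow> 'm" where
  "tBox_proj n i f \<equiv> orbit_proj C (sym_group n) (Box C n i f) (Box_act C n i f)"

abbreviation pow_proj :: "nat \<Rightarrow> 'o \<Rightarrow> 'm" where
  "pow_proj n X \<equiv> orbit_proj C (sym_group n) (tensor_pow C n X) (pow_act C n X)"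

lemma tBox_map:
  assumes f: "f \<in> Arr C"
  shows "tBox_map C n i f \<in> Arr C" "Dom C (tBox_map C n i f) = tBox C n (i - 1) f"
    "Cod C (tBox_map C n i f) = tBox C n i f"
    "tBox_map C n i f \<bullet> tBox_proj n (i - 1) f = tBox_proj n i f \<bullet> Box_map C n i f"
  unfolding tBox_map_def tBox_def
  by (rule orbit_map[OF tBox_orbit[OF f, unfolded tBox_def] tBox_orbit[OF f, unfolded tBox_def]],
      use Box_map[OF f, where n=n and i=i] Box_map_equivariant[OF f] in \<open>simp_all add: sym_group_carrier\<close>)+

lemma full_tuples: "full_tuple n \<in> tuples n n"
  by (simp add: tuples_def del: atLeastAtMost_iff)

lemma le_full: "e \<in> tuples n i \<Longrightarrow> e \<le> full_tuple n"
  by (auto simp: tuples_def le_fun_def)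

lemma Box_to_pow:
  assumes f: "f \<in> Arr C"
  shows "Box_to_pow C n f \<in> Arr C" "Dom C (Box_to_pow C n f) = Box C n (n - 1) f"
    "Cod C (Box_to_pow C n f) = tensor_pow C n (Cod C f)"
    "e \<in> tuples n (n - 1) \<Longrightarrow> Box_to_pow C n f \<bullet> Box_leg C n (n - 1) f e = cube_arr C n f e (full_tuple n)"
proof -
  let ?k = "\<lambda>e. on_arr (K_pow C n f) (e, full_tuple n)"
  have k: "?k e = cube_arr C n f e (full_tuple n)" for e by (simp add: K_pow_def)
  have "is_cocone (tuple_cat (tuples n (n - 1))) C (K_pow C n f) (tensor_pow C n (Cod C f)) ?k"
    unfolding cube_cocone_iff[OF f] k cube_full[symmetric]
    using f cube_arr_comp[OF f _ le_full] le_full[of _ n "n - 1"] by simp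
  from Box_desc[OF f this]
  show "Box_to_pow C n f \<in> Arr C" "Dom C (Box_to_pow C n f) = Box C n (n - 1) f"
    "Cod C (Box_to_pow C n f) = tensor_pow C n (Cod C f)"
    "e \<in> tuples n (n - 1) \<Longrightarrow> Box_to_pow C n f \<bullet> Box_leg C n (n - 1) f e = cube_arr C n f e (full_tuple n)"
    by (simp_all only: Box_to_pow_def k)
qed

lemma Box_to_pow_equivariant:
  assumes f: "f \<in> Arr C" and s: "\<sigma> permutes {1..n}"
  shows "Box_to_pow C n f \<bullet> Box_act C n (n - 1) f \<sigma> = pow_act C n (Cod C f) \<sigma> \<bullet> Box_to_pow C n f"
proof (rule Box_ext[OF f, of _ _ n "n - 1"])
  note B = Box_to_pow[OF f, where n=n] and A = Box_act[OF f s, where i="n - 1"]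
  fix e assume e: "e \<in> tuples n (n - 1)"
  note e' = permuted_tuples[OF s e]
  note P = cube_perm_arr[OF s f, of e]
  have "(Box_to_pow C n f \<bullet> Box_act C n (n - 1) f \<sigma>) \<bullet> Box_leg C n (n - 1) f e
      = Box_to_pow C n f \<bullet> (Box_act C n (n - 1) f \<sigma> \<bullet> Box_leg C n (n - 1) f e)"
    using B(1-3) A(1-3) e f by simp
  also have "\<dots> = (Box_to_pow C n f \<bullet> Box_leg C n (n - 1) f (e \<circ> inv' \<sigma>)) \<bullet> cube_perm C n f \<sigma> e"
    unfolding A(4)[OF e] using B(1-3) P e' f by (simp del: comp_apply)
  also have "\<dots> = cube_arr C n f (e \<circ> inv' \<sigma>) (full_tuple n \<circ> inv' \<sigma>) \<bullet> cube_perm C n f \<sigma> e"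
    by (simp only: B(4)[OF e'] full_tuple_permuted[OF s])
  also have "\<dots> = pow_act C n (Cod C f) \<sigma> \<bullet> cube_arr C n f e (full_tuple n)"
    by (simp only: cube_perm_natural[OF s f le_full[OF e], symmetric] cube_perm_full[OF s])
  also have "\<dots> = (pow_act C n (Cod C f) \<sigma> \<bullet> Box_to_pow C n f) \<bullet> Box_leg C n (n - 1) f e"
    unfolding B(4)[OF e, symmetric] using B(1-3) e f s by simp
  finally show "(Box_to_pow C n f \<bullet> Box_act C n (n - 1) f \<sigma>) \<bullet> Box_leg C n (n - 1) f e
      = (pow_act C n (Cod C f) \<sigma> \<bullet> Box_to_pow C n f) \<bullet> Box_leg C n (n - 1) f e" .
qed (use Box_to_pow[OF f, where n=n] Box_act[OF f s, where i="n - 1"] f s in simp_all)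

lemma tBox_to_sym_pow:
  assumes f: "f \<in> Arr C"
  shows "tBox_to_sym_pow C n f \<in> Arr C" "Dom C (tBox_to_sym_pow C n f) = tBox C n (n - 1) f"
    "Cod C (tBox_to_sym_pow C n f) = sym_pow C n (Cod C f)"
    "tBox_to_sym_pow C n f \<bullet> tBox_proj n (n - 1) f = pow_proj n (Cod C f) \<bullet> Box_to_pow C n f"
proof -
  have Y: "Cod C f \<in> Obj C" using f by simp
  show "tBox_to_sym_pow C n f \<in> Arr C" "Dom C (tBox_to_sym_pow C n f) = tBox C n (n - 1) f"
    "Cod C (tBox_to_sym_pow C n f) = sym_pow C n (Cod C f)"
    "tBox_to_sym_pow C n f \<bullet> tBox_proj n (n - 1) f = pow_proj n (Cod C f) \<bullet> Box_to_pow C n f"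
    unfolding tBox_to_sym_pow_def tBox_def sym_pow_def
    by (rule orbit_map[OF tBox_orbit[OF f, unfolded tBox_def] sym_pow_orbit[OF Y, unfolded sym_pow_def]],
        use Box_to_pow[OF f, where n=n] Box_to_pow_equivariant[OF f] in \<open>simp_all add: sym_group_carrier\<close>)+
qed

text \<open>A pair of block permutations is one permutation \<sigma> of all positions. Invariance
  lets the action of \<sigma> be inserted before the leg, where it moves the leg and, through
  \<open>block_join_equivariant\<close>, acts on the two blocks separately.\<close>

lemma invariant_block:
  assumes f: "f \<in> Arr C" and q: "0 < q" and w: "w \<in> Arr C" "Dom C w = Box C (a + q) j f"
    and inv: "\<And>\<sigma>. \<sigma> permutes {1..a + q} \<Longrightarrow> w \<bullet> Box_act C (a + q) j f \<sigma> = w"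
    and s: "\<alpha> permutes {1..a}" "\<beta> permutes {1..q}" and e: "e \<in> tuples q j"
  shows "(w \<bullet> Box_leg C (a + q) j f (shift_tuple a (e \<circ> inv' \<beta>)) \<bullet> block_join a q f (e \<circ> inv' \<beta>)) \<bullet>
      (pow_act C a (Dom C f) \<alpha> \<diamond> cube_perm C q f \<beta> e)
    = w \<bullet> Box_leg C (a + q) j f (shift_tuple a e) \<bullet> block_join a q f e"
proof -
  obtain \<sigma> where \<sigma>: "\<sigma> \<in> block_subgroup a q" "left_block a \<sigma> = \<alpha>" "right_block a q \<sigma> = \<beta>"
    using block_subgroup_surj[OF s] .
  note S = block_subgroupD[OF \<sigma>(1)]
  have e': "{k. e k} \<subseteq> {1..q}" using e by (simp add: tuples_def)
  let ?n = "a + q" and ?e = "shift_tuple a e" and ?e' = "shift_tuple a (e \<circ> inv' \<beta>)"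
  have se: "?e \<circ> inv' \<sigma> = ?e'" using shift_tuple_permuted[OF \<sigma>(1) e'] \<sigma>(3) by simp
  note t = shift_tuples[OF e, of a] shift_tuples[OF permuted_tuples[OF s(2) e], of a]
  note J = block_join_arr[OF f q, of a e] block_join_arr[OF f q, of a "e \<circ> inv' \<beta>"]
  note P = cube_perm_arr[OF S(1) f, of ?e] cube_perm_arr[OF s(2) f, of e]
  note A = Box_act[OF f S(1), where i=j]
  have "(w \<bullet> Box_leg C ?n j f ?e' \<bullet> block_join a q f (e \<circ> inv' \<beta>)) \<bullet> (pow_act C a (Dom C f) \<alpha> \<diamond> cube_perm C q f \<beta> e)
    = (w \<bullet> Box_leg C ?n j f ?e') \<bullet> (block_join a q f (e \<circ> inv' \<beta>) \<bullet> (pow_act C a (Dom C f) \<alpha> \<diamond> cube_perm C q f \<beta> e))"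
    using w t J P f s by (simp del: comp_apply)
  also have "block_join a q f (e \<circ> inv' \<beta>) \<bullet> (pow_act C a (Dom C f) \<alpha> \<diamond> cube_perm C q f \<beta> e)
    = cube_perm C ?n f \<sigma> ?e \<bullet> block_join a q f e"
    using block_join_equivariant[OF f q \<sigma>(1) e'] \<sigma>(2,3) by simp
  also have "(w \<bullet> Box_leg C ?n j f ?e') \<bullet> \<dots> = w \<bullet> (Box_leg C ?n j f (?e \<circ> inv' \<sigma>) \<bullet> cube_perm C ?n f \<sigma> ?e) \<bullet> block_join a q f e"
    unfolding se using w t J P[unfolded se] f by (simp del: comp_apply)
  also have "\<dots> = (w \<bullet> Box_act C ?n j f \<sigma>) \<bullet> Box_leg C ?n j f ?e \<bullet> block_join a q f e"
    unfolding A(4)[OF t(1), symmetric] using w t J A(1-3) f by simp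
  also have "\<dots> = w \<bullet> Box_leg C ?n j f ?e \<bullet> block_join a q f e"
    by (simp only: inv[OF S(1)])
  finally show ?thesis .
qed

text \<open>Up to isomorphism \<open>tBox_map\<close> is a push-out of the product in
  \<open>lift\<close>. Instead of constructing that push-out, the proof carries a lifting problem
  over to the product, solves it there and spreads the solution over the orbit of top
  vertices.\<close>

lemma tBox_map_lifts:
  assumes f: "f \<in> Arr C" and q: "1 \<le> q" and g: "g \<in> Arr C"
    and lift: "lifts C (Id C (sym_pow C a (Dom C f)) \<diamond> tBox_to_sym_pow C q f) g"
  shows "lifts C (tBox_map C (a + q) q f) g"
  unfolding lifts_def
proof (intro allI impI)
  let ?n = "a + q" and ?X = "Dom C f" and ?Y = "Cod C f" and ?e0 = "shift_tuple a (full_tuple q)"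
  let ?SX = "sym_pow C a ?X" and ?SY = "sym_pow C q ?Y" and ?TX = "tensor_pow C a ?X"
  let ?\<pi>X = "pow_proj a ?X" and ?\<pi>Y = "pow_proj q ?Y" and ?\<pi>B = "tBox_proj q (q - 1) f"
  let ?t = "tBox_to_sym_pow C q f"
  fix u v
  assume "u \<in> Hom C (Dom C (tBox_map C ?n q f)) (Dom C g) \<and> v \<in> Hom C (Cod C (tBox_map C ?n q f)) (Cod C g) \<and>
    g \<bullet> u = v \<bullet> tBox_map C ?n q f"
  note T = tBox_map[OF f, where n="?n" and i=q] and B = Box_map[OF f, where n="?n" and i=q]
  then have u: "u \<in> Arr C" "Dom C u = tBox C ?n (q - 1) f" "Cod C u = Dom C g"
    and v: "v \<in> Arr C" "Dom C v = tBox C ?n q f" "Cod C v = Cod C g" and guv: "g \<bullet> u = v \<bullet> tBox_map C ?n q f"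
    using \<open>u \<in> _ \<and> _\<close> by auto
  have q0: "0 < q" using q by simp
  have XY: "?X \<in> Obj C" "?Y \<in> Obj C" using f by simp_all
  note o = orbit_arr[OF tBox_orbit[OF f, of ?n "q - 1"], simplified sym_group_carrier]
    and o' = orbit_arr[OF tBox_orbit[OF f, of ?n q], simplified sym_group_carrier]
    and oB = orbit_arr[OF tBox_orbit[OF f, of q "q - 1"], simplified sym_group_carrier]
    and oX = orbit_arr[OF sym_pow_orbit[OF XY(1), of a], simplified sym_group_carrier]
    and oY = orbit_arr[OF sym_pow_orbit[OF XY(2), of q], simplified sym_group_carrier]
  note TS = tBox_to_sym_pow[OF f, where n=q] and BP = Box_to_pow[OF f, where n=q]
  \<comment> \<open>Morphisms out of the orbit objects are replaced by invariant morphisms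
    \<open>w\<close> and \<open>y\<close> out of the objects before passing to orbits, where legs
    are available.\<close>
  define w where "w = u \<bullet> tBox_proj ?n (q - 1) f"
  define y where "y = v \<bullet> tBox_proj ?n q f"
  have w: "w \<in> Arr C" "Dom C w = Box C ?n (q - 1) f" "Cod C w = Dom C g" using u o by (simp_all add: w_def)
  have y: "y \<in> Arr C" "Dom C y = Box C ?n q f" "Cod C y = Cod C g" using v o' by (simp_all add: y_def)
  have w_inv: "w \<bullet> Box_act C ?n (q - 1) f \<sigma> = w" if s: "\<sigma> permutes {1..?n}" for \<sigma>
    using u o(1-4) o(5)[OF s] Box_act(1-3)[OF f s, where i="q - 1"] by (simp add: w_def)
  have y_inv: "y \<bullet> Box_act C ?n q f \<sigma> = y" if s: "\<sigma> permutes {1..?n}" for \<sigma>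
    using v o'(1-4) o'(5)[OF s] Box_act(1-3)[OF f s, where i=q] by (simp add: y_def)
  have gw: "g \<bullet> w = y \<bullet> Box_map C ?n q f"
  proof -
    have "g \<bullet> w = (g \<bullet> u) \<bullet> tBox_proj ?n (q - 1) f" using g u o by (simp add: w_def)
    also have "\<dots> = v \<bullet> (tBox_map C ?n q f \<bullet> tBox_proj ?n (q - 1) f)"
      unfolding guv using v T(1-3) o by simp
    also have "\<dots> = y \<bullet> Box_map C ?n q f"
      unfolding T(4) using v o' B(1-3) by (simp add: y_def)
    finally show ?thesis .
  qed
  note FX = left_adjoint_tensor_left[OF tensor_pow_obj[OF XY(1), of a]]
  let ?m = "\<lambda>e. w \<bullet> Box_leg C ?n (q - 1) f (shift_tuple a e) \<bullet> block_join a q f e"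
  note J = block_join_arr[OF f q0, of a]
  have shift_le: "shift_tuple a d \<le> shift_tuple a e" if "d \<le> e" for d e
    using that by (auto simp: shift_tuple_def le_fun_def)
  \<comment> \<open>The restriction of \<open>w\<close> to the vertices with ones only in the last
    \<open>q\<close> positions. Tensoring with the power of \<open>X\<close> preserves colimits, so
    it is a single morphism out of that power times the boundary of the
    \<open>q\<close>-cube.\<close>
  obtain u1 where u1: "u1 \<in> Arr C" "Dom C u1 = ?TX \<diamondop> Box C q (q - 1) f" "Cod C u1 = Dom C g"
    and u1l: "\<And>e. e \<in> tuples q (q - 1) \<Longrightarrow> u1 \<bullet> (Id C ?TX \<diamond> Box_leg C q (q - 1) f e) = ?m e"
  proof (rule cube_colimit_desc[OF Box_colimit[OF f, of q "q - 1"] f FX, of "Dom C g" ?m])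
    fix e assume e: "e \<in> tuples q (q - 1)"
    show "?m e \<in> Arr C \<and> Dom C (?m e) = ?TX \<diamondop> cube_obj C q f e \<and> Cod C (?m e) = Dom C g"
      using w J[of e] shift_tuples[OF e, of a] f by simp
    fix d assume d: "d \<in> tuples q (q - 1)" and le: "d \<le> e"
    note sd = shift_tuples[OF d, of a] and se = shift_tuples[OF e, of a]
    have "?m e \<bullet> (Id C ?TX \<diamond> cube_arr C q f d e)
        = w \<bullet> Box_leg C ?n (q - 1) f (shift_tuple a e) \<bullet> (block_join a q f e \<bullet> (Id C ?TX \<diamond> cube_arr C q f d e))"
      using w J[of e] se f le XY by simp
    also have "\<dots> = w \<bullet> (Box_leg C ?n (q - 1) f (shift_tuple a e) \<bullet> cube_arr C ?n f (shift_tuple a d) (shift_tuple a e)) \<bullet> block_join a q f d"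
      unfolding block_join_natural[OF f q0 le, symmetric]
      using w J[of d] se f shift_le[OF le] by simp
    also have "\<dots> = ?m d"
      by (simp only: Box_leg_comp[OF f sd se shift_le[OF le]])
    finally show "?m e \<bullet> (Id C ?TX \<diamond> cube_arr C q f d e) = ?m d" .
  qed (use g in auto)
  have u1_inv: "u1 \<bullet> (pow_act C a ?X \<alpha> \<diamond> Box_act C q (q - 1) f \<beta>) = u1"
    if s: "\<alpha> permutes {1..a}" "\<beta> permutes {1..q}" for \<alpha> \<beta>
  proof (rule cube_colimit_ext[OF Box_colimit[OF f, of q "q - 1"] f FX])
    note A = Box_act[OF f s(2), where i="q - 1"]
    fix e assume e: "e \<in> tuples q (q - 1)"
    note e' = permuted_tuples[OF s(2) e]
    have "(u1 \<bullet> (pow_act C a ?X \<alpha> \<diamond> Box_act C q (q - 1) f \<beta>)) \<bullet> (Id C ?TX \<diamond> Box_leg C q (q - 1) f e)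
        = u1 \<bullet> (pow_act C a ?X \<alpha> \<diamond> (Box_act C q (q - 1) f \<beta> \<bullet> Box_leg C q (q - 1) f e))"
      using u1 A(1-3) e f s XY by (simp add: tensor_comp)
    also have "\<dots> = (u1 \<bullet> (Id C ?TX \<diamond> Box_leg C q (q - 1) f (e \<circ> inv' \<beta>))) \<bullet> (pow_act C a ?X \<alpha> \<diamond> cube_perm C q f \<beta> e)"
      unfolding A(4)[OF e] using u1 e' f s XY by (simp add: tensor_comp del: comp_apply)
    also have "\<dots> = ?m e"
      unfolding u1l[OF e'] by (rule invariant_block[OF f q0 w(1,2) w_inv s e])
    finally show "(u1 \<bullet> (pow_act C a ?X \<alpha> \<diamond> Box_act C q (q - 1) f \<beta>)) \<bullet> (Id C ?TX \<diamond> Box_leg C q (q - 1) f e)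
        = u1 \<bullet> (Id C ?TX \<diamond> Box_leg C q (q - 1) f e)"
      using u1l[OF e] by simp
  qed (use u1 s f XY Box_act[OF f s(2), where i="q - 1"] in simp_all)
  note GX = sym_group_is_group[of a] and GQ = sym_group_is_group[of q]
  \<comment> \<open>Invariance under both blocks brings \<open>u1\<close> down to the product of the
    two orbit objects, the source of the morphism in \<open>lift\<close>.\<close>
  obtain u2 where u2: "u2 \<in> Arr C" "Dom C u2 = ?SX \<diamondop> tBox C q (q - 1) f" "Cod C u2 = Cod C u1"
    "u2 \<bullet> (?\<pi>X \<diamond> ?\<pi>B) = u1"
    by (rule orbit_tensor_desc[OF GX GQ sym_pow_orbit[OF XY(1)] tBox_orbit[OF f] u1(1,2)])
      (use u1_inv in \<open>auto simp: sym_group_carrier\<close>)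
  let ?J0 = "block_join a q f (full_tuple q)"
  have J0: "iso_arr C ?J0" "Dom C ?J0 = ?TX \<diamondop> tensor_pow C q ?Y" "Cod C ?J0 = cube_obj C ?n f ?e0"
    using J[of "full_tuple q"] cube_full[of q f] by simp_all
  note e0 = shift_full_tuples[of a q]
  \<comment> \<open>\<open>v1\<close> and its descent \<open>v2\<close> do the same for
    \<open>y\<close> at the top vertex \<open>?e0\<close>, giving the bottom side of the lifting
    square.\<close>
  define v1 where "v1 = y \<bullet> Box_leg C ?n q f ?e0 \<bullet> ?J0"
  have v1: "v1 \<in> Arr C" "Dom C v1 = ?TX \<diamondop> tensor_pow C q ?Y" "Cod C v1 = Cod C g"
    using y J0 e0(1) f by (simp_all add: v1_def)
  have v1_inv: "v1 \<bullet> (pow_act C a ?X \<alpha> \<diamond> pow_act C q ?Y \<beta>) = v1"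
    if s: "\<alpha> permutes {1..a}" "\<beta> permutes {1..q}" for \<alpha> \<beta>
    using invariant_block[OF f q0 y(1,2) y_inv s full_tuples] unfolding full_tuple_permuted[OF s(2)] cube_perm_full[OF s(2)] v1_def .
  obtain v2 where v2: "v2 \<in> Arr C" "Dom C v2 = ?SX \<diamondop> ?SY" "Cod C v2 = Cod C v1" "v2 \<bullet> (?\<pi>X \<diamond> ?\<pi>Y) = v1"
    by (rule orbit_tensor_desc[OF GX GQ sym_pow_orbit[OF XY(1)] sym_pow_orbit[OF XY(2)] v1(1,2)])
      (use v1_inv in \<open>auto simp: sym_group_carrier\<close>)
  let ?K = "\<lambda>e. Id C ?TX \<diamond> cube_arr C q f e (full_tuple q)"
  have pi_t: "(Id C ?SX \<diamond> ?t) \<bullet> (?\<pi>X \<diamond> ?\<pi>B) \<bullet> (Id C ?TX \<diamond> Box_leg C q (q - 1) f e) = (?\<pi>X \<diamond> ?\<pi>Y) \<bullet> ?K e"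
    if e: "e \<in> tuples q (q - 1)" for e
  proof -
    have "(Id C ?SX \<diamond> ?t) \<bullet> (?\<pi>X \<diamond> ?\<pi>B) \<bullet> (Id C ?TX \<diamond> Box_leg C q (q - 1) f e)
        = ?\<pi>X \<diamond> ((?t \<bullet> ?\<pi>B) \<bullet> Box_leg C q (q - 1) f e)"
      using TS(1-3) oX(1-6) oB(1-4) e f XY by (simp add: tensor_comp)
    also have "\<dots> = ?\<pi>X \<diamond> (?\<pi>Y \<bullet> (Box_to_pow C q f \<bullet> Box_leg C q (q - 1) f e))"
      unfolding TS(4) using oY(1-4) BP(1-3) e f by simp
    also have "\<dots> = (?\<pi>X \<diamond> ?\<pi>Y) \<bullet> ?K e"
      unfolding BP(4)[OF e] using oX(1-6) oY(1-6) f XY le_full[OF e] cube_full[of q f] by (simp add: tensor_comp)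
    finally show ?thesis .
  qed
  have JK: "?J0 \<bullet> ?K e = cube_arr C ?n f (shift_tuple a e) ?e0 \<bullet> block_join a q f e"
    if e: "e \<in> tuples q (q - 1)" for e
    using block_join_natural[OF f q0 le_full[OF e], of a] by simp
  \<comment> \<open>The square commutes: after the orbit projections and on each leg of the
    boundary, both paths are \<open>y\<close> at the leg of the shifted vertex.\<close>
  have gu2: "g \<bullet> u2 = v2 \<bullet> (Id C ?SX \<diamond> ?t)"
  proof (rule orbit_tensor_ext[OF GX GQ sym_pow_orbit[OF XY(1)] tBox_orbit[OF f]])
    have "g \<bullet> u1 = (v2 \<bullet> (Id C ?SX \<diamond> ?t)) \<bullet> (?\<pi>X \<diamond> ?\<pi>B)"
    proof (rule cube_colimit_ext[OF Box_colimit[OF f, of q "q - 1"] f FX])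
      fix e assume e: "e \<in> tuples q (q - 1)"
      note se = shift_tuples[OF e, of a]
      have "(g \<bullet> u1) \<bullet> (Id C ?TX \<diamond> Box_leg C q (q - 1) f e) = g \<bullet> ?m e"
        using g u1 u1l[OF e] e f XY by simp
      also have "\<dots> = (g \<bullet> w) \<bullet> Box_leg C ?n (q - 1) f (shift_tuple a e) \<bullet> block_join a q f e"
        using g w se J[of e] f by simp
      also have "\<dots> = y \<bullet> (Box_map C ?n q f \<bullet> Box_leg C ?n (q - 1) f (shift_tuple a e)) \<bullet> block_join a q f e"
        unfolding gw using y B(1-3) se J[of e] f by simp
      also have "\<dots> = y \<bullet> (Box_leg C ?n q f ?e0 \<bullet> cube_arr C ?n f (shift_tuple a e) ?e0) \<bullet> block_join a q f e"
        by (simp only: B(4)[OF se] Box_leg_comp[OF f tuples_mono[OF se] e0(1) shift_le[OF le_full[OF e]]])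
      also have "\<dots> = (y \<bullet> Box_leg C ?n q f ?e0) \<bullet> (cube_arr C ?n f (shift_tuple a e) ?e0 \<bullet> block_join a q f e)"
        using y e0(1) J[of e] f shift_le[OF le_full[OF e]] by simp
      also have "\<dots> = v1 \<bullet> ?K e"
        unfolding JK[OF e, symmetric] v1_def using y e0(1) J0 f XY le_full[OF e] cube_full[of q f] by simp
      also have "\<dots> = v2 \<bullet> ((?\<pi>X \<diamond> ?\<pi>Y) \<bullet> ?K e)"
        unfolding v2(4)[symmetric]
        using v2(1,2) oX(1-4) oY(1-4) f XY le_full[OF e] cube_full[of q f] by simp
      also have "\<dots> = ((v2 \<bullet> (Id C ?SX \<diamond> ?t)) \<bullet> (?\<pi>X \<diamond> ?\<pi>B)) \<bullet> (Id C ?TX \<diamond> Box_leg C q (q - 1) f e)"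
        unfolding pi_t[OF e, symmetric] using v2(1,2) TS(1-3) oX(1-4) oB(1-4) e f XY by simp
      finally show "(g \<bullet> u1) \<bullet> (Id C ?TX \<diamond> Box_leg C q (q - 1) f e)
          = ((v2 \<bullet> (Id C ?SX \<diamond> ?t)) \<bullet> (?\<pi>X \<diamond> ?\<pi>B)) \<bullet> (Id C ?TX \<diamond> Box_leg C q (q - 1) f e)" .
    qed (use g u1 v2(1-3) v1 TS(1-3) oX(1-4) oB(1-4) in simp_all)
    then show "(g \<bullet> u2) \<bullet> (?\<pi>X \<diamond> ?\<pi>B) = (v2 \<bullet> (Id C ?SX \<diamond> ?t)) \<bullet> (?\<pi>X \<diamond> ?\<pi>B)"
      using g u2 u1 oX(1-4) oB(1-4) by simp
  qed (use g u2 u1 v2 v1 TS(1-3) oX(1-4) in simp_all)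
  obtain h where h: "h \<in> Arr C" "Dom C h = ?SX \<diamondop> ?SY" "Cod C h = Dom C g"
    "h \<bullet> (Id C ?SX \<diamond> ?t) = u2" "g \<bullet> h = v2"
    by (rule liftsE[OF lift _ _ _ _ _ _ gu2]) (use u2 u1 v2 v1 TS(1-3) oX(1-4) in simp_all)
  let ?hp = "h \<bullet> (?\<pi>X \<diamond> ?\<pi>Y)"
  have hp: "?hp \<in> Arr C" "Dom C ?hp = ?TX \<diamondop> tensor_pow C q ?Y" "Cod C ?hp = Dom C g"
    using h oX(1-4) oY(1-4) by simp_all
  \<comment> \<open>The lift, pulled back along the orbit projections and moved to the bracketing of
    the vertex \<open>?e0\<close>.\<close>
  define h0 where "h0 = ?hp \<bullet> inverse_arr C ?J0"
  have h0: "h0 \<in> Arr C" "Dom C h0 = cube_obj C ?n f ?e0" "Cod C h0 = Dom C g" "h0 \<bullet> ?J0 = ?hp"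
    using hp J0 by (simp_all add: h0_def)
  have gh0: "g \<bullet> h0 = y \<bullet> Box_leg C ?n q f ?e0"
  proof (rule iso_cancel_right[OF J0(1)])
    have "(g \<bullet> h0) \<bullet> ?J0 = (g \<bullet> h) \<bullet> (?\<pi>X \<diamond> ?\<pi>Y)"
      using g h0 J0 h(1-3) oX(1-4) oY(1-4) by simp
    also have "\<dots> = v1" unfolding h(5) by (rule v2(4))
    finally show "(g \<bullet> h0) \<bullet> ?J0 = (y \<bullet> Box_leg C ?n q f ?e0) \<bullet> ?J0"
      using y e0(1) J0 f by (simp add: v1_def)
  qed (use g h0 y e0(1) f J0 in simp_all)
  have h0_low: "h0 \<bullet> cube_arr C ?n f d ?e0 = w \<bullet> Box_leg C ?n (q - 1) f d" if d: "d < ?e0" for d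
  proof -
    \<comment> \<open>A vertex below \<open>?e0\<close> has all its ones among the last
      \<open>q\<close> positions, so it is the shift of a vertex of the \<open>q\<close>-cube, where
      \<open>w\<close> is known through \<open>u1\<close>.\<close>
    define e where "e = (\<lambda>k. 0 < k \<and> d (a + k))"
    have dk: "a < k \<and> k \<le> a + q" if "d k" for k
      using less_imp_le[OF d] that by (auto simp: le_fun_def shift_tuple_def)
    have "d k \<longleftrightarrow> shift_tuple a e k" for k
      using dk[of k] by (cases "a < k") (auto simp: e_def shift_tuple_def)
    then have de: "d = shift_tuple a e" by blast
    have "e < full_tuple q"
    proof (rule order.not_eq_order_implies_strict)
      show "e \<noteq> full_tuple q" using d de by auto
      show "e \<le> full_tuple q" using dk by (fastforce simp: e_def le_fun_def)
    qed
    then have e: "e \<in> tuples q (q - 1)" by (rule below_tuples[OF full_tuples])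
    note se = shift_tuples[OF e, of a]
    show ?thesis
      unfolding de
    proof (rule iso_cancel_right[OF J(1)[of e]])
      have "(h0 \<bullet> cube_arr C ?n f (shift_tuple a e) ?e0) \<bullet> block_join a q f e = h0 \<bullet> (?J0 \<bullet> ?K e)"
        unfolding JK[OF e] using h0(1-3) J[of e] f shift_le[OF le_full[OF e]] by simp
      also have "\<dots> = ?hp \<bullet> ?K e"
        unfolding h0(4)[symmetric] using h0(1-3) J0 f XY le_full[OF e] cube_full[of q f] by simp
      also have "\<dots> = h \<bullet> ((?\<pi>X \<diamond> ?\<pi>Y) \<bullet> ?K e)"
        using h(1-3) oX(1-4) oY(1-4) f XY le_full[OF e] cube_full[of q f] by simp
      also have "\<dots> = ((h \<bullet> (Id C ?SX \<diamond> ?t)) \<bullet> (?\<pi>X \<diamond> ?\<pi>B)) \<bullet> (Id C ?TX \<diamond> Box_leg C q (q - 1) f e)"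
        unfolding pi_t[OF e, symmetric] using h(1-3) TS(1-3) oX(1-4) oB(1-4) e f XY by simp
      also have "\<dots> = ?m e" unfolding h(4) u2(4) by (rule u1l[OF e])
      also have "\<dots> = (w \<bullet> Box_leg C ?n (q - 1) f (shift_tuple a e)) \<bullet> block_join a q f e"
        using w se J[of e] f by simp
      finally show "(h0 \<bullet> cube_arr C ?n f (shift_tuple a e) ?e0) \<bullet> block_join a q f e
          = (w \<bullet> Box_leg C ?n (q - 1) f (shift_tuple a e)) \<bullet> block_join a q f e" .
    qed (use h0 w se J[of e] f shift_le[OF le_full[OF e]] in simp_all)
  qed
  \<comment> \<open>Invariant families are equivariant ones for the trivial action on the target, so
    \<open>equivariant_extend\<close> applies to \<open>h0\<close>.\<close>
  let ?d = "\<lambda>_ :: nat \<Rightarrow> nat. Id C (Dom C g)"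
  have act: "action C (sym_group ?n) (Dom C g) ?d"
    using g by (simp add: action_def)
  have stab: "h0 \<bullet> cube_perm C ?n f \<sigma> ?e0 = ?d \<sigma> \<bullet> h0"
    if s': "\<sigma> permutes {1..?n}" and st: "?e0 \<circ> inv' \<sigma> = ?e0" for \<sigma>
  proof (rule iso_cancel_right[OF J0(1)])
    have s: "\<sigma> \<in> block_subgroup a q" using stabilizer_block[OF s'] st by simp
    note S = block_subgroupD[OF s]
    note P = cube_perm_arr[OF s' f, of ?e0, unfolded st]
    let ?w = "pow_act C a ?X (left_block a \<sigma>) \<diamond> pow_act C q ?Y (right_block a q \<sigma>)"
    have "{k. full_tuple q k} \<subseteq> {1..q}" by auto
    from block_join_equivariant[OF f q0 s this]
    have Jw: "cube_perm C ?n f \<sigma> ?e0 \<bullet> ?J0 = ?J0 \<bullet> ?w"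
      unfolding full_tuple_permuted[OF S(3)] cube_perm_full[OF S(3)] .
    have "(h0 \<bullet> cube_perm C ?n f \<sigma> ?e0) \<bullet> ?J0 = h0 \<bullet> (?J0 \<bullet> ?w)"
      unfolding Jw[symmetric] using h0(1-3) P J0 by simp
    also have "\<dots> = ?hp \<bullet> ?w"
      unfolding h0(4)[symmetric] using h0(1-3) J0 S XY by simp
    also have "\<dots> = h \<bullet> ((?\<pi>X \<bullet> pow_act C a ?X (left_block a \<sigma>)) \<diamond> (?\<pi>Y \<bullet> pow_act C q ?Y (right_block a q \<sigma>)))"
      using h(1-3) oX(1-4) oY(1-4) S XY by (simp add: tensor_comp)
    also have "\<dots> = ?hp" by (simp only: oX(5)[OF S(2)] oY(5)[OF S(3)])
    also have "\<dots> = (?d \<sigma> \<bullet> h0) \<bullet> ?J0" using h0 J0 g by simp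
    finally show "(h0 \<bullet> cube_perm C ?n f \<sigma> ?e0) \<bullet> ?J0 = (?d \<sigma> \<bullet> h0) \<bullet> ?J0" .
    show "h0 \<bullet> cube_perm C ?n f \<sigma> ?e0 \<in> Arr C" "?d \<sigma> \<bullet> h0 \<in> Arr C"
      "Dom C (h0 \<bullet> cube_perm C ?n f \<sigma> ?e0) = Cod C ?J0" "Dom C (?d \<sigma> \<bullet> h0) = Cod C ?J0"
      using h0(1-3) P J0 g by simp_all
  qed
  obtain l where l: "\<And>\<tau>. \<tau> permutes {1..?n} \<Longrightarrow> l (?e0 \<circ> inv' \<tau>) \<in> Arr C \<and>
      Dom C (l (?e0 \<circ> inv' \<tau>)) = cube_obj C ?n f (?e0 \<circ> inv' \<tau>) \<and> Cod C (l (?e0 \<circ> inv' \<tau>)) = Dom C g \<and>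
      l (?e0 \<circ> inv' \<tau>) \<bullet> cube_perm C ?n f \<tau> ?e0 = ?d \<tau> \<bullet> h0"
    and l_eq: "\<And>\<sigma> \<tau>. \<lbrakk>\<sigma> permutes {1..?n}; \<tau> permutes {1..?n}\<rbrakk> \<Longrightarrow>
      l (?e0 \<circ> inv' \<tau> \<circ> inv' \<sigma>) \<bullet> cube_perm C ?n f \<sigma> (?e0 \<circ> inv' \<tau>) = ?d \<sigma> \<bullet> l (?e0 \<circ> inv' \<tau>)"
  proof (rule equivariant_extend[OF f act h0(1-3) stab], goal_cases)
    case (3 l)
    show ?case by (rule 3(1)[OF 3(2-3)])
  qed
  have la: "l e \<in> Arr C \<and> Dom C (l e) = cube_obj C ?n f e \<and> Cod C (l e) = Cod C w"
    if "e \<in> tuples ?n q" "card {k. e k} = q" for e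
    using top_tuple_orbit[OF that] l w(3) by metis
  \<comment> \<open>By invariance of \<open>w\<close>, the boundary condition at any top vertex is
    the conjugate by \<tau> of the one at \<open>?e0\<close>.\<close>
  have l_low: "l e \<bullet> cube_arr C ?n f d e = w \<bullet> Box_leg C ?n (q - 1) f d"
    if e: "e \<in> tuples ?n q" "card {k. e k} = q" and d: "d < e" for d e
  proof -
    obtain \<tau> where t: "\<tau> permutes {1..?n}" and et: "e = ?e0 \<circ> inv' \<tau>" using top_tuple_orbit[OF e] .
    define d0 where "d0 = d \<circ> \<tau>"
    have dt: "d = d0 \<circ> inv' \<tau>" unfolding d0_def by (rule comp_inv_cancel(1)[OF t, symmetric])
    have et': "?e0 = e \<circ> \<tau>" unfolding et by (rule comp_inv_cancel(2)[OF t, symmetric])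
    have "d0 \<le> ?e0" unfolding d0_def et' by (rule comp_inv_mono) (use d in simp)
    moreover have "d0 \<noteq> ?e0" using d dt et by auto
    ultimately have d0: "d0 < ?e0" "d0 \<le> ?e0" by simp_all
    note bd = below_tuples[OF e(1) d] and bd0 = below_tuples[OF e0(1) d0(1)]
    note P = cube_perm_arr[OF t f, of d0, folded dt] cube_perm_arr[OF t f, of ?e0, folded et]
    have le: "d \<le> e" using d by simp
    have lt: "l e \<in> Arr C" "Dom C (l e) = cube_obj C ?n f e" "Cod C (l e) = Dom C g"
      "l e \<bullet> cube_perm C ?n f \<tau> ?e0 = h0"
      using l[OF t, folded et] h0 by auto
    show ?thesis
    proof (rule iso_cancel_right[OF P(4)])
      have "(l e \<bullet> cube_arr C ?n f d e) \<bullet> cube_perm C ?n f \<tau> d0 = l e \<bullet> (cube_perm C ?n f \<tau> ?e0 \<bullet> cube_arr C ?n f d0 ?e0)"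
        unfolding cube_perm_natural[OF t f d0(2), folded dt et] using lt P f le by simp
      also have "\<dots> = h0 \<bullet> cube_arr C ?n f d0 ?e0"
        unfolding lt(4)[symmetric] using lt(1-3) P f d0(2) by simp
      also have "\<dots> = w \<bullet> Box_leg C ?n (q - 1) f d0" by (rule h0_low[OF d0(1)])
      also have "\<dots> = (w \<bullet> Box_act C ?n (q - 1) f \<tau>) \<bullet> Box_leg C ?n (q - 1) f d0"
        by (simp only: w_inv[OF t])
      also have "\<dots> = w \<bullet> (Box_leg C ?n (q - 1) f d \<bullet> cube_perm C ?n f \<tau> d0)"
        using Box_act(1-3)[OF f t, where i="q - 1"] Box_act(4)[OF f t bd0, folded dt] w bd0 f by simp
      also have "\<dots> = (w \<bullet> Box_leg C ?n (q - 1) f d) \<bullet> cube_perm C ?n f \<tau> d0"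
        using w bd f P by simp
      finally show "(l e \<bullet> cube_arr C ?n f d e) \<bullet> cube_perm C ?n f \<tau> d0
          = (w \<bullet> Box_leg C ?n (q - 1) f d) \<bullet> cube_perm C ?n f \<tau> d0" .
    qed (use lt P f le w bd in simp_all)
  qed
  obtain x where x: "x \<in> Arr C" "Dom C x = Box C ?n q f" "Cod C x = Cod C w" "x \<bullet> Box_map C ?n q f = w"
    and xl: "\<And>e. \<lbrakk>e \<in> tuples ?n q; card {k. e k} = q\<rbrakk> \<Longrightarrow> x \<bullet> Box_leg C ?n q f e = l e"
  proof (rule Box_extend[OF f q w(1,2) la l_low], goal_cases)
    case (6 x)
    show ?case by (rule 6(1)[OF 6(2-6)])
  qed
  have gx: "g \<bullet> x = y"
  proof (rule Box_ext_top[OF f q, of _ _ ?n])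
    show "(g \<bullet> x) \<bullet> Box_map C ?n q f = y \<bullet> Box_map C ?n q f"
      using g x w(3) B(1-3) gw by simp
    fix e assume e: "e \<in> tuples ?n q" "card {k. e k} = q"
    obtain \<tau> where t: "\<tau> permutes {1..?n}" and et: "e = ?e0 \<circ> inv' \<tau>" using top_tuple_orbit[OF e] .
    note P = cube_perm_arr[OF t f, of ?e0, folded et]
    have lt: "l e \<in> Arr C" "Dom C (l e) = cube_obj C ?n f e" "Cod C (l e) = Dom C g"
      "l e \<bullet> cube_perm C ?n f \<tau> ?e0 = h0"
      using l[OF t, folded et] h0 by auto
    have "(g \<bullet> x) \<bullet> Box_leg C ?n q f e = g \<bullet> l e"
      using g x w(3) e(1) f xl[OF e] by simp
    also have "\<dots> = y \<bullet> Box_leg C ?n q f e"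
    proof (rule iso_cancel_right[OF P(4)])
      have "(g \<bullet> l e) \<bullet> cube_perm C ?n f \<tau> ?e0 = g \<bullet> h0"
        unfolding lt(4)[symmetric] using g lt(1-3) P by simp
      also have "\<dots> = (y \<bullet> Box_act C ?n q f \<tau>) \<bullet> Box_leg C ?n q f ?e0"
        by (simp only: gh0 y_inv[OF t])
      also have "\<dots> = (y \<bullet> Box_leg C ?n q f e) \<bullet> cube_perm C ?n f \<tau> ?e0"
        using Box_act(1-3)[OF f t, where i=q] Box_act(4)[OF f t e0(1), folded et] y e0(1) e(1) f P by simp
      finally show "(g \<bullet> l e) \<bullet> cube_perm C ?n f \<tau> ?e0 = (y \<bullet> Box_leg C ?n q f e) \<bullet> cube_perm C ?n f \<tau> ?e0" .
    qed (use g lt P y e(1) f in simp_all)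
    finally show "(g \<bullet> x) \<bullet> Box_leg C ?n q f e = y \<bullet> Box_leg C ?n q f e" .
  qed (use g x w y in simp_all)
  \<comment> \<open>Invariance holds on the previous stage by \<open>w_inv\<close> and at the top
    vertices by the equivariance of \<open>l\<close>; it lets the lift descend to orbits.\<close>
  have x_inv: "x \<bullet> Box_act C ?n q f \<sigma> = x" if s: "\<sigma> permutes {1..?n}" for \<sigma>
  proof (rule Box_ext_top[OF f q, of _ _ ?n])
    note A = Box_act[OF f s, where i=q] and A' = Box_act[OF f s, where i="q - 1"]
    have "(x \<bullet> Box_act C ?n q f \<sigma>) \<bullet> Box_map C ?n q f = x \<bullet> (Box_map C ?n q f \<bullet> Box_act C ?n (q - 1) f \<sigma>)"
      unfolding Box_map_equivariant[OF f s] using x A(1-3) B(1-3) by simp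
    also have "\<dots> = (x \<bullet> Box_map C ?n q f) \<bullet> Box_act C ?n (q - 1) f \<sigma>"
      using x(1,2) A'(1-3) B(1-3) by simp
    also have "\<dots> = x \<bullet> Box_map C ?n q f" by (simp only: x(4) w_inv[OF s])
    finally show "(x \<bullet> Box_act C ?n q f \<sigma>) \<bullet> Box_map C ?n q f = x \<bullet> Box_map C ?n q f" .
    fix e assume e: "e \<in> tuples ?n q" "card {k. e k} = q"
    obtain \<tau> where t: "\<tau> permutes {1..?n}" and et: "e = ?e0 \<circ> inv' \<tau>" using top_tuple_orbit[OF e] .
    have e': "e \<circ> inv' \<sigma> \<in> tuples ?n q" "card {k. (e \<circ> inv' \<sigma>) k} = q"
      using permuted_tuples[OF s e(1)] card_permuted[OF s, of e] e(2) by simp_all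
    note P = cube_perm_arr[OF s f, of e]
    have "(x \<bullet> Box_act C ?n q f \<sigma>) \<bullet> Box_leg C ?n q f e = x \<bullet> (Box_act C ?n q f \<sigma> \<bullet> Box_leg C ?n q f e)"
      using x(1,2) A(1-3) e(1) f by simp
    also have "\<dots> = (x \<bullet> Box_leg C ?n q f (e \<circ> inv' \<sigma>)) \<bullet> cube_perm C ?n f \<sigma> e"
      unfolding A(4)[OF e(1)] using x(1,2) e'(1) f P by (simp del: comp_apply)
    also have "\<dots> = Id C (Dom C g) \<bullet> l e"
      unfolding xl[OF e'] unfolding et by (rule l_eq[OF s t])
    also have "\<dots> = x \<bullet> Box_leg C ?n q f e"
      using la[OF e] w(3) xl[OF e] by simp
    finally show "(x \<bullet> Box_act C ?n q f \<sigma>) \<bullet> Box_leg C ?n q f e = x \<bullet> Box_leg C ?n q f e" .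
  qed (use x Box_act[OF f s, where i=q] in simp_all)
  obtain z where z: "z \<in> Arr C" "Dom C z = tBox C ?n q f" "Cod C z = Cod C x" "z \<bullet> tBox_proj ?n q f = x"
    by (rule orbit_desc[OF tBox_orbit[OF f, of ?n q] x(1,2)]) (use x_inv in \<open>auto simp: sym_group_carrier\<close>)
  have "z \<bullet> tBox_map C ?n q f = u"
  proof (rule orbit_ext[OF tBox_orbit[OF f, of ?n "q - 1"]])
    have "(z \<bullet> tBox_map C ?n q f) \<bullet> tBox_proj ?n (q - 1) f = z \<bullet> (tBox_map C ?n q f \<bullet> tBox_proj ?n (q - 1) f)"
      using z(1,2) T(1-3) o by simp
    also have "\<dots> = (z \<bullet> tBox_proj ?n q f) \<bullet> Box_map C ?n q f"
      unfolding T(4) using z(1,2) o' B(1-3) by simp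
    also have "\<dots> = u \<bullet> tBox_proj ?n (q - 1) f"
      unfolding z(4) x(4) w_def ..
    finally show "(z \<bullet> tBox_map C ?n q f) \<bullet> tBox_proj ?n (q - 1) f = u \<bullet> tBox_proj ?n (q - 1) f" .
  qed (use z x w T(1-3) u in simp_all)
  moreover have "g \<bullet> z = v"
  proof (rule orbit_ext[OF tBox_orbit[OF f, of ?n q]])
    have "(g \<bullet> z) \<bullet> tBox_proj ?n q f = g \<bullet> x"
      unfolding z(4)[symmetric] using g z(1-3) x w o' by simp
    then show "(g \<bullet> z) \<bullet> tBox_proj ?n q f = v \<bullet> tBox_proj ?n q f"
      unfolding gx y_def .
  qed (use g z x w v in simp_all)
  ultimately show "\<exists>h. h \<in> Hom C (Cod C (tBox_map C ?n q f)) (Dom C g) \<and> h \<bullet> tBox_map C ?n q f = u \<and> g \<bullet> h = v"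
    using z x w T by (intro exI[of _ z]) simp
qed

text \<open>Sym^0(X) is the orbit object of the unit under the trivial group, so its projection is
  invertible and the left unit constraint identifies the product with \<open>g\<close>. This stands
  in for \<open>cofibrant_tensor_cofib\<close>, which would ask the unit to be cofibrant.\<close>

lemma sym_pow_zero_retract:
  assumes X: "X \<in> Obj C" and g: "g \<in> Arr C"
  shows "is_retract C (Id C (sym_pow C 0 X) \<diamond> g) g"
proof -
  let ?S = "sym_pow C 0 X" and ?\<pi> = "pow_proj 0 X"
  note orb = sym_pow_orbit[OF X, of 0]
  note o = orbit_arr[OF orb]
  have T: "tensor_pow C 0 X = Unit C" by (simp add: tensor_pow_def)
  have \<pi>: "?\<pi> \<in> Arr C" "Dom C ?\<pi> = Unit C" "Cod C ?\<pi> = ?S" "?S \<in> Obj C" using o(1-4) T by simp_all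
  have act: "pow_act C 0 X \<sigma> = Id C (Unit C)" if "\<sigma> \<in> carrier (sym_group 0)" for \<sigma>
    using that o(8) T by (simp add: sym_group_carrier sym_group_one)
  \<comment> \<open>The group acts by the identity, so the identity of the unit is invariant and
    descends to an inverse of the projection.\<close>
  obtain u where u: "u \<in> Arr C" "Dom C u = ?S" "Cod C u = Unit C" "u \<bullet> ?\<pi> = Id C (Unit C)"
    by (rule orbit_desc[OF orb, of "Id C (Unit C)"]) (use act T in auto)
  have "(?\<pi> \<bullet> u) \<bullet> ?\<pi> = Id C ?S \<bullet> ?\<pi>" using u \<pi> by simp
  then have pu: "?\<pi> \<bullet> u = Id C ?S"
    by (rule orbit_ext[OF orb, rotated -1]) (use u(1-3) \<pi> in simp_all)
  have nat: "inverse_arr C (Lunit C (Cod C g)) \<bullet> g = (Id C (Unit C) \<diamond> g) \<bullet> inverse_arr C (Lunit C (Dom C g))"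
    by (rule inverse_natural[OF _ _ lunit_natural]) (use g in simp_all)
  show ?thesis
    unfolding is_retract_def
  proof (intro conjI exI)
    show "((?\<pi> \<diamond> Id C (Dom C g)) \<bullet> inverse_arr C (Lunit C (Dom C g))) \<bullet> (Lunit C (Dom C g) \<bullet> (u \<diamond> Id C (Dom C g)))
        = Id C (Dom C (Id C ?S \<diamond> g))"
      "((?\<pi> \<diamond> Id C (Cod C g)) \<bullet> inverse_arr C (Lunit C (Cod C g))) \<bullet> (Lunit C (Cod C g) \<bullet> (u \<diamond> Id C (Cod C g)))
        = Id C (Cod C (Id C ?S \<diamond> g))"
      using u(1-3) \<pi> g pu by (simp_all add: tensor_comp)
    have "g \<bullet> (Lunit C (Dom C g) \<bullet> (u \<diamond> Id C (Dom C g))) = (g \<bullet> Lunit C (Dom C g)) \<bullet> (u \<diamond> Id C (Dom C g))"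
      using u g by simp
    also have "\<dots> = (Lunit C (Cod C g) \<bullet> (Id C (Unit C) \<diamond> g)) \<bullet> (u \<diamond> Id C (Dom C g))"
      using lunit_natural[OF g refl refl] by simp
    also have "\<dots> = (Lunit C (Cod C g) \<bullet> (u \<diamond> Id C (Cod C g))) \<bullet> (Id C ?S \<diamond> g)"
      using u(1-3) \<pi>(4) g by (simp add: tensor_comp)
    finally show "g \<bullet> (Lunit C (Dom C g) \<bullet> (u \<diamond> Id C (Dom C g)))
      = (Lunit C (Cod C g) \<bullet> (u \<diamond> Id C (Cod C g))) \<bullet> (Id C ?S \<diamond> g)" .
    have "(Id C ?S \<diamond> g) \<bullet> ((?\<pi> \<diamond> Id C (Dom C g)) \<bullet> inverse_arr C (Lunit C (Dom C g)))
      = (?\<pi> \<diamond> Id C (Cod C g)) \<bullet> ((Id C (Unit C) \<diamond> g) \<bullet> inverse_arr C (Lunit C (Dom C g)))"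
      using \<pi> g by (simp add: tensor_comp_assoc)
    also have "\<dots> = ((?\<pi> \<diamond> Id C (Cod C g)) \<bullet> inverse_arr C (Lunit C (Cod C g))) \<bullet> g"
      unfolding nat[symmetric] using \<pi> g by simp
    finally show "(Id C ?S \<diamond> g) \<bullet> ((?\<pi> \<diamond> Id C (Dom C g)) \<bullet> inverse_arr C (Lunit C (Dom C g)))
      = ((?\<pi> \<diamond> Id C (Cod C g)) \<bullet> inverse_arr C (Lunit C (Cod C g))) \<bullet> g" .
  qed (use u \<pi> g in simp_all)
qed

lemma sym_pow_tensor_cofib:
  assumes X: "X \<in> Obj C" and a: "1 \<le> a \<Longrightarrow> cofibrant C (sym_pow C a X)" and g: "g \<in> Cofib C"
  shows "Id C (sym_pow C a X) \<diamond> g \<in> Cofib C \<and> (g \<in> Weq C \<longrightarrow> Id C (sym_pow C a X) \<diamond> g \<in> Weq C)"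
proof (cases "a = 0")
  case True
  then show ?thesis
    using retracts[OF sym_pow_zero_retract[OF X cofib_arr[OF g]]] g by simp
next
  case False
  then show ?thesis using cofibrant_tensor_cofib[OF g a] by simp
qed

text \<open>\<open>tBox_map_lifts\<close> transfers lifting against a single morphism at a time, so
  it serves lifting against trivial fibrations and against all fibrations alike.\<close>

lemma tBox_map_cofib:
  assumes f: "f \<in> Arr C" and q: "1 \<le> q" and a: "1 \<le> a \<Longrightarrow> cofibrant C (sym_pow C a (Dom C f))"
    and t: "tBox_to_sym_pow C q f \<in> Cofib C"
  shows "tBox_map C (a + q) q f \<in> Cofib C"
    and "tBox_to_sym_pow C q f \<in> Weq C \<Longrightarrow> tBox_map C (a + q) q f \<in> Cofib C \<inter> Weq C"
proof -
  have X: "Dom C f \<in> Obj C" using f by simp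
  note c = sym_pow_tensor_cofib[OF X a t]
  note T = tBox_map(1)[OF f, of "a + q" q]
  show "tBox_map C (a + q) q f \<in> Cofib C"
    unfolding cofib_iff_lifts
    using T c tBox_map_lifts[OF f q] lifting by (blast intro: fib_arr)
  assume "tBox_to_sym_pow C q f \<in> Weq C"
  then show "tBox_map C (a + q) q f \<in> Cofib C \<inter> Weq C"
    unfolding trivial_cofib_iff_lifts
    using T c tBox_map_lifts[OF f q] lifting by (blast intro: fib_arr)
qed

text \<open>Both objects represent the morphisms out of \<open>X\<^sup>\<and>\<^sup>a \<and> Z\<^sup>\<and>\<^sup>q\<close> that are invariant under the two
  blocks.\<close>

lemma tBox_quotient:
  assumes pt: "pointed C" and f: "f \<in> Arr C" and p: "is_coker C {f} p" and q: "1 \<le> q"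
  shows "isomorphic C (quot_obj C (tBox_map C (a + q) q f))
    (sym_pow C a (Dom C f) \<diamondop> sym_pow C q (Cod C p))"
proof -
  let ?n = "a + q" and ?X = "Dom C f" and ?Z = "Cod C p"
  let ?W = "tensor_pow C a ?X \<diamondop> tensor_pow C q ?Z" and ?S = "sym_pow C a ?X \<diamondop> sym_pow C q ?Z"
  let ?w = "\<lambda>\<sigma>. pow_act C a ?X (left_block a \<sigma>) \<diamond> pow_act C q ?Z (right_block a q \<sigma>)"
  let ?\<pi> = "tBox_proj ?n q f" and ?\<pi>' = "tBox_proj ?n (q - 1) f"
  have XZ: "?X \<in> Obj C" "?Z \<in> Obj C" using f p by (auto simp: is_coker_def)
  note B = Box_map[OF f, where n="?n" and i=q] and T = tBox_map[OF f, where n="?n" and i=q]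
  obtain Q \<rho> z where quot: "quotient C (Box_map C ?n q f) = (Q, \<rho>, z)" "is_quotient C (Box_map C ?n q f) Q \<rho> z"
    using quotient_exists[OF finite_colimits finite_limits B(1)] .
  obtain Q' \<rho>' z' where quot': "quotient C (tBox_map C ?n q f) = (Q', \<rho>', z')"
      "is_quotient C (tBox_map C ?n q f) Q' \<rho>' z'"
    using quotient_exists[OF finite_colimits finite_limits T(1)] .
  have Q'_eq: "quot_obj C (tBox_map C ?n q f) = Q'" by (simp add: quot_obj_def quot'(1))
  have c: "is_coker C {Box_map C ?n q f} \<rho>" and c': "is_coker C {tBox_map C ?n q f} \<rho>'"
    by (rule quotient_coker[OF pt quot(2)], rule quotient_coker[OF pt quot'(2)])
  have \<rho>: "\<rho> \<in> Arr C" "Dom C \<rho> = Box C ?n q f" "Cod C \<rho> = Q" "null C (\<rho> \<bullet> Box_map C ?n q f)"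
    and \<rho>': "\<rho>' \<in> Arr C" "Dom C \<rho>' = tBox C ?n q f" "Cod C \<rho>' = Q'" "null C (\<rho>' \<bullet> tBox_map C ?n q f)"
  proof -
    obtain T1 t1 T2 t2 where "is_pushout C (Box_map C ?n q f) t1 Q \<rho> z" "is_pushout C (tBox_map C ?n q f) t2 Q' \<rho>' z'"
      using quot(2) quot'(2) unfolding is_quotient_def by blast
    note po = pushout_arr(1-3)[OF this(1)] pushout_arr(1-3)[OF this(2)]
    show "\<rho> \<in> Arr C" "Dom C \<rho> = Box C ?n q f" "Cod C \<rho> = Q" "\<rho>' \<in> Arr C" "Dom C \<rho>' = tBox C ?n q f" "Cod C \<rho>' = Q'"
      using po B(3) T(3) by simp_all
    show "null C (\<rho> \<bullet> Box_map C ?n q f)" "null C (\<rho>' \<bullet> tBox_map C ?n q f)"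
      using c c' by (simp_all add: is_coker_def)
  qed
  note o = orbit_arr[OF tBox_orbit[OF f, of ?n q], simplified sym_group_carrier]
    and o' = orbit_arr[OF tBox_orbit[OF f, of ?n "q - 1"], simplified sym_group_carrier]
  let ?b = "snd (Box_quot C ?n q f)"
  note QA = Box_quot_action[OF f quot]
  have bh: "?b \<sigma> \<in> Arr C" "Dom C (?b \<sigma>) = Q" "Cod C (?b \<sigma>) = Q" if "\<sigma> permutes {1..?n}" for \<sigma>
    using QA(1) that unfolding QA(3) by (auto simp: action_def sym_group_carrier)
  obtain e where "is_cor C (sym_group ?n) (block_subgroup a q) ?W ?w Q ?b e"
    by (rule Box_quot_is_cor[OF pt f p q quot]) (simp add: block_object_def QA(3))
  then have e: "e \<in> Hom C ?W Q" "equivariant C (block_subgroup a q) ?w ?b e"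
    and cor: "\<And>U d k. \<lbrakk>action C (sym_group ?n) U d; k \<in> Hom C ?W U; equivariant C (block_subgroup a q) ?w d k\<rbrakk> \<Longrightarrow>
      \<exists>!u. u \<in> Hom C Q U \<and> equivariant C (carrier (sym_group ?n)) ?b d u \<and> u \<bullet> e = k"
    unfolding is_cor_def by blast+
  \<comment> \<open>Applied to trivial actions, the universal property of the induced object says
    that invariant morphisms out of \<open>Q\<close> correspond to block-invariant morphisms out of
    \<open>?W\<close>.\<close>
  have cor_inv: "\<exists>!u. u \<in> Hom C Q U \<and> (\<forall>\<sigma>. \<sigma> permutes {1..?n} \<longrightarrow> u \<bullet> ?b \<sigma> = u) \<and> u \<bullet> e = k"
    if k: "k \<in> Hom C ?W U" "\<And>\<sigma>. \<sigma> \<in> block_subgroup a q \<Longrightarrow> k \<bullet> ?w \<sigma> = k" for k U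
  proof -
    have U: "U \<in> Obj C" using k(1) by auto
    have "action C (sym_group ?n) U (\<lambda>_. Id C U)" using U by (simp add: action_def)
    moreover have "equivariant C (block_subgroup a q) ?w (\<lambda>_. Id C U) k"
      using k by (simp add: equivariant_def)
    ultimately have "\<exists>!u. u \<in> Hom C Q U \<and> equivariant C (carrier (sym_group ?n)) ?b (\<lambda>_. Id C U) u \<and> u \<bullet> e = k"
      using cor k(1) by blast
    moreover have "equivariant C (carrier (sym_group ?n)) ?b (\<lambda>_. Id C U) u \<longleftrightarrow> (\<forall>\<sigma>. \<sigma> permutes {1..?n} \<longrightarrow> u \<bullet> ?b \<sigma> = u)"
      if "u \<in> Hom C Q U" for u
      using that by (auto simp: equivariant_def sym_group_carrier)
    ultimately show ?thesis by (metis (no_types, lifting))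
  qed
  have "null C ((\<rho>' \<bullet> ?\<pi>) \<bullet> Box_map C ?n q f)"
  proof -
    have "(\<rho>' \<bullet> ?\<pi>) \<bullet> Box_map C ?n q f = \<rho>' \<bullet> (?\<pi> \<bullet> Box_map C ?n q f)"
      using \<rho>' o(1-4) B by simp
    also have "\<dots> = (\<rho>' \<bullet> tBox_map C ?n q f) \<bullet> ?\<pi>'"
      unfolding T(4)[symmetric] using \<rho>' o'(1-4) T(1-3) by simp
    finally show ?thesis
      using null_comp_right[OF \<rho>'(4), of ?\<pi>'] o'(1-4) T(1-3) \<rho>' by simp
  qed
  \<comment> \<open>The orbit projections form a commuting square with the two stage inclusions, so
    they induce a morphism between the quotients.\<close>
  then obtain \<phi> where \<phi>: "\<phi> \<in> Arr C" "Dom C \<phi> = Q" "Cod C \<phi> = Q'" "\<phi> \<bullet> \<rho> = \<rho>' \<bullet> ?\<pi>"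
    using coker_desc[OF c, of "\<rho>' \<bullet> ?\<pi>"] \<rho> \<rho>' o(1-4) by auto
  define e' where "e' = \<phi> \<bullet> e"
  have e': "e' \<in> Hom C ?W Q'" using e(1) \<phi> by (simp add: e'_def)
  have \<phi>_inv: "(s \<bullet> \<phi>) \<bullet> ?b \<sigma> = s \<bullet> \<phi>" if s: "s \<in> Arr C" "Dom C s = Q'" and \<sigma>: "\<sigma> permutes {1..?n}" for s \<sigma>
  proof (rule coker_ext[OF c])
    note A = Box_act(1-3)[OF f \<sigma>, of q]
    have "((s \<bullet> \<phi>) \<bullet> ?b \<sigma>) \<bullet> \<rho> = (s \<bullet> \<phi>) \<bullet> (?b \<sigma> \<bullet> \<rho>)"
      using s \<phi>(1-3) bh[OF \<sigma>] \<rho> by simp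
    also have "\<dots> = s \<bullet> (\<phi> \<bullet> \<rho>) \<bullet> Box_act C ?n q f \<sigma>"
      unfolding QA(2)[OF \<sigma>] using s \<phi>(1-3) \<rho> A by simp
    also have "\<dots> = s \<bullet> \<phi> \<bullet> \<rho>"
      unfolding \<phi>(4) using s \<rho>' o(1-4) o(5)[OF \<sigma>] A by simp
    also have "\<dots> = (s \<bullet> \<phi>) \<bullet> \<rho>"
      using s \<phi>(1-3) \<rho> by simp
    finally show "((s \<bullet> \<phi>) \<bullet> ?b \<sigma>) \<bullet> \<rho> = (s \<bullet> \<phi>) \<bullet> \<rho>" .
  qed (use s \<phi>(1-3) bh[OF \<sigma>] \<rho>(3) in simp_all)
  have wa: "?w \<sigma> \<in> Arr C" "Dom C (?w \<sigma>) = ?W" "Cod C (?w \<sigma>) = ?W" if "\<sigma> \<in> block_subgroup a q" for \<sigma>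
    using block_subgroupD[OF that] XZ by simp_all
  have e'_inv: "(s \<bullet> e') \<bullet> ?w \<sigma> = s \<bullet> e'"
    if s: "s \<in> Arr C" "Dom C s = Q'" and \<sigma>: "\<sigma> \<in> block_subgroup a q" for s \<sigma>
  proof -
    note \<sigma>' = block_subgroupD(1)[OF \<sigma>]
    have "(s \<bullet> e') \<bullet> ?w \<sigma> = (s \<bullet> \<phi>) \<bullet> (e \<bullet> ?w \<sigma>)"
      using s \<phi>(1-3) e(1) wa[OF \<sigma>] by (simp add: e'_def)
    also have "\<dots> = ((s \<bullet> \<phi>) \<bullet> ?b \<sigma>) \<bullet> e"
    proof -
      have "e \<bullet> ?w \<sigma> = ?b \<sigma> \<bullet> e" using e(2) \<sigma> by (simp add: equivariant_def)
      then show ?thesis using s \<phi>(1-3) e(1) bh[OF \<sigma>'] by simp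
    qed
    also have "\<dots> = s \<bullet> e'"
      unfolding \<phi>_inv[OF s \<sigma>'] using s \<phi>(1-3) e(1) by (simp add: e'_def)
    finally show ?thesis .
  qed
  \<comment> \<open>\<open>ext\<close> and \<open>desc\<close> together state that \<open>e'\<close>
    is universal among the block-invariant morphisms out of \<open>?W\<close>: a morphism out of
    \<open>Q'\<close> amounts to an invariant one out of \<open>Q\<close>, hence to a
    block-invariant one out of \<open>?W\<close>.\<close>
  have ext: "s = t" if st: "s \<in> Arr C" "t \<in> Arr C" "Dom C s = Q'" "Dom C t = Q'" "Cod C s = Cod C t"
      and eq: "s \<bullet> e' = t \<bullet> e'" for s t
  proof -
    have "s \<bullet> e' \<in> Hom C ?W (Cod C s)" using st(1,3) e' by simp
    from cor_inv[OF this e'_inv[OF st(1,3)]]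
    have "\<exists>!u. u \<in> Hom C Q (Cod C s) \<and> (\<forall>\<sigma>. \<sigma> permutes {1..?n} \<longrightarrow> u \<bullet> ?b \<sigma> = u) \<and> u \<bullet> e = s \<bullet> e'" .
    moreover have "s \<bullet> \<phi> \<in> Hom C Q (Cod C s) \<and> (\<forall>\<sigma>. \<sigma> permutes {1..?n} \<longrightarrow> (s \<bullet> \<phi>) \<bullet> ?b \<sigma> = s \<bullet> \<phi>) \<and> (s \<bullet> \<phi>) \<bullet> e = s \<bullet> e'"
      using \<phi>_inv[OF st(1,3)] st(1,3) \<phi>(1-3) e(1) by (simp add: e'_def)
    moreover have "t \<bullet> \<phi> \<in> Hom C Q (Cod C s) \<and> (\<forall>\<sigma>. \<sigma> permutes {1..?n} \<longrightarrow> (t \<bullet> \<phi>) \<bullet> ?b \<sigma> = t \<bullet> \<phi>) \<and> (t \<bullet> \<phi>) \<bullet> e = s \<bullet> e'"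
      unfolding eq using \<phi>_inv[OF st(2,4)] st(2,4,5) \<phi>(1-3) e(1) by (simp add: e'_def)
    ultimately have "s \<bullet> \<phi> = t \<bullet> \<phi>" by blast
    then have "(s \<bullet> \<phi>) \<bullet> \<rho> = (t \<bullet> \<phi>) \<bullet> \<rho>" by simp
    moreover have "(x \<bullet> \<phi>) \<bullet> \<rho> = (x \<bullet> \<rho>') \<bullet> ?\<pi>" if "x \<in> Arr C" "Dom C x = Q'" for x
      using that \<phi> \<rho> \<rho>' o(1-4) by simp
    ultimately have "(s \<bullet> \<rho>') \<bullet> ?\<pi> = (t \<bullet> \<rho>') \<bullet> ?\<pi>" using st by simp
    then have "s \<bullet> \<rho>' = t \<bullet> \<rho>'"
      by (rule orbit_ext[OF tBox_orbit[OF f, of ?n q], rotated -1]) (use st \<rho>' in simp_all)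
    then show "s = t"
      by (rule coker_ext[OF c', rotated -1]) (use st \<rho>' in simp_all)
  qed
  have desc: "\<exists>s. s \<in> Hom C Q' (Cod C k) \<and> s \<bullet> e' = k"
    if k: "k \<in> Arr C" "Dom C k = ?W" "\<And>\<sigma>. \<sigma> \<in> block_subgroup a q \<Longrightarrow> k \<bullet> ?w \<sigma> = k" for k
  proof -
    have "k \<in> Hom C ?W (Cod C k)" using k by simp
    from cor_inv[OF this k(3)] obtain u where u: "u \<in> Hom C Q (Cod C k)" "u \<bullet> e = k"
      and u_inv: "\<And>\<sigma>. \<sigma> permutes {1..?n} \<Longrightarrow> u \<bullet> ?b \<sigma> = u" by blast
    have u\<rho>: "(u \<bullet> \<rho>) \<bullet> Box_act C ?n q f \<sigma> = u \<bullet> \<rho>" if s: "\<sigma> permutes {1..?n}" for \<sigma>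
    proof -
      have "(u \<bullet> \<rho>) \<bullet> Box_act C ?n q f \<sigma> = u \<bullet> (\<rho> \<bullet> Box_act C ?n q f \<sigma>)"
        using u(1) \<rho> Box_act(1-3)[OF f s, of q] by simp
      also have "\<dots> = (u \<bullet> ?b \<sigma>) \<bullet> \<rho>"
        unfolding QA(2)[OF s, symmetric] using u(1) \<rho> bh[OF s] by simp
      finally show ?thesis by (simp only: u_inv[OF s])
    qed
    obtain t where t: "t \<in> Arr C" "Dom C t = tBox C ?n q f" "Cod C t = Cod C (u \<bullet> \<rho>)" "t \<bullet> ?\<pi> = u \<bullet> \<rho>"
      by (rule orbit_desc[OF tBox_orbit[OF f, of ?n q], of "u \<bullet> \<rho>"])
        (use u(1) \<rho> u\<rho> in \<open>auto simp: sym_group_carrier\<close>)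
    have tc: "Cod C t = Cod C k" using t(3) u(1) \<rho> by simp
    \<comment> \<open>The orbit projection of the lower stage is an epimorphism, so the claim is
      checked after composing with it, by comparison with a zero morphism \<open>x\<close>.\<close>
    have "null C (t \<bullet> tBox_map C ?n q f)"
    proof -
      obtain x where x: "null C x" "x \<in> Arr C" "Dom C x = tBox C ?n (q - 1) f" "Cod C x = Cod C k"
        using null_exists[OF pt, of "tBox C ?n (q - 1) f" "Cod C k"] o'(1) k(1) by auto
      have "(t \<bullet> tBox_map C ?n q f) \<bullet> ?\<pi>' = t \<bullet> (tBox_map C ?n q f \<bullet> ?\<pi>')"
        using t(1,2) T(1-3) o'(1-4) by simp
      also have "\<dots> = (t \<bullet> ?\<pi>) \<bullet> Box_map C ?n q f"
        unfolding T(4) using t(1,2) o(1-4) B by simp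
      also have "\<dots> = u \<bullet> (\<rho> \<bullet> Box_map C ?n q f)"
        unfolding t(4) using u(1) \<rho> B by simp
      finally have "null C ((t \<bullet> tBox_map C ?n q f) \<bullet> ?\<pi>')"
        using null_comp_left[OF \<rho>(4), of u] u(1) \<rho> B by simp
      moreover have "null C (x \<bullet> ?\<pi>')"
        using null_comp_right[OF x(1), of ?\<pi>'] x o'(1-4) by simp
      ultimately have "(t \<bullet> tBox_map C ?n q f) \<bullet> ?\<pi>' = x \<bullet> ?\<pi>'"
        using t(1,2) tc T(1-3) o'(1-4) x by (intro null_eq) simp_all
      then have "t \<bullet> tBox_map C ?n q f = x"
        by (rule orbit_ext[OF tBox_orbit[OF f, of ?n "q - 1"], rotated -1])
          (use t(1,2) tc T(1-3) x in simp_all)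
      then show ?thesis using x by simp
    qed
    then obtain s where s: "s \<in> Arr C" "Dom C s = Q'" "Cod C s = Cod C k" "s \<bullet> \<rho>' = t"
      using coker_desc[OF c', of t] t(1,2) tc \<rho>' by auto
    have "(s \<bullet> \<phi>) \<bullet> \<rho> = s \<bullet> (\<rho>' \<bullet> ?\<pi>)" using s(1,2) \<phi> \<rho> by simp
    also have "\<dots> = t \<bullet> ?\<pi>" unfolding s(4)[symmetric] using s(1,2) \<rho>' o(1-4) by simp
    also have "\<dots> = u \<bullet> \<rho>" by (rule t(4))
    finally have "s \<bullet> \<phi> = u"
      by (rule coker_ext[OF c, rotated -1]) (use s \<phi> u(1) \<rho> in simp_all)
    then have "s \<bullet> e' = k"
      using comp_reassoc[of s \<phi> u e] s(1,2) \<phi>(1-3) e(1) u(2) by (simp add: e'_def)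
    then show ?thesis using s by auto
  qed
  note oX = orbit_arr[OF sym_pow_orbit[OF XZ(1), of a], simplified sym_group_carrier]
    and oZ = orbit_arr[OF sym_pow_orbit[OF XZ(2), of q], simplified sym_group_carrier]
  let ?\<pi>S = "pow_proj a ?X \<diamond> pow_proj q ?Z"
  have \<pi>S: "?\<pi>S \<in> Arr C" "Dom C ?\<pi>S = ?W" "Cod C ?\<pi>S = ?S" using oX(1-4) oZ(1-4) by simp_all
  have \<pi>S_inv: "?\<pi>S \<bullet> ?w \<sigma> = ?\<pi>S" if "\<sigma> \<in> block_subgroup a q" for \<sigma>
  proof -
    note S = block_subgroupD[OF that]
    have "?\<pi>S \<bullet> ?w \<sigma> = (pow_proj a ?X \<bullet> pow_act C a ?X (left_block a \<sigma>)) \<diamond> (pow_proj q ?Z \<bullet> pow_act C q ?Z (right_block a q \<sigma>))"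
      using oX(1-4) oZ(1-4) S XZ by (simp add: tensor_comp)
    then show ?thesis by (simp only: oX(5)[OF S(2)] oZ(5)[OF S(3)])
  qed
  have Q': "Q' \<in> Obj C" "?S \<in> Obj C" using \<rho>' oX(1) oZ(1) by auto
  \<comment> \<open>\<open>?\<pi>S\<close> is universal for the same invariants by
    \<open>orbit_tensor_desc\<close> and \<open>orbit_tensor_ext\<close>; the morphisms
    \<open>s\<close> and \<open>t\<close> induced in the two directions are mutually
    inverse.\<close>
  obtain s where s: "s \<in> Arr C" "Dom C s = Q'" "Cod C s = ?S" "s \<bullet> e' = ?\<pi>S"
    using desc[OF \<pi>S(1,2) \<pi>S_inv] \<pi>S(3) by auto
  have e'_self: "e' \<bullet> ?w \<sigma> = e'" if "\<sigma> \<in> block_subgroup a q" for \<sigma>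
    using e'_inv[of "Id C Q'" \<sigma>] that e' Q' wa[OF that] by simp
  obtain t where t: "t \<in> Arr C" "Dom C t = ?S" "Cod C t = Cod C e'" "t \<bullet> ?\<pi>S = e'"
  proof (rule orbit_tensor_desc[OF sym_group_is_group sym_group_is_group sym_pow_orbit[OF XZ(1)] sym_pow_orbit[OF XZ(2)], of e'])
    fix \<alpha> \<beta> assume "\<alpha> \<in> carrier (sym_group a)" "\<beta> \<in> carrier (sym_group q)"
    then have "\<alpha> permutes {1..a}" "\<beta> permutes {1..q}" by (simp_all add: sym_group_carrier)
    then obtain \<sigma> where "\<sigma> \<in> block_subgroup a q" "left_block a \<sigma> = \<alpha>" "right_block a q \<sigma> = \<beta>"
      by (rule block_subgroup_surj)
    then show "e' \<bullet> (pow_act C a ?X \<alpha> \<diamond> pow_act C q ?Z \<beta>) = e'" using e'_self by blast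
  qed (use e' in auto)
  have "(t \<bullet> s) \<bullet> e' = Id C Q' \<bullet> e'"
    using t s e' Q' by simp
  then have ts: "t \<bullet> s = Id C Q'"
    by (rule ext[rotated -1]) (use t s e' Q' in simp_all)
  have "(s \<bullet> t) \<bullet> ?\<pi>S = Id C ?S \<bullet> ?\<pi>S"
    using t s(1-3) s(4) e' \<pi>S by simp
  then have st: "s \<bullet> t = Id C ?S"
    by (rule orbit_tensor_ext[OF sym_group_is_group sym_group_is_group sym_pow_orbit[OF XZ(1)] sym_pow_orbit[OF XZ(2)], rotated -1])
      (use t s e' Q'(2) in simp_all)
  have "iso_arr C s"
    unfolding iso_arr_def is_inverse_def using s t st ts e' by (intro exI[of _ t]) simp
  then show ?thesis
    unfolding isomorphic_def Q'_eq using s by (intro bexI[of _ s]) simp_all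
qed

end

theorem theorem20:
  fixes C :: "('o, 'm, 'z) mon_model_cat_scheme"
    and X Y Z :: 'o and f p :: 'm and n i :: nat
  assumes "closed_symmetric_monoidal_model_category C"
    and "cofibre_sequence C X Y Z f p"
    and "1 \<le> i" and "i \<le> n"
  shows "Box_map C n i f \<in> Hom C (Box C n (i - 1) f) (Box C n i f) \<inter> Cofib C \<and>
    (pointed C \<longrightarrow>
       equivariantly_isomorphic C (sym_group n) (Box_quot C n i f)
         (cor C (sym_group n) (block_subgroup (n - i) i) (block_object C (n - i) i X Z))) \<and>
    (symmetrizable_cofibration C f \<and> (\<forall>k\<ge>1. cofibrant C (sym_pow C k X)) \<longrightarrow>
       tBox_map C n i f \<in> Hom C (tBox C n (i - 1) f) (tBox C n i f) \<inter> Cofib C \<and>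
       (pointed C \<longrightarrow>
          isomorphic C (quot_obj C (tBox_map C n i f))
            (sym_pow C (n - i) X \<diamondop>\<^bsub>C\<^esub> sym_pow C i Z))) \<and>
    (symmetrizable_trivial_cofibration C f \<and> (\<forall>k\<ge>1. cofibrant C (sym_pow C k X)) \<longrightarrow>
       tBox_map C n i f \<in> Cofib C \<inter> Weq C)"
proof -
  interpret closed_symmetric_monoidal_model_category C by (rule assms(1))
  have f: "f \<in> Arr C" "Dom C f = X" "f \<in> Cofib C" and X: "cofibrant C X"
    using assms(2) by (auto simp: cofibre_sequence_def)
  obtain z where z: "is_quotient C f Z p z"
    using assms(2) by (auto simp: cofibre_sequence_def)
  have Z: "Cod C p = Z"
    using z pushout_arr(3) unfolding is_quotient_def by blast
  \<comment> \<open>The results on blocks are stated for \<open>a + q\<close> factors; here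
    \<open>a\<close> is \<open>n - i\<close> and \<open>q\<close> is \<open>i\<close>, and
    \<open>i \<le> n\<close> makes the subtraction exact.\<close>
  have n: "(n - i) + i = n" using assms(4) by simp
  have coker: "is_coker C {f} p" if "pointed C" by (rule quotient_coker[OF that z])
  note B = Box_map[OF f(1), where n=n and i=i]
  have "equivariantly_isomorphic C (sym_group n) (Box_quot C n i f)
      (cor C (sym_group n) (block_subgroup (n - i) i) (block_object C (n - i) i X Z))" if pt: "pointed C"
  proof -
    obtain Q \<rho> y where quot: "quotient C (Box_map C n i f) = (Q, \<rho>, y)" "is_quotient C (Box_map C n i f) Q \<rho> y"
      using quotient_exists[OF finite_colimits finite_limits B(1)] .
    obtain e where "is_cor C (sym_group n) (block_subgroup (n - i) i) (fst (block_object C (n - i) i X Z))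
        (snd (block_object C (n - i) i X Z)) (fst (Box_quot C n i f)) (snd (Box_quot C n i f)) e"
      using Box_quot_is_cor[OF pt f(1) coker[OF pt] assms(3), of "n - i", unfolded n f(2) Z, OF quot] .
    from cor_equivariantly_isomorphic[OF this] show ?thesis by simp
  qed
  moreover have "Box_map C n i f \<in> Cofib C"
    using Box_map_cofib[OF f(3) _ assms(3,4)] X f(2) by simp
  moreover have "tBox_map C n i f \<in> Cofib C"
    if "symmetrizable_cofibration C f \<and> (\<forall>k\<ge>1. cofibrant C (sym_pow C k X))"
    using tBox_map_cofib(1)[OF f(1) assms(3), of "n - i"] that assms(3) f(2) n
    by (simp add: symmetrizable_cofibration_def)
  moreover have "tBox_map C n i f \<in> Cofib C \<inter> Weq C"
    if "symmetrizable_trivial_cofibration C f \<and> (\<forall>k\<ge>1. cofibrant C (sym_pow C k X))"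
    using tBox_map_cofib(2)[OF f(1) assms(3), of "n - i"] that assms(3) f(2) n
    by (simp add: symmetrizable_trivial_cofibration_def)
  moreover have "isomorphic C (quot_obj C (tBox_map C n i f)) (sym_pow C (n - i) X \<diamondop>\<^bsub>C\<^esub> sym_pow C i Z)"
    if "pointed C"
    using tBox_quotient[OF that f(1) coker[OF that] assms(3), of "n - i"] unfolding n f(2) Z .
  ultimately show ?thesis
    using B(1-3) tBox_map[OF f(1), where n=n and i=i] by simp
qed

end
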